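(* Let $a,b>0$ and let $\{(u_n,v_n)\}\subset D_a\times D_b$ be a bounded sequence in $\mathbb D$ such that (i) $J(u_n,v_n)\to C_{(a,b)}$; (ii) $J'(u_n,v_n)+\lambda_{1,n}(u_n,0)+\lambda_{2,n}(0,v_n)\to0$ in $\mathbb D^*$ for some real sequences $\{\lambda_{1,n}\},\{\lambda_{2,n}\}$; (iii) $P(u_n,v_n)\to0$; (iv) $(u_n,v_n)\rightharpoonup(u,v)$ weakly in $\mathbb D$ and $(u_n,v_n)\to(u,v)$ strongly in $L^\eta(\mathbb R^2)\times L^\eta(\mathbb R^2)$ for all $2<\eta<2_s$, with $u\ge0$, $v\ge0$. Assume $C_{(a,b)}<\min\{m_{p,\mu_1,a},m_{q,\mu_2,b}\}$. Then, up to a subsequence, $(u_n,v_n)\to(u,v)$ strongly in $\mathbb D$ and $(u,v)\in S_a\times S_b$.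
   Context: Standing assumptions: $s\in(\tfrac12,1)$, $\mu_1,\mu_2,\beta>0$, $r_1,r_2>1$, $\frac{2(1+3s)}{1+s}<p,q,r_1+r_2<2_s=\frac{2(1+s)}{1-s}$. $\mathcal H^{1,s}(\mathbb R^2)$: $u\in L^2(\mathbb R^2)$ with $\partial_xu,(-\Delta)_y^{s/2}u\in L^2$ ($(-\Delta)_y^{s/2}$ the fractional Laplacian in $y$ only); $\mathbb D=\mathcal H^{1,s}\times\mathcal H^{1,s}$, $\mathbb D^*$ its dual; $(u,0)\in\mathbb D^*$ is $(\varphi,\psi)\mapsto\int u\varphi$, $(0,v)$ is $(\varphi,\psi)\mapsto\int v\psi$. $K(u)=\int(|\partial_xu|^2+|(-\Delta)_y^{s/2}u|^2)$. $J(u,v)=\tfrac12K(u)+\tfrac12K(v)-\frac{\mu_1}{p}\|u\|_p^p-\frac{\mu_2}{q}\|v\|_q^q-\beta\int|u|^{r_1}|v|^{r_2}$; $P(u,v)=sK(u)+sK(v)-\frac{(1+s)(p-2)}{2p}\mu_1\|u\|_p^p-\frac{(1+s)(q-2)}{2q}\mu_2\|v\|_q^q-\frac{(1+s)(r_1+r_2-2)}{2}\beta\int|u|^{r_1}|v|^{r_2}$; $\mathcal P=\{(u,v)\ne(0,0):P(u,v)=0\}$; $S_a=\{u:\|u\|_2^2=a\}$, $D_a=\{u:\|u\|_2^2\le a\}$; $\mathcal P_{(a,b)}=\mathcal P\cap(D_a\times D_b)$; $C_{(a,b)}=\inf_{\mathcal P_{(a,b)}}J$. For $p\in(2,2_s)$,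 $u_p$ is the unique positive ground state of $-\partial_{xx}u+(-\Delta)_y^su+u=u^{p-1}$; $z_{p,\mu,a}(x,y)=(\lambda/\mu)^{1/(p-2)}u_p(\lambda^{1/2}x,\lambda^{1/(2s)}y)$ with $\lambda=a^{\frac{-2s(p-2)}{(1+s)(p-2)-4s}}\|u_p\|_2^{\frac{4s(p-2)}{(1+s)(p-2)-4s}}\mu^{\frac{-4s}{(1+s)(p-2)-4s}}$; $m_{p,\mu_1,a}=J(z_{p,\mu_1,a},0)$ and $m_{q,\mu_2,b}=J(0,z_{q,\mu_2,b})$. *)

theory Defs
  imports "HOL-Analysis.Analysis"
begin

text \<open>Functions on R^2 = real x real (first coordinate x, second coordinate y).
  Elements of H^{1,s} are represented by Borel measurable representatives.\<close>

type_synonym fn2 = "real \<times> real \<Rightarrow> real"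

definition Lpow :: "real \<Rightarrow> fn2 \<Rightarrow> real" where
  "Lpow p u = (LINT z|lborel. \<bar>u z\<bar> powr p)"

definition memLp :: "real \<Rightarrow> fn2 \<Rightarrow> bool" where
  "memLp p u \<longleftrightarrow> u \<in> borel_measurable lborel \<and> integrable lborel (\<lambda>z. \<bar>u z\<bar> powr p)"

definition test_fun :: "fn2 \<Rightarrow> bool" where
  "test_fun \<phi> \<longleftrightarrow> (\<forall>z. \<phi> differentiable (at z))
     \<and> continuous_on UNIV (\<lambda>z. frechet_derivative \<phi> (at z) (1,0))
     \<and> continuous_on UNIV (\<lambda>z. frechet_derivative \<phi> (at z) (0,1))
     \<and> compact (closure {z. \<phi> z \<noteq> 0})"

definition dxf :: "fn2 \<Rightarrow> fn2" where
  "dxf \<phi> z = frechet_derivative \<phi> (at z) (1,0)"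

definition has_weak_dx :: "fn2 \<Rightarrow> fn2 \<Rightarrow> bool" where
  "has_weak_dx u g \<longleftrightarrow> memLp 2 g \<and>
     (\<forall>\<phi>. test_fun \<phi> \<longrightarrow> (LINT z|lborel. u z * dxf \<phi> z) = - (LINT z|lborel. g z * \<phi> z))"

definition wdx :: "fn2 \<Rightarrow> fn2" where
  "wdx u = (SOME g. has_weak_dx u g)"

text \<open>Fractional Laplacian in y: for sigma in (0,1),
  norm of (-Delta)^{sigma/2} u squared = C(1,sigma)/2 * Gagliardo double integral in y,
  C(1,sigma) = sigma 4^sigma Gamma(1/2+sigma)/(sqrt pi Gamma(1-sigma)).\<close>
definition frac_const :: "real \<Rightarrow> real" where
  "frac_const s = s * 4 powr s * Gamma (1/2 + s) / (sqrt pi * Gamma (1 - s)) / 2"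

definition gag_integrand :: "real \<Rightarrow> fn2 \<Rightarrow> fn2 \<Rightarrow> real \<times> real \<times> real \<Rightarrow> real" where
  "gag_integrand s u w = (\<lambda>(x, y, y'). (u (x, y) - u (x, y')) * (w (x, y) - w (x, y'))
       / \<bar>y - y'\<bar> powr (1 + 2 * s))"

text \<open>(-Delta)_y^{s/2} u in L^2\<close>
definition fracy_fin :: "real \<Rightarrow> fn2 \<Rightarrow> bool" where
  "fracy_fin s u \<longleftrightarrow> integrable lborel (gag_integrand s u u)"

text \<open>integral of (-Delta)_y^{s/2} u * (-Delta)_y^{s/2} w\<close>
definition Gy :: "real \<Rightarrow> fn2 \<Rightarrow> fn2 \<Rightarrow> real" where
  "Gy s u w = frac_const s * (LINT t|lborel. gag_integrand s u w t)"

definition inH :: "real \<Rightarrow> fn2 \<Rightarrow> bool" where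
  "inH s u \<longleftrightarrow> memLp 2 u \<and> (\<exists>g. has_weak_dx u g) \<and> fracy_fin s u"

definition inD :: "real \<Rightarrow> fn2 \<Rightarrow> fn2 \<Rightarrow> bool" where
  "inD s u v \<longleftrightarrow> inH s u \<and> inH s v"

definition innerK :: "real \<Rightarrow> fn2 \<Rightarrow> fn2 \<Rightarrow> real" where
  "innerK s u w = (LINT z|lborel. wdx u z * wdx w z) + Gy s u w"

definition Kf :: "real \<Rightarrow> fn2 \<Rightarrow> real" where
  "Kf s u = innerK s u u"

definition innerH :: "real \<Rightarrow> fn2 \<Rightarrow> fn2 \<Rightarrow> real" where
  "innerH s u w = (LINT z|lborel. u z * w z) + innerK s u w"

definition normD2 :: "real \<Rightarrow> fn2 \<Rightarrow> fn2 \<Rightarrow> real" where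
  "normD2 s u v = innerH s u u + innerH s v v"

definition coupling :: "real \<Rightarrow> real \<Rightarrow> fn2 \<Rightarrow> fn2 \<Rightarrow> real" where
  "coupling r1 r2 u v = (LINT z|lborel. \<bar>u z\<bar> powr r1 * \<bar>v z\<bar> powr r2)"

definition Jf :: "real \<Rightarrow> real \<Rightarrow> real \<Rightarrow> real \<Rightarrow> real \<Rightarrow> real \<Rightarrow> real \<Rightarrow> real
                   \<Rightarrow> fn2 \<Rightarrow> fn2 \<Rightarrow> real" where
  "Jf s \<mu>1 \<mu>2 \<beta> p q r1 r2 u v =
     Kf s u / 2 + Kf s v / 2 - \<mu>1 / p * Lpow p u - \<mu>2 / q * Lpow q v - \<beta> * coupling r1 r2 u v"

definition Pf :: "real \<Rightarrow> real \<Rightarrow> real \<Rightarrow> real \<Rightarrow> real \<Rightarrow> real \<Rightarrow> real \<Rightarrow> real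
                   \<Rightarrow> fn2 \<Rightarrow> fn2 \<Rightarrow> real" where
  "Pf s \<mu>1 \<mu>2 \<beta> p q r1 r2 u v =
     s * Kf s u + s * Kf s v
     - (1 + s) * (p - 2) / (2 * p) * \<mu>1 * Lpow p u
     - (1 + s) * (q - 2) / (2 * q) * \<mu>2 * Lpow q v
     - (1 + s) * (r1 + r2 - 2) / 2 * \<beta> * coupling r1 r2 u v"

definition dJ :: "real \<Rightarrow> real \<Rightarrow> real \<Rightarrow> real \<Rightarrow> real \<Rightarrow> real \<Rightarrow> real \<Rightarrow> real
                   \<Rightarrow> fn2 \<Rightarrow> fn2 \<Rightarrow> fn2 \<Rightarrow> fn2 \<Rightarrow> real" where
  "dJ s \<mu>1 \<mu>2 \<beta> p q r1 r2 u v \<phi> \<psi> =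
     innerK s u \<phi> + innerK s v \<psi>
     - \<mu>1 * (LINT z|lborel. sgn (u z) * \<bar>u z\<bar> powr (p - 1) * \<phi> z)
     - \<mu>2 * (LINT z|lborel. sgn (v z) * \<bar>v z\<bar> powr (q - 1) * \<psi> z)
     - \<beta> * r1 * (LINT z|lborel. sgn (u z) * \<bar>u z\<bar> powr (r1 - 1) * \<bar>v z\<bar> powr r2 * \<phi> z)
     - \<beta> * r2 * (LINT z|lborel. \<bar>u z\<bar> powr r1 * sgn (v z) * \<bar>v z\<bar> powr (r2 - 1) * \<psi> z)"

definition PohoSet :: "real \<Rightarrow> real \<Rightarrow> real \<Rightarrow> real \<Rightarrow> real \<Rightarrow> real \<Rightarrow> real \<Rightarrow> real
                   \<Rightarrow> real \<Rightarrow> real \<Rightarrow> (fn2 \<times> fn2) set" where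
  "PohoSet s \<mu>1 \<mu>2 \<beta> p q r1 r2 a b =
     {(u, v). inD s u v \<and> \<not> (Lpow 2 u = 0 \<and> Lpow 2 v = 0)
        \<and> Pf s \<mu>1 \<mu>2 \<beta> p q r1 r2 u v = 0 \<and> Lpow 2 u \<le> a \<and> Lpow 2 v \<le> b}"

definition Cab :: "real \<Rightarrow> real \<Rightarrow> real \<Rightarrow> real \<Rightarrow> real \<Rightarrow> real \<Rightarrow> real \<Rightarrow> real
                   \<Rightarrow> real \<Rightarrow> real \<Rightarrow> real" where
  "Cab s \<mu>1 \<mu>2 \<beta> p q r1 r2 a b =
     Inf ((\<lambda>(u, v). Jf s \<mu>1 \<mu>2 \<beta> p q r1 r2 u v) ` PohoSet s \<mu>1 \<mu>2 \<beta> p q r1 r2 a b)"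

text \<open>Ground state of  -u_xx + (-Delta)_y^s u + u = |u|^{p-2} u  (weak sense).\<close>
definition weak_sol :: "real \<Rightarrow> real \<Rightarrow> fn2 \<Rightarrow> bool" where
  "weak_sol s p u \<longleftrightarrow> inH s u \<and>
     (\<forall>\<phi>. inH s \<phi> \<longrightarrow> innerH s u \<phi> = (LINT z|lborel. sgn (u z) * \<bar>u z\<bar> powr (p - 1) * \<phi> z))"

definition action :: "real \<Rightarrow> real \<Rightarrow> fn2 \<Rightarrow> real" where
  "action s p u = innerH s u u / 2 - Lpow p u / p"

definition is_pos_ground_state :: "real \<Rightarrow> real \<Rightarrow> fn2 \<Rightarrow> bool" where
  "is_pos_ground_state s p u \<longleftrightarrow> weak_sol s p u \<and> (AE z in lborel. u z > 0)
     \<and> (\<forall>w. weak_sol s p w \<and> Lpow 2 w \<noteq> 0 \<longrightarrow> action s p u \<le> action s p w)"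

definition u_gs :: "real \<Rightarrow> real \<Rightarrow> fn2" where
  "u_gs s p = (SOME u. is_pos_ground_state s p u)"

definition lam_z :: "real \<Rightarrow> real \<Rightarrow> real \<Rightarrow> real \<Rightarrow> real" where
  "lam_z s p \<mu> a =
     (let d = (1 + s) * (p - 2) - 4 * s in
       a powr (- 2 * s * (p - 2) / d) * sqrt (Lpow 2 (u_gs s p)) powr (4 * s * (p - 2) / d)
       * \<mu> powr (- 4 * s / d))"

definition z_fun :: "real \<Rightarrow> real \<Rightarrow> real \<Rightarrow> real \<Rightarrow> fn2" where
  "z_fun s p \<mu> a = (\<lambda>(x, y). let l = lam_z s p \<mu> a in
      (l / \<mu>) powr (1 / (p - 2)) * u_gs s p (l powr (1/2) * x, l powr (1 / (2 * s)) * y))"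

end

theory Submission
  imports Defs
begin

text \<open>The mass-preserving dilation multiplies \<open>K\<close> by \<open>y\<close> and the other terms of \<open>J\<close> by powers of \<open>y\<close> with
  exponents above \<open>1\<close>, so each fibre carries exactly one point of the Pohozaev set, where \<open>J\<close> is maximal
  along the fibre. Since the nonlinear terms converge, a loss of \<open>K\<close> in the weak limit \<open>(u, v)\<close> would push its
  projection below the infimum; hence \<open>(u, v)\<close> is a minimiser and \<open>K\<close> converges. If \<open>u \<noteq> 0\<close> has mass below
  \<open>a\<close>, one-sided variations make \<open>u\<close> a supersolution of \<open>-\<partial>\<^sub>x\<^sub>x u + (-\<Delta>)\<^sub>y\<^sup>s u = \<mu>1 u\<^sup>p\<^sup>-\<^sup>1\<close>, which is
  impossible because the homogeneous dimension \<open>1 + 1/s\<close> is less than \<open>4\<close>. If \<open>v = 0\<close>, then \<open>u\<close> optimises the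
  Gagliardo--Nirenberg inequality, so its rescaling is a ground state with the \<open>K\<close>, mass and \<open>L\<^sup>p\<close> norm of
  \<open>u_gs\<close>; this gives \<open>C = J(z, 0)\<close>, contrary to the energy assumption.\<close>

subsection \<open>Lebesgue measure on products\<close>

text \<open>\<open>u_gs\<close> is a Hilbert choice of a positive ground state, so the energy
  threshold carries information only once such a function is known to exist and its scalars are
  known. The minimiser supplies existence, but it is only nonnegative; strict positivity needs a
  strong maximum principle for an operator that is local in x and nonlocal in y. The two directions
  are treated separately: jumps of the Gagliardo kernel exclude vertical lines that meet both the
  zero set and its complement, and a quadratic bound on horizontal increments makes the zero set
  invariant under horizontal shifts.

  The dimension condition comes from scaling. On the cutoff eta(l x, l^(1/s) y) the operator gains
  l^2, while the L^2 norm of the cutoff has size l^(-(1 + 1/s)/2); the pairing is of order l^((3 -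
  1/s)/2), a positive power for s > 1/2.

  Strong convergence stops short of the exponent 2. Weak convergence in L^2 gives the limits of the
  cross terms, and the saturated masses finally exclude a loss of mass.\<close>

lemma lborel_scale:
  fixes \<alpha> \<beta> :: real
  assumes "\<alpha> > 0" "\<beta> > 0"
  shows "(lborel :: (real \<times> 'b::euclidean_space) measure)
    = density (distr lborel borel (\<lambda>t. (\<alpha> * fst t, \<beta> *\<^sub>R snd t))) (\<lambda>_. ennreal (\<alpha> * \<beta> ^ DIM('b)))"
proof -
  define c :: "real \<times> 'b \<Rightarrow> real" where "c = (\<lambda>j. if fst j \<noteq> 0 then \<alpha> else \<beta>)"
  have c0: "\<And>j. j \<in> Basis \<Longrightarrow> c j \<noteq> 0" using assms by (auto simp: c_def)
  have T: "0 + (\<Sum>j\<in>Basis. (c j * (x \<bullet> j)) *\<^sub>R j) = (\<alpha> * fst x, \<beta> *\<^sub>R snd x)" for x :: "real \<times> 'b"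
  proof -
    have "(\<Sum>j\<in>Basis. (c j * (x \<bullet> j)) *\<^sub>R j)
       = (\<Sum>j\<in>(Basis::real set). (c (j,0) * (x \<bullet> (j,0))) *\<^sub>R (j,0::'b)) + (\<Sum>j\<in>(Basis::'b set). (c (0,j) * (x \<bullet> (0,j))) *\<^sub>R (0,j))"
      by (simp add: sum_Basis_prod_eq)
    also have "\<dots> = (\<alpha> * fst x, \<beta> *\<^sub>R snd x)"
      by (simp add: c_def inner_prod_def prod_eq_iff fst_sum snd_sum scaleR_scaleR[symmetric] scaleR_sum_right[symmetric] euclidean_representation
         del: scaleR_scaleR)
    finally show ?thesis by simp
  qed
  have P: "(\<Prod>j\<in>(Basis::(real\<times>'b) set). \<bar>c j\<bar>) = \<alpha> * \<beta> ^ DIM('b)"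
  proof -
    have inj: "inj_on (\<lambda>u. (u, 0::'b)) Basis" "inj_on (\<lambda>u. (0::real, u)) (Basis::'b set)"
      by (auto intro!: inj_onI)
    have d: "(\<lambda>u. (u, 0::'b)) ` (Basis::real set) \<inter> (\<lambda>u. (0, u)) ` Basis = {}" by auto
    have "(\<Prod>j\<in>(Basis::(real\<times>'b) set). \<bar>c j\<bar>) = (\<Prod>j\<in>(Basis::real set). \<bar>c (j,0)\<bar>) * (\<Prod>j\<in>(Basis::'b set). \<bar>c (0,j)\<bar>)"
      unfolding Basis_prod_def using d by (subst prod.union_disjoint) (auto simp: prod.reindex[OF inj(1)] prod.reindex[OF inj(2)])
    thus ?thesis using assms by (simp add: c_def)
  qed
  show ?thesis
    using lborel_affine_euclidean[of c 0, OF c0] unfolding T P by simp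
qed

text \<open>The second factor is kept general because two kinds of dilation occur: with
  \<open>real\<close> the formula acts on the plane, with \<open>real \<times> real\<close> on the
  triples (x, y, y') of the Gagliardo integrand, whose Jacobian contains the square of the vertical
  factor.\<close>

lemma
  fixes f :: "real \<times> 'b::euclidean_space \<Rightarrow> real"
  assumes "\<alpha> > 0" "\<beta> > 0" and [measurable]: "f \<in> borel_measurable borel"
  shows integrable_scale: "integrable lborel (\<lambda>t. f (\<alpha> * fst t, \<beta> *\<^sub>R snd t)) \<longleftrightarrow> integrable lborel f"
    and integral_scale: "(LINT t|lborel. f (\<alpha> * fst t, \<beta> *\<^sub>R snd t)) = (LINT t|lborel. f t) / (\<alpha> * \<beta> ^ DIM('b))"
proof -
  let ?T = "\<lambda>t::real\<times>'b. (\<alpha> * fst t, \<beta> *\<^sub>R snd t)"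
  have pos: "\<alpha> * \<beta> ^ DIM('b) > 0" using assms by simp
  have [measurable]: "?T \<in> borel \<rightarrow>\<^sub>M borel"
    by (intro borel_measurable_continuous_onI continuous_intros)
  have "integrable lborel f \<longleftrightarrow> integrable (density (distr lborel borel ?T) (\<lambda>_. ennreal (\<alpha> * \<beta> ^ DIM('b)))) f"
    using lborel_scale[OF assms(1,2), where 'b='b] by simp
  also have "\<dots> \<longleftrightarrow> integrable lborel (\<lambda>t. f (?T t))"
    using assms by (subst integrable_density) (auto simp: integrable_distr_eq)
  finally show "integrable lborel (\<lambda>t. f (?T t)) \<longleftrightarrow> integrable lborel f" by simp
  have "(LINT t|lborel. f t) = (LINT t|density (distr lborel borel ?T) (\<lambda>_. ennreal (\<alpha> * \<beta> ^ DIM('b))). f t)"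
    using lborel_scale[OF assms(1,2), where 'b='b] by simp
  also have "\<dots> = (\<alpha> * \<beta> ^ DIM('b)) * (LINT t|lborel. f (?T t))"
    using assms by (subst integral_density) (auto simp: integral_distr)
  finally show "(LINT t|lborel. f (?T t)) = (LINT t|lborel. f t) / (\<alpha> * \<beta> ^ DIM('b))"
    using assms(1,2) by (simp add: field_simps)
qed

lemma AE_scale:
  assumes "\<alpha> > 0" "\<beta> > 0" and "AE t in lborel. P (t :: real \<times> 'b::euclidean_space)"
  shows "AE t in lborel. P (\<alpha> * fst t, \<beta> *\<^sub>R snd t)"
proof -
  let ?T = "\<lambda>t::real\<times>'b. (\<alpha> * fst t, \<beta> *\<^sub>R snd t)"
  have [measurable]: "?T \<in> borel \<rightarrow>\<^sub>M borel"
    by (intro borel_measurable_continuous_onI continuous_intros)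
  have pos: "\<alpha> * \<beta> ^ DIM('b) > 0" using assms by simp
  have "AE t in density (distr lborel borel ?T) (\<lambda>_. ennreal (\<alpha> * \<beta> ^ DIM('b))). P t"
    using assms(3) unfolding lborel_scale[OF assms(1,2), where 'b='b, symmetric] .
  then have "AE t in distr lborel borel ?T. P t"
    using assms by (subst (asm) AE_density) auto
  then show ?thesis
    by (rule AE_distrD[rotated]) measurable
qed

text \<open>Shifts, the exchange of y and y', shears and reflections all have Jacobian one; the
  predicate collects the transfer of integrals, integrability and null sets once for all of
  them.\<close>

definition lborel_preserving :: "('a::euclidean_space \<Rightarrow> 'a) \<Rightarrow> bool" where
  "lborel_preserving T \<longleftrightarrow> T \<in> borel_measurable borel \<and> distr lborel borel T = lborel"

lemma lborel_preservingI:
  assumes [measurable]: "T \<in> borel_measurable borel"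
    and "\<And>f. f \<in> borel_measurable borel \<Longrightarrow> (\<integral>\<^sup>+ t. f (T t) \<partial>lborel) = (\<integral>\<^sup>+ t. f t \<partial>lborel)"
  shows "lborel_preserving T"
  unfolding lborel_preserving_def
proof (intro conjI measure_eqI)
  fix A assume "A \<in> sets (distr lborel borel T)"
  then have [measurable]: "A \<in> sets borel" by simp
  have "emeasure (distr lborel borel T) A = (\<integral>\<^sup>+ t. indicator A t \<partial>distr lborel borel T)" by simp
  also have "\<dots> = (\<integral>\<^sup>+ t. indicator A (T t) \<partial>lborel)" by (subst nn_integral_distr) auto
  also have "\<dots> = emeasure lborel A" by (subst assms(2)) auto
  finally show "emeasure (distr lborel borel T) A = emeasure lborel A" .
qed auto

lemma
  assumes "lborel_preserving T"
  shows preserving_measurable: "T \<in> borel_measurable borel"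
  and preserving_nn_integral: "g \<in> borel_measurable borel \<Longrightarrow> (\<integral>\<^sup>+ t. g (T t) \<partial>lborel) = (\<integral>\<^sup>+ t. g t \<partial>lborel)"
  and preserving_integral: "f \<in> borel_measurable borel \<Longrightarrow> (LINT t|lborel. f (T t)) = (LINT t|lborel. (f t :: real))"
  and preserving_integrable: "f \<in> borel_measurable borel \<Longrightarrow> integrable lborel (\<lambda>t. f (T t)) \<longleftrightarrow> integrable lborel f"
  and preserving_AE: "AE t in lborel. P t \<Longrightarrow> AE t in lborel. P (T t)"
proof -
  show T[measurable]: "T \<in> borel_measurable borel" using assms by (simp add: lborel_preserving_def)
  have D: "distr lborel borel T = lborel" using assms by (simp add: lborel_preserving_def)
  show "g \<in> borel_measurable borel \<Longrightarrow> (\<integral>\<^sup>+ t. g (T t) \<partial>lborel) = (\<integral>\<^sup>+ t. g t \<partial>lborel)"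
    by (subst (2) D[symmetric], subst nn_integral_distr) auto
  show "f \<in> borel_measurable borel \<Longrightarrow> (LINT t|lborel. f (T t)) = (LINT t|lborel. f t)"
    by (subst (2) D[symmetric], subst integral_distr) auto
  show "f \<in> borel_measurable borel \<Longrightarrow> integrable lborel (\<lambda>t. f (T t)) \<longleftrightarrow> integrable lborel f"
    by (subst (2) D[symmetric], subst integrable_distr_eq) auto
  have TL: "T \<in> lborel \<rightarrow>\<^sub>M borel" by simp
  show "AE t in lborel. P (T t)" if "AE t in lborel. P t"
    using that AE_distrD[OF TL, of P] unfolding D by blast
qed

lemma nn_integral_real2:
  fixes f :: "'a::euclidean_space \<times> 'b::euclidean_space \<Rightarrow> ennreal"
  assumes "f \<in> borel_measurable borel"
  shows "(\<integral>\<^sup>+ t. f t \<partial>lborel) = (\<integral>\<^sup>+ x. \<integral>\<^sup>+ y. f (x, y) \<partial>lborel \<partial>lborel)"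
proof -
  have "f \<in> borel_measurable (lborel \<Otimes>\<^sub>M lborel)" using assms by (simp add: lborel_prod)
  from lborel.nn_integral_fst[OF this] show ?thesis by (simp add: lborel_prod)
qed

lemma nn_integral_real2_swap:
  fixes f :: "'a::euclidean_space \<times> 'b::euclidean_space \<Rightarrow> ennreal"
  assumes "f \<in> borel_measurable borel"
  shows "(\<integral>\<^sup>+ x. \<integral>\<^sup>+ y. f (x, y) \<partial>lborel \<partial>lborel) = (\<integral>\<^sup>+ y. \<integral>\<^sup>+ x. f (x, y) \<partial>lborel \<partial>lborel)"
proof -
  have "f \<in> borel_measurable (lborel \<Otimes>\<^sub>M lborel)" using assms by (simp add: lborel_prod)
  from lborel_pair.nn_integral_snd[OF this] nn_integral_real2[OF assms] show ?thesis by (simp add: lborel_prod)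
qed

lemma measurable_Pair_section:
  fixes f :: "'a::euclidean_space \<times> 'b::euclidean_space \<Rightarrow> 'c::topological_space"
  assumes "f \<in> borel_measurable borel"
  shows "(\<lambda>y. f (x, y)) \<in> borel_measurable borel"
  by (rule measurable_compose[OF _ assms]) (intro borel_measurable_continuous_onI continuous_intros)

lemma nn_integral_real3:
  fixes f :: "real \<times> real \<times> real \<Rightarrow> ennreal"
  assumes "f \<in> borel_measurable borel"
  shows "(\<integral>\<^sup>+ t. f t \<partial>lborel) = (\<integral>\<^sup>+ x. \<integral>\<^sup>+ y. \<integral>\<^sup>+ y'. f (x, y, y') \<partial>lborel \<partial>lborel \<partial>lborel)"
  unfolding nn_integral_real2[OF assms]
  by (rule nn_integral_cong, rule nn_integral_real2, rule measurable_Pair_section[OF assms])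

lemma nn_integral_shift:
  fixes f :: "'a::euclidean_space \<Rightarrow> ennreal"
  assumes [measurable]: "f \<in> borel_measurable borel"
  shows "(\<integral>\<^sup>+ t. f (c + t) \<partial>lborel) = (\<integral>\<^sup>+ t. f t \<partial>lborel)"
  by (subst (2) lborel_distr_plus[of c, symmetric], subst nn_integral_distr) auto

lemma preserving_shift: "lborel_preserving ((+) (c :: 'a::euclidean_space))"
  by (rule lborel_preservingI) (auto simp: nn_integral_shift)

lemma preserving_swap: "lborel_preserving (\<lambda>t::real\<times>real\<times>real. (fst t, snd (snd t), fst (snd t)))"
proof (rule lborel_preservingI)
  show m: "(\<lambda>t::real\<times>real\<times>real. (fst t, snd (snd t), fst (snd t))) \<in> borel_measurable borel"
    by (intro borel_measurable_continuous_onI continuous_intros)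
  fix f :: "real \<times> real \<times> real \<Rightarrow> ennreal" assume f: "f \<in> borel_measurable borel"
  have fT: "(\<lambda>t. f ((fst t, snd (snd t), fst (snd t)))) \<in> borel_measurable borel" using measurable_compose[OF m f] .
  show "(\<integral>\<^sup>+ t. f ((fst t, snd (snd t), fst (snd t))) \<partial>lborel) = (\<integral>\<^sup>+ t. f t \<partial>lborel)"
    unfolding nn_integral_real3[OF f] nn_integral_real3[OF fT] fst_conv snd_conv
    by (rule nn_integral_cong, rule nn_integral_real2_swap[symmetric], rule measurable_Pair_section[OF f])
qed

text \<open>Passes from the pair (y, y') to a base point and an increment, y' = y + h, so that the
  Gagliardo kernel depends on the last coordinate alone.\<close>

lemma preserving_shear: "lborel_preserving (\<lambda>t::real\<times>real\<times>real. (fst t, fst (snd t), fst (snd t) + snd (snd t)))"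
proof (rule lborel_preservingI)
  show m: "(\<lambda>t::real\<times>real\<times>real. (fst t, fst (snd t), fst (snd t) + snd (snd t))) \<in> borel_measurable borel"
    by (intro borel_measurable_continuous_onI continuous_intros)
  fix f :: "real \<times> real \<times> real \<Rightarrow> ennreal" assume f: "f \<in> borel_measurable borel"
  have fT: "(\<lambda>t. f ((fst t, fst (snd t), fst (snd t) + snd (snd t)))) \<in> borel_measurable borel" using measurable_compose[OF m f] .
  show "(\<integral>\<^sup>+ t. f ((fst t, fst (snd t), fst (snd t) + snd (snd t))) \<partial>lborel) = (\<integral>\<^sup>+ t. f t \<partial>lborel)"
    unfolding nn_integral_real3[OF f] nn_integral_real3[OF fT] fst_conv snd_conv
    by (intro nn_integral_cong nn_integral_shift measurable_Pair_section f)
qed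

lemma nn_integral_uminus:
  fixes f :: "real \<Rightarrow> ennreal"
  assumes [measurable]: "f \<in> borel_measurable borel"
  shows "(\<integral>\<^sup>+ t. f (- t) \<partial>lborel) = (\<integral>\<^sup>+ t. f t \<partial>lborel)"
  by (subst (2) lborel_distr_uminus[symmetric], subst nn_integral_distr) auto

lemma preserving_reflect: "lborel_preserving (\<lambda>t::real\<times>real\<times>real. (fst t, fst (snd t), - snd (snd t)))"
proof (rule lborel_preservingI)
  show m: "(\<lambda>t::real\<times>real\<times>real. (fst t, fst (snd t), - snd (snd t))) \<in> borel_measurable borel"
    by (intro borel_measurable_continuous_onI continuous_intros)
  fix f :: "real \<times> real \<times> real \<Rightarrow> ennreal" assume f: "f \<in> borel_measurable borel"
  have fT: "(\<lambda>t. f ((fst t, fst (snd t), - snd (snd t)))) \<in> borel_measurable borel" using measurable_compose[OF m f] .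
  show "(\<integral>\<^sup>+ t. f ((fst t, fst (snd t), - snd (snd t))) \<partial>lborel) = (\<integral>\<^sup>+ t. f t \<partial>lborel)"
    unfolding nn_integral_real3[OF f] nn_integral_real3[OF fT] fst_conv snd_conv
    by (intro nn_integral_cong nn_integral_uminus measurable_Pair_section f)
qed

subsection \<open>Square-integrable functions\<close>

lemma memLp2_iff: "memLp 2 f \<longleftrightarrow> f \<in> borel_measurable borel \<and> integrable lborel (\<lambda>z. (f z)^2)"
proof -
  have "\<bar>f z\<bar> powr 2 = (f z)^2" for z
    by (cases "f z = 0") (auto simp: powr_numeral)
  then show ?thesis by (simp add: memLp_def)
qed

lemma Lpow2_eq: "Lpow 2 f = (LINT z|lborel. (f z)^2)"
proof -
  have "\<bar>f z\<bar> powr 2 = (f z)^2" for z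
    by (cases "f z = 0") (auto simp: powr_numeral)
  then show ?thesis by (simp add: Lpow_def)
qed

lemma memLp2_mult:
  assumes "memLp 2 f" "memLp 2 g"
  shows "integrable lborel (\<lambda>z. f z * g z)"
proof -
  have [measurable]: "f \<in> borel_measurable borel" "g \<in> borel_measurable borel"
    using assms by (auto simp: memLp2_iff)
  have "integrable lborel (\<lambda>z. (f z)^2 + (g z)^2)" using assms by (auto simp: memLp2_iff)
  then show ?thesis
  proof (rule Bochner_Integration.integrable_bound)
    have "\<bar>a * b\<bar> \<le> a^2 + b^2" for a b :: real
    proof -
      have "\<bar>a * b\<bar> \<le> 2 * \<bar>a\<bar> * \<bar>b\<bar>" by (simp add: abs_mult)
      also have "\<dots> \<le> \<bar>a\<bar>^2 + \<bar>b\<bar>^2" by (rule sum_squares_bound)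
      finally show ?thesis by simp
    qed
    then show "AE z in lborel. norm (f z * g z) \<le> norm ((f z)\<^sup>2 + (g z)\<^sup>2)" by auto
  qed measurable
qed

lemma memLp2_lin:
  assumes "memLp 2 f" "memLp 2 g"
  shows "memLp 2 (\<lambda>z. a * f z + b * g z)"
proof -
  have [measurable]: "f \<in> borel_measurable borel" "g \<in> borel_measurable borel"
    using assms by (auto simp: memLp2_iff)
  have "integrable lborel (\<lambda>z. a^2 * (f z)^2 + 2 * (a * b) * (f z * g z) + b^2 * (g z)^2)"
    using assms memLp2_mult[OF assms] by (auto simp: memLp2_iff)
  moreover have "a^2 * (f z)^2 + 2 * (a * b) * (f z * g z) + b^2 * (g z)^2 = (a * f z + b * g z)^2" for z
    by (simp add: power2_eq_square algebra_simps)
  ultimately show ?thesis by (simp add: memLp2_iff)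
qed

subsection \<open>Test functions\<close>

lemma compact_closure_iff: "compact (closure S) \<longleftrightarrow> bounded (S :: 'a::euclidean_space set)"
  by (meson bounded_closure bounded_subset closed_closure closure_subset compact_eq_bounded_closed)

lemma test_funI:
  assumes "\<And>z. (\<phi> has_derivative (\<lambda>w. fst w * f1 z + snd w * f2 z)) (at z)"
    and "continuous_on UNIV f1" "continuous_on UNIV f2" and "bounded {z. \<phi> z \<noteq> 0}"
  shows "test_fun \<phi>" "dxf \<phi> = f1"
proof -
  have fd: "frechet_derivative \<phi> (at z) = (\<lambda>w. fst w * f1 z + snd w * f2 z)" for z
    using frechet_derivative_at[OF assms(1)] by simp
  show "dxf \<phi> = f1" by (rule ext) (simp add: dxf_def fd)
  show "test_fun \<phi>"
    unfolding test_fun_def fd compact_closure_iff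
    using assms by (auto simp: differentiable_def)
qed

lemma test_funD:
  assumes "test_fun \<phi>"
  obtains f2 where "\<And>z. (\<phi> has_derivative (\<lambda>w. fst w * dxf \<phi> z + snd w * f2 z)) (at z)"
    "continuous_on UNIV (dxf \<phi>)" "continuous_on UNIV f2" "bounded {z. \<phi> z \<noteq> 0}"
proof -
  define f2 where "f2 = (\<lambda>z. frechet_derivative \<phi> (at z) (0,1))"
  have d: "(\<phi> has_derivative frechet_derivative \<phi> (at z)) (at z)" for z
    using assms frechet_derivative_works unfolding test_fun_def by blast
  have "frechet_derivative \<phi> (at z) = (\<lambda>w. fst w * dxf \<phi> z + snd w * f2 z)" for z
  proof
    fix w :: "real \<times> real"
    interpret bounded_linear "frechet_derivative \<phi> (at z)" using d has_derivative_bounded_linear by blast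
    have "w = fst w *\<^sub>R (1,0) + snd w *\<^sub>R (0,1)" by (simp add: prod_eq_iff)
    then have "frechet_derivative \<phi> (at z) w = frechet_derivative \<phi> (at z) (fst w *\<^sub>R (1,0) + snd w *\<^sub>R (0,1))" by simp
    also have "\<dots> = fst w * dxf \<phi> z + snd w * f2 z"
      by (simp only: add scaleR) (simp add: dxf_def f2_def)
    finally show "frechet_derivative \<phi> (at z) w = fst w * dxf \<phi> z + snd w * f2 z" .
  qed
  then have "\<And>z. (\<phi> has_derivative (\<lambda>w. fst w * dxf \<phi> z + snd w * f2 z)) (at z)" using d by metis
  moreover have "continuous_on UNIV (dxf \<phi>)" "continuous_on UNIV f2" "bounded {z. \<phi> z \<noteq> 0}"
    using assms unfolding test_fun_def dxf_def[abs_def] f2_def compact_closure_iff by auto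
  ultimately show thesis using that by blast
qed

lemma continuous_compact_support:
  fixes \<phi> :: "real \<times> real \<Rightarrow> real"
  assumes "continuous_on UNIV \<phi>" "bounded {z. \<phi> z \<noteq> 0}"
  shows "\<exists>B. \<forall>z. \<bar>\<phi> z\<bar> \<le> B" "\<exists>R. \<forall>z. \<phi> z \<noteq> 0 \<longrightarrow> \<bar>fst z\<bar> \<le> R \<and> \<bar>snd z\<bar> \<le> R" "memLp 2 \<phi>"
proof -
  obtain R where R: "\<And>z. \<phi> z \<noteq> 0 \<Longrightarrow> norm z \<le> R" using assms(2) by (auto simp: bounded_iff)
  show "\<exists>R. \<forall>z. \<phi> z \<noteq> 0 \<longrightarrow> \<bar>fst z\<bar> \<le> R \<and> \<bar>snd z\<bar> \<le> R"
    using R norm_fst_le norm_snd_le by (metis order_trans prod.collapse real_norm_def)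
  have "compact (\<phi> ` cball 0 R)" using assms(1) by (intro compact_continuous_image) (auto intro: continuous_on_subset)
  then have "bounded (\<phi> ` cball 0 R)" by (rule compact_imp_bounded)
  then obtain B where B: "\<And>z. norm z \<le> R \<Longrightarrow> \<bar>\<phi> z\<bar> \<le> B"
    unfolding bounded_iff by (metis imageI mem_cball_0 real_norm_def)
  have B': "\<bar>\<phi> z\<bar> \<le> max B 0" for z using R[of z] B[of z] by fastforce
  then show "\<exists>B. \<forall>z. \<bar>\<phi> z\<bar> \<le> B" by blast
  have [measurable]: "\<phi> \<in> borel_measurable borel" by (rule borel_measurable_continuous_onI[OF assms(1)])
  have "integrable lborel (\<lambda>z. indicator (cball 0 R) z *\<^sub>R (\<phi> z)^2)"
    by (rule borel_integrable_compact) (auto intro!: continuous_intros continuous_on_subset[OF assms(1)])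
  then have "integrable lborel (\<lambda>z. indicator (cball 0 R) z * (\<phi> z)^2)" by simp
  moreover have "indicator (cball 0 R) z * (\<phi> z)^2 = (\<phi> z)^2" for z using R[of z] by (auto simp: indicator_def)
  ultimately show "memLp 2 \<phi>" by (simp add: memLp2_iff)
qed

lemma test_fun_continuous: assumes "test_fun \<phi>" shows "continuous_on UNIV \<phi>"
proof -
  obtain f2 where "\<And>z. (\<phi> has_derivative (\<lambda>w. fst w * dxf \<phi> z + snd w * f2 z)) (at z)"
    using test_funD[OF assms] by blast
  then show ?thesis using has_derivative_continuous continuous_at_imp_continuous_on by blast
qed

lemma test_fun_supp: assumes "test_fun \<phi>" shows "bounded {z. \<phi> z \<noteq> 0}" "{z. dxf \<phi> z \<noteq> 0} \<subseteq> closure {z. \<phi> z \<noteq> 0}"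
proof -
  show "bounded {z. \<phi> z \<noteq> 0}" using test_funD[OF assms] by blast
  show "{z. dxf \<phi> z \<noteq> 0} \<subseteq> closure {z. \<phi> z \<noteq> 0}"
  proof (rule ccontr)
    assume "\<not> ?thesis"
    then obtain z where z: "dxf \<phi> z \<noteq> 0" "z \<in> - closure {z. \<phi> z \<noteq> 0}" by auto
    have "(\<phi> has_derivative (\<lambda>w. 0)) (at z)"
    proof (rule has_derivative_transform_within_open[of "\<lambda>_. 0"])
      show "open (- closure {z. \<phi> z \<noteq> 0})" by (rule open_Compl[OF closed_closure])
      show "\<And>x. x \<in> - closure {z. \<phi> z \<noteq> 0} \<Longrightarrow> 0 = \<phi> x"
        using closure_subset[of "{z. \<phi> z \<noteq> 0}"] by auto
    qed (use z in auto)
    then have "frechet_derivative \<phi> (at z) = (\<lambda>w. 0)" by (rule frechet_derivative_at[symmetric])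
    with z show False by (simp add: dxf_def)
  qed
qed

lemma test_fun_dxf: assumes "test_fun \<phi>"
  shows "continuous_on UNIV (dxf \<phi>)" "bounded {z. dxf \<phi> z \<noteq> 0}"
proof -
  show "continuous_on UNIV (dxf \<phi>)" using test_funD[OF assms] by blast
  show "bounded {z. dxf \<phi> z \<noteq> 0}"
    using test_fun_supp[OF assms] bounded_subset bounded_closure by blast
qed

lemma test_fun_memLp2: assumes "test_fun \<phi>" shows "memLp 2 \<phi>" "memLp 2 (dxf \<phi>)"
  using continuous_compact_support(3) test_fun_continuous[OF assms] test_fun_supp[OF assms] test_fun_dxf[OF assms] by auto

subsection \<open>Uniqueness of weak derivatives and the energy space\<close>

text \<open>The explicit cutoffs and truncations below are built from powers of positive parts; from
  the second power on the corner at zero is differentiable, since the difference quotient there is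
  at most \<open>\<bar>h\<bar> ^ Suc n\<close>.\<close>

lemma pos_part_power_deriv:
  "((\<lambda>x::real. (max 0 x) ^ Suc (Suc n)) has_real_derivative real (Suc (Suc n)) * (max 0 x) ^ Suc n) (at x)"
proof (cases x "0::real" rule: linorder_cases)
  case less
  have "((\<lambda>x::real. (max 0 x) ^ Suc (Suc n)) has_real_derivative 0) (at x)"
    by (rule has_field_derivative_transform_within_open[of "\<lambda>_. 0" _ _ "{..<0}"]) (use less in auto)
  then show ?thesis using less by simp
next
  case greater
  have "((\<lambda>x::real. x ^ Suc (Suc n)) has_real_derivative real (Suc (Suc n)) * x ^ Suc n) (at x)"
    by (rule DERIV_cong[OF DERIV_pow]) simp
  then have "((\<lambda>x::real. (max 0 x) ^ Suc (Suc n)) has_real_derivative real (Suc (Suc n)) * x ^ Suc n) (at x)"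
    by (rule has_field_derivative_transform_within_open[of _ _ _ "{0<..}"]) (use greater in auto)
  then show ?thesis using greater by simp
next
  case equal
  have "((\<lambda>h::real. (max 0 h) ^ Suc (Suc n) / h) \<longlongrightarrow> 0) (at 0)"
  proof (rule Lim_null_comparison)
    have "norm ((max 0 h) ^ Suc (Suc n) / h) \<le> \<bar>h\<bar> ^ Suc n" for h :: real
    proof (cases "h > 0")
      case False
      then have "max 0 h = 0" by simp
      then show ?thesis by (simp del: power_Suc add: power_0_left)
    qed simp
    then show "\<forall>\<^sub>F h in at 0. norm ((max 0 h) ^ Suc (Suc n) / h) \<le> \<bar>h\<bar> ^ Suc n" for h :: real by simp
    have "((\<lambda>h::real. \<bar>h\<bar> ^ Suc n) \<longlongrightarrow> \<bar>0\<bar> ^ Suc n) (at 0)" by (intro tendsto_intros)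
    then show "((\<lambda>h::real. \<bar>h\<bar> ^ Suc n) \<longlongrightarrow> 0) (at 0)" by simp
  qed
  then show ?thesis using equal by (simp add: DERIV_def)
qed

lemma test_fun_prod:
  fixes f g :: "real \<Rightarrow> real"
  assumes f: "\<And>x. (f has_real_derivative f' x) (at x)" "continuous_on UNIV f'" "\<And>x. \<bar>x\<bar> > R \<Longrightarrow> f x = 0"
    and g: "\<And>x. (g has_real_derivative g' x) (at x)" "continuous_on UNIV g'" "\<And>x. \<bar>x\<bar> > R \<Longrightarrow> g x = 0"
  shows "test_fun (\<lambda>z. f (fst z) * g (snd z))" "dxf (\<lambda>z. f (fst z) * g (snd z)) = (\<lambda>z. f' (fst z) * g (snd z))"
proof -
  let ?p = "\<lambda>z. f (fst z) * g (snd z)"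
  have cf: "continuous_on UNIV f" using f(1) by (meson DERIV_isCont continuous_at_imp_continuous_on)
  have cg: "continuous_on UNIV g" using g(1) by (meson DERIV_isCont continuous_at_imp_continuous_on)
  have 1: "(?p has_derivative (\<lambda>w. fst w * (f' (fst z) * g (snd z)) + snd w * (f (fst z) * g' (snd z)))) (at z)" for z
  proof -
    have a: "((\<lambda>z. f (fst z)) has_derivative (\<lambda>w. f' (fst z) * fst w)) (at z)"
      by (rule has_derivative_compose[OF has_derivative_fst[OF has_derivative_ident] f(1)[unfolded has_field_derivative_def]])
    have b: "((\<lambda>z. g (snd z)) has_derivative (\<lambda>w. g' (snd z) * snd w)) (at z)"
      by (rule has_derivative_compose[OF has_derivative_snd[OF has_derivative_ident] g(1)[unfolded has_field_derivative_def]])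
    show ?thesis by (rule has_derivative_eq_rhs[OF has_derivative_mult[OF a b]]) (auto simp: algebra_simps)
  qed
  have 2: "continuous_on UNIV (\<lambda>z. f' (fst z) * g (snd z))" "continuous_on UNIV (\<lambda>z. f (fst z) * g' (snd z))"
    by (intro continuous_intros continuous_on_compose2[OF f(2)] continuous_on_compose2[OF cf]
          continuous_on_compose2[OF g(2)] continuous_on_compose2[OF cg]; simp)+
  have 3: "bounded {z. ?p z \<noteq> 0}"
  proof (rule bounded_subset)
    show "bounded (cbox (-R,-R) (R,R))" by simp
    have "\<bar>fst z\<bar> \<le> R \<and> \<bar>snd z\<bar> \<le> R" if "?p z \<noteq> 0" for z using that f(3)[of "fst z"] g(3)[of "snd z"] by (auto simp: not_less[symmetric])
    then show "{z. ?p z \<noteq> 0} \<subseteq> cbox (-R,-R) (R,R)" by (force simp: cbox_Pair_eq)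
  qed
  show "test_fun ?p" "dxf ?p = (\<lambda>z. f' (fst z) * g (snd z))"
    using test_funI[OF 1 2 3] by auto
qed

text \<open>A product of squared positive parts is a C^1 function that is positive exactly on the
  box; the map t |-> n t / (1 + n t) then pushes its positive values to 1 and keeps the support,
  which avoids mollifiers.\<close>

lemma test_fun_box_approx:
  fixes a b :: "real \<times> real"
  obtains \<phi> :: "nat \<Rightarrow> fn2" where "\<And>n. test_fun (\<phi> n)" "\<And>n z. \<bar>\<phi> n z\<bar> \<le> indicator (box a b) z"
    "\<And>z. (\<lambda>n. \<phi> n z) \<longlonglongrightarrow> indicator (box a b) z"
proof -
  define \<psi> where "\<psi> = (\<lambda>l r x::real. (max 0 (x - l))^2 * (max 0 (r - x))^2)"
  define \<psi>' where "\<psi>' = (\<lambda>l r x::real. 2 * max 0 (x - l) * (max 0 (r - x))^2 - (max 0 (x - l))^2 * (2 * max 0 (r - x)))"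
  have d: "(\<psi> l r has_real_derivative \<psi>' l r x) (at x)" for l r x
  proof -
    have p: "((\<lambda>x. (max 0 x)^2) has_real_derivative 2 * max 0 x) (at x)" for x :: real
      using pos_part_power_deriv[of 0 x] by (simp add: numeral_2_eq_2)
    have a: "((\<lambda>x. (max 0 (x - l))\<^sup>2) has_real_derivative (2 * max 0 (x - l)) * 1) (at x)"
      by (rule DERIV_chain2[OF p]) (auto intro!: derivative_eq_intros)
    have b: "((\<lambda>x. (max 0 (r - x))\<^sup>2) has_real_derivative (2 * max 0 (r - x)) * (-1)) (at x)"
      by (rule DERIV_chain2[OF p]) (auto intro!: derivative_eq_intros)
    show ?thesis unfolding \<psi>_def \<psi>'_def
      by (rule DERIV_cong[OF DERIV_mult[OF a b]]) (simp add: algebra_simps)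
  qed
  have c: "continuous_on UNIV (\<psi>' l r)" for l r unfolding \<psi>'_def by (intro continuous_intros)
  have z: "\<psi> l r x = 0" if "\<not> (l < x \<and> x < r)" for l r x using that by (auto simp: \<psi>_def)
  have nn: "\<psi> l r x \<ge> 0" for l r x by (simp add: \<psi>_def)
  have pos: "\<psi> l r x > 0" if "l < x" "x < r" for l r x using that by (auto simp: \<psi>_def)
  define R where "R = \<bar>fst a\<bar> + \<bar>fst b\<bar> + \<bar>snd a\<bar> + \<bar>snd b\<bar>"
  define \<Psi> where "\<Psi> = (\<lambda>z. \<psi> (fst a) (fst b) (fst z) * \<psi> (snd a) (snd b) (snd z))"
  have R: "\<bar>fst a\<bar> \<le> R" "\<bar>fst b\<bar> \<le> R" "\<bar>snd a\<bar> \<le> R" "\<bar>snd b\<bar> \<le> R" by (auto simp: R_def)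
  have t: "test_fun \<Psi>"
    unfolding \<Psi>_def by (rule test_fun_prod(1)[OF d c _ d c, of R]) (use R in \<open>intro z; auto\<close>)+
  have nnP: "\<Psi> z \<ge> 0" for z using nn by (simp add: \<Psi>_def)
  have box: "z \<in> box a b \<longleftrightarrow> fst a < fst z \<and> fst z < fst b \<and> snd a < snd z \<and> snd z < snd b" for z
    by (cases a; cases b; cases z) (auto simp: box_def Basis_prod_def inner_prod_def)
  have zP: "\<Psi> w = 0" if "w \<notin> box a b" for w using that z by (force simp: \<Psi>_def box)
  have posP: "\<Psi> z > 0" if "z \<in> box a b" for z using that pos by (simp add: \<Psi>_def box)
  obtain f2 where f2: "\<And>z. (\<Psi> has_derivative (\<lambda>w. fst w * dxf \<Psi> z + snd w * f2 z)) (at z)"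
    "continuous_on UNIV (dxf \<Psi>)" "continuous_on UNIV f2" "bounded {z. \<Psi> z \<noteq> 0}" using test_funD[OF t] by blast
  define \<phi> where "\<phi> = (\<lambda>n::nat. \<lambda>z. real n * \<Psi> z / (1 + real n * \<Psi> z))"
  have ne: "1 + real n * \<Psi> z > 0" for n z using nnP[of z] by (simp add: add_pos_nonneg)
  show thesis
  proof (rule that[of \<phi>])
    fix n
    have "\<phi> n z \<noteq> 0 \<longrightarrow> \<Psi> z \<noteq> 0" for z by (auto simp: \<phi>_def)
    then have bd: "bounded {z. \<phi> n z \<noteq> 0}" using f2(4) by (auto intro: bounded_subset)
    have dd: "(\<phi> n has_derivative (\<lambda>w. fst w * (real n * dxf \<Psi> z / (1 + real n * \<Psi> z)^2) + snd w * (real n * f2 z / (1 + real n * \<Psi> z)^2))) (at z)" for z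
    proof -
      have g: "((\<lambda>t. real n * t / (1 + real n * t)) has_real_derivative real n / (1 + real n * \<Psi> z)^2) (at (\<Psi> z))"
        using ne[of n z] by (auto intro!: derivative_eq_intros simp: field_simps power2_eq_square)
      show ?thesis unfolding \<phi>_def
        by (rule has_derivative_eq_rhs[OF has_derivative_compose[OF f2(1) g[unfolded has_field_derivative_def]]]) (auto simp: field_simps add_divide_distrib)
    qed
    show "test_fun (\<phi> n)"
      by (rule test_funI(1)[OF dd _ _ bd])
        (intro continuous_intros f2(2,3) test_fun_continuous[OF t] ballI; use ne[of n] in \<open>metis less_irrefl power_eq_0_iff\<close>)+
  next
    fix n z
    have "\<phi> n z \<le> 1" "\<phi> n z \<ge> 0" using ne[of n z] nnP[of z] by (auto simp: \<phi>_def field_simps)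
    moreover have "\<phi> n z = 0" if "z \<notin> box a b" using zP[OF that] by (simp add: \<phi>_def)
    ultimately show "\<bar>\<phi> n z\<bar> \<le> indicator (box a b) z" by (auto simp: indicator_def)
  next
    fix z
    show "(\<lambda>n. \<phi> n z) \<longlonglongrightarrow> indicator (box a b) z"
    proof (cases "z \<in> box a b")
      case True
      have c: "\<Psi> z > 0" using posP True by simp
      have "(\<lambda>n. 1 - 1 / (1 + real n * \<Psi> z)) \<longlonglongrightarrow> 1 - 0"
      proof (intro tendsto_intros real_tendsto_divide_at_top[OF tendsto_const] filterlim_tendsto_add_at_top[OF tendsto_const])
        show "filterlim (\<lambda>n. real n * \<Psi> z) at_top sequentially"
          using filterlim_at_top_mult_tendsto_pos[OF tendsto_const c filterlim_real_sequentially] by simp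
      qed
      moreover have "1 - 1 / (1 + real n * \<Psi> z) = \<phi> n z" for n using ne[of n z] by (simp add: \<phi>_def field_simps)
      ultimately show ?thesis using True by simp
    next
      case False
      then show ?thesis using zP by (simp add: \<phi>_def)
    qed
  qed
qed

text \<open>Boxes form an intersection-stable generator, so two measures that agree and are finite
  on them coincide; equality of the measures then forces their densities to agree.\<close>

lemma AE_zero_if_box_integrals_zero:
  fixes w :: "'a::euclidean_space \<Rightarrow> real"
  assumes [measurable]: "w \<in> borel_measurable borel"
    and int: "\<And>a b. integrable lborel (\<lambda>z. indicator (box a b) z * w z)"
    and zero: "\<And>a b. (LINT z|lborel. indicator (box a b) z * w z) = 0"
  shows "AE z in lborel. w z = 0"
proof -
  \<comment> \<open>\<open>ennreal\<close> maps negative reals to zero, so these densities are the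
    positive and the negative part of \<open>w\<close>.\<close>
  let ?M = "density lborel (\<lambda>z. ennreal (w z))" and ?N = "density lborel (\<lambda>z. ennreal (- w z))"
  have e: "emeasure (density lborel (\<lambda>z. ennreal (f z))) (box a b) = ennreal (LINT z|lborel. max 0 (indicator (box a b) z * f z))"
    if [measurable]: "f \<in> borel_measurable borel" and i: "integrable lborel (\<lambda>z. indicator (box a b) z * f z)" for f :: "'a \<Rightarrow> real" and a b
  proof -
    have "emeasure (density lborel (\<lambda>z. ennreal (f z))) (box a b) = (\<integral>\<^sup>+ z. ennreal (max 0 (indicator (box a b) z * f z)) \<partial>lborel)"
      by (subst emeasure_density) (auto intro!: nn_integral_cong simp: indicator_def max_def ennreal_neg)
    also have "\<dots> = ennreal (LINT z|lborel. max 0 (indicator (box a b) z * f z))"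
      using i by (intro nn_integral_eq_integral) auto
    finally show ?thesis .
  qed
  have eq: "emeasure ?M (box a b) = emeasure ?N (box a b)" for a b
  proof -
    have i2: "integrable lborel (\<lambda>z. indicator (box a b) z * - w z)" using int[of a b] by simp
    have "(LINT z|lborel. max 0 (indicator (box a b) z * w z)) - (LINT z|lborel. max 0 (indicator (box a b) z * - w z))
      = (LINT z|lborel. max 0 (indicator (box a b) z * w z) - max 0 (indicator (box a b) z * - w z))"
      using int[of a b] i2 by (subst Bochner_Integration.integral_diff) auto
    also have "\<dots> = (LINT z|lborel. indicator (box a b) z * w z)"
      by (intro Bochner_Integration.integral_cong) (auto simp: max_def)
    finally have "(LINT z|lborel. max 0 (indicator (box a b) z * w z)) = (LINT z|lborel. max 0 (indicator (box a b) z * - w z))"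
      using zero[of a b] by simp
    then show ?thesis using e[OF _ int[of a b]] e[OF _ i2] by simp
  qed
  have "?M = ?N"
  proof (rule measure_eqI_generator_eq)
    let ?E = "range (\<lambda>(a, b). box a b::'a set)"
    show "Int_stable ?E" by (auto simp: Int_stable_def box_Int_box)
    show "?E \<subseteq> Pow UNIV" "sets ?M = sigma_sets UNIV ?E" "sets ?N = sigma_sets UNIV ?E"
      by (simp_all add: borel_eq_box)
    let ?A = "\<lambda>n::nat. box (- (real n *\<^sub>R One)) (real n *\<^sub>R One) :: 'a set"
    show "range ?A \<subseteq> ?E" "(\<Union>i. ?A i) = UNIV"
      unfolding UN_box_eq_UNIV by auto
    show "emeasure ?M (?A i) \<noteq> \<infinity>" for i using e[OF _ int] by simp
    show "emeasure ?M X = emeasure ?N X" if "X \<in> ?E" for X using that eq by auto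
  qed
  then have "AE z in lborel. ennreal (w z) = ennreal (- w z)"
    by (intro sigma_finite_measure.density_unique[OF lborel.sigma_finite_measure_axioms]) auto
  then show ?thesis
  proof eventually_elim
    case (elim z)
    then show ?case by (cases "w z" "0::real" rule: linorder_cases) (auto simp: ennreal_neg ennreal_eq_0_iff dest: sym)
  qed
qed

lemma memLp2_box: "memLp 2 f \<Longrightarrow> integrable lborel (\<lambda>z. indicator (box a b) z * f z)"
proof (rule memLp2_mult)
  have "(\<lambda>z. (indicator (box a b) z :: real)^2) = indicator (box a b)" by (auto simp: indicator_def)
  moreover have "integrable lborel (indicator (box a b) :: _ \<Rightarrow> real)" using emeasure_bounded_finite[OF bounded_box, of a b] by (intro integrable_real_indicator) auto
  ultimately show "memLp 2 (indicator (box a b))" by (simp add: memLp2_iff)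
qed

lemma fundamental_lemma:
  fixes w :: fn2
  assumes [measurable]: "w \<in> borel_measurable borel"
    and int: "\<And>a b. integrable lborel (\<lambda>z. indicator (box a b) z * w z)"
    and zero: "\<And>\<phi>. test_fun \<phi> \<Longrightarrow> (LINT z|lborel. w z * \<phi> z) = 0"
  shows "AE z in lborel. w z = 0"
proof (rule AE_zero_if_box_integrals_zero[OF assms(1) int])
  fix a b :: "real \<times> real"
  obtain \<phi> where \<phi>: "\<And>n. test_fun (\<phi> n)" "\<And>n z. \<bar>\<phi> n z\<bar> \<le> indicator (box a b) z"
    "\<And>z. (\<lambda>n. \<phi> n z) \<longlonglongrightarrow> indicator (box a b) z" using test_fun_box_approx by blast
  have [measurable]: "\<phi> n \<in> borel_measurable borel" for n using test_fun_memLp2(1)[OF \<phi>(1)] by (simp add: memLp2_iff)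
  have "(\<lambda>n. LINT z|lborel. w z * \<phi> n z) \<longlonglongrightarrow> (LINT z|lborel. w z * indicator (box a b) z)"
  proof (rule integral_dominated_convergence[where w="\<lambda>z. \<bar>indicator (box a b) z * w z\<bar>"])
    show "AE z in lborel. (\<lambda>n. w z * \<phi> n z) \<longlonglongrightarrow> w z * indicator (box a b) z"
      using \<phi>(3) by (auto intro!: tendsto_intros)
    show "AE z in lborel. norm (w z * \<phi> n z) \<le> \<bar>indicator (box a b) z * w z\<bar>" for n
    proof (intro AE_I2)
      fix z show "norm (w z * \<phi> n z) \<le> \<bar>indicator (box a b) z * w z\<bar>"
        using mult_left_mono[OF \<phi>(2)[of n z], of "\<bar>w z\<bar>"] by (simp add: abs_mult mult.commute)
    qed
  qed (use int in auto)
  moreover have "(LINT z|lborel. w z * \<phi> n z) = 0" for n using zero[OF \<phi>(1)] .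
  ultimately have "(LINT z|lborel. w z * indicator (box a b) z) = 0" by (simp add: LIMSEQ_const_iff)
  then show "(LINT z|lborel. indicator (box a b) z * w z) = 0" by (simp add: mult.commute)
qed

text \<open>\<open>wdx\<close> is a Hilbert choice, so nothing about it can be computed directly:
  linearity, scaling and the chain rule for it hold almost everywhere, each obtained by comparison
  with an explicit weak derivative.\<close>

lemma weak_dx_unique:
  assumes "has_weak_dx u g" "has_weak_dx u g'"
  shows "AE z in lborel. g z = g' z"
proof -
  have L: "memLp 2 g" "memLp 2 g'" using assms by (auto simp: has_weak_dx_def)
  have D: "memLp 2 (\<lambda>z. 1 * g z + (-1) * g' z)" by (rule memLp2_lin[OF L])
  have "AE z in lborel. 1 * g z + (-1) * g' z = 0"
  proof (rule fundamental_lemma)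
    show "(\<lambda>z. 1 * g z + (-1) * g' z) \<in> borel_measurable borel" using D by (simp add: memLp2_iff)
    show "integrable lborel (\<lambda>z. indicator (box a b) z * (1 * g z + (-1) * g' z))" for a b by (rule memLp2_box[OF D])
    fix \<phi> assume t: "test_fun \<phi>"
    have "(LINT z|lborel. g z * \<phi> z) = (LINT z|lborel. g' z * \<phi> z)" using assms t by (auto simp: has_weak_dx_def)
    moreover have "integrable lborel (\<lambda>z. g z * \<phi> z)" "integrable lborel (\<lambda>z. g' z * \<phi> z)"
      using memLp2_mult L test_fun_memLp2[OF t] by auto
    ultimately show "(LINT z|lborel. (1 * g z + (-1) * g' z) * \<phi> z) = 0" by (simp add: left_diff_distrib)
  qed
  then show ?thesis by eventually_elim simp
qed

lemma has_weak_dx_lin: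
  assumes "memLp 2 u" "memLp 2 w" "has_weak_dx u g" "has_weak_dx w h"
  shows "has_weak_dx (\<lambda>z. a * u z + b * w z) (\<lambda>z. a * g z + b * h z)"
  unfolding has_weak_dx_def
proof (intro conjI allI impI)
  have L: "memLp 2 g" "memLp 2 h" using assms by (auto simp: has_weak_dx_def)
  show "memLp 2 (\<lambda>z. a * g z + b * h z)" by (rule memLp2_lin[OF L])
  fix \<phi> assume t: "test_fun \<phi>"
  have i: "integrable lborel (\<lambda>z. g z * \<phi> z)" "integrable lborel (\<lambda>z. h z * \<phi> z)"
      "integrable lborel (\<lambda>z. u z * dxf \<phi> z)" "integrable lborel (\<lambda>z. w z * dxf \<phi> z)"
    using memLp2_mult L assms test_fun_memLp2[OF t] by auto
  have "(LINT z|lborel. (a * u z + b * w z) * dxf \<phi> z) = (LINT z|lborel. a * (u z * dxf \<phi> z) + b * (w z * dxf \<phi> z))"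
    by (simp add: algebra_simps)
  also have "\<dots> = - (LINT z|lborel. a * (g z * \<phi> z) + b * (h z * \<phi> z))"
    using i assms(3,4) t by (simp add: has_weak_dx_def)
  finally show "(LINT z|lborel. (a * u z + b * w z) * dxf \<phi> z) = - (LINT z|lborel. (a * g z + b * h z) * \<phi> z)"
    by (simp add: algebra_simps)
qed

section \<open>Linear structure of the energy space\<close>

lemma inH_wdx: "inH s u \<Longrightarrow> has_weak_dx u (wdx u)"
  unfolding inH_def wdx_def by (metis someI_ex)

lemma inH_memLp: "inH s u \<Longrightarrow> memLp 2 u" "inH s u \<Longrightarrow> memLp 2 (wdx u)"
  using inH_wdx by (auto simp: inH_def has_weak_dx_def)

lemma inH_measurable: "inH s u \<Longrightarrow> u \<in> borel_measurable borel" "inH s u \<Longrightarrow> wdx u \<in> borel_measurable borel"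
  using inH_memLp by (auto simp: memLp2_iff)

lemma gag_eq: "gag_integrand s u w = (\<lambda>t. (u (fst t, fst (snd t)) - u (fst t, snd (snd t))) * (w (fst t, fst (snd t)) - w (fst t, snd (snd t)))
       / \<bar>fst (snd t) - snd (snd t)\<bar> powr (1 + 2 * s))"
  by (auto simp: gag_integrand_def fun_eq_iff)

lemma measurable_sections:
  assumes "u \<in> borel_measurable (borel :: (real \<times> real) measure)"
  shows "(\<lambda>t::real\<times>real\<times>real. u (fst t, fst (snd t))) \<in> borel_measurable borel"
    "(\<lambda>t::real\<times>real\<times>real. u (fst t, snd (snd t))) \<in> borel_measurable borel"
    "(\<lambda>t::real\<times>real\<times>real. u (fst t, fst (snd t) + snd (snd t))) \<in> borel_measurable borel"
    "(\<lambda>t::real\<times>real\<times>real. u (fst t, fst (snd t) - snd (snd t))) \<in> borel_measurable borel"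
    "(\<lambda>t::real\<times>real\<times>real. u (fst t + fst (snd t), snd (snd t))) \<in> borel_measurable borel"
  by (rule measurable_compose[OF _ assms], intro borel_measurable_continuous_onI continuous_intros)+

lemma gag_measurable [measurable]:
  assumes [measurable]: "u \<in> borel_measurable borel" "w \<in> borel_measurable borel"
  shows "gag_integrand s u w \<in> borel_measurable borel"
proof -
  have [measurable]: "(\<lambda>t::real\<times>real\<times>real. fst (snd t) - snd (snd t)) \<in> borel_measurable borel"
    by (intro borel_measurable_continuous_onI continuous_intros)
  note measurable_sections[OF assms(1), measurable] measurable_sections[OF assms(2), measurable]
  show ?thesis unfolding gag_eq by measurable
qed

lemma gag_nonneg: "gag_integrand s u u t \<ge> 0"
  by (simp add: gag_eq)

lemma gag_sym: "gag_integrand s u w = gag_integrand s w u"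
  by (simp add: gag_eq mult.commute)

lemma gag_lin: "gag_integrand s (\<lambda>z. a * u z + b * w z) v t = a * gag_integrand s u v t + b * gag_integrand s w v t"
  by (simp add: gag_eq add_divide_distrib[symmetric] algebra_simps)

lemma gag_lin_right: "gag_integrand s v (\<lambda>z. a * u z + b * w z) t = a * gag_integrand s v u t + b * gag_integrand s v w t"
  by (subst (1 2 3) gag_sym) (rule gag_lin)

lemma gag_integrable:
  assumes "inH s u" "inH s w"
  shows "integrable lborel (gag_integrand s u w)"
proof -
  have [measurable]: "u \<in> borel_measurable borel" "w \<in> borel_measurable borel"
    using assms inH_measurable by auto
  have "integrable lborel (\<lambda>t. gag_integrand s u u t + gag_integrand s w w t)"
    using assms by (auto simp: inH_def fracy_fin_def)
  then show ?thesis
  proof (rule Bochner_Integration.integrable_bound)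
    have *: "\<bar>a * b\<bar> \<le> a * a + b * b" for a b :: real
    proof -
      have "\<bar>a * b\<bar> \<le> 2 * \<bar>a\<bar> * \<bar>b\<bar>" by (simp add: abs_mult)
      also have "\<dots> \<le> \<bar>a\<bar>^2 + \<bar>b\<bar>^2" by (rule sum_squares_bound)
      finally show ?thesis by (simp add: power2_eq_square)
    qed
    have "norm (gag_integrand s u w t) \<le> gag_integrand s u u t + gag_integrand s w w t" for t
      unfolding gag_eq add_divide_distrib[symmetric] using * by (simp add: divide_right_mono)
    then show "AE t in lborel. norm (gag_integrand s u w t) \<le> norm (gag_integrand s u u t + gag_integrand s w w t)"
      by (intro AE_I2) (metis abs_ge_self order_trans real_norm_def)
  qed measurable
qed

lemma inH_lin:
  assumes "inH s u" "inH s w"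
  shows "inH s (\<lambda>z. a * u z + b * w z)"
  unfolding inH_def
proof (intro conjI)
  show "memLp 2 (\<lambda>z. a * u z + b * w z)" using memLp2_lin assms by (auto simp: inH_def)
  show "\<exists>g. has_weak_dx (\<lambda>z. a * u z + b * w z) g"
    using has_weak_dx_lin[OF _ _ inH_wdx[OF assms(1)] inH_wdx[OF assms(2)]] assms by (auto simp: inH_def)
  have "integrable lborel (\<lambda>t. a * (a * gag_integrand s u u t + b * gag_integrand s u w t) + b * (a * gag_integrand s w u t + b * gag_integrand s w w t))"
    using gag_integrable assms by auto
  also have "(\<lambda>t. a * (a * gag_integrand s u u t + b * gag_integrand s u w t) + b * (a * gag_integrand s w u t + b * gag_integrand s w w t))
     = gag_integrand s (\<lambda>z. a * u z + b * w z) (\<lambda>z. a * u z + b * w z)"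
    by (rule ext) (simp only: gag_lin gag_lin_right)
  finally show "fracy_fin s (\<lambda>z. a * u z + b * w z)" by (simp add: fracy_fin_def)
qed

lemma wdx_lin:
  assumes "inH s u" "inH s w"
  shows "AE z in lborel. wdx (\<lambda>z. a * u z + b * w z) z = a * wdx u z + b * wdx w z"
  by (rule weak_dx_unique[OF inH_wdx[OF inH_lin[OF assms]] has_weak_dx_lin[OF _ _ inH_wdx[OF assms(1)] inH_wdx[OF assms(2)]]])
    (use assms in \<open>auto simp: inH_def\<close>)

lemma innerK_sym: "innerK s u w = innerK s w u"
  unfolding innerK_def Gy_def by (simp add: mult.commute gag_sym[of s u w])

lemma innerK_lin:
  assumes "inH s u" "inH s w" "inH s v"
  shows "innerK s (\<lambda>z. a * u z + b * w z) v = a * innerK s u v + b * innerK s w v"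
proof -
  have m: "wdx u \<in> borel_measurable borel" "wdx w \<in> borel_measurable borel" "wdx v \<in> borel_measurable borel"
    "wdx (\<lambda>z. a * u z + b * w z) \<in> borel_measurable borel"
    using assms inH_measurable inH_lin by blast+
  have i: "integrable lborel (\<lambda>z. wdx u z * wdx v z)" "integrable lborel (\<lambda>z. wdx w z * wdx v z)"
    using memLp2_mult inH_memLp assms by blast+
  have "(LINT z|lborel. wdx (\<lambda>z. a * u z + b * w z) z * wdx v z) = (LINT z|lborel. a * (wdx u z * wdx v z) + b * (wdx w z * wdx v z))"
    by (rule integral_cong_AE) (use m wdx_lin[OF assms(1,2), of a b] in \<open>auto simp: algebra_simps\<close>)
  also have "\<dots> = a * (LINT z|lborel. wdx u z * wdx v z) + b * (LINT z|lborel. wdx w z * wdx v z)" using i by simp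
  finally have 1: "(LINT z|lborel. wdx (\<lambda>z. a * u z + b * w z) z * wdx v z) = \<dots>" .
  have "(LINT t|lborel. gag_integrand s (\<lambda>z. a * u z + b * w z) v t) = a * (LINT t|lborel. gag_integrand s u v t) + b * (LINT t|lborel. gag_integrand s w v t)"
    unfolding gag_lin using gag_integrable assms by simp
  with 1 show ?thesis by (simp add: innerK_def Gy_def algebra_simps)
qed

lemma innerK_lin_right:
  assumes "inH s u" "inH s w" "inH s v"
  shows "innerK s v (\<lambda>z. a * u z + b * w z) = a * innerK s v u + b * innerK s v w"
  using innerK_lin[OF assms] by (simp add: innerK_sym[of s v])

lemma Kf_lin:
  assumes "inH s u" "inH s w"
  shows "Kf s (\<lambda>z. a * u z + b * w z) = a^2 * Kf s u + 2 * (a * b) * innerK s u w + b^2 * Kf s w"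
  unfolding Kf_def innerK_lin[OF assms inH_lin[OF assms]] innerK_lin_right[OF assms assms(1)] innerK_lin_right[OF assms assms(2)]
  by (simp add: innerK_sym[of s w u] power2_eq_square algebra_simps)

lemma L2_lin:
  assumes "memLp 2 u" "memLp 2 w"
  shows "Lpow 2 (\<lambda>z. a * u z + b * w z) = a^2 * Lpow 2 u + 2 * (a * b) * (LINT z|lborel. u z * w z) + b^2 * Lpow 2 w"
proof -
  have i: "integrable lborel (\<lambda>z. u z * w z)" "integrable lborel (\<lambda>z. (u z)^2)" "integrable lborel (\<lambda>z. (w z)^2)"
    using assms memLp2_mult by (auto simp: memLp2_iff)
  have "Lpow 2 (\<lambda>z. a * u z + b * w z) = (LINT z|lborel. a^2 * (u z)^2 + 2 * (a * b) * (u z * w z) + b^2 * (w z)^2)"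
    unfolding Lpow2_eq by (simp add: power2_eq_square algebra_simps)
  also have "\<dots> = a^2 * Lpow 2 u + 2 * (a * b) * (LINT z|lborel. u z * w z) + b^2 * Lpow 2 w"
    using i by (simp add: Lpow2_eq)
  finally show ?thesis .
qed

lemma innerH_self: "innerH s u u = Lpow 2 u + Kf s u"
  by (simp add: innerH_def Lpow2_eq Kf_def power2_eq_square)

lemma frac_const_pos: "0 < s \<Longrightarrow> s < 1 \<Longrightarrow> frac_const s > 0"
  unfolding frac_const_def by (intro divide_pos_pos mult_pos_pos) (auto intro!: Gamma_real_pos)

lemma Kf_nonneg: assumes "0 < s" "s < 1" shows "Kf s u \<ge> 0"
  unfolding Kf_def innerK_def Gy_def using frac_const_pos[OF assms]
  by (intro add_nonneg_nonneg mult_nonneg_nonneg integral_nonneg_AE) (auto simp: gag_nonneg)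

lemma Lpow_nonneg: "Lpow p u \<ge> 0"
  unfolding Lpow_def by (intro integral_nonneg_AE) auto

lemma has_weak_dx_zero: "AE z in lborel. u z = 0 \<Longrightarrow> has_weak_dx u (\<lambda>_. 0)"
  unfolding has_weak_dx_def
proof (intro conjI allI impI)
  assume z: "AE z in lborel. u z = 0"
  show "memLp 2 (\<lambda>_::real\<times>real. 0)" by (simp add: memLp2_iff)
  fix \<phi>
  have "(LINT z|lborel. u z * dxf \<phi> z) = 0"
    by (rule integral_eq_zero_AE) (use z in \<open>eventually_elim, simp\<close>)
  then show "(LINT z|lborel. u z * dxf \<phi> z) = - (LINT z|lborel. 0 * \<phi> z)" by simp
qed

text \<open>Transfers null sets of the plane to triples: the triples whose first two coordinates lie
  in \<open>N\<close> form a cylinder over \<open>N\<close>, and exchanging y and y' handles the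
  other pair.\<close>

lemma AE_sections:
  assumes "AE z in lborel. P (z :: real \<times> real)"
  shows "AE t in lborel. P (fst t, fst (snd t)) \<and> P (fst t, snd (snd t :: real \<times> real))"
proof -
  obtain N where N: "{z. \<not> P z} \<subseteq> N" "N \<in> sets lborel" "emeasure lborel N = 0" using AE_E[OF assms] by auto
  have [measurable]: "N \<in> sets borel" using N by simp
  have I: "(indicator N :: _ \<Rightarrow> ennreal) \<in> borel_measurable borel" by simp
  have m: "(\<lambda>t::real\<times>real\<times>real. indicator N (fst t, fst (snd t)) :: ennreal) \<in> borel_measurable borel"
    by (rule measurable_compose[OF _ I]) (intro borel_measurable_continuous_onI continuous_intros)
  have z: "AE x in lborel. (\<integral>\<^sup>+ y. indicator N (x, y) \<partial>lborel) = 0"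
  proof -
    have "(\<lambda>x. \<integral>\<^sup>+ y. indicator N (x, y) \<partial>lborel) \<in> borel_measurable lborel"
      by (rule lborel.borel_measurable_nn_integral_fst) (simp add: lborel_prod)
    moreover have "(\<integral>\<^sup>+ x. \<integral>\<^sup>+ y. indicator N (x, y) \<partial>lborel \<partial>lborel) = 0"
      using N nn_integral_real2[OF I] by simp
    ultimately show ?thesis by (subst (asm) nn_integral_0_iff_AE) auto
  qed
  \<comment> \<open>The free coordinate y' contributes a factor of infinity, harmless because almost
    every vertical section of \<open>N\<close> is null and zero times infinity is zero.\<close>
  have "(\<integral>\<^sup>+ t. indicator N (fst t, fst (snd t)) \<partial>(lborel::(real\<times>real\<times>real) measure))
    = (\<integral>\<^sup>+ x. (\<integral>\<^sup>+ y. indicator N (x, y) * \<infinity> \<partial>lborel) \<partial>lborel)"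
    unfolding nn_integral_real3[OF m] by (auto intro!: nn_integral_cong)
  also have "\<dots> = (\<integral>\<^sup>+ x. (\<integral>\<^sup>+ y. indicator N (x, y) \<partial>lborel) * \<infinity> \<partial>lborel)"
    by (intro nn_integral_cong nn_integral_multc) (use measurable_Pair_section[OF I] in simp)
  also have "\<dots> = (\<integral>\<^sup>+ x. 0 \<partial>(lborel :: real measure))"
    by (rule nn_integral_cong_AE) (use z in \<open>eventually_elim, simp\<close>)
  finally have "(\<integral>\<^sup>+ t. indicator N (fst t, fst (snd t)) \<partial>(lborel::(real\<times>real\<times>real) measure)) = 0" by simp
  then have a: "AE t in (lborel::(real\<times>real\<times>real) measure). (indicator N (fst t, fst (snd t)) :: ennreal) = 0"
    using m by (subst (asm) nn_integral_0_iff_AE) auto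
  have b: "AE t in (lborel::(real\<times>real\<times>real) measure). (indicator N (fst t, snd (snd t)) :: ennreal) = 0"
    using preserving_AE[OF preserving_swap a] by simp
  show ?thesis using a b
  proof eventually_elim
    case (elim t)
    then show ?case using N(1) by (auto simp: indicator_def split: if_splits)
  qed
qed

lemma gag_cong_AE:
  assumes "AE z in lborel. u z = u' z" "AE z in lborel. w z = w' z"
  shows "AE t in lborel. gag_integrand s u w t = gag_integrand s u' w' t"
  using AE_sections[OF assms(1)] AE_sections[OF assms(2)]
  by eventually_elim (simp add: gag_eq)

text \<open>Lets a representative be changed on a null set, as when a function that is nonnegative
  almost everywhere is replaced by its positive part.\<close>

lemma inH_zero_AE:
  assumes "u \<in> borel_measurable borel" "AE z in lborel. u z = 0"
  shows "inH s u"
  unfolding inH_def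
proof (intro conjI)
  note assms(1)[measurable]
  have "AE z in lborel. 0 = (u z)^2" using assms(2) by eventually_elim simp
  then have "integrable lborel (\<lambda>z. (u z)^2)"
    by (rule integrable_cong_AE_imp[of lborel "\<lambda>_. 0", rotated 2]) auto
  then show "memLp 2 u" using assms(1) by (simp add: memLp2_iff)
  show "\<exists>g. has_weak_dx u g" by (rule exI, rule has_weak_dx_zero, rule assms(2))
  have "AE t in lborel. gag_integrand s u u t = gag_integrand s (\<lambda>_. 0) (\<lambda>_. 0) t" by (rule gag_cong_AE[OF assms(2) assms(2)])
  then have "AE t in lborel. 0 = gag_integrand s u u t" by eventually_elim (simp add: gag_eq)
  then show "fracy_fin s u" unfolding fracy_fin_def
    by (rule integrable_cong_AE_imp[of lborel "\<lambda>_. 0", rotated 2]) (use gag_measurable[OF assms(1) assms(1)] in auto)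
qed

lemma innerK_zero_AE:
  assumes "u \<in> borel_measurable borel" "AE z in lborel. u z = 0" "inH s w"
  shows "innerK s u w = 0"
proof -
  have H: "inH s u" by (rule inH_zero_AE[OF assms(1,2)])
  have "AE z in lborel. wdx u z = 0" by (rule weak_dx_unique[OF inH_wdx[OF H] has_weak_dx_zero[OF assms(2)]])
  then have 1: "(LINT z|lborel. wdx u z * wdx w z) = 0" by (auto intro!: integral_eq_zero_AE elim!: eventually_mono)
  have "AE t in lborel. gag_integrand s u w t = gag_integrand s (\<lambda>_. 0) w t" by (rule gag_cong_AE[OF assms(2)]) simp
  then have "AE t in lborel. gag_integrand s u w t = 0" by eventually_elim (simp add: gag_eq)
  then have 2: "(LINT t|lborel. gag_integrand s u w t) = 0" by (rule integral_eq_zero_AE)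
  show ?thesis using 1 2 by (simp add: innerK_def Gy_def)
qed

lemma inH_zero: "inH s (\<lambda>_. 0)" by (rule inH_zero_AE) auto

lemma Lpow2_zero_iff: "memLp 2 u \<Longrightarrow> Lpow 2 u = 0 \<longleftrightarrow> (AE z in lborel. u z = 0)"
  unfolding Lpow2_eq memLp2_iff by (subst integral_nonneg_eq_0_iff_AE) auto

subsection \<open>Anisotropic dilations\<close>

text \<open>The vertical exponent 1/s is the one for which the x-derivative and the fractional
  y-derivative pick up the same factor, so that \<open>Kf\<close> scales by a single power of
  \<open>l\<close>; the homogeneous dimension is then 1 + 1/s.\<close>

definition dil :: "real \<Rightarrow> real \<Rightarrow> real \<Rightarrow> fn2 \<Rightarrow> fn2" where
  "dil s c l w = (\<lambda>z. c * w (l * fst z, l powr (1 / s) * snd z))"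

lemma integral_scale2:
  fixes f :: fn2
  assumes "l > 0" "m > 0" "f \<in> borel_measurable borel"
  shows "(LINT z|lborel. f (l * fst z, m * snd z)) = (LINT z|lborel. f z) / (l * m)"
    "integrable lborel (\<lambda>z. f (l * fst z, m * snd z)) \<longleftrightarrow> integrable lborel f"
  using integral_scale[OF assms] integrable_scale[OF assms] by simp_all

lemma measurable_scale2:
  fixes f :: fn2
  assumes "f \<in> borel_measurable borel"
  shows "(\<lambda>z. f (l * fst z, m * snd z)) \<in> borel_measurable borel"
  by (rule measurable_compose[OF _ assms]) (intro borel_measurable_continuous_onI continuous_intros)

lemma dil_measurable: "w \<in> borel_measurable borel \<Longrightarrow> dil s c l w \<in> borel_measurable borel"
  unfolding dil_def by (intro borel_measurable_times borel_measurable_const measurable_scale2)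

lemma memLp2_dil:
  assumes "memLp 2 w" "l > 0"
  shows "memLp 2 (dil s c l w)"
proof -
  have w: "w \<in> borel_measurable borel" and i: "integrable lborel (\<lambda>z. (w z)^2)" using assms(1) by (auto simp: memLp2_iff)
  have m: "l powr (1/s) > 0" using assms(2) by simp
  have w2: "(\<lambda>z. (w z)^2) \<in> borel_measurable borel" using w by simp
  have "integrable lborel (\<lambda>z. (w (l * fst z, l powr (1/s) * snd z))^2)"
    by (subst integral_scale2(2)[OF assms(2) m w2]) (rule i)
  then have "integrable lborel (\<lambda>z. c^2 * (w (l * fst z, l powr (1/s) * snd z))^2)" by (rule integrable_mult_right)
  moreover have "(\<lambda>z. (dil s c l w z)^2) = (\<lambda>z. c^2 * (w (l * fst z, l powr (1/s) * snd z))^2)"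
    by (rule ext) (simp only: dil_def power_mult_distrib)
  ultimately show ?thesis using dil_measurable[OF w] by (simp only: memLp2_iff)
qed

lemma powr_scale: "l > 0 \<Longrightarrow> l * l powr (1/s) = l powr (1 + 1/s)" for l :: real
  by (simp add: powr_add)

lemma Lpow_dil:
  assumes [measurable]: "w \<in> borel_measurable borel" and "l > 0"
  shows "Lpow p (dil s c l w) = \<bar>c\<bar> powr p / l powr (1 + 1/s) * Lpow p w"
proof -
  have "Lpow p (dil s c l w) = (LINT z|lborel. \<bar>c\<bar> powr p * \<bar>w (l * fst z, l powr (1/s) * snd z)\<bar> powr p)"
    by (simp add: Lpow_def dil_def abs_mult powr_mult)
  also have "\<dots> = \<bar>c\<bar> powr p * (LINT z|lborel. \<bar>w (l * fst z, l powr (1/s) * snd z)\<bar> powr p)" by simp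
  also have "(LINT z|lborel. \<bar>w (l * fst z, l powr (1/s) * snd z)\<bar> powr p) = Lpow p w / (l * l powr (1/s))"
    using integral_scale2(1)[of l "l powr (1/s)" "\<lambda>z. \<bar>w z\<bar> powr p"] assms by (simp add: Lpow_def)
  finally show ?thesis using assms powr_scale by simp
qed

lemma coupling_dil:
  assumes [measurable]: "u \<in> borel_measurable borel" "v \<in> borel_measurable borel" and "l > 0"
  shows "coupling r1 r2 (dil s c l u) (dil s c l v) = \<bar>c\<bar> powr (r1 + r2) / l powr (1 + 1/s) * coupling r1 r2 u v"
proof -
  let ?T = "\<lambda>z. (l * fst z, l powr (1/s) * snd z)"
  have "coupling r1 r2 (dil s c l u) (dil s c l v) = (LINT z|lborel. \<bar>c\<bar> powr (r1 + r2) * (\<bar>u (?T z)\<bar> powr r1 * \<bar>v (?T z)\<bar> powr r2))"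
    unfolding coupling_def dil_def
    by (rule Bochner_Integration.integral_cong) (auto simp: abs_mult powr_mult powr_add)
  also have "\<dots> = \<bar>c\<bar> powr (r1 + r2) * (LINT z|lborel. (\<bar>u (?T z)\<bar> powr r1 * \<bar>v (?T z)\<bar> powr r2))" by simp
  also have "(LINT z|lborel. (\<bar>u (?T z)\<bar> powr r1 * \<bar>v (?T z)\<bar> powr r2)) = coupling r1 r2 u v / (l * l powr (1/s))"
    using integral_scale2(1)[of l "l powr (1/s)" "\<lambda>z. \<bar>u z\<bar> powr r1 * \<bar>v z\<bar> powr r2"] assms by (simp add: coupling_def)
  finally show ?thesis using assms powr_scale by simp
qed

lemma test_fun_scale:
  assumes t: "test_fun \<phi>" and "l > 0" "m > 0"
  shows "test_fun (\<lambda>z. \<phi> (l * fst z, m * snd z))"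
    "dxf (\<lambda>z. \<phi> (l * fst z, m * snd z)) = (\<lambda>z. l * dxf \<phi> (l * fst z, m * snd z))"
proof -
  let ?T = "\<lambda>z::real\<times>real. (l * fst z, m * snd z)"
  obtain f2 where f2: "\<And>z. (\<phi> has_derivative (\<lambda>w. fst w * dxf \<phi> z + snd w * f2 z)) (at z)"
    "continuous_on UNIV (dxf \<phi>)" "continuous_on UNIV f2" "bounded {z. \<phi> z \<noteq> 0}" using test_funD[OF t] by blast
  have T: "(?T has_derivative ?T) (at z)" for z
    by (auto intro!: derivative_eq_intros)
  have cT: "continuous_on UNIV ?T" by (intro continuous_intros)
  have 1: "((\<lambda>z. \<phi> (?T z)) has_derivative (\<lambda>w. fst w * (l * dxf \<phi> (?T z)) + snd w * (m * f2 (?T z)))) (at z)" for z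
    by (rule has_derivative_eq_rhs[OF has_derivative_compose[OF T f2(1)]]) (auto simp: algebra_simps)
  obtain R where R: "\<And>z. \<phi> z \<noteq> 0 \<Longrightarrow> \<bar>fst z\<bar> \<le> R \<and> \<bar>snd z\<bar> \<le> R"
    using continuous_compact_support(2)[OF test_fun_continuous[OF t] f2(4)] by blast
  have 2: "bounded {z. \<phi> (?T z) \<noteq> 0}"
  proof (rule bounded_subset)
    show "bounded (cbox (-R/l,-R/m) (R/l,R/m))" by simp
    show "{z. \<phi> (?T z) \<noteq> 0} \<subseteq> cbox (-R/l,-R/m) (R/l,R/m)"
    proof
      fix z assume "z \<in> {z. \<phi> (?T z) \<noteq> 0}"
      then have "\<bar>l * fst z\<bar> \<le> R" "\<bar>m * snd z\<bar> \<le> R" using R[of "?T z"] by auto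
      then show "z \<in> cbox (-R/l,-R/m) (R/l,R/m)" using assms(2,3)
        by (cases z) (auto simp: cbox_Pair_eq abs_le_iff field_simps)
    qed
  qed
  have 3: "continuous_on UNIV (\<lambda>z. l * dxf \<phi> (?T z))" "continuous_on UNIV (\<lambda>z. m * f2 (?T z))"
    by (intro continuous_intros continuous_on_compose2[OF f2(2) cT] continuous_on_compose2[OF f2(3) cT]; simp)+
  show "test_fun (\<lambda>z. \<phi> (?T z))" "dxf (\<lambda>z. \<phi> (?T z)) = (\<lambda>z. l * dxf \<phi> (?T z))"
    using test_funI[OF 1 3 2] by auto
qed

lemma has_weak_dx_dil:
  assumes u: "u \<in> borel_measurable borel" and g: "has_weak_dx u g" and l: "l > 0"
  shows "has_weak_dx (dil s c l u) (dil s (c * l) l g)"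
  unfolding has_weak_dx_def
proof (intro conjI allI impI)
  define m where "m = l powr (1/s)"
  have m: "m > 0" using l by (simp add: m_def)
  have L: "memLp 2 g" and [measurable]: "g \<in> borel_measurable borel" using g by (auto simp: has_weak_dx_def memLp2_iff)
  show "memLp 2 (dil s (c * l) l g)"
    by (rule memLp2_dil[OF L l])
  fix \<phi> assume t: "test_fun \<phi>"
  define \<psi> where "\<psi> = (\<lambda>z. \<phi> ((1/l) * fst z, (1/m) * snd z))"
  have \<psi>: "test_fun \<psi>" "dxf \<psi> = (\<lambda>z. (1/l) * dxf \<phi> ((1/l) * fst z, (1/m) * snd z))"
    unfolding \<psi>_def using test_fun_scale[OF t, of "1/l" "1/m"] l m by auto
  have [measurable]: "\<psi> \<in> borel_measurable borel" "dxf \<psi> \<in> borel_measurable borel"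
    using test_fun_memLp2[OF \<psi>(1)] by (auto simp: memLp2_iff)
  note u[measurable]
  have "(LINT z|lborel. dil s c l u z * dxf \<phi> z) = (LINT z|lborel. (c * l) * (u (l * fst z, m * snd z) * dxf \<psi> (l * fst z, m * snd z)))"
    using l m by (intro Bochner_Integration.integral_cong) (auto simp: dil_def m_def \<psi>(2))
  also have "\<dots> = (c * l) * ((LINT z|lborel. u z * dxf \<psi> z) / (l * m))"
    using integral_scale2(1)[OF l m, of "\<lambda>z. u z * dxf \<psi> z"] by simp
  also have "\<dots> = - ((c * l) * ((LINT z|lborel. g z * \<psi> z) / (l * m)))" using g \<psi>(1) by (simp add: has_weak_dx_def)
  also have "\<dots> = - (LINT z|lborel. (c * l) * (g (l * fst z, m * snd z) * \<psi> (l * fst z, m * snd z)))"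
    using integral_scale2(1)[OF l m, of "\<lambda>z. g z * \<psi> z"] by simp
  also have "\<dots> = - (LINT z|lborel. dil s (c * l) l g z * \<phi> z)"
    using l m by (intro arg_cong[where f=uminus] Bochner_Integration.integral_cong) (auto simp: dil_def m_def \<psi>_def)
  finally show "(LINT z|lborel. dil s c l u z * dxf \<phi> z) = - (LINT z|lborel. dil s (c * l) l g z * \<phi> z)" .
qed

lemma gag_dil:
  assumes "l > 0"
  shows "gag_integrand s (dil s c l u) (dil s d l w) t
    = c * d * (l powr (1/s)) powr (1 + 2 * s) * gag_integrand s u w (l * fst t, l powr (1/s) *\<^sub>R snd t)"
proof -
  let ?m = "l powr (1/s)"
  have m: "?m > 0" using assms by simp
  have e: "\<bar>?m * a - ?m * b\<bar> powr (1 + 2 * s) = ?m powr (1 + 2 * s) * \<bar>a - b\<bar> powr (1 + 2 * s)" for a b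
  proof -
    have "\<bar>?m * a - ?m * b\<bar> = ?m * \<bar>a - b\<bar>" using m by (simp add: right_diff_distrib[symmetric] abs_mult)
    then show ?thesis using m by (simp only: powr_mult)
  qed
  have ne: "?m powr (1 + 2 * s) \<noteq> 0" using m by simp
  have id: "(c * a - c * b) * (d * a' - d * b') / P = c * d * M * ((a - b) * (a' - b') / (M * P))" if "M \<noteq> 0" for a b a' b' P M :: real
    using that by (cases "P = 0") (simp_all add: field_simps)
  show ?thesis unfolding gag_eq dil_def fst_conv snd_conv fst_scaleR snd_scaleR real_scaleR_def e
    by (rule id[OF ne])
qed

text \<open>Kernel factor over the Jacobian of the triples. The result is the same power
  \<open>l^2 / (l * l powr (1/s))\<close> that the x-derivative produces.\<close>

lemma dil_exponent:
  fixes l s :: real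
  assumes "l > 0" "s > 0"
  shows "(l powr (1/s)) powr (1 + 2 * s) / (l * (l powr (1/s))^2) = l powr (1 - 1/s)"
proof -
  have "(l powr (1/s)) powr (1 + 2 * s) = l powr (1/s * (1 + 2 * s))" by (rule powr_powr)
  also have "1/s * (1 + 2 * s) = 1/s + 2" using assms by (simp add: field_simps)
  finally have 1: "(l powr (1/s)) powr (1 + 2 * s) = l powr (1/s + 2)" .
  have 2: "l * (l powr (1/s))^2 = l powr (1 + (1/s + 1/s))" using assms
    unfolding power2_eq_square powr_add by simp
  have "(1/s + 2) - (1 + (1/s + 1/s)) = 1 - 1/s" by simp
  then show ?thesis unfolding 1 2 powr_diff[symmetric] by simp
qed

lemma dil_H:
  assumes l: "l > 0" and s: "s > 0" and u: "inH s u"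
  shows "inH s (dil s c l u)"
  unfolding inH_def
proof (intro conjI)
  have [measurable]: "u \<in> borel_measurable borel" using u inH_measurable by auto
  have m: "l powr (1/s) > 0" using l by simp
  show "memLp 2 (dil s c l u)"
    by (rule memLp2_dil[OF inH_memLp(1)[OF u] l])
  show "\<exists>g. has_weak_dx (dil s c l u) g" using has_weak_dx_dil[OF _ inH_wdx[OF u] l, of s c] by auto
  have "integrable lborel (\<lambda>t. gag_integrand s u u (l * fst t, l powr (1/s) *\<^sub>R snd t))"
    by (subst integrable_scale[OF l m]) (use u in \<open>auto simp: inH_def fracy_fin_def\<close>)
  then have "integrable lborel (\<lambda>t. c * c * (l powr (1/s)) powr (1 + 2 * s) * gag_integrand s u u (l * fst t, l powr (1/s) *\<^sub>R snd t))"
    by (rule integrable_mult_right)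
  moreover have "gag_integrand s (dil s c l u) (dil s c l u) = (\<lambda>t. c * c * (l powr (1/s)) powr (1 + 2 * s) * gag_integrand s u u (l * fst t, l powr (1/s) *\<^sub>R snd t))"
    by (rule ext) (rule gag_dil[OF l])
  ultimately show "fracy_fin s (dil s c l u)" unfolding fracy_fin_def by (simp only:)
qed

lemma wdx_dil:
  assumes l: "l > 0" and s: "s > 0" and u: "inH s u"
  shows "AE z in lborel. wdx (dil s c l u) z = dil s (c * l) l (wdx u) z"
  by (rule weak_dx_unique[OF inH_wdx[OF dil_H[OF assms]] has_weak_dx_dil[OF inH_measurable(1)[OF u] inH_wdx[OF u] l]])

lemma innerK_dil:
  assumes l: "l > 0" and s: "s > 0" and u: "inH s u" and w: "inH s w"
  shows "innerK s (dil s c l u) (dil s d l w) = c * d * l powr (1 - 1/s) * innerK s u w"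
proof -
  let ?m = "l powr (1/s)"
  have m: "?m > 0" using l by simp
  have [measurable]: "u \<in> borel_measurable borel" "w \<in> borel_measurable borel"
    "wdx u \<in> borel_measurable borel" "wdx w \<in> borel_measurable borel"
    "wdx (dil s c l u) \<in> borel_measurable borel" "wdx (dil s d l w) \<in> borel_measurable borel"
    using u w inH_measurable dil_H[OF l s] by auto
  have "(LINT z|lborel. wdx (dil s c l u) z * wdx (dil s d l w) z)
     = (LINT z|lborel. (c * d * l^2) * (wdx u (l * fst z, ?m * snd z) * wdx w (l * fst z, ?m * snd z)))"
  proof (rule integral_cong_AE)
    show "AE z in lborel. wdx (dil s c l u) z * wdx (dil s d l w) z = (c * d * l^2) * (wdx u (l * fst z, ?m * snd z) * wdx w (l * fst z, ?m * snd z))"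
      using wdx_dil[OF l s u, of c] wdx_dil[OF l s w, of d]
      by eventually_elim (simp add: dil_def power2_eq_square)
    show "(\<lambda>z. (c * d * l^2) * (wdx u (l * fst z, ?m * snd z) * wdx w (l * fst z, ?m * snd z))) \<in> borel_measurable lborel"
      using measurable_scale2[of "\<lambda>z. wdx u z * wdx w z"] by simp
  qed measurable
  also have "\<dots> = (c * d * l^2) * ((LINT z|lborel. wdx u z * wdx w z) / (l * ?m))"
    using integral_scale2(1)[OF l m, of "\<lambda>z. wdx u z * wdx w z"] by simp
  also have "\<dots> = c * d * (l^2 / (l * ?m)) * (LINT z|lborel. wdx u z * wdx w z)" by simp
  also have "l^2 / (l * ?m) = l powr (1 - 1/s)"
    using l by (simp add: power2_eq_square powr_diff)
  finally have 1: "(LINT z|lborel. wdx (dil s c l u) z * wdx (dil s d l w) z) = c * d * l powr (1 - 1/s) * (LINT z|lborel. wdx u z * wdx w z)" .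
  have "(LINT t|lborel. gag_integrand s (dil s c l u) (dil s d l w) t)
     = c * d * ?m powr (1 + 2 * s) * ((LINT t|lborel. gag_integrand s u w t) / (l * ?m^2))"
    unfolding gag_dil[OF l] using integral_scale[OF l m, of "gag_integrand s u w", OF gag_measurable] by (simp add: power2_eq_square)
  also have "\<dots> = c * d * (?m powr (1 + 2 * s) / (l * ?m^2)) * (LINT t|lborel. gag_integrand s u w t)" by simp
  finally have 2: "(LINT t|lborel. gag_integrand s (dil s c l u) (dil s d l w) t) = c * d * l powr (1 - 1/s) * (LINT t|lborel. gag_integrand s u w t)"
    unfolding dil_exponent[OF l s] .
  show ?thesis unfolding innerK_def Gy_def 1 2 by (simp add: algebra_simps)
qed

lemma Kf_dil:
  assumes "l > 0" "s > 0" "inH s u"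
  shows "Kf s (dil s c l u) = c^2 * l powr (1 - 1/s) * Kf s u"
  unfolding Kf_def innerK_dil[OF assms assms(3)] by (simp only: power2_eq_square)

lemma dil_dil:
  assumes "l > 0" "k > 0"
  shows "dil s c l (dil s d k w) = dil s (c * d) (l * k) w"
  using assms by (auto simp: dil_def fun_eq_iff powr_mult algebra_simps)

lemma dil_one: "dil s 1 1 w = w"
  by (simp add: dil_def fun_eq_iff)

subsection \<open>Translations in the first variable\<close>

lemma lborel_Fubini:
  fixes F :: "'a::euclidean_space \<times> 'b::euclidean_space \<Rightarrow> real"
  assumes "integrable lborel F"
  shows "(LINT x|lborel. LINT y|lborel. F (x, y)) = (LINT p|lborel. F p)"
    "(LINT y|lborel. LINT x|lborel. F (x, y)) = (LINT p|lborel. F p)"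
proof -
  have i: "integrable (lborel \<Otimes>\<^sub>M lborel) F" using assms by (simp add: lborel_prod)
  show "(LINT x|lborel. LINT y|lborel. F (x, y)) = (LINT p|lborel. F p)"
    using lborel_pair.integral_fst'[OF i] by (simp add: lborel_prod)
  have "integrable (lborel \<Otimes>\<^sub>M lborel) (case_prod (\<lambda>x y. F (x, y)))" using i by simp
  from lborel_pair.integral_snd[OF this]
  show "(LINT y|lborel. LINT x|lborel. F (x, y)) = (LINT p|lborel. F p)" by (simp add: lborel_prod)
qed

lemma measurable_borel_pairI:
  fixes f :: "'a::euclidean_space \<Rightarrow> 'b::euclidean_space" and g :: "'b \<Rightarrow> 'c::topological_space"
  assumes "g \<in> borel_measurable borel" "continuous_on UNIV f"
  shows "(\<lambda>x. g (f x)) \<in> borel_measurable borel"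
  by (rule measurable_compose[OF borel_measurable_continuous_onI[OF assms(2)] assms(1)])

lemma measurable_x_shift: "u \<in> borel_measurable borel \<Longrightarrow> (\<lambda>z::real\<times>real. u (fst z + a, snd z)) \<in> borel_measurable borel"
  by (rule measurable_borel_pairI) (auto intro!: continuous_intros)

lemma x_shift_eq: "(\<lambda>z::real\<times>real. u (fst z + a, snd z)) = (\<lambda>z. u ((a, 0) + z))"
  by (auto simp: fun_eq_iff plus_prod_def add.commute)

lemma
  fixes u :: fn2
  assumes "u \<in> borel_measurable borel"
  shows integral_x_shift: "(LINT z|lborel. u (fst z + a, snd z)) = (LINT z|lborel. u z)"
    and integrable_x_shift: "integrable lborel (\<lambda>z. u (fst z + a, snd z)) \<longleftrightarrow> integrable lborel u"
  unfolding x_shift_eq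
  using preserving_integral[OF preserving_shift assms] preserving_integrable[OF preserving_shift assms] by auto

lemma nn_integral_x_shift:
  fixes u :: "real \<times> real \<Rightarrow> ennreal"
  assumes "u \<in> borel_measurable borel"
  shows "(\<integral>\<^sup>+ z. u (fst z + a, snd z) \<partial>lborel) = (\<integral>\<^sup>+ z. u z \<partial>lborel)"
  unfolding x_shift_eq by (rule nn_integral_shift[OF assms])

lemma memLp2_x_shift: "memLp 2 u \<Longrightarrow> memLp 2 (\<lambda>z. u (fst z + a, snd z))"
  unfolding memLp2_iff using integrable_x_shift[of "\<lambda>z. (u z)^2" a, OF borel_measurable_power] measurable_x_shift[of u a] by simp

lemma nn_integral_L2: "memLp 2 g \<Longrightarrow> (\<integral>\<^sup>+ z. ennreal ((g z)^2) \<partial>lborel) = ennreal (Lpow 2 g)"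
  unfolding memLp2_iff Lpow2_eq by (intro nn_integral_eq_integral) auto

lemma memLp2I_nn:
  assumes "g \<in> borel_measurable borel" "(\<integral>\<^sup>+ z. ennreal ((g z)^2) \<partial>lborel) \<le> ennreal C" "C \<ge> 0"
  shows "memLp 2 g" "Lpow 2 g \<le> C"
proof -
  note assms(1)[measurable]
  have "integrable lborel (\<lambda>z. (g z)^2)"
    using le_less_trans[OF assms(2)] by (intro integrableI_bounded) auto
  then show m: "memLp 2 g" using assms(1) by (simp add: memLp2_iff)
  show "Lpow 2 g \<le> C" using assms(2,3) unfolding nn_integral_L2[OF m] by (simp add: ennreal_le_iff)
qed

lemma test_fun_x_shift:
  assumes t: "test_fun \<phi>"
  shows "test_fun (\<lambda>z. \<phi> (fst z + a, snd z))" "dxf (\<lambda>z. \<phi> (fst z + a, snd z)) = (\<lambda>z. dxf \<phi> (fst z + a, snd z))"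
proof -
  let ?T = "\<lambda>z::real\<times>real. (fst z + a, snd z)"
  obtain f2 where f2: "\<And>z. (\<phi> has_derivative (\<lambda>w. fst w * dxf \<phi> z + snd w * f2 z)) (at z)"
    "continuous_on UNIV (dxf \<phi>)" "continuous_on UNIV f2" "bounded {z. \<phi> z \<noteq> 0}" using test_funD[OF t] by blast
  have T: "(?T has_derivative (\<lambda>w. w)) (at z)" for z
    by (rule has_derivative_eq_rhs[of _ "\<lambda>w. (fst w + 0, snd w)"]) (auto intro!: derivative_eq_intros)
  have cT: "continuous_on UNIV ?T" by (intro continuous_intros)
  have 1: "((\<lambda>z. \<phi> (?T z)) has_derivative (\<lambda>w. fst w * dxf \<phi> (?T z) + snd w * f2 (?T z))) (at z)" for z
    by (rule has_derivative_compose[OF T f2(1)])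
  obtain R where R: "\<And>z. \<phi> z \<noteq> 0 \<Longrightarrow> \<bar>fst z\<bar> \<le> R \<and> \<bar>snd z\<bar> \<le> R"
    using continuous_compact_support(2)[OF test_fun_continuous[OF t] f2(4)] by blast
  have 2: "bounded {z. \<phi> (?T z) \<noteq> 0}"
  proof (rule bounded_subset)
    show "bounded (cbox (-R-a,-R) (R-a,R))" by simp
    show "{z. \<phi> (?T z) \<noteq> 0} \<subseteq> cbox (-R-a,-R) (R-a,R)"
    proof
      fix z assume "z \<in> {z. \<phi> (?T z) \<noteq> 0}"
      then have "\<bar>fst z + a\<bar> \<le> R" "\<bar>snd z\<bar> \<le> R" using R[of "?T z"] by auto
      then show "z \<in> cbox (-R-a,-R) (R-a,R)" by (cases z) (auto simp: cbox_Pair_eq abs_le_iff)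
    qed
  qed
  have 3: "continuous_on UNIV (\<lambda>z. dxf \<phi> (?T z))" "continuous_on UNIV (\<lambda>z. f2 (?T z))"
    by (rule continuous_on_compose2[OF f2(2) cT] continuous_on_compose2[OF f2(3) cT]; simp)+
  show "test_fun (\<lambda>z. \<phi> (?T z))" "dxf (\<lambda>z. \<phi> (?T z)) = (\<lambda>z. dxf \<phi> (?T z))"
    using test_funI[OF 1 3 2] by auto
qed

lemma integrable_strip:
  fixes H :: "real \<times> (real \<times> real) \<Rightarrow> real"
  assumes H: "H \<in> borel_measurable borel" and t: "t \<ge> 0" and C: "C \<ge> 0"
    and b: "\<And>\<sigma>. (\<integral>\<^sup>+ z. ennreal \<bar>H (\<sigma>, z)\<bar> \<partial>lborel) \<le> ennreal C"
  shows "integrable lborel (\<lambda>p. indicator {0..t} (fst p) * H p)"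
proof (rule integrableI_bounded)
  have i: "(\<lambda>p::real \<times> (real \<times> real). indicator {0..t} (fst p) :: real) \<in> borel_measurable borel"
    by (rule measurable_borel_pairI[where g="indicator {0..t}"]) (auto intro!: continuous_intros)
  note H[measurable] i[measurable]
  show "(\<lambda>p. indicator {0..t} (fst p) * H p) \<in> borel_measurable lborel" by measurable
  have "(\<integral>\<^sup>+ p. ennreal (norm (indicator {0..t} (fst p) * H p)) \<partial>lborel)
     = (\<integral>\<^sup>+ \<sigma>. \<integral>\<^sup>+ z. ennreal (norm (indicator {0..t} \<sigma> * H (\<sigma>, z))) \<partial>lborel \<partial>lborel)"
    by (subst nn_integral_real2) auto
  also have "\<dots> \<le> (\<integral>\<^sup>+ \<sigma>. ennreal C * indicator {0..t} \<sigma> \<partial>lborel)"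
    using b by (intro nn_integral_mono) (auto simp: indicator_def)
  also have "\<dots> = ennreal C * ennreal t" using t by (simp add: nn_integral_cmult_indicator)
  also have "\<dots> < \<infinity>" by (simp add: ennreal_mult_less_top)
  finally show "(\<integral>\<^sup>+ p. ennreal (norm (indicator {0..t} (fst p) * H p)) \<partial>lborel) < \<infinity>" .
qed

lemma nn_integral_prod_bound:
  assumes "memLp 2 f" "memLp 2 g"
  shows "(\<integral>\<^sup>+ z. ennreal \<bar>f z * g z\<bar> \<partial>lborel) \<le> ennreal (Lpow 2 f + Lpow 2 g)"
proof -
  have m: "f \<in> borel_measurable borel" "g \<in> borel_measurable borel" using assms by (auto simp: memLp2_iff)
  note m[measurable]
  have *: "\<bar>a * b\<bar> \<le> a^2 + b^2" for a b :: real
  proof -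
    have "\<bar>a * b\<bar> \<le> 2 * \<bar>a\<bar> * \<bar>b\<bar>" by (simp add: abs_mult)
    also have "\<dots> \<le> \<bar>a\<bar>^2 + \<bar>b\<bar>^2" by (rule sum_squares_bound)
    finally show ?thesis by simp
  qed
  have "(\<integral>\<^sup>+ z. ennreal \<bar>f z * g z\<bar> \<partial>lborel) \<le> (\<integral>\<^sup>+ z. ennreal ((f z)^2) + ennreal ((g z)^2) \<partial>lborel)"
    using * by (intro nn_integral_mono) (simp flip: ennreal_plus)
  also have "\<dots> = ennreal (Lpow 2 f + Lpow 2 g)"
    by (subst nn_integral_add) (auto simp: nn_integral_L2 assms ennreal_plus Lpow_nonneg)
  finally show ?thesis .
qed

lemma Lpow2_x_shift: "u \<in> borel_measurable borel \<Longrightarrow> Lpow 2 (\<lambda>z. u (fst z + a, snd z)) = Lpow 2 u"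
  unfolding Lpow2_eq using integral_x_shift[of "\<lambda>z. (u z)^2" a, OF borel_measurable_power] by simp

text \<open>Supplies the Fubini hypothesis for horizontal shifts integrated over a segment;
  \<open>c\<close> is 1 when the shift acts on a weak derivative and -1 when it has been moved to
  the test function.\<close>

lemma strip_pairing:
  assumes f: "memLp 2 f" and g: "memLp 2 g" and t: "t \<ge> 0"
  shows "integrable lborel (\<lambda>p::real\<times>(real\<times>real). indicator {0..t} (fst p) * (f (fst (snd p) + c * fst p, snd (snd p)) * g (snd p)))"
proof (rule integrable_strip[OF _ t, of _ "Lpow 2 f + Lpow 2 g"])
  have m: "f \<in> borel_measurable borel" "g \<in> borel_measurable borel" using f g by (auto simp: memLp2_iff)
  show "(\<lambda>p::real\<times>(real\<times>real). f (fst (snd p) + c * fst p, snd (snd p)) * g (snd p)) \<in> borel_measurable borel"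
    by (rule borel_measurable_times; rule measurable_borel_pairI[OF m(1)] measurable_borel_pairI[OF m(2)]; intro continuous_intros)
  show "0 \<le> Lpow 2 f + Lpow 2 g" by (simp add: Lpow_nonneg)
  fix \<sigma> :: real
  show "(\<integral>\<^sup>+ z. ennreal \<bar>f (fst (snd (\<sigma>, z)) + c * fst (\<sigma>, z), snd (snd (\<sigma>, z))) * g (snd (\<sigma>, z))\<bar> \<partial>lborel) \<le> ennreal (Lpow 2 f + Lpow 2 g)"
    using nn_integral_prod_bound[OF memLp2_x_shift[OF f, of "c * \<sigma>"] g] m by (simp add: Lpow2_x_shift)
qed

text \<open>The increment over a horizontal step \<open>t\<close> that a function with weak
  derivative \<open>g\<close> should have; it is not divided by \<open>t\<close>.\<close>

definition x_avg :: "real \<Rightarrow> fn2 \<Rightarrow> fn2" where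
  "x_avg t g z = (LINT \<sigma>|lborel. indicator {0..t} \<sigma> * g (fst z + \<sigma>, snd z))"

lemma x_avg_measurable:
  assumes "g \<in> borel_measurable borel"
  shows "x_avg t g \<in> borel_measurable borel"
proof -
  have "(\<lambda>p::(real\<times>real)\<times>real. indicator {0..t} (snd p) * g (fst (fst p) + snd p, snd (fst p))) \<in> borel_measurable borel"
  proof (rule borel_measurable_times)
    show "(\<lambda>p::(real\<times>real)\<times>real. indicator {0..t} (snd p) :: real) \<in> borel_measurable borel"
      by (rule measurable_borel_pairI[where g="indicator {0..t}"]) (auto intro!: continuous_intros)
    show "(\<lambda>p::(real\<times>real)\<times>real. g (fst (fst p) + snd p, snd (fst p))) \<in> borel_measurable borel"
      by (rule measurable_borel_pairI[OF assms]) (intro continuous_intros)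
  qed
  then have "(\<lambda>(z, \<sigma>). indicator {0..t} \<sigma> * g (fst z + \<sigma>, snd z)) \<in> borel_measurable (lborel \<Otimes>\<^sub>M lborel)"
    by (simp add: split_beta' lborel_prod)
  from lborel.borel_measurable_lebesgue_integral[OF this] show ?thesis by (simp add: x_avg_def[abs_def])
qed

text \<open>Cauchy--Schwarz on the segment yields one factor \<open>t\<close>; integrating over the
  base point and using translation invariance yields the other.\<close>

lemma x_avg_L2:
  assumes g: "memLp 2 g" and t: "t \<ge> 0"
  shows "memLp 2 (x_avg t g)" "Lpow 2 (x_avg t g) \<le> t^2 * Lpow 2 g"
proof -
  have m: "g \<in> borel_measurable borel" using g by (auto simp: memLp2_iff)
  have ms: "(\<lambda>\<sigma>. g (fst z + \<sigma>, snd z)) \<in> borel_measurable borel" for z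
    by (rule measurable_borel_pairI[OF m]) (intro continuous_intros)
  note ms[measurable]
  have pt: "ennreal ((x_avg t g z)^2) \<le> ennreal t * (\<integral>\<^sup>+ \<sigma>. indicator {0..t} \<sigma> * ennreal ((g (fst z + \<sigma>, snd z))^2) \<partial>lborel)" for z
  proof -
    have "ennreal \<bar>x_avg t g z\<bar> \<le> (\<integral>\<^sup>+ \<sigma>. ennreal \<bar>indicator {0..t} \<sigma> * g (fst z + \<sigma>, snd z)\<bar> \<partial>lborel)"
    proof (cases "integrable lborel (\<lambda>\<sigma>. indicator {0..t} \<sigma> * g (fst z + \<sigma>, snd z))")
      case True
      from integral_norm_bound_ennreal[OF this] show ?thesis by (simp add: x_avg_def)
    next
      \<comment> \<open>A Bochner integral that does not exist has the value zero, so the bound is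
        trivial.\<close>
      case False
      then show ?thesis by (simp add: x_avg_def not_integrable_integral_eq)
    qed
    also have "\<dots> = (\<integral>\<^sup>+ \<sigma>. indicator {0..t} \<sigma> * ennreal \<bar>indicator {0..t} \<sigma> * g (fst z + \<sigma>, snd z)\<bar> \<partial>lborel)"
      by (intro nn_integral_cong) (auto simp: indicator_def)
    finally have a: "ennreal \<bar>x_avg t g z\<bar> \<le> \<dots>" .
    have "ennreal ((x_avg t g z)^2) = (ennreal \<bar>x_avg t g z\<bar>)^2" by (simp add: ennreal_power)
    also have "\<dots> \<le> (\<integral>\<^sup>+ \<sigma>. indicator {0..t} \<sigma> * ennreal \<bar>indicator {0..t} \<sigma> * g (fst z + \<sigma>, snd z)\<bar> \<partial>lborel)^2"
      using a by (intro power_mono) auto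
    also have "\<dots> \<le> (\<integral>\<^sup>+ \<sigma>. (indicator {0..t} \<sigma>)^2 \<partial>lborel) * (\<integral>\<^sup>+ \<sigma>. (ennreal \<bar>indicator {0..t} \<sigma> * g (fst z + \<sigma>, snd z)\<bar>)^2 \<partial>lborel)"
      by (rule Cauchy_Schwarz_nn_integral) auto
    also have "(\<integral>\<^sup>+ \<sigma>. (indicator {0..t} \<sigma>)^2 \<partial>lborel) = (\<integral>\<^sup>+ \<sigma>. indicator {0..t} \<sigma> \<partial>(lborel::real measure))"
      by (intro nn_integral_cong) (auto simp: indicator_def)
    also have "\<dots> = ennreal t" using t by simp
    also have "(\<integral>\<^sup>+ \<sigma>. (ennreal \<bar>indicator {0..t} \<sigma> * g (fst z + \<sigma>, snd z)\<bar>)^2 \<partial>lborel) = (\<integral>\<^sup>+ \<sigma>. indicator {0..t} \<sigma> * ennreal ((g (fst z + \<sigma>, snd z))^2) \<partial>lborel)"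
      by (intro nn_integral_cong) (auto simp: indicator_def ennreal_power)
    finally show ?thesis .
  qed
  have mm: "(\<lambda>p::(real\<times>real)\<times>real. indicator {0..t} (snd p) * ennreal ((g (fst (fst p) + snd p, snd (fst p)))^2)) \<in> borel_measurable borel"
  proof -
    have "(\<lambda>p::(real\<times>real)\<times>real. g (fst (fst p) + snd p, snd (fst p))) \<in> borel_measurable borel"
      by (rule measurable_borel_pairI[OF m]) (intro continuous_intros)
    moreover have "(\<lambda>p::(real\<times>real)\<times>real. indicator {0..t} (snd p) :: ennreal) \<in> borel_measurable borel"
      by (rule measurable_borel_pairI[where g="indicator {0..t}"]) (auto intro!: continuous_intros)
    ultimately show ?thesis by measurable
  qed
  have msec: "(\<lambda>z. \<integral>\<^sup>+ \<sigma>. indicator {0..t} \<sigma> * ennreal ((g (fst z + \<sigma>, snd z))^2) \<partial>lborel) \<in> borel_measurable lborel"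
    using lborel.borel_measurable_nn_integral_fst[of "\<lambda>p::(real\<times>real)\<times>real. indicator {0..t} (snd p) * ennreal ((g (fst (fst p) + snd p, snd (fst p)))^2)" lborel] mm
    by (simp add: lborel_prod)
  have "(\<integral>\<^sup>+ z. ennreal ((x_avg t g z)^2) \<partial>lborel) \<le> (\<integral>\<^sup>+ z. ennreal t * (\<integral>\<^sup>+ \<sigma>. indicator {0..t} \<sigma> * ennreal ((g (fst z + \<sigma>, snd z))^2) \<partial>lborel) \<partial>lborel)"
    by (intro nn_integral_mono pt)
  also have "\<dots> = ennreal t * (\<integral>\<^sup>+ z. (\<integral>\<^sup>+ \<sigma>. indicator {0..t} \<sigma> * ennreal ((g (fst z + \<sigma>, snd z))^2) \<partial>lborel) \<partial>lborel)"
    by (rule nn_integral_cmult[OF msec])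
  also have "(\<integral>\<^sup>+ z. (\<integral>\<^sup>+ \<sigma>. indicator {0..t} \<sigma> * ennreal ((g (fst z + \<sigma>, snd z))^2) \<partial>lborel) \<partial>lborel)
     = (\<integral>\<^sup>+ \<sigma>. (\<integral>\<^sup>+ z. indicator {0..t} \<sigma> * ennreal ((g (fst z + \<sigma>, snd z))^2) \<partial>lborel) \<partial>lborel)"
    using nn_integral_real2_swap[OF mm] by simp
  also have "\<dots> = (\<integral>\<^sup>+ \<sigma>. indicator {0..t} \<sigma> * ennreal (Lpow 2 g) \<partial>lborel)"
  proof (rule nn_integral_cong)
    fix \<sigma> :: real
    have m2: "(\<lambda>z. ennreal ((g z)^2)) \<in> borel_measurable borel" using m by measurable
    have "(\<integral>\<^sup>+ z. indicator {0..t} \<sigma> * ennreal ((g (fst z + \<sigma>, snd z))^2) \<partial>lborel) = indicator {0..t} \<sigma> * (\<integral>\<^sup>+ z. ennreal ((g (fst z + \<sigma>, snd z))^2) \<partial>lborel)"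
      using measurable_x_shift[OF m2, of \<sigma>] by (intro nn_integral_cmult) simp
    also have "(\<integral>\<^sup>+ z. ennreal ((g (fst z + \<sigma>, snd z))^2) \<partial>lborel) = ennreal (Lpow 2 g)"
      using nn_integral_x_shift[OF m2, of \<sigma>] nn_integral_L2[OF g] by simp
    finally show "(\<integral>\<^sup>+ z. indicator {0..t} \<sigma> * ennreal ((g (fst z + \<sigma>, snd z))^2) \<partial>lborel) = indicator {0..t} \<sigma> * ennreal (Lpow 2 g)" .
  qed
  also have "\<dots> = ennreal t * ennreal (Lpow 2 g)"
    using t by (subst nn_integral_multc) auto
  also have "ennreal t * (ennreal t * ennreal (Lpow 2 g)) = ennreal (t^2 * Lpow 2 g)"
    using t by (simp add: ennreal_mult Lpow_nonneg power2_eq_square mult.assoc)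
  finally have le: "(\<integral>\<^sup>+ z. ennreal ((x_avg t g z)^2) \<partial>lborel) \<le> ennreal (t^2 * Lpow 2 g)" .
  show "memLp 2 (x_avg t g)" "Lpow 2 (x_avg t g) \<le> t^2 * Lpow 2 g"
    by (rule memLp2I_nn[OF x_avg_measurable[OF m] le], simp add: Lpow_nonneg)+
qed

lemma x_avg_pairing:
  assumes g: "memLp 2 g" and \<psi>: "memLp 2 \<psi>" and t: "t \<ge> 0"
  shows "(LINT z|lborel. x_avg t g z * \<psi> z) = (LINT \<sigma>|lborel. indicator {0..t} \<sigma> * (LINT z|lborel. g (fst z + \<sigma>, snd z) * \<psi> z))"
proof -
  note F = lborel_Fubini[OF strip_pairing[OF g \<psi> t, of 1]]
  have "(LINT z|lborel. x_avg t g z * \<psi> z) = (LINT z|lborel. LINT \<sigma>|lborel. indicator {0..t} \<sigma> * (g (fst z + \<sigma>, snd z) * \<psi> z))"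
    unfolding x_avg_def by (simp flip: mult.assoc)
  also have "\<dots> = (LINT \<sigma>|lborel. LINT z|lborel. indicator {0..t} \<sigma> * (g (fst z + \<sigma>, snd z) * \<psi> z))"
    using F by simp
  finally show ?thesis by simp
qed

text \<open>Tested against \<open>\<phi>\<close>, the shift moves to \<open>\<phi>\<close>, the weak
  derivative becomes \<open>dxf \<phi>\<close>, and the segment integral of
  \<open>dxf \<phi>\<close> is evaluated by the classical fundamental theorem of calculus.\<close>

lemma weak_dx_FTC:
  assumes u: "memLp 2 u" and g: "has_weak_dx u g" and t: "t \<ge> 0"
  shows "AE z in lborel. u (fst z + t, snd z) - u z = x_avg t g z"
proof -
  have gL: "memLp 2 g" using g by (simp add: has_weak_dx_def)
  have um: "u \<in> borel_measurable borel" and gm: "g \<in> borel_measurable borel" using u gL by (auto simp: memLp2_iff)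
  define w where "w = (\<lambda>z. 1 * (1 * u (fst z + t, snd z) + (-1) * u z) + (-1) * x_avg t g z)"
  have wL: "memLp 2 w" unfolding w_def by (intro memLp2_lin memLp2_x_shift u x_avg_L2(1) gL t)
  have "AE z in lborel. w z = 0"
  proof (rule fundamental_lemma[OF _ memLp2_box[OF wL]])
    show "w \<in> borel_measurable borel" using wL by (simp add: memLp2_iff)
    fix \<phi> assume T: "test_fun \<phi>"
    note L = test_fun_memLp2[OF T]
    have \<phi>m: "\<phi> \<in> borel_measurable borel" "dxf \<phi> \<in> borel_measurable borel" using L by (auto simp: memLp2_iff)
    obtain f2 where f2: "\<And>z. (\<phi> has_derivative (\<lambda>w. fst w * dxf \<phi> z + snd w * f2 z)) (at z)" using test_funD[OF T] by blast
    have ftc: "(LINT \<sigma>|lborel. indicator {0..t} \<sigma> * dxf \<phi> (fst z + (-1) * \<sigma>, snd z)) = \<phi> z - \<phi> (fst z + (- t), snd z)" for z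
    proof -
      have "(LINT \<sigma>|lborel. dxf \<phi> (fst z - \<sigma>, snd z) * indicator {0..t} \<sigma>) = - \<phi> (fst z - t, snd z) - (- \<phi> (fst z - 0, snd z))"
      proof (rule integral_FTC_Icc_real[OF t])
        fix \<sigma> assume "0 \<le> \<sigma>" "\<sigma> \<le> t"
        have c: "((\<lambda>\<sigma>. (fst z - \<sigma>, snd z)) has_derivative (\<lambda>h. (- h, 0))) (at \<sigma>)"
          by (auto intro!: derivative_eq_intros)
        have "((\<lambda>\<sigma>. - \<phi> (fst z - \<sigma>, snd z)) has_derivative (\<lambda>h. h * dxf \<phi> (fst z - \<sigma>, snd z))) (at \<sigma>)"
          by (rule has_derivative_eq_rhs[OF has_derivative_minus[OF has_derivative_compose[OF c f2]]]) auto
        then show "((\<lambda>\<sigma>. - \<phi> (fst z - \<sigma>, snd z)) has_real_derivative dxf \<phi> (fst z - \<sigma>, snd z)) (at \<sigma>)"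
          by (simp add: has_field_derivative_def mult.commute[of _ "dxf _ _"])
        have "continuous_on UNIV (\<lambda>\<sigma>. dxf \<phi> (fst z - \<sigma>, snd z))"
          by (rule continuous_on_compose2[OF test_fun_dxf(1)[OF T]]) (auto intro!: continuous_intros)
        then show "isCont (\<lambda>\<sigma>. dxf \<phi> (fst z - \<sigma>, snd z)) \<sigma>" by (simp add: continuous_on_eq_continuous_at)
      qed
      then show ?thesis by (simp add: mult.commute)
    qed
    have i1: "integrable lborel (\<lambda>z. u (fst z + t, snd z) * \<phi> z)" "integrable lborel (\<lambda>z. u z * \<phi> z)"
      "integrable lborel (\<lambda>z. x_avg t g z * \<phi> z)" "integrable lborel (\<lambda>z. u z * \<phi> (fst z + (-t), snd z))"
      by (intro memLp2_mult memLp2_x_shift u L x_avg_L2(1) gL t)+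
    have wd: "(LINT z|lborel. g (fst z + \<sigma>, snd z) * \<phi> z) = - (LINT z|lborel. u z * dxf \<phi> (fst z + (-1) * \<sigma>, snd z))" for \<sigma>
    proof -
      have "(LINT z|lborel. g (fst z + \<sigma>, snd z) * \<phi> z) = (LINT z|lborel. g z * \<phi> (fst z + (-\<sigma>), snd z))"
        using integral_x_shift[of "\<lambda>z. g z * \<phi> (fst z + (-\<sigma>), snd z)" \<sigma>] borel_measurable_times[OF gm measurable_x_shift[OF \<phi>m(1), of "-\<sigma>"]] by simp
      also have "\<dots> = - (LINT z|lborel. u z * dxf \<phi> (fst z + (-\<sigma>), snd z))"
        using g[unfolded has_weak_dx_def, THEN conjunct2, rule_format, OF test_fun_x_shift(1)[OF T, of "-\<sigma>"]]
        unfolding test_fun_x_shift(2)[OF T] by simp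
      finally show ?thesis by simp
    qed
    have "(LINT z|lborel. x_avg t g z * \<phi> z) = (LINT \<sigma>|lborel. indicator {0..t} \<sigma> * (LINT z|lborel. g (fst z + \<sigma>, snd z) * \<phi> z))"
      by (rule x_avg_pairing[OF gL L(1) t])
    also have "\<dots> = (LINT \<sigma>|lborel. indicator {0..t} \<sigma> * - (LINT z|lborel. u z * dxf \<phi> (fst z + (-1) * \<sigma>, snd z)))"
      unfolding wd ..
    also have "\<dots> = - (LINT \<sigma>|lborel. LINT z|lborel. indicator {0..t} \<sigma> * (dxf \<phi> (fst z + (-1) * \<sigma>, snd z) * u z))"
      by (simp add: mult.commute[of "u _"])
    also have "(LINT \<sigma>|lborel. LINT z|lborel. indicator {0..t} \<sigma> * (dxf \<phi> (fst z + (-1) * \<sigma>, snd z) * u z))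
       = (LINT z|lborel. LINT \<sigma>|lborel. indicator {0..t} \<sigma> * (dxf \<phi> (fst z + (-1) * \<sigma>, snd z) * u z))"
      using lborel_Fubini[OF strip_pairing[OF L(2) u t, of "-1"]] by simp
    also have "\<dots> = (LINT z|lborel. (\<phi> z - \<phi> (fst z + (- t), snd z)) * u z)"
      unfolding mult.assoc[symmetric] integral_mult_left_zero ftc ..
    also have "\<dots> = (LINT z|lborel. u z * \<phi> z) - (LINT z|lborel. u z * \<phi> (fst z + (-t), snd z))"
      using i1 by (subst Bochner_Integration.integral_diff[symmetric]) (auto simp: algebra_simps)
    also have "(LINT z|lborel. u z * \<phi> (fst z + (-t), snd z)) = (LINT z|lborel. u (fst z + t, snd z) * \<phi> z)"
      using integral_x_shift[of "\<lambda>z. u z * \<phi> (fst z + (-t), snd z)" t] borel_measurable_times[OF um measurable_x_shift[OF \<phi>m(1), of "-t"]] by simp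
    finally have "(LINT z|lborel. x_avg t g z * \<phi> z) = (LINT z|lborel. u (fst z + t, snd z) * \<phi> z) - (LINT z|lborel. u z * \<phi> z)" by simp
    moreover have "(LINT z|lborel. w z * \<phi> z) = (LINT z|lborel. u (fst z + t, snd z) * \<phi> z - u z * \<phi> z - x_avg t g z * \<phi> z)"
      by (simp add: w_def algebra_simps)
    ultimately show "(LINT z|lborel. w z * \<phi> z) = 0" using i1 by simp
  qed
  then show ?thesis by eventually_elim (simp add: w_def)
qed

lemma x_shift_diff_L2:
  assumes u: "memLp 2 u" and g: "has_weak_dx u g" and t: "t \<ge> 0"
  shows "Lpow 2 (\<lambda>z. u (fst z + t, snd z) - u z) \<le> t^2 * Lpow 2 g"
proof -
  have gL: "memLp 2 g" using g by (simp add: has_weak_dx_def)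
  have um: "u \<in> borel_measurable borel" and gm: "g \<in> borel_measurable borel" using u gL by (auto simp: memLp2_iff)
  have "Lpow 2 (\<lambda>z. u (fst z + t, snd z) - u z) = Lpow 2 (x_avg t g)"
    unfolding Lpow_def using weak_dx_FTC[OF assms] measurable_x_shift[OF um, of t] um x_avg_measurable[OF gm, of t]
    by (intro integral_cong_AE) auto
  then show ?thesis using x_avg_L2(2)[OF gL t] by simp
qed

subsection \<open>Embedding and Gagliardo--Nirenberg inequality\<close>

lemma powr_sq: "(x::real) > 0 \<Longrightarrow> x^2 = x powr 2"
  by (simp add: powr_numeral)

text \<open>For increments at most \<open>\<tau>\<close> the kernel is at least
  \<open>\<tau> powr (- (1 + 2 * s))\<close>, so the Gagliardo energy controls the integrated
  squared differences. This is the vertical counterpart of the bound for horizontal shifts.\<close>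

lemma nn_integral_y_differences:
  assumes u: "inH s u" and s: "0 < s" and \<tau>: "\<tau> > 0"
  shows "(\<integral>\<^sup>+ \<eta>. indicator {0..\<tau>} \<eta> * (\<integral>\<^sup>+ z. ennreal ((u z - u (fst z, snd z + \<eta>))^2) \<partial>lborel) \<partial>lborel)
    \<le> ennreal (\<tau> powr (1 + 2 * s) * (LINT t|lborel. gag_integrand s u u t))"
proof -
  have um: "u \<in> borel_measurable borel" using u by (rule inH_measurable)
  have gm: "gag_integrand s u u \<in> borel_measurable borel" by (rule gag_measurable[OF um um])
  let ?G = "\<lambda>t. ennreal (gag_integrand s u u t)"
  have Gm: "?G \<in> borel_measurable borel" using gm by measurable
  let ?H = "\<lambda>p::(real\<times>real)\<times>real. ennreal (gag_integrand s u u (fst (fst p), snd (fst p), snd (fst p) + snd p))"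
  have Hm: "?H \<in> borel_measurable borel"
    by (rule measurable_borel_pairI[OF Gm]) (intro continuous_intros)
  let ?F = "\<lambda>p::(real\<times>real)\<times>real. indicator {0..\<tau>} (snd p) * ennreal ((u (fst p) - u (fst (fst p), snd (fst p) + snd p))^2)"
  have m1: "(\<lambda>p::(real\<times>real)\<times>real. u (fst p)) \<in> borel_measurable borel"
     "(\<lambda>p::(real\<times>real)\<times>real. u (fst (fst p), snd (fst p) + snd p)) \<in> borel_measurable borel"
    by (rule measurable_borel_pairI[OF um], intro continuous_intros)+
  have m2: "(\<lambda>p::(real\<times>real)\<times>real. indicator {0..\<tau>} (snd p) :: ennreal) \<in> borel_measurable borel"
    by (rule measurable_borel_pairI[where g="indicator {0..\<tau>}"]) (auto intro!: continuous_intros)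
  have Fm: "?F \<in> borel_measurable borel" using m1 m2 by measurable
  have mz: "(\<lambda>z. ennreal ((u z - u (fst z, snd z + \<eta>))^2)) \<in> borel_measurable borel" for \<eta>
  proof -
    have "(\<lambda>z. u (fst z, snd z + \<eta>)) \<in> borel_measurable borel"
      by (rule measurable_borel_pairI[OF um]) (intro continuous_intros)
    then show ?thesis using um by measurable
  qed
  have "(\<integral>\<^sup>+ \<eta>. indicator {0..\<tau>} \<eta> * (\<integral>\<^sup>+ z. ennreal ((u z - u (fst z, snd z + \<eta>))^2) \<partial>lborel) \<partial>lborel)
    = (\<integral>\<^sup>+ \<eta>. \<integral>\<^sup>+ z. ?F (z, \<eta>) \<partial>lborel \<partial>lborel)"
    by (intro nn_integral_cong) (simp add: nn_integral_cmult mz)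
  also have "\<dots> \<le> (\<integral>\<^sup>+ \<eta>. \<integral>\<^sup>+ z. ennreal (\<tau> powr (1 + 2 * s)) * ?H (z, \<eta>) \<partial>lborel \<partial>lborel)"
  proof (intro nn_integral_mono)
    fix \<eta> :: real and z :: "real \<times> real"
    show "?F (z, \<eta>) \<le> ennreal (\<tau> powr (1 + 2 * s)) * ?H (z, \<eta>)"
    proof (cases "0 < \<eta> \<and> \<eta> \<le> \<tau>")
      case True
      let ?d = "(u z - u (fst z, snd z + \<eta>))^2"
      have "?d = \<eta> powr (1 + 2 * s) * (?d / \<eta> powr (1 + 2 * s))" using True by simp
      also have "\<dots> \<le> \<tau> powr (1 + 2 * s) * (?d / \<eta> powr (1 + 2 * s))"
        using True s by (intro mult_right_mono powr_mono2) auto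
      finally have "?d \<le> \<tau> powr (1 + 2 * s) * (?d / \<eta> powr (1 + 2 * s))" .
      then show ?thesis using True by (simp add: gag_eq power2_eq_square ennreal_leI flip: ennreal_mult)
    next
      case False
      then show ?thesis by (cases "\<eta> = 0") (auto simp: indicator_def)
    qed
  qed
  also have "\<dots> = (\<integral>\<^sup>+ z. \<integral>\<^sup>+ \<eta>. ennreal (\<tau> powr (1 + 2 * s)) * ?H (z, \<eta>) \<partial>lborel \<partial>lborel)"
    by (rule nn_integral_real2_swap[symmetric]) (use Hm in measurable)
  also have "\<dots> = (\<integral>\<^sup>+ p. ennreal (\<tau> powr (1 + 2 * s)) * ?H p \<partial>lborel)"
    by (rule nn_integral_real2[symmetric]) (use Hm in measurable)
  also have "\<dots> = ennreal (\<tau> powr (1 + 2 * s)) * (\<integral>\<^sup>+ p. ?H p \<partial>lborel)"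
    by (rule nn_integral_cmult) (use Hm in simp)
  also have "(\<integral>\<^sup>+ p. ?H p \<partial>lborel) = (\<integral>\<^sup>+ z. \<integral>\<^sup>+ \<eta>. ?H (z, \<eta>) \<partial>lborel \<partial>lborel)"
    by (rule nn_integral_real2[OF Hm])
  also have "\<dots> = (\<integral>\<^sup>+ x. \<integral>\<^sup>+ y. \<integral>\<^sup>+ \<eta>. ?H ((x, y), \<eta>) \<partial>lborel \<partial>lborel \<partial>lborel)"
    by (rule nn_integral_real2) (use lborel.borel_measurable_nn_integral_fst[of ?H lborel] Hm in \<open>simp add: lborel_prod\<close>)
  also have "\<dots> = (\<integral>\<^sup>+ t. ?G (fst t, fst (snd t), fst (snd t) + snd (snd t)) \<partial>lborel)"
    by (subst nn_integral_real3) (use measurable_compose[OF preserving_measurable[OF preserving_shear] Gm] in simp_all)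
  also have "\<dots> = (\<integral>\<^sup>+ t. ?G t \<partial>lborel)"
    using preserving_nn_integral[OF preserving_shear Gm] by simp
  also have "\<dots> = ennreal (LINT t|lborel. gag_integrand s u u t)"
    using gag_integrable[OF u u] by (intro nn_integral_eq_integral) (auto simp: gag_nonneg)
  finally show ?thesis by (simp add: ennreal_mult' integral_nonneg_AE gag_nonneg)
qed

section \<open>Level sets and weak-type bounds\<close>

lemma level_set_finite:
  assumes u: "memLp 2 u" and l: "\<rho> > 0"
  shows "emeasure lborel {z. \<rho> < \<bar>u z\<bar>} \<le> ennreal (Lpow 2 u / \<rho>^2)"
proof -
  have [measurable]: "u \<in> borel_measurable borel" using u by (simp add: memLp2_iff)
  have S: "{z. \<rho> < \<bar>u z\<bar>} \<in> sets lborel" by measurable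
  have "emeasure lborel {z. \<rho> < \<bar>u z\<bar>} = (\<integral>\<^sup>+ z. indicator {z. \<rho> < \<bar>u z\<bar>} z \<partial>lborel)" using S by simp
  also have "\<dots> \<le> (\<integral>\<^sup>+ z. ennreal (1 / \<rho>^2) * ennreal ((u z)^2) \<partial>lborel)"
  proof (rule nn_integral_mono)
    fix z
    show "indicator {z. \<rho> < \<bar>u z\<bar>} z \<le> ennreal (1 / \<rho>^2) * ennreal ((u z)^2)"
    proof (cases "\<rho> < \<bar>u z\<bar>")
      case True
      then have "\<rho>^2 \<le> \<bar>u z\<bar>^2" using l by (intro power_mono) auto
      then have "1 \<le> 1 / \<rho>^2 * (u z)^2" using l by (simp add: field_simps)
      then show ?thesis using True l by (simp flip: ennreal_mult)
    qed simp
  qed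
  also have "\<dots> = ennreal (1 / \<rho>^2) * ennreal (Lpow 2 u)"
    by (subst nn_integral_cmult) (auto simp: nn_integral_L2[OF u])
  also have "\<dots> = ennreal (Lpow 2 u / \<rho>^2)" using Lpow_nonneg[of 2 u] by (simp flip: ennreal_mult)
  finally show ?thesis .
qed

definition lset :: "fn2 \<Rightarrow> real \<Rightarrow> real" where
  "lset u \<rho> = measure lborel {z. \<rho> < \<bar>u z\<bar>}"

lemma lset_emeasure: "memLp 2 u \<Longrightarrow> \<rho> > 0 \<Longrightarrow> emeasure lborel {z. \<rho> < \<bar>u z\<bar>} = ennreal (lset u \<rho>)"
  unfolding lset_def using level_set_finite[of u \<rho>]
  by (intro emeasure_eq_ennreal_measure) (auto simp: top_unique)

lemma lset_le: "memLp 2 u \<Longrightarrow> \<rho> > 0 \<Longrightarrow> lset u \<rho> \<le> Lpow 2 u / \<rho>^2"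
  using level_set_finite[of u \<rho>] lset_emeasure[of u \<rho>] by (simp add: ennreal_le_iff Lpow_nonneg)

text \<open>Comparing \<open>u z\<close> with \<open>u (z + \<zeta>)\<close> for \<open>\<zeta>\<close> in an anisotropic box whose measure is twice that
  of the level set.\<close>
lemma level_halving:
  assumes u: "inH s u" and s: "0 < s" and l: "\<rho> > 0" and t: "t > 0"
    and big: "2 * lset u \<rho> \<le> t powr (1 + 1/s)"
  shows "lset u (2 * \<rho>) \<le> 4 * t^2 * ((LINT t|lborel. gag_integrand s u u t) + Lpow 2 (wdx u)) / \<rho>^2"
proof -
  let ?\<tau> = "t powr (1/s)"
  let ?B = "\<lambda>\<zeta>::real\<times>real. indicator {0..t} (fst \<zeta>) * indicator {0..?\<tau>} (snd \<zeta>) :: ennreal"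
  let ?G = "LINT t|lborel. gag_integrand s u u t"
  define N where "N = (\<lambda>\<eta>. \<integral>\<^sup>+ z. ennreal ((u z - u (fst z, snd z + \<eta>))^2) \<partial>lborel)"
  have N: "N \<eta> = (\<integral>\<^sup>+ z. ennreal ((u z - u (fst z, snd z + \<eta>))^2) \<partial>lborel)" for \<eta> by (simp add: N_def)
  have G0: "?G \<ge> 0" by (intro integral_nonneg_AE) (auto simp: gag_nonneg)
  have \<tau>: "?\<tau> > 0" using t by simp
  have t\<tau>: "t * ?\<tau> = t powr (1 + 1/s)" using t by (rule powr_scale)
  have uL: "memLp 2 u" and um: "u \<in> borel_measurable borel" using u inH_memLp inH_measurable by auto
  define T where "T = t * ?\<tau>"
  have T: "T > 0" using t \<tau> by (simp add: T_def)
  have mB: "?B \<in> borel_measurable borel"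
    by (rule borel_measurable_times_ennreal; rule measurable_borel_pairI[where g="indicator _"]; auto intro!: continuous_intros)
  have mplus: "(\<lambda>p::(real\<times>real)\<times>(real\<times>real). u (fst p + snd p)) \<in> borel_measurable borel"
     "(\<lambda>p::(real\<times>real)\<times>(real\<times>real). u (fst p)) \<in> borel_measurable borel"
    by (rule measurable_borel_pairI[OF um], intro continuous_intros)+
  have mB2: "(\<lambda>p::(real\<times>real)\<times>(real\<times>real). ?B (snd p)) \<in> borel_measurable borel"
    by (rule measurable_borel_pairI[OF mB]) (intro continuous_intros)
  let ?F = "\<lambda>p::(real\<times>real)\<times>(real\<times>real). ?B (snd p) * ennreal ((u (fst p) - u (fst p + snd p))^2)"
  have Fm: "?F \<in> borel_measurable borel" using mplus mB2 by measurable
  have sw: "(\<integral>\<^sup>+ z. \<integral>\<^sup>+ \<zeta>. ?F (z, \<zeta>) \<partial>lborel \<partial>lborel) = (\<integral>\<^sup>+ \<zeta>. \<integral>\<^sup>+ z. ?F (z, \<zeta>) \<partial>lborel \<partial>lborel)"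
    by (rule nn_integral_real2_swap[OF Fm])
  have Bint: "(\<integral>\<^sup>+ \<zeta>. ?B \<zeta> \<partial>lborel) = ennreal T"
  proof -
    have "(\<integral>\<^sup>+ \<zeta>. ?B \<zeta> \<partial>lborel) = (\<integral>\<^sup>+ \<xi>. \<integral>\<^sup>+ \<eta>. indicator {0..t} \<xi> * indicator {0..?\<tau>} \<eta> \<partial>lborel \<partial>lborel)"
      using nn_integral_real2[OF mB] by simp
    also have "\<dots> = (\<integral>\<^sup>+ \<xi>. indicator {0..t} \<xi> * ennreal ?\<tau> \<partial>lborel)"
      using \<tau> by (intro nn_integral_cong) (simp add: nn_integral_cmult)
    also have "\<dots> = ennreal T" using t \<tau> by (simp add: nn_integral_multc T_def ennreal_mult)
    finally show ?thesis .
  qed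
  \<comment> \<open>Where \<open>\<bar>u z\<bar>\<close> exceeds \<open>2 * \<rho>\<close>, the box
    of measure \<open>T\<close> contains at least measure \<open>T / 2\<close> of displacements with
    \<open>\<bar>u (z + \<zeta>)\<bar> \<le> \<rho>\<close>, because the level set has measure at
    most \<open>T / 2\<close>; each of them gives a difference of at least
    \<open>\<rho>\<close>.\<close>
  have lower: "ennreal (\<rho>^2 * (T / 2)) * indicator {z. 2 * \<rho> < \<bar>u z\<bar>} z \<le> (\<integral>\<^sup>+ \<zeta>. ?F (z, \<zeta>) \<partial>lborel)" for z
  proof (cases "2 * \<rho> < \<bar>u z\<bar>")
    case True
    have ms: "(\<lambda>\<zeta>. u (z + \<zeta>)) \<in> borel_measurable borel"
      by (rule measurable_borel_pairI[OF um]) (intro continuous_intros)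
    note ms[measurable] mB[measurable] um[measurable]
    let ?I = "\<lambda>\<zeta>. indicator {\<zeta>. \<bar>u (z + \<zeta>)\<bar> \<le> \<rho>} \<zeta> :: ennreal"
    let ?J = "\<lambda>\<zeta>. indicator {\<zeta>. \<rho> < \<bar>u (z + \<zeta>)\<bar>} \<zeta> :: ennreal"
    have "ennreal T \<le> (\<integral>\<^sup>+ \<zeta>. ?B \<zeta> * ?I \<zeta> + ?J \<zeta> \<partial>lborel)"
      unfolding Bint[symmetric] by (intro nn_integral_mono) (auto simp: indicator_def)
    also have "\<dots> = (\<integral>\<^sup>+ \<zeta>. ?B \<zeta> * ?I \<zeta> \<partial>lborel) + (\<integral>\<^sup>+ \<zeta>. ?J \<zeta> \<partial>lborel)"
      by (rule nn_integral_add) measurable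
    also have "(\<integral>\<^sup>+ \<zeta>. ?J \<zeta> \<partial>lborel) = (\<integral>\<^sup>+ \<zeta>. indicator {\<zeta>. \<rho> < \<bar>u \<zeta>\<bar>} (z + \<zeta>) \<partial>lborel)"
      by (intro nn_integral_cong) (auto simp: indicator_def)
    also have "\<dots> = emeasure lborel {\<zeta>. \<rho> < \<bar>u \<zeta>\<bar>}"
      by (subst nn_integral_shift) auto
    also have "\<dots> \<le> ennreal (T / 2)"
      using lset_emeasure[OF uL l] big by (simp add: T_def t\<tau> ennreal_leI)
    finally have "ennreal T \<le> (\<integral>\<^sup>+ \<zeta>. ?B \<zeta> * ?I \<zeta> \<partial>lborel) + ennreal (T / 2)" by (simp add: add_left_mono)
    moreover have "ennreal T = ennreal (T / 2) + ennreal (T / 2)" using T by (simp flip: ennreal_plus)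
    ultimately have "ennreal (T / 2) + ennreal (T / 2) \<le> ennreal (T / 2) + (\<integral>\<^sup>+ \<zeta>. ?B \<zeta> * ?I \<zeta> \<partial>lborel)"
      by (simp only: ac_simps)
    then have X: "ennreal (T / 2) \<le> (\<integral>\<^sup>+ \<zeta>. ?B \<zeta> * ?I \<zeta> \<partial>lborel)"
      by (simp only: ennreal_add_left_cancel_le ennreal_neq_top) simp
    have "ennreal (\<rho>^2 * (T / 2)) = ennreal (\<rho>^2) * ennreal (T / 2)" by (rule ennreal_mult) (use T in auto)
    also have "\<dots> \<le> ennreal (\<rho>^2) * (\<integral>\<^sup>+ \<zeta>. ?B \<zeta> * ?I \<zeta> \<partial>lborel)" using X by (rule mult_left_mono) simp
    also have "\<dots> = (\<integral>\<^sup>+ \<zeta>. ennreal (\<rho>^2) * (?B \<zeta> * ?I \<zeta>) \<partial>lborel)" by (rule nn_integral_cmult[symmetric]) measurable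
    also have "\<dots> \<le> (\<integral>\<^sup>+ \<zeta>. ?F (z, \<zeta>) \<partial>lborel)"
    proof (rule nn_integral_mono)
      fix \<zeta>
      show "ennreal (\<rho>^2) * (?B \<zeta> * ?I \<zeta>) \<le> ?F (z, \<zeta>)"
      proof (cases "\<bar>u (z + \<zeta>)\<bar> \<le> \<rho>")
        case True2: True
        have "\<rho> \<le> \<bar>u z - u (z + \<zeta>)\<bar>" using True True2 by linarith
        then have "\<rho>^2 \<le> \<bar>u z - u (z + \<zeta>)\<bar>^2" using l by (intro power_mono) auto
        then have "ennreal (\<rho>^2) \<le> ennreal ((u z - u (z + \<zeta>))^2)" by (simp add: ennreal_leI)
        then have "ennreal (\<rho>^2) * ?B \<zeta> \<le> ennreal ((u z - u (z + \<zeta>))^2) * ?B \<zeta>" by (rule mult_right_mono) simp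
        then show ?thesis using True2 by (simp add: ac_simps)
      qed simp
    qed
    finally show ?thesis using True by simp
  qed simp
  \<comment> \<open>A displacement is split into a vertical and a horizontal step. The horizontal
    one costs the L^2 norm of the weak derivative; the vertical one stays as \<open>N\<close> until
    it is integrated over the box.\<close>
  have upper: "(\<integral>\<^sup>+ z. ?F (z, \<zeta>) \<partial>lborel) \<le> ?B \<zeta> * (2 * N (snd \<zeta>) + ennreal (2 * t^2 * Lpow 2 (wdx u)))" for \<zeta>
  proof (cases "?B \<zeta> = 0")
    case False
    then have \<zeta>: "0 \<le> fst \<zeta>" "fst \<zeta> \<le> t" by (auto simp: indicator_def split: if_splits)
    have ms: "(\<lambda>z. u (z + \<zeta>)) \<in> borel_measurable borel" "(\<lambda>z. u (fst z, snd z + snd \<zeta>)) \<in> borel_measurable borel"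
      "(\<lambda>z. u (fst z + fst \<zeta>, snd z)) \<in> borel_measurable borel"
      by (rule measurable_borel_pairI[OF um], intro continuous_intros)+
    note ms[measurable] um[measurable]
    let ?D = "\<lambda>z. ennreal ((u (fst z + fst \<zeta>, snd z) - u z)^2)"
    have Dm: "?D \<in> borel_measurable borel" by measurable
    have Dsh: "(\<lambda>z. ?D (fst z, snd z + snd \<zeta>)) = (\<lambda>z. ?D ((0, snd \<zeta>) + z))"
      by (auto simp: fun_eq_iff plus_prod_def add.commute)
    have Dm2: "(\<lambda>z. ?D (fst z, snd z + snd \<zeta>)) \<in> borel_measurable borel"
      by (rule measurable_borel_pairI[OF Dm]) (intro continuous_intros)
    have "(\<integral>\<^sup>+ z. ennreal ((u z - u (z + \<zeta>))^2) \<partial>lborel)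
      \<le> (\<integral>\<^sup>+ z. 2 * ennreal ((u z - u (fst z, snd z + snd \<zeta>))^2) + 2 * ?D (fst z, snd z + snd \<zeta>) \<partial>lborel)"
    proof (rule nn_integral_mono)
      fix z
      have e: "z + \<zeta> = (fst z + fst \<zeta>, snd z + snd \<zeta>)" by (simp add: plus_prod_def)
      have q: "(a - c)^2 \<le> 2 * (a - b)^2 + 2 * (c - b)^2" for a b c :: real
        using sum_squares_bound[of "a - b" "b - c"] by (simp add: power2_eq_square algebra_simps)
      show "ennreal ((u z - u (z + \<zeta>))^2) \<le> 2 * ennreal ((u z - u (fst z, snd z + snd \<zeta>))^2) + 2 * ?D (fst z, snd z + snd \<zeta>)"
        unfolding e using q[of "u z" "u (fst z + fst \<zeta>, snd z + snd \<zeta>)" "u (fst z, snd z + snd \<zeta>)"]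
        by (simp add: ennreal_leI flip: ennreal_plus ennreal_numeral ennreal_mult)
    qed
    also have "\<dots> = 2 * N (snd \<zeta>) + 2 * (\<integral>\<^sup>+ z. ?D (fst z, snd z + snd \<zeta>) \<partial>lborel)"
      unfolding N using Dm2 by (subst nn_integral_add) (auto simp: nn_integral_cmult)
    also have "(\<integral>\<^sup>+ z. ?D (fst z, snd z + snd \<zeta>) \<partial>lborel) = (\<integral>\<^sup>+ z. ?D z \<partial>lborel)"
      unfolding Dsh by (rule nn_integral_shift[OF Dm])
    also have "\<dots> = ennreal (Lpow 2 (\<lambda>z. u (fst z + fst \<zeta>, snd z) - u z))"
      using memLp2_lin[OF memLp2_x_shift[OF uL, of "fst \<zeta>"] uL, of 1 "-1"] by (intro nn_integral_L2) simp
    also have "\<dots> \<le> ennreal (t^2 * Lpow 2 (wdx u))"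
    proof (rule ennreal_leI)
      have "Lpow 2 (\<lambda>z. u (fst z + fst \<zeta>, snd z) - u z) \<le> (fst \<zeta>)^2 * Lpow 2 (wdx u)"
        by (rule x_shift_diff_L2[OF uL inH_wdx[OF u] \<zeta>(1)])
      also have "\<dots> \<le> t^2 * Lpow 2 (wdx u)" using \<zeta> by (intro mult_right_mono power_mono) (auto simp: Lpow_nonneg)
      finally show "Lpow 2 (\<lambda>z. u (fst z + fst \<zeta>, snd z) - u z) \<le> t^2 * Lpow 2 (wdx u)" .
    qed
    finally have b: "(\<integral>\<^sup>+ z. ennreal ((u z - u (z + \<zeta>))^2) \<partial>lborel) \<le> 2 * N (snd \<zeta>) + 2 * ennreal (t^2 * Lpow 2 (wdx u))"
      by (simp add: add_left_mono mult_left_mono)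
    have "(\<integral>\<^sup>+ z. ?F (z, \<zeta>) \<partial>lborel) = ?B \<zeta> * (\<integral>\<^sup>+ z. ennreal ((u z - u (z + \<zeta>))^2) \<partial>lborel)"
      by (simp add: nn_integral_cmult)
    also have "\<dots> \<le> ?B \<zeta> * (2 * N (snd \<zeta>) + 2 * ennreal (t^2 * Lpow 2 (wdx u)))" using b by (rule mult_left_mono) simp
    also have "2 * ennreal (t^2 * Lpow 2 (wdx u)) = ennreal (2 * t^2 * Lpow 2 (wdx u))"
      by (simp add: ennreal_mult Lpow_nonneg mult.assoc)
    finally show ?thesis .
  next
    case True
    have z: "?F (z, \<zeta>) = 0" for z unfolding snd_conv True by simp
    show ?thesis unfolding z by simp
  qed
  have Nm: "N \<in> borel_measurable borel"
  proof -
    have "(\<lambda>p::real\<times>(real\<times>real). u (snd p)) \<in> borel_measurable borel"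
     "(\<lambda>p::real\<times>(real\<times>real). u (fst (snd p), snd (snd p) + fst p)) \<in> borel_measurable borel"
      by (rule measurable_borel_pairI[OF um], intro continuous_intros)+
    then have "(\<lambda>p::real\<times>(real\<times>real). ennreal ((u (snd p) - u (fst (snd p), snd (snd p) + fst p))^2)) \<in> borel_measurable (lborel \<Otimes>\<^sub>M lborel)"
      unfolding lborel_prod measurable_lborel1 by measurable
    from lborel.borel_measurable_nn_integral_fst[OF this] show ?thesis by (simp add: N_def)
  qed
  define CC where "CC = 2 * t^2 * Lpow 2 (wdx u)"
  have C0: "CC \<ge> 0" by (simp add: CC_def Lpow_nonneg)
  have "ennreal (\<rho>^2 * (T / 2) * lset u (2 * \<rho>)) = (\<integral>\<^sup>+ z. ennreal (\<rho>^2 * (T / 2)) * indicator {z. 2 * \<rho> < \<bar>u z\<bar>} z \<partial>lborel)"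
  proof -
    have "{z. 2 * \<rho> < \<bar>u z\<bar>} \<in> sets lborel" using um by measurable
    then have "(\<integral>\<^sup>+ z. ennreal (\<rho>^2 * (T / 2)) * indicator {z. 2 * \<rho> < \<bar>u z\<bar>} z \<partial>lborel)
      = ennreal (\<rho>^2 * (T / 2)) * emeasure lborel {z. 2 * \<rho> < \<bar>u z\<bar>}"
      by (rule nn_integral_cmult_indicator)
    also have "\<dots> = ennreal (\<rho>^2 * (T / 2)) * ennreal (lset u (2 * \<rho>))"
      using lset_emeasure[OF uL, of "2 * \<rho>"] l by simp
    also have "\<dots> = ennreal (\<rho>^2 * (T / 2) * lset u (2 * \<rho>))"
      by (rule ennreal_mult'[symmetric]) (use T in auto)
    finally show ?thesis by simp
  qed
  also have "\<dots> \<le> (\<integral>\<^sup>+ z. \<integral>\<^sup>+ \<zeta>. ?F (z, \<zeta>) \<partial>lborel \<partial>lborel)" by (intro nn_integral_mono lower)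
  also have "\<dots> \<le> (\<integral>\<^sup>+ \<zeta>. ?B \<zeta> * (2 * N (snd \<zeta>) + ennreal CC) \<partial>lborel)"
    unfolding sw CC_def by (intro nn_integral_mono upper)
  also have "\<dots> = (\<integral>\<^sup>+ \<xi>. \<integral>\<^sup>+ \<eta>. indicator {0..t} \<xi> * (indicator {0..?\<tau>} \<eta> * (2 * N \<eta> + ennreal CC)) \<partial>lborel \<partial>lborel)"
  proof (subst nn_integral_real2)
    have "(\<lambda>\<zeta>::real\<times>real. N (snd \<zeta>)) \<in> borel_measurable borel"
      by (rule measurable_borel_pairI[OF Nm]) (intro continuous_intros)
    then show "(\<lambda>\<zeta>. ?B \<zeta> * (2 * N (snd \<zeta>) + ennreal CC)) \<in> borel_measurable borel" using mB by measurable
  qed (simp add: mult.assoc)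
  also have "\<dots> = (\<integral>\<^sup>+ \<xi>. indicator {0..t} \<xi> * (\<integral>\<^sup>+ \<eta>. indicator {0..?\<tau>} \<eta> * (2 * N \<eta> + ennreal CC) \<partial>lborel) \<partial>lborel)"
  proof -
    have m: "(\<lambda>\<eta>. indicator {0..?\<tau>} \<eta> * (2 * N \<eta> + ennreal CC)) \<in> borel_measurable lborel"
      by (intro borel_measurable_times_ennreal borel_measurable_add borel_measurable_const) (use Nm in auto)
    show ?thesis by (rule nn_integral_cong, rule nn_integral_cmult[OF m])
  qed
  also have "\<dots> = ennreal t * (\<integral>\<^sup>+ \<eta>. indicator {0..?\<tau>} \<eta> * (2 * N \<eta> + ennreal CC) \<partial>lborel)"
    using t by (subst nn_integral_multc) auto
  also have "(\<integral>\<^sup>+ \<eta>. indicator {0..?\<tau>} \<eta> * (2 * N \<eta> + ennreal CC) \<partial>lborel)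
     = (\<integral>\<^sup>+ \<eta>. 2 * (indicator {0..?\<tau>} \<eta> * N \<eta>) + indicator {0..?\<tau>} \<eta> * ennreal CC \<partial>lborel)"
    by (intro nn_integral_cong) (auto simp: indicator_def)
  also have "\<dots> = 2 * (\<integral>\<^sup>+ \<eta>. indicator {0..?\<tau>} \<eta> * N \<eta> \<partial>lborel) + ennreal ?\<tau> * ennreal CC"
    using Nm \<tau> by (subst nn_integral_add) (auto simp: nn_integral_cmult nn_integral_multc)
  also have "\<dots> \<le> 2 * ennreal (?\<tau> powr (1 + 2 * s) * ?G) + ennreal ?\<tau> * ennreal CC"
    unfolding N by (intro add_right_mono mult_left_mono nn_integral_y_differences u s \<tau>) simp
  also have "\<dots> = ennreal (2 * (?\<tau> powr (1 + 2 * s) * ?G) + ?\<tau> * CC)"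
    using \<tau> G0 C0 by (simp add: ennreal_plus ennreal_mult)
  also have "ennreal t * \<dots> = ennreal (t * (2 * (?\<tau> powr (1 + 2 * s) * ?G) + ?\<tau> * CC))"
    using t by (simp add: ennreal_mult')
  finally have "ennreal (\<rho>^2 * (T / 2) * lset u (2 * \<rho>)) \<le> ennreal (t * (2 * (?\<tau> powr (1 + 2 * s) * ?G) + ?\<tau> * CC))"
    by (simp add: mult_left_mono)
  then have "\<rho>^2 * (T / 2) * lset u (2 * \<rho>) \<le> t * (2 * (?\<tau> powr (1 + 2 * s) * ?G) + ?\<tau> * CC)"
    using t \<tau> G0 C0 by (subst (asm) ennreal_le_iff) auto
  \<comment> \<open>The side \<open>t powr (1/s)\<close> was chosen for this: the vertical kernel
    factor becomes \<open>?\<tau> * t^2\<close>, so both directions contribute at the same order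
    \<open>t^2\<close>.\<close>
  also have "?\<tau> powr (1 + 2 * s) = ?\<tau> * t^2"
  proof -
    have ex2: "1/s * (1 + 2 * s) = 1/s + 2" using s by (simp add: field_simps)
    have "?\<tau> powr (1 + 2 * s) = t powr (1/s * (1 + 2 * s))" by (rule powr_powr)
    also have "\<dots> = ?\<tau> * t^2" unfolding ex2 by (simp only: powr_add powr_sq[OF t])
    finally show ?thesis .
  qed
  also have "t * (2 * (?\<tau> * t^2 * ?G) + ?\<tau> * CC) = T * (2 * t^2 * (?G + Lpow 2 (wdx u)))"
    by (simp add: T_def CC_def algebra_simps)
  finally have "\<rho>^2 * (T / 2) * lset u (2 * \<rho>) \<le> T * (2 * t^2 * (?G + Lpow 2 (wdx u)))" .
  moreover have "\<rho>^2 * (T / 2) * lset u (2 * \<rho>) = T * (\<rho>^2 / 2 * lset u (2 * \<rho>))" by simp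
  ultimately have "T * (\<rho>^2 / 2 * lset u (2 * \<rho>)) \<le> T * (2 * t^2 * (?G + Lpow 2 (wdx u)))" by (simp only:)
  then have "\<rho>^2 / 2 * lset u (2 * \<rho>) \<le> 2 * t^2 * (?G + Lpow 2 (wdx u))"
    using T by (simp only: mult_le_cancel_left_pos)
  then show ?thesis using l by (simp add: field_simps)
qed

lemma Kf_controls:
  assumes "0 < s" "s < 1"
  shows "(LINT t|lborel. gag_integrand s u u t) + Lpow 2 (wdx u) \<le> (1 + 1 / frac_const s) * Kf s u"
proof -
  let ?G = "LINT t|lborel. gag_integrand s u u t"
  have c: "frac_const s > 0" using frac_const_pos[OF assms] .
  have G: "?G \<ge> 0" by (intro integral_nonneg_AE) (auto simp: gag_nonneg)
  have K: "Kf s u = Lpow 2 (wdx u) + frac_const s * ?G"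
    by (simp add: Kf_def innerK_def Gy_def Lpow2_eq power2_eq_square)
  have "(1 + 1 / frac_const s) * Kf s u = Lpow 2 (wdx u) + ?G + frac_const s * ?G + Lpow 2 (wdx u) / frac_const s"
    using c unfolding K by (simp add: field_simps)
  then show ?thesis using c G Lpow_nonneg[of 2 "wdx u"] by simp
qed

definition unit_class :: "real \<Rightarrow> real \<Rightarrow> fn2 set" where
  "unit_class s a = {u. inH s u \<and> Kf s u \<le> 1 \<and> Lpow 2 u \<le> a}"

text \<open>A weak Lebesgue (Marcinkiewicz) bound of exponent \<open>r\<close>, uniform over the
  class; uniformity is what makes the iterated constant independent of the function.\<close>

definition weak_bound :: "real \<Rightarrow> real \<Rightarrow> real \<Rightarrow> bool" where
  "weak_bound s a r \<longleftrightarrow> (\<exists>C>0. \<forall>u\<in>unit_class s a. \<forall>\<rho>>0. lset u \<rho> \<le> C * \<rho> powr (- r))"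

lemma weak_bound_2: assumes "a > 0" shows "weak_bound s a 2"
  unfolding weak_bound_def
proof (intro exI[of _ a] conjI ballI allI impI assms)
  fix u \<rho> assume u: "u \<in> unit_class s a" and l: "(\<rho>::real) > 0"
  have "lset u \<rho> \<le> Lpow 2 u / \<rho>^2" using u l inH_memLp by (intro lset_le) (auto simp: unit_class_def)
  also have "\<dots> \<le> a / \<rho>^2" using u by (intro divide_right_mono) (auto simp: unit_class_def)
  also have "\<dots> = a * \<rho> powr (-2)" using l by (simp add: powr_minus_divide powr_numeral)
  finally show "lset u \<rho> \<le> a * \<rho> powr (-2)" .
qed

text \<open>Taking \<open>t\<close> just large enough that the assumed decay makes the box twice the
  level set gives \<open>t^2\<close> of order \<open>\<rho> powr (- (2 * s / (1 + s) * r))\<close>,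
  and level halving divides by a further \<open>\<rho>^2\<close>.\<close>

lemma weak_bound_step:
  assumes s: "0 < s" "s < 1" and W: "weak_bound s a r"
  shows "weak_bound s a (2 + 2 * s / (1 + s) * r)"
proof -
  obtain C where C: "C > 0" "\<And>u \<rho>. u \<in> unit_class s a \<Longrightarrow> \<rho> > 0 \<Longrightarrow> lset u \<rho> \<le> C * \<rho> powr (- r)"
    using W by (auto simp: weak_bound_def)
  define c1 where "c1 = 1 + 1 / frac_const s"
  have c1: "c1 > 0" using frac_const_pos[OF s] by (simp add: c1_def add_pos_pos)
  define e where "e = 2 * s / (1 + s)"
  \<comment> \<open>The last factor converts the estimate at \<open>\<rho> = \<mu> / 2\<close> into
    one at \<open>\<mu>\<close>.\<close>
  define D where "D = 4 * (2 * C) powr e * c1 * (1/2) powr (- (2 + e * r))"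
  show ?thesis unfolding weak_bound_def e_def[symmetric]
  proof (intro exI[of _ D] conjI ballI allI impI)
    show "D > 0" using C c1 by (simp add: D_def)
    fix u \<mu> assume u: "u \<in> unit_class s a" and m: "(\<mu>::real) > 0"
    define \<rho> where "\<rho> = \<mu> / 2"
    have l: "\<rho> > 0" using m by (simp add: \<rho>_def)
    have uH: "inH s u" and K: "Kf s u \<le> 1" using u by (auto simp: unit_class_def)
    define t where "t = (2 * (C * \<rho> powr (- r))) powr (s / (1 + s))"
    have t: "t > 0" using C l by (simp add: t_def)
    have ex: "s / (1 + s) * (1 + 1/s) = 1" using s add_pos_pos[of s "s * s"] by (simp add: field_simps)
    have "t powr (1 + 1/s) = 2 * (C * \<rho> powr (- r))"
      unfolding t_def powr_powr ex using C l by simp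
    then have "2 * lset u \<rho> \<le> t powr (1 + 1/s)" using C(2)[OF u l] by simp
    from level_halving[OF uH s(1) l t this]
    have "lset u (2 * \<rho>) \<le> 4 * t^2 * ((LINT t|lborel. gag_integrand s u u t) + Lpow 2 (wdx u)) / \<rho>^2" .
    also have "\<dots> \<le> 4 * t^2 * c1 / \<rho>^2"
    proof -
      have "(LINT t|lborel. gag_integrand s u u t) + Lpow 2 (wdx u) \<le> c1 * Kf s u" unfolding c1_def by (rule Kf_controls[OF s])
      also have "\<dots> \<le> c1" using K c1 by simp
      finally show ?thesis by (intro divide_right_mono mult_left_mono) auto
    qed
    also have "t^2 = (2 * C) powr e * \<rho> powr (- (e * r))"
    proof -
      have "t^2 = t powr 2" using t by (rule powr_sq)
      also have "\<dots> = (2 * C * \<rho> powr (- r)) powr e" unfolding t_def powr_powr by (simp add: e_def mult.assoc mult.commute[of s])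
      also have "\<dots> = (2 * C) powr e * \<rho> powr (- (e * r))" using C by (simp add: powr_mult powr_powr mult.commute)
      finally show ?thesis .
    qed
    also have "4 * ((2 * C) powr e * \<rho> powr (- (e * r))) * c1 / \<rho>^2 = 4 * (2 * C) powr e * c1 * \<rho> powr (- (2 + e * r))"
    proof -
      have "\<rho> powr (- (2 + e * r)) = \<rho> powr (- (e * r)) / \<rho>^2"
      proof -
        have "- (2 + e * r) = - (e * r) - 2" by simp
        then show ?thesis by (simp only: powr_diff powr_sq[OF l])
      qed
      then show ?thesis by simp
    qed
    also have "\<rho> powr (- (2 + e * r)) = (1/2) powr (- (2 + e * r)) * \<mu> powr (- (2 + e * r))"
      using m unfolding \<rho>_def by (subst powr_mult[symmetric]) auto
    finally have "lset u (2 * \<rho>) \<le> D * \<mu> powr (- (2 + e * r))" by (simp only: D_def mult.assoc)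
    then show "lset u \<mu> \<le> D * \<mu> powr (- (2 + e * r))" by (simp add: \<rho>_def)
  qed
qed

text \<open>The improvement of exponents r |-> 2 + e r is an affine contraction whose fixed point is
  the critical exponent \<open>R\<close>; iterating from 2 gives \<open>R - e ^ n * (R - 2)\<close>,
  which passes every subcritical \<open>p\<close>.\<close>

lemma weak_bound_below_critical:
  assumes s: "0 < s" "s < 1" and a: "a > 0" and p: "p < 2 * (1 + s) / (1 - s)"
  obtains r where "r > p" "weak_bound s a r"
proof -
  define R where "R = 2 * (1 + s) / (1 - s)"
  define e where "e = 2 * s / (1 + s)"
  have e: "0 < e" "e < 1" using s by (auto simp: e_def field_simps)
  have fp: "2 + e * R = R"
  proof -
    have "1 - e = (1 - s) / (1 + s)" using s by (simp add: e_def field_simps)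
    then have "R * (1 - e) = 2" using s by (simp add: R_def) (simp add: field_simps)
    then show ?thesis by (simp add: algebra_simps)
  qed
  have W: "weak_bound s a (R - e ^ n * (R - 2))" for n
  proof (induction n)
    case 0
    then show ?case using weak_bound_2[OF a] by simp
  next
    case (Suc n)
    have "2 + e * (R - e ^ n * (R - 2)) = R - e ^ Suc n * (R - 2)"
      using fp by (simp add: algebra_simps)
    then show ?case using weak_bound_step[OF s Suc] by (simp add: e_def)
  qed
  have "(\<lambda>n. R - e ^ n * (R - 2)) \<longlonglongrightarrow> R - 0 * (R - 2)"
    using e by (intro tendsto_intros LIMSEQ_realpow_zero) auto
  then have "eventually (\<lambda>n. R - e ^ n * (R - 2) > p) sequentially"
    by (rule order_tendstoD) (use p in \<open>simp add: R_def\<close>)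
  then obtain n where "R - e ^ n * (R - 2) > p" by (auto simp: eventually_sequentially)
  then show thesis using that W by blast
qed

text \<open>Dyadic layer cake: values at most 1 are charged to the mass, the layer above
  \<open>2 ^ k\<close> to its level set, and the layers sum to a geometric series of ratio
  \<open>2 powr (p - r)\<close>.\<close>

lemma Lp_from_levels:
  assumes u: "memLp 2 u" "Lpow 2 u \<le> a" and p: "2 < p" "p < r" and a: "a > 0" and C: "C > 0"
    and W: "\<And>\<rho>. \<rho> > 0 \<Longrightarrow> lset u \<rho> \<le> C * \<rho> powr (- r)"
  shows "memLp p u" "Lpow p u \<le> a + C * 2 powr p / (1 - 2 powr (p - r))"
proof -
  have um: "u \<in> borel_measurable borel" using u by (simp add: memLp2_iff)
  note um[measurable]
  define q where "q = 2 powr (p - r)"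
  have q: "0 < q" "q < 1" using p by (auto simp: q_def powr_less_one)
  have pt: "ennreal (\<bar>u z\<bar> powr p) \<le> ennreal ((u z)^2) + (\<Sum>k. ennreal (2 powr (p * (k + 1))) * indicator {z. 2 ^ k < \<bar>u z\<bar>} z)" for z
  proof (cases "\<bar>u z\<bar> \<le> 1")
    case True
    have "\<bar>u z\<bar> powr p \<le> (u z)^2"
    proof (cases "u z = 0")
      case False
      then have "\<bar>u z\<bar> powr p \<le> \<bar>u z\<bar> powr 2" using True p by (intro powr_mono') auto
      then show ?thesis using False by (simp add: powr_numeral)
    qed simp
    then show ?thesis by (meson add_increasing2 ennreal_leI zero_le)
  next
    case False
    obtain n where n: "\<bar>u z\<bar> < 2 ^ n" using real_arch_pow[of 2 "\<bar>u z\<bar>"] by auto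
    \<comment> \<open>The least dyadic level that bounds \<open>\<bar>u z\<bar>\<close>; since
      \<open>\<bar>u z\<bar> > 1\<close> it is not the zeroth, and its predecessor lies strictly
      below \<open>\<bar>u z\<bar>\<close>.\<close>
    define k where "k = (LEAST n. \<bar>u z\<bar> \<le> 2 ^ n)"
    have k1: "\<bar>u z\<bar> \<le> 2 ^ k" unfolding k_def by (rule LeastI[of _ n]) (use n in simp)
    have "k \<noteq> 0" using k1 False by (cases k) auto
    then obtain j where j: "k = Suc j" using not0_implies_Suc by blast
    have j2: "2 ^ j < \<bar>u z\<bar>" using not_less_Least[of j "\<lambda>n. \<bar>u z\<bar> \<le> 2 ^ n"] j by (simp add: k_def[symmetric])
    have "\<bar>u z\<bar> powr p \<le> (2 ^ k) powr p" using k1 p by (intro powr_mono2) auto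
    also have "\<dots> = 2 powr (p * (j + 1))"
    proof -
      have "(2 ^ k :: real) = 2 powr (j + 1)" unfolding j by (subst powr_realpow[symmetric]) (auto simp: add.commute)
      then show ?thesis by (simp only: powr_powr mult.commute)
    qed
    finally have "ennreal (\<bar>u z\<bar> powr p) \<le> ennreal (2 powr (p * (j + 1))) * indicator {z. 2 ^ j < \<bar>u z\<bar>} z"
      using j2 by (simp add: ennreal_leI)
    also have "\<dots> \<le> (\<Sum>k. ennreal (2 powr (p * (k + 1))) * indicator {z. 2 ^ k < \<bar>u z\<bar>} z)"
    proof -
      define f :: "nat \<Rightarrow> ennreal" where "f = (\<lambda>k. ennreal (2 powr (p * real (k + 1))) * indicator {z. 2 ^ k < \<bar>u z\<bar>} z)"
      have "f j \<le> (\<Sum>k. f k)" using sum_le_suminf[of f "{j}"] by simp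
      then show ?thesis by (simp only: f_def)
    qed
    finally show ?thesis by (meson add_increasing zero_le)
  qed
  have lv: "(\<integral>\<^sup>+ z. ennreal (2 powr (p * (k + 1))) * indicator {z. 2 ^ k < \<bar>u z\<bar>} z \<partial>lborel) \<le> ennreal (C * 2 powr p * q ^ k)" for k :: nat
  proof -
    have "{z. 2 ^ k < \<bar>u z\<bar>} \<in> sets lborel" by measurable
    then have "(\<integral>\<^sup>+ z. ennreal (2 powr (p * (k + 1))) * indicator {z. 2 ^ k < \<bar>u z\<bar>} z \<partial>lborel) = ennreal (2 powr (p * (k + 1)) * lset u (2 ^ k))"
      using lset_emeasure[OF u(1), of "2 ^ k"] by (simp add: nn_integral_cmult_indicator ennreal_mult lset_def)
    also have "\<dots> \<le> ennreal (2 powr (p * (k + 1)) * (C * (2 ^ k) powr (- r)))"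
      using W[of "2 ^ k"] by (intro ennreal_leI mult_left_mono) auto
    also have "2 powr (p * (k + 1)) * (C * (2 ^ k) powr (- r)) = C * 2 powr p * q ^ k"
    proof -
      have "(2 ^ k) powr (- r) = 2 powr (- r * k)" by (simp add: powr_realpow[symmetric] powr_powr mult.commute)
      moreover have "q ^ k = 2 powr ((p - r) * k)" by (simp add: q_def powr_realpow[symmetric] powr_powr)
      moreover have "2 powr (p * (k + 1)) * 2 powr (- r * k) = 2 powr p * 2 powr ((p - r) * k)"
        unfolding powr_add[symmetric] by (simp add: algebra_simps)
      ultimately show ?thesis by (simp add: algebra_simps)
    qed
    finally show ?thesis .
  qed
  have "(\<integral>\<^sup>+ z. ennreal (\<bar>u z\<bar> powr p) \<partial>lborel) \<le> (\<integral>\<^sup>+ z. ennreal ((u z)^2) + (\<Sum>k. ennreal (2 powr (p * (k + 1))) * indicator {z. 2 ^ k < \<bar>u z\<bar>} z) \<partial>lborel)"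
    by (intro nn_integral_mono pt)
  also have "\<dots> = (\<integral>\<^sup>+ z. ennreal ((u z)^2) \<partial>lborel) + (\<Sum>k. \<integral>\<^sup>+ z. ennreal (2 powr (p * (k + 1))) * indicator {z. 2 ^ k < \<bar>u z\<bar>} z \<partial>lborel)"
    by (subst nn_integral_add) (auto intro!: nn_integral_suminf arg_cong2[where f="(+)"])
  also have "\<dots> \<le> ennreal a + (\<Sum>k. ennreal (C * 2 powr p * q ^ k))"
    unfolding nn_integral_L2[OF u(1)] using lv u(2) by (intro add_mono suminf_le ennreal_leI) auto
  also have "(\<Sum>k. ennreal (C * 2 powr p * q ^ k)) = ennreal (\<Sum>k. C * 2 powr p * q ^ k)"
    using q C by (intro suminf_ennreal2 summable_mult) auto
  also have "(\<Sum>k. C * 2 powr p * q ^ k) = C * 2 powr p / (1 - q)"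
    using q by (subst suminf_mult) (auto simp: suminf_geometric)
  finally have b: "(\<integral>\<^sup>+ z. ennreal (\<bar>u z\<bar> powr p) \<partial>lborel) \<le> ennreal (a + C * 2 powr p / (1 - q))"
    using a q C by (simp add: ennreal_plus)
  have i: "integrable lborel (\<lambda>z. \<bar>u z\<bar> powr p)"
    using le_less_trans[OF b] by (intro integrableI_bounded) auto
  then show "memLp p u" by (simp add: memLp_def)
  have "ennreal (Lpow p u) = (\<integral>\<^sup>+ z. ennreal (\<bar>u z\<bar> powr p) \<partial>lborel)"
    unfolding Lpow_def using i by (intro nn_integral_eq_integral[symmetric]) auto
  with b have "ennreal (Lpow p u) \<le> ennreal (a + C * 2 powr p / (1 - q))" by simp
  then show "Lpow p u \<le> a + C * 2 powr p / (1 - 2 powr (p - r))"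
    using a q C by (subst (asm) ennreal_le_iff) (auto simp: q_def)
qed

section \<open>The subcritical embedding and the Gagliardo--Nirenberg inequality\<close>

lemma embedding:
  assumes s: "0 < s" "s < 1" and a: "a > 0" and p: "2 < p" "p < 2 * (1 + s) / (1 - s)"
  obtains C where "C > 0" "\<And>u. inH s u \<Longrightarrow> Kf s u \<le> 1 \<Longrightarrow> Lpow 2 u \<le> a \<Longrightarrow> memLp p u \<and> Lpow p u \<le> C"
proof -
  obtain r where r: "r > p" "weak_bound s a r" using weak_bound_below_critical[OF s a p(2)] by blast
  then obtain C where C: "C > 0" "\<And>u \<rho>. u \<in> unit_class s a \<Longrightarrow> \<rho> > 0 \<Longrightarrow> lset u \<rho> \<le> C * \<rho> powr (- r)"
    by (auto simp: weak_bound_def)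
  show thesis
  proof (rule that)
    have "2 powr (p - r) < 1" using r by (simp add: powr_less_one)
    then show "a + C * 2 powr p / (1 - 2 powr (p - r)) > 0" using a C by (intro add_pos_pos divide_pos_pos) auto
    fix u assume u: "inH s u" "Kf s u \<le> 1" "Lpow 2 u \<le> a"
    show "memLp p u \<and> Lpow p u \<le> a + C * 2 powr p / (1 - 2 powr (p - r))"
      using Lp_from_levels[OF inH_memLp(1)[OF u(1)] u(3) p(1) r(1) a C(1) C(2)] u by (auto simp: unit_class_def)
  qed
qed

lemma inH_memLp_p:
  assumes s: "0 < s" "s < 1" and p: "2 < p" "p < 2 * (1 + s) / (1 - s)" and u: "inH s u"
  shows "memLp p u"
proof -
  define c where "c = 1 / sqrt (Kf s u + 1)"
  have K: "Kf s u \<ge> 0" by (rule Kf_nonneg[OF s])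
  have c: "c > 0" "c^2 = 1 / (Kf s u + 1)" using K by (auto simp: c_def power_divide)
  let ?w = "dil s c 1 u"
  have w: "inH s ?w" using dil_H[OF _ s(1) u] by simp
  have "Kf s ?w \<le> 1" using Kf_dil[OF _ s(1) u, of 1 c] K by (simp add: c)
  moreover obtain C where "\<And>u. inH s u \<Longrightarrow> Kf s u \<le> 1 \<Longrightarrow> Lpow 2 u \<le> Lpow 2 ?w + 1 \<Longrightarrow> memLp p u \<and> Lpow p u \<le> C"
    using embedding[OF s _ p, of "Lpow 2 ?w + 1"] Lpow_nonneg[of 2 ?w] by (metis add_nonneg_pos zero_less_one)
  ultimately have "memLp p ?w" using w by simp
  then have "integrable lborel (\<lambda>z. c powr p * \<bar>u z\<bar> powr p)" using c by (simp add: memLp_def dil_def abs_mult powr_mult)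
  then show ?thesis using c inH_measurable(1)[OF u] by (simp add: memLp_def)
qed

text \<open>The mass-preserving dilation that brings \<open>Kf\<close> to 1 reduces the claim to the
  embedding; the power of \<open>Kf\<close> records what this dilation does to
  \<open>Lpow p\<close>.\<close>

lemma GN_inequality:
  assumes s: "0 < s" "s < 1" and a: "a > 0" and p: "2 < p" "p < 2 * (1 + s) / (1 - s)"
  obtains C where "C > 0" "\<And>u. inH s u \<Longrightarrow> Lpow 2 u \<le> a \<Longrightarrow> Kf s u > 0 \<Longrightarrow> Lpow p u \<le> C * Kf s u powr ((p - 2) * (1 + s) / (4 * s))"
proof -
  obtain C where C: "C > 0" "\<And>u. inH s u \<Longrightarrow> Kf s u \<le> 1 \<Longrightarrow> Lpow 2 u \<le> a \<Longrightarrow> memLp p u \<and> Lpow p u \<le> C"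
    using embedding[OF s a p] by blast
  show thesis
  proof (rule that[OF C(1)])
    fix u assume u: "inH s u" "Lpow 2 u \<le> a" "Kf s u > 0"
    define K where "K = Kf s u"
    have K: "K > 0" using u by (simp add: K_def)
    \<comment> \<open>With the mass fixed, the dilation multiplies \<open>Kf\<close> by
      \<open>l^2\<close>, which determines \<open>l\<close>.\<close>
    define l where "l = K powr (- 1/2)"
    have l: "l > 0" using K by (simp add: l_def)
    define c where "c = l powr ((1 + 1/s) / 2)"
    have c: "c > 0" using l by (simp add: c_def)
    have c2: "c^2 = l powr (1 + 1/s)"
  proof -
    have "(1 + 1/s) / 2 * 2 = 1 + 1/s" by simp
    moreover have "c^2 = c powr 2" by (rule powr_sq[OF c])
    ultimately show ?thesis by (simp only: c_def powr_powr)
  qed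
    let ?w = "dil s c l u"
    have w: "inH s ?w" by (rule dil_H[OF l s(1) u(1)])
    have um: "u \<in> borel_measurable borel" using u inH_measurable by auto
    have "Lpow 2 ?w = c^2 / l powr (1 + 1/s) * Lpow 2 u"
      using Lpow_dil[OF um l, of 2 s c] c by (simp add: powr_numeral)
    then have M: "Lpow 2 ?w \<le> a" using u l by (simp add: c2)
    have "Kf s ?w = l powr (1 + 1/s) * l powr (1 - 1/s) * K" using Kf_dil[OF l s(1) u(1), of c] by (simp add: c2 K_def)
    also have "l powr (1 + 1/s) * l powr (1 - 1/s) = l powr 2" by (simp flip: powr_add)
    also have "l powr 2 = 1 / K" unfolding l_def powr_powr using K by (simp add: powr_minus_divide)
    finally have "Kf s ?w \<le> 1" using K by simp
    then have "Lpow p ?w \<le> C" using C(2)[OF w _ M] by simp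
    then have *: "c powr p / l powr (1 + 1/s) * Lpow p u \<le> C" using Lpow_dil[OF um l, of p s c] c by simp
    have "c powr p / l powr (1 + 1/s) = l powr ((1 + 1/s) / 2 * p - (1 + 1/s))"
      by (simp add: c_def powr_powr flip: powr_diff)
    also have "\<dots> = K powr (- ((p - 2) * (1 + s) / (4 * s)))"
      unfolding l_def powr_powr by (rule arg_cong[where f="\<lambda>x. K powr x"]) (use s in \<open>simp add: field_simps\<close>)
    finally have "K powr (- ((p - 2) * (1 + s) / (4 * s))) * Lpow p u \<le> C" using * by simp
    then show "Lpow p u \<le> C * Kf s u powr ((p - 2) * (1 + s) / (4 * s))"
      using K by (simp add: powr_minus_divide K_def[symmetric] field_simps)
  qed
qed

text \<open>Otherwise its mass-preserving dilations would violate the embedding.\<close>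
lemma Kf_zero_imp:
  assumes s: "0 < s" "s < 1" and u: "inH s u" and K: "Kf s u = 0"
  shows "AE z in lborel. u z = 0"
proof -
  have um: "u \<in> borel_measurable borel" using u inH_measurable by auto
  have uL: "memLp 2 u" using u inH_memLp by auto
  have G: "(LINT t|lborel. gag_integrand s u u t) + Lpow 2 (wdx u) \<le> 0" using Kf_controls[OF s, of u] K by simp
  \<comment> \<open>With vanishing energy the halving estimate bounds the level set by zero;
    \<open>t\<close> only has to make the box large enough.\<close>
  have z: "lset u (2 * \<rho>) \<le> 0" if l: "\<rho> > 0" for \<rho>
  proof -
    define t where "t = (2 * lset u \<rho> + 1) powr (s / (1 + s))"
    have L0: "lset u \<rho> \<ge> 0" by (simp add: lset_def)
    have t: "t > 0" using L0 by (simp add: t_def)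
    have ex: "s / (1 + s) * (1 + 1/s) = 1" using s add_pos_pos[of s "s * s"] by (simp add: field_simps)
    have "2 * lset u \<rho> \<le> t powr (1 + 1/s)" unfolding t_def powr_powr ex using L0 by simp
    from level_halving[OF u s(1) l t this] have "lset u (2 * \<rho>) \<le> 4 * t^2 * ((LINT t|lborel. gag_integrand s u u t) + Lpow 2 (wdx u)) / \<rho>^2" .
    also have "\<dots> \<le> 0" using G by (intro divide_nonpos_nonneg mult_nonneg_nonpos) auto
    finally show ?thesis .
  qed
  have "AE z in lborel. \<forall>n::nat. \<not> (1 / real (Suc n) < \<bar>u z\<bar>)"
  proof (subst AE_all_countable, intro allI)
    fix n :: nat
    have half: "y = 2 * (y / 2)" for y :: real by simp
    note x = half[of "1 / real (Suc n)"]
    have "lset u (1 / real (Suc n)) \<le> 0" by (subst x, rule z) simp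
    then have "lset u (1 / real (Suc n)) = 0" by (simp add: lset_def measure_le_0_iff)
    then have "emeasure lborel {z. 1 / real (Suc n) < \<bar>u z\<bar>} = 0" using lset_emeasure[OF uL, of "1 / real (Suc n)"] by simp
    moreover have "{z. 1 / real (Suc n) < \<bar>u z\<bar>} \<in> sets lborel" using um by measurable
    ultimately show "AE z in lborel. \<not> (1 / real (Suc n) < \<bar>u z\<bar>)"
      by (intro AE_I[of _ _ "{z. 1 / real (Suc n) < \<bar>u z\<bar>}"]) auto
  qed
  then show ?thesis
  proof eventually_elim
    case (elim z)
    show ?case
    proof (rule ccontr)
      assume "u z \<noteq> 0"
      then obtain n where "inverse (real (Suc n)) < \<bar>u z\<bar>" using reals_Archimedean[of "\<bar>u z\<bar>"] by auto
      then show False using elim by (simp add: inverse_eq_divide)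
    qed
  qed
qed

subsection \<open>Convergence of the nonlinear terms\<close>

lemma homogeneous_bound:
  fixes F :: "real \<times> real \<Rightarrow> real"
  assumes cont: "continuous_on UNIV F" and hom: "\<And>t x. t > 0 \<Longrightarrow> F (t *\<^sub>R x) = t powr r * F x" and r: "r > 0"
  obtains B where "B \<ge> 0" "\<And>x. \<bar>F x\<bar> \<le> B * norm x powr r"
proof -
  have F0: "F 0 = 0"
  proof -
    have "F 0 = 2 powr r * F 0" using hom[of 2 0] by simp
    moreover have "2 powr r > 1" using r by simp
    ultimately show ?thesis by (metis mult_cancel_right1 order_less_irrefl)
  qed
  have "compact (F ` cball 0 1)" using cont by (intro compact_continuous_image) (auto intro: continuous_on_subset)
  then have "bounded (F ` cball 0 1)" by (rule compact_imp_bounded)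
  then obtain B where "\<forall>y\<in>F ` cball 0 1. norm y \<le> B" unfolding bounded_iff by blast
  then have B: "\<bar>F x\<bar> \<le> B" if "norm x \<le> 1" for x using that by auto
  have "B \<ge> 0" using B[of 0] F0 by simp
  moreover have "\<bar>F x\<bar> \<le> B * norm x powr r" for x
  proof (cases "x = 0")
    case False
    let ?e = "(1 / norm x) *\<^sub>R x"
    have "\<bar>F x\<bar> = norm x powr r * \<bar>F ?e\<bar>" using hom[of "norm x" ?e] False by (simp add: abs_mult)
    also have "\<dots> \<le> norm x powr r * B" by (intro mult_left_mono B) (use False in auto)
    finally show ?thesis by (simp only: mult.commute)
  qed (simp add: F0)
  ultimately show thesis using that by blast
qed

text \<open>Treats the two power terms and the coupling at once, all being homogeneous in the pair
  (u, v). For increments small relative to \<open>x\<close>, rescale to the unit sphere and use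
  uniform continuity; otherwise \<open>norm x\<close> is bounded by a multiple of
  \<open>norm h\<close> and the growth bound suffices.\<close>

lemma homogeneous_estimate:
  fixes F :: "real \<times> real \<Rightarrow> real"
  assumes cont: "continuous_on UNIV F" and hom: "\<And>t x. t > 0 \<Longrightarrow> F (t *\<^sub>R x) = t powr r * F x" and r: "r > 0"
    and \<epsilon>: "\<epsilon> > 0"
  obtains C where "C \<ge> 0" "\<And>x h. \<bar>F (x + h) - F x\<bar> \<le> \<epsilon> * norm x powr r + C * norm h powr r"
proof -
  obtain B where B: "B \<ge> 0" "\<And>x. \<bar>F x\<bar> \<le> B * norm x powr r" using homogeneous_bound[OF cont hom r] by blast
  have "uniformly_continuous_on (cball 0 2) F"
    using cont by (intro compact_uniformly_continuous) (auto intro: continuous_on_subset)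
  then obtain \<delta>' where \<delta>': "\<delta>' > 0" "\<And>x y. norm x \<le> 2 \<Longrightarrow> norm y \<le> 2 \<Longrightarrow> dist y x < \<delta>' \<Longrightarrow> dist (F y) (F x) < \<epsilon>"
    unfolding uniformly_continuous_on_def using \<epsilon> by (metis mem_cball_0)
  \<comment> \<open>The cap 1 keeps the rescaled perturbed point inside the ball of radius
    2.\<close>
  define \<delta> where "\<delta> = min (\<delta>' / 2) 1"
  have \<delta>: "\<delta> > 0" "\<delta> < \<delta>'" "\<delta> \<le> 1" using \<delta>' by (auto simp: \<delta>_def)
  define C where "C = B * (1 / \<delta> + 1) powr r + B * (1 / \<delta>) powr r"
  have C0: "C \<ge> 0" using B by (simp add: C_def)
  have "\<bar>F (x + h) - F x\<bar> \<le> \<epsilon> * norm x powr r + C * norm h powr r" for x h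
  proof (cases "x \<noteq> 0 \<and> norm h \<le> \<delta> * norm x")
    case True
    let ?e = "(1 / norm x) *\<^sub>R x" and ?k = "(1 / norm x) *\<^sub>R h"
    have k: "norm ?k \<le> \<delta>" using True by (simp add: divide_le_eq)
    have e: "norm ?e = 1" using True by simp
    have ek: "norm (?e + ?k) \<le> 2" using norm_triangle_ineq[of ?e ?k] k e \<delta> by linarith
    have "dist (F (?e + ?k)) (F ?e) < \<epsilon>" by (rule \<delta>'(2)) (use e ek k \<delta> in \<open>auto simp: dist_norm\<close>)
    moreover have "F (x + h) = norm x powr r * F (?e + ?k)" "F x = norm x powr r * F ?e"
      using hom[of "norm x" "?e + ?k"] hom[of "norm x" ?e] True by (auto simp: scaleR_add_right)
    ultimately have "\<bar>F (x + h) - F x\<bar> \<le> norm x powr r * \<epsilon>"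
      by (simp add: dist_real_def abs_mult right_diff_distrib[symmetric] mult_left_mono)
    then show ?thesis using C0 by (simp add: mult.commute add_increasing2)
  next
    case False
    then have xh: "norm x \<le> norm h / \<delta>" using \<delta> by (cases "x = 0") (auto simp: field_simps)
    have 1: "\<bar>F x\<bar> \<le> B * ((1 / \<delta>) powr r * norm h powr r)"
    proof -
      have "norm x powr r \<le> (1 / \<delta> * norm h) powr r" using xh r by (intro powr_mono2) auto
      also have "\<dots> = (1 / \<delta>) powr r * norm h powr r" using \<delta> by (intro powr_mult)
      finally show ?thesis using B by (meson mult_left_mono order_trans)
    qed
    have 2: "\<bar>F (x + h)\<bar> \<le> B * ((1 / \<delta> + 1) powr r * norm h powr r)"
    proof -
      have "norm (x + h) \<le> (1 / \<delta> + 1) * norm h" using norm_triangle_ineq[of x h] xh by (simp add: algebra_simps)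
      then have "norm (x + h) powr r \<le> ((1 / \<delta> + 1) * norm h) powr r" using r by (intro powr_mono2) auto
      also have "\<dots> = (1 / \<delta> + 1) powr r * norm h powr r" using \<delta> by (intro powr_mult)
      finally show ?thesis using B by (meson mult_left_mono order_trans)
    qed
    have "\<bar>F (x + h) - F x\<bar> \<le> C * norm h powr r" using 1 2 by (simp add: C_def algebra_simps)
    then show ?thesis using \<epsilon> by (simp add: add_increasing)
  qed
  then show thesis using that C0 by blast
qed

lemma norm_pair_powr: "r > 0 \<Longrightarrow> norm (a :: real, b :: real) powr r \<le> 2 powr r * (\<bar>a\<bar> powr r + \<bar>b\<bar> powr r)"
proof -
  assume r: "r > 0"
  have "norm (a, b) \<le> \<bar>a\<bar> + \<bar>b\<bar>" using norm_Pair_le[of a b] by simp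
  also have "\<dots> \<le> 2 * max \<bar>a\<bar> \<bar>b\<bar>" by auto
  finally have "norm (a, b) powr r \<le> (2 * max \<bar>a\<bar> \<bar>b\<bar>) powr r" using r by (intro powr_mono2) auto
  also have "\<dots> = 2 powr r * max \<bar>a\<bar> \<bar>b\<bar> powr r" by (intro powr_mult)
  also have "max \<bar>a\<bar> \<bar>b\<bar> powr r \<le> \<bar>a\<bar> powr r + \<bar>b\<bar> powr r" by (auto simp: max_def)
  finally show ?thesis by simp
qed

lemma homogeneous_integrable:
  fixes F :: "real \<times> real \<Rightarrow> real"
  assumes cont: "continuous_on UNIV F" and hom: "\<And>t x. t > 0 \<Longrightarrow> F (t *\<^sub>R x) = t powr r * F x" and r: "r > 0"
    and u: "memLp r u" and v: "memLp r v"
  shows "integrable lborel (\<lambda>z. F (u z, v z))"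
proof -
  obtain B where B: "B \<ge> 0" "\<And>x. \<bar>F x\<bar> \<le> B * norm x powr r" using homogeneous_bound[OF cont hom r] by blast
  have [measurable]: "u \<in> borel_measurable borel" "v \<in> borel_measurable borel" using u v by (auto simp: memLp_def)
  have [measurable]: "F \<in> borel_measurable borel" by (rule borel_measurable_continuous_onI[OF cont])
  have m: "(\<lambda>z. (u z, v z)) \<in> borel_measurable borel" by measurable
  have Fm: "(\<lambda>z. F (u z, v z)) \<in> borel_measurable borel" by measurable
  have "integrable lborel (\<lambda>z. B * (2 powr r * (\<bar>u z\<bar> powr r + \<bar>v z\<bar> powr r)))"
    using u v by (auto simp: memLp_def)
  then show ?thesis
  proof (rule Bochner_Integration.integrable_bound)
    show "(\<lambda>z. F (u z, v z)) \<in> borel_measurable lborel" using Fm by simp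
    show "AE z in lborel. norm (F (u z, v z)) \<le> norm (B * (2 powr r * (\<bar>u z\<bar> powr r + \<bar>v z\<bar> powr r)))"
    proof (intro AE_I2)
      fix z
      have "\<bar>F (u z, v z)\<bar> \<le> B * norm (u z, v z) powr r" by (rule B)
      also have "\<dots> \<le> B * (2 powr r * (\<bar>u z\<bar> powr r + \<bar>v z\<bar> powr r))" using B norm_pair_powr[OF r] by (intro mult_left_mono) auto
      finally show "norm (F (u z, v z)) \<le> norm (B * (2 powr r * (\<bar>u z\<bar> powr r + \<bar>v z\<bar> powr r)))"
        by (metis abs_ge_self order_trans real_norm_def)
    qed
  qed
qed

lemma homogeneous_converge:
  fixes F :: "real \<times> real \<Rightarrow> real" and un vn :: "nat \<Rightarrow> fn2"
  assumes cont: "continuous_on UNIV F" and hom: "\<And>t x. t > 0 \<Longrightarrow> F (t *\<^sub>R x) = t powr r * F x" and r: "r > 0"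
    and u: "memLp r u" and v: "memLp r v" and un: "\<And>n. memLp r (un n)" and vn: "\<And>n. memLp r (vn n)"
    and du: "\<And>n. memLp r (\<lambda>z. un n z - u z)" and dv: "\<And>n. memLp r (\<lambda>z. vn n z - v z)"
    and lu: "(\<lambda>n. Lpow r (\<lambda>z. un n z - u z)) \<longlonglongrightarrow> 0" and lv: "(\<lambda>n. Lpow r (\<lambda>z. vn n z - v z)) \<longlonglongrightarrow> 0"
  shows "(\<lambda>n. LINT z|lborel. F (un n z, vn n z)) \<longlonglongrightarrow> (LINT z|lborel. F (u z, v z))"
proof (rule LIMSEQ_I)
  fix \<epsilon> :: real assume \<epsilon>: "\<epsilon> > 0"
  define S where "S = 2 powr r * (Lpow r u + Lpow r v)"
  have S: "S \<ge> 0" by (simp add: S_def Lpow_nonneg)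
  define \<kappa> where "\<kappa> = \<epsilon> / (2 * (S + 1))"
  have \<kappa>: "\<kappa> > 0" using S \<epsilon> by (simp add: \<kappa>_def)
  obtain C where C: "C \<ge> 0" "\<And>x h. \<bar>F (x + h) - F x\<bar> \<le> \<kappa> * norm x powr r + C * norm h powr r"
    using homogeneous_estimate[OF cont hom r \<kappa>] by blast
  have "(\<lambda>n. C * (2 powr r * (Lpow r (\<lambda>z. un n z - u z) + Lpow r (\<lambda>z. vn n z - v z)))) \<longlonglongrightarrow> C * (2 powr r * (0 + 0))"
    by (intro tendsto_intros lu lv)
  then have "eventually (\<lambda>n. C * (2 powr r * (Lpow r (\<lambda>z. un n z - u z) + Lpow r (\<lambda>z. vn n z - v z))) < \<epsilon> / 2) sequentially"
    by (rule order_tendstoD) (use \<epsilon> in simp)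
  then obtain N where N: "\<And>n. n \<ge> N \<Longrightarrow> C * (2 powr r * (Lpow r (\<lambda>z. un n z - u z) + Lpow r (\<lambda>z. vn n z - v z))) < \<epsilon> / 2"
    by (auto simp: eventually_sequentially)
  show "\<exists>no. \<forall>n\<ge>no. norm ((LINT z|lborel. F (un n z, vn n z)) - (LINT z|lborel. F (u z, v z))) < \<epsilon>"
  proof (intro exI allI impI)
    fix n assume n: "n \<ge> N"
    have i1: "integrable lborel (\<lambda>z. F (un n z, vn n z))" "integrable lborel (\<lambda>z. F (u z, v z))"
      by (rule homogeneous_integrable[OF cont hom r]; use u v un vn in simp)+
    let ?b = "\<lambda>z. \<kappa> * (2 powr r * (\<bar>u z\<bar> powr r + \<bar>v z\<bar> powr r)) + C * (2 powr r * (\<bar>un n z - u z\<bar> powr r + \<bar>vn n z - v z\<bar> powr r))"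
    have i2: "integrable lborel ?b" using u v du dv by (auto simp: memLp_def)
    have pt: "\<bar>F (un n z, vn n z) - F (u z, v z)\<bar> \<le> ?b z" for z
    proof -
      have "(u z, v z) + (un n z - u z, vn n z - v z) = (un n z, vn n z)" by simp
      then have "\<bar>F (un n z, vn n z) - F (u z, v z)\<bar> \<le> \<kappa> * norm (u z, v z) powr r + C * norm (un n z - u z, vn n z - v z) powr r"
        using C(2)[of "(u z, v z)" "(un n z - u z, vn n z - v z)"] by simp
      also have "\<dots> \<le> ?b z" using \<kappa> C(1) norm_pair_powr[OF r] by (intro add_mono mult_left_mono) auto
      finally show ?thesis .
    qed
    have "\<bar>(LINT z|lborel. F (un n z, vn n z)) - (LINT z|lborel. F (u z, v z))\<bar> = \<bar>LINT z|lborel. F (un n z, vn n z) - F (u z, v z)\<bar>"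
      using i1 by simp
    also have "\<dots> \<le> (LINT z|lborel. \<bar>F (un n z, vn n z) - F (u z, v z)\<bar>)" by (rule integral_abs_bound)
    also have "\<dots> \<le> (LINT z|lborel. ?b z)"
      using i1 i2 pt by (intro integral_mono) auto
    also have "\<dots> = \<kappa> * S + C * (2 powr r * (Lpow r (\<lambda>z. un n z - u z) + Lpow r (\<lambda>z. vn n z - v z)))"
      using u v du dv by (simp add: memLp_def S_def Lpow_def)
    also have "\<kappa> * S \<le> \<epsilon> / 2"
    proof -
      have "\<kappa> * S \<le> \<kappa> * (S + 1)" using \<kappa> by simp
      also have "\<dots> = \<epsilon> / 2"
      proof -
        have "e / (2 * X) * X = e / 2" if "X \<noteq> 0" for e X :: real using that by simp
        then show ?thesis using S unfolding \<kappa>_def by (metis add_nonneg_eq_0_iff zero_le_one zero_neq_one)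
      qed
      finally show ?thesis .
    qed
    finally show "norm ((LINT z|lborel. F (un n z, vn n z)) - (LINT z|lborel. F (u z, v z))) < \<epsilon>"
      using N[OF n] by simp
  qed
qed

lemma continuous_abs_powr: "p > 0 \<Longrightarrow> continuous_on UNIV f \<Longrightarrow> continuous_on UNIV (\<lambda>x. \<bar>f x :: real\<bar> powr p)"
  by (rule continuous_on_powr') (auto intro!: continuous_intros)

lemma Lpow_homogeneous:
  assumes "p > 0"
  shows "continuous_on UNIV (\<lambda>x::real\<times>real. \<bar>fst x\<bar> powr p)"
    "t > 0 \<Longrightarrow> (\<lambda>x::real\<times>real. \<bar>fst x\<bar> powr p) (t *\<^sub>R x) = t powr p * (\<lambda>x::real\<times>real. \<bar>fst x\<bar> powr p) x"
  using assms by (auto intro!: continuous_abs_powr continuous_intros simp: abs_mult powr_mult)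

lemma coupling_homogeneous:
  assumes "r1 > 0" "r2 > 0"
  shows "continuous_on UNIV (\<lambda>x::real\<times>real. \<bar>fst x\<bar> powr r1 * \<bar>snd x\<bar> powr r2)"
    "t > 0 \<Longrightarrow> (\<lambda>x::real\<times>real. \<bar>fst x\<bar> powr r1 * \<bar>snd x\<bar> powr r2) (t *\<^sub>R x)
      = t powr (r1 + r2) * (\<lambda>x::real\<times>real. \<bar>fst x\<bar> powr r1 * \<bar>snd x\<bar> powr r2) x"
  using assms by (auto intro!: continuous_abs_powr continuous_intros simp: abs_mult powr_mult powr_add)

lemma coupling_integrable:
  assumes "r1 > 0" "r2 > 0" "memLp (r1 + r2) u" "memLp (r1 + r2) v"
  shows "integrable lborel (\<lambda>z. \<bar>u z\<bar> powr r1 * \<bar>v z\<bar> powr r2)"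
  using homogeneous_integrable[OF coupling_homogeneous[OF assms(1,2)] _ assms(3,4)] assms(1,2) by simp

lemma coupling_le:
  assumes "r1 > 0" "r2 > 0" "memLp (r1 + r2) u" "memLp (r1 + r2) v"
  shows "coupling r1 r2 u v \<le> Lpow (r1 + r2) u + Lpow (r1 + r2) v"
proof -
  have "\<bar>a\<bar> powr r1 * \<bar>b\<bar> powr r2 \<le> \<bar>a\<bar> powr (r1 + r2) + \<bar>b\<bar> powr (r1 + r2)" for a b :: real
  proof (cases "\<bar>a\<bar> \<le> \<bar>b\<bar>")
    case True
    then have "\<bar>a\<bar> powr r1 * \<bar>b\<bar> powr r2 \<le> \<bar>b\<bar> powr r1 * \<bar>b\<bar> powr r2" using assms by (intro mult_right_mono powr_mono2) auto
    then show ?thesis by (simp add: powr_add[of "\<bar>b\<bar>"] add_increasing)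
  next
    case False
    then have "\<bar>a\<bar> powr r1 * \<bar>b\<bar> powr r2 \<le> \<bar>a\<bar> powr r1 * \<bar>a\<bar> powr r2" using assms by (intro mult_left_mono powr_mono2) auto
    then show ?thesis by (simp add: powr_add[of "\<bar>a\<bar>"] add_increasing2)
  qed
  then have "coupling r1 r2 u v \<le> (LINT z|lborel. \<bar>u z\<bar> powr (r1 + r2) + \<bar>v z\<bar> powr (r1 + r2))"
    unfolding coupling_def using assms by (intro integral_mono coupling_integrable) (auto simp: memLp_def)
  also have "\<dots> = Lpow (r1 + r2) u + Lpow (r1 + r2) v" using assms by (simp add: Lpow_def memLp_def)
  finally show ?thesis .
qed

lemma coupling_nonneg: "coupling r1 r2 u v \<ge> 0"
  unfolding coupling_def by (intro integral_nonneg_AE) auto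

text \<open>Strong convergence is only available above the exponent 2; together with a bound on the
  mass it still gives weak convergence in L^2, which is what the cross terms need.\<close>

lemma L2_pairing_null:
  fixes D :: "nat \<Rightarrow> fn2"
  assumes D: "\<And>n. memLp 2 (D n)" "\<And>n. Lpow 2 (D n) \<le> B" and \<eta>: "\<eta> > 2" and D\<eta>: "\<And>n. memLp \<eta> (D n)"
    and lim: "(\<lambda>n. Lpow \<eta> (D n)) \<longlonglongrightarrow> 0" and \<phi>: "memLp 2 \<phi>"
  shows "(\<lambda>n. LINT z|lborel. D n z * \<phi> z) \<longlonglongrightarrow> 0"
proof (rule LIMSEQ_I)
  fix \<epsilon> :: real assume \<epsilon>: "\<epsilon> > 0"
  have B: "B \<ge> 0" using D(2) Lpow_nonneg order_trans by blast
  have \<phi>m[measurable]: "\<phi> \<in> borel_measurable borel" and \<phi>i: "integrable lborel (\<lambda>z. (\<phi> z)^2)" using \<phi> by (auto simp: memLp2_iff)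
  define \<kappa> where "\<kappa> = \<epsilon> / (3 * (Lpow 2 \<phi> + B + 1))"
  have den: "Lpow 2 \<phi> + B + 1 > 0" using B Lpow_nonneg[of 2 \<phi>] by simp
  have \<kappa>: "\<kappa> > 0" using den \<epsilon> by (simp add: \<kappa>_def)
  let ?s = "\<lambda>k::nat. \<lambda>z. (\<phi> z)^2 * indicator {z. \<bar>\<phi> z\<bar> \<le> 1 / real (Suc k)} z"
  have sm: "?s k \<in> borel_measurable borel" for k by measurable
  have si: "integrable lborel (?s k)" for k
    by (rule Bochner_Integration.integrable_bound[OF \<phi>i]) (use sm in \<open>auto simp: indicator_def\<close>)
  have "(\<lambda>k. LINT z|lborel. ?s k z) \<longlonglongrightarrow> (LINT z|(lborel::(real\<times>real) measure). (0::real))"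
  proof (rule integral_dominated_convergence[where w="\<lambda>z. (\<phi> z)^2"])
    show "AE z in lborel. (\<lambda>k. ?s k z) \<longlonglongrightarrow> 0"
    proof (intro AE_I2)
      fix z
      show "(\<lambda>k. ?s k z) \<longlonglongrightarrow> 0"
      proof (cases "\<phi> z = 0")
        case False
        then obtain n where n: "inverse (real (Suc n)) < \<bar>\<phi> z\<bar>" using reals_Archimedean[of "\<bar>\<phi> z\<bar>"] by auto
        have "?s k z = 0" if "k \<ge> n" for k
        proof -
          have "1 / real (Suc k) \<le> 1 / real (Suc n)" using that by (intro divide_left_mono) auto
          then have "1 / real (Suc k) < \<bar>\<phi> z\<bar>" using n by (simp add: inverse_eq_divide)
          then show ?thesis by simp
        qed
        then show ?thesis by (intro tendsto_eventually) (auto simp: eventually_sequentially)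
      qed simp
    qed
  qed (use sm \<phi>i in \<open>auto simp: indicator_def\<close>)
  then have "eventually (\<lambda>k. 1 / \<kappa> * (LINT z|lborel. ?s k z) < \<epsilon> / 3) sequentially"
    by (intro order_tendstoD(2)[of "\<lambda>k. 1 / \<kappa> * (LINT z|lborel. ?s k z)" "1 / \<kappa> * 0"] tendsto_intros) (use \<epsilon> in auto)
  then obtain k where k: "1 / \<kappa> * (LINT z|lborel. ?s k z) < \<epsilon> / 3" by (auto simp: eventually_sequentially)
  define \<delta> where "\<delta> = 1 / real (Suc k)"
  have \<delta>: "\<delta> > 0" by (simp add: \<delta>_def)
  \<comment> \<open>Where \<open>\<bar>d\<bar> > \<kappa> * \<delta>\<close>, the square of
    \<open>d\<close> is at most \<open>(\<kappa> * \<delta>) powr (2 - \<eta>) * \<bar>d\<bar> powr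
    \<eta>\<close>, since \<open>2 - \<eta>\<close> is negative.\<close>
  define C where "C = (1 / \<kappa>) * (\<kappa> * \<delta>) powr (2 - \<eta>)"
  have C: "C \<ge> 0" using \<kappa> by (simp add: C_def)
  \<comment> \<open>Three regimes: \<open>f\<close> small, where the tail of \<open>\<phi>\<close>
    and \<open>\<kappa>\<close> times the mass of \<open>D n\<close> pay; \<open>d\<close> small
    compared with \<open>f\<close>, where \<open>\<kappa>\<close> times the mass of
    \<open>\<phi>\<close> pays; and \<open>d\<close> bounded away from zero, where the stronger norm
    of \<open>D n\<close> pays.\<close>
  have pt: "\<bar>d * f\<bar> \<le> \<kappa> * f^2 + \<kappa> * d^2 + 1 / \<kappa> * (f^2 * (if \<bar>f\<bar> \<le> \<delta> then 1 else 0)) + C * \<bar>d\<bar> powr \<eta>" for d f :: real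
  proof -
    have nn: "0 \<le> \<kappa> * f^2" "0 \<le> \<kappa> * d^2" "0 \<le> 1 / \<kappa> * (f^2 * (if \<bar>f\<bar> \<le> \<delta> then 1 else 0))" "0 \<le> C * \<bar>d\<bar> powr \<eta>"
      using \<kappa> C by auto
    consider "\<bar>f\<bar> \<le> \<delta>" | "\<bar>f\<bar> > \<delta>" "\<bar>d\<bar> \<le> \<kappa> * \<bar>f\<bar>" | "\<bar>f\<bar> > \<delta>" "\<bar>d\<bar> > \<kappa> * \<bar>f\<bar>" by linarith
    then show ?thesis
    proof cases
      case 1
      have "0 \<le> (\<kappa> * \<bar>d\<bar> - \<bar>f\<bar>)^2 / \<kappa>" using \<kappa> by simp
      also have "\<dots> = \<kappa> * d^2 - 2 * \<bar>d * f\<bar> + 1 / \<kappa> * f^2" using \<kappa> by (simp add: power2_eq_square field_simps abs_mult)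
      finally show ?thesis using 1 nn by simp
    next
      case 2
      have "\<bar>d * f\<bar> \<le> (\<kappa> * \<bar>f\<bar>) * \<bar>f\<bar>" unfolding abs_mult using 2 by (intro mult_right_mono) auto
      also have "\<dots> = \<kappa> * f^2" by (simp add: power2_eq_square)
      finally show ?thesis using nn by linarith
    next
      case 3
      have d: "\<bar>d\<bar> > \<kappa> * \<delta>" using 3 \<kappa> by (meson mult_less_cancel_left_pos order_less_trans)
      have d0: "\<bar>d\<bar> > 0" using d \<kappa> \<delta> by (meson mult_pos_pos order_less_trans)
      have "\<bar>f\<bar> \<le> \<bar>d\<bar> / \<kappa>" using 3 \<kappa> by (simp add: field_simps)
      then have "\<bar>d * f\<bar> \<le> \<bar>d\<bar> * (\<bar>d\<bar> / \<kappa>)" unfolding abs_mult by (intro mult_left_mono) auto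
      also have "\<dots> = 1 / \<kappa> * \<bar>d\<bar> powr 2" using d0 by (simp add: powr_numeral power2_eq_square)
      also have "\<bar>d\<bar> powr 2 = \<bar>d\<bar> powr (2 - \<eta>) * \<bar>d\<bar> powr \<eta>" by (simp flip: powr_add)
      also have "\<bar>d\<bar> powr (2 - \<eta>) \<le> (\<kappa> * \<delta>) powr (2 - \<eta>)" using d \<eta> \<kappa> \<delta> by (intro powr_mono2') auto
      finally have "\<bar>d * f\<bar> \<le> C * \<bar>d\<bar> powr \<eta>" using \<kappa> by (simp add: C_def mult_left_mono mult_right_mono divide_right_mono)
      then show ?thesis using nn by linarith
    qed
  qed
  have "eventually (\<lambda>n. C * Lpow \<eta> (D n) < \<epsilon> / 3) sequentially"
    by (intro order_tendstoD(2)[of "\<lambda>n. C * Lpow \<eta> (D n)" "C * 0"] tendsto_intros lim) (use \<epsilon> in auto)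
  then obtain N where N: "\<And>n. n \<ge> N \<Longrightarrow> C * Lpow \<eta> (D n) < \<epsilon> / 3" by (auto simp: eventually_sequentially)
  show "\<exists>no. \<forall>n\<ge>no. norm ((LINT z|lborel. D n z * \<phi> z) - 0) < \<epsilon>"
  proof (intro exI allI impI)
    fix n assume n: "n \<ge> N"
    have i: "integrable lborel (\<lambda>z. D n z * \<phi> z)" using memLp2_mult[OF D(1) \<phi>] .
    have i2: "integrable lborel (\<lambda>z. (D n z)^2)" "integrable lborel (\<lambda>z. \<bar>D n z\<bar> powr \<eta>)"
      using D(1)[of n] D\<eta>[of n] by (auto simp: memLp2_iff memLp_def)
    let ?b = "\<lambda>z. \<kappa> * (\<phi> z)^2 + \<kappa> * (D n z)^2 + 1 / \<kappa> * ?s k z + C * \<bar>D n z\<bar> powr \<eta>"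
    have ib: "integrable lborel ?b"
      by (intro Bochner_Integration.integrable_add integrable_mult_right i2 \<phi>i si)
    have "\<bar>LINT z|lborel. D n z * \<phi> z\<bar> \<le> (LINT z|lborel. \<bar>D n z * \<phi> z\<bar>)" by (rule integral_abs_bound)
    also have "\<dots> \<le> (LINT z|lborel. ?b z)"
    proof (rule integral_mono)
      show "integrable lborel (\<lambda>z. \<bar>D n z * \<phi> z\<bar>)" using i by simp
      show "\<bar>D n z * \<phi> z\<bar> \<le> ?b z" for z using pt[of "D n z" "\<phi> z"] by (cases "\<bar>\<phi> z\<bar> \<le> 1 / real (Suc k)") (auto simp: indicator_def \<delta>_def)
    qed (rule ib)
    also have "\<dots> = \<kappa> * Lpow 2 \<phi> + \<kappa> * Lpow 2 (D n) + 1 / \<kappa> * (LINT z|lborel. ?s k z) + C * Lpow \<eta> (D n)"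
      unfolding Lpow2_eq Lpow_def[of \<eta>] using i2 \<phi>i si by simp
    also have "\<dots> \<le> \<kappa> * (Lpow 2 \<phi> + B + 1) + 1 / \<kappa> * (LINT z|lborel. ?s k z) + C * Lpow \<eta> (D n)"
    proof -
      have "\<kappa> * Lpow 2 (D n) \<le> \<kappa> * (B + 1)" using D(2)[of n] \<kappa> by (intro mult_left_mono) auto
      then show ?thesis by (simp add: algebra_simps)
    qed
    also have "\<kappa> * (Lpow 2 \<phi> + B + 1) = \<epsilon> / 3"
    proof -
      have "e / (3 * X) * X = e / 3" if "X \<noteq> 0" for e X :: real using that by simp
      then show ?thesis using den unfolding \<kappa>_def by (metis less_irrefl)
    qed
    finally have "\<bar>LINT z|lborel. D n z * \<phi> z\<bar> \<le> \<epsilon> / 3 + 1 / \<kappa> * (LINT z|lborel. ?s k z) + C * Lpow \<eta> (D n)" .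
    then show "norm ((LINT z|lborel. D n z * \<phi> z) - 0) < \<epsilon>"
      using N[OF n] k unfolding real_norm_def diff_zero by linarith
  qed
qed

subsection \<open>Fibre projection and minimisers\<close>

text \<open>Along a fibre the energy is
  \<open>y * k / 2 - (\<Sum>i\<in>I. c i * y powr \<theta> i)\<close>, and the equation is its
  stationarity. The right-hand side is continuous and zero at \<open>y = 0\<close>, and its j-th
  term alone reaches \<open>k / 2\<close> at \<open>Y\<close>.\<close>

lemma scalar_projection:
  fixes c \<theta> :: "nat \<Rightarrow> real"
  assumes I: "finite I" and c: "\<And>i. i \<in> I \<Longrightarrow> c i \<ge> 0" and \<theta>: "\<And>i. i \<in> I \<Longrightarrow> \<theta> i > 1"
    and j: "j \<in> I" "c j > 0" and k: "k > 0"
  obtains y where "y > 0" "k / 2 = (\<Sum>i\<in>I. c i * \<theta> i * y powr (\<theta> i - 1))"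
proof -
  define h where "h = (\<lambda>y::real. \<Sum>i\<in>I. c i * \<theta> i * y powr (\<theta> i - 1))"
  define A where "A = k / (2 * c j * \<theta> j)"
  define Y where "Y = A powr (1 / (\<theta> j - 1))"
  have tj: "\<theta> j > 1" using \<theta> j by auto
  have A: "A > 0" using k j tj by (simp add: A_def)
  have Y: "Y > 0" using A by (simp add: Y_def)
  have "Y powr (\<theta> j - 1) = A" unfolding Y_def powr_powr using tj A by simp
  then have "k / 2 = c j * \<theta> j * Y powr (\<theta> j - 1)" using j tj by (simp add: A_def)
  also have "c j * \<theta> j * Y powr (\<theta> j - 1) \<le> h Y" unfolding h_def
    by (rule member_le_sum[OF j(1) _ I]) (use c \<theta> in \<open>force intro!: mult_nonneg_nonneg\<close>)
  finally have hY: "k / 2 \<le> h Y" .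
  have h0: "h 0 = 0" unfolding h_def by simp
  have "continuous_on {0..Y} h" unfolding h_def
    by (intro continuous_intros continuous_on_powr') (use \<theta> in auto)
  then obtain y where y: "0 \<le> y" "y \<le> Y" "h y = k / 2"
    using IVT'[of h 0 "k / 2" Y] h0 hY k Y by auto
  have "y \<noteq> 0" using y h0 k by auto
  then show thesis using that[of y] y by (simp add: h_def)
qed

lemma powr_lt_one: "0 < x \<Longrightarrow> x < 1 \<Longrightarrow> 0 < a \<Longrightarrow> x powr a < 1" for x a :: real
  using powr_less_mono2[of a x 1] by simp

text \<open>Here \<open>k\<close> is the kinetic term of the weak limit, and the last two
  assumptions are lower semicontinuity and minimality. If \<open>y > 1\<close>, the stationarity
  equation exceeds the semicontinuity bound; if \<open>y < 1\<close>, the energy at \<open>y\<close>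
  falls below the left-hand side of the last assumption.\<close>

lemma scalar_rigidity:
  fixes c \<theta> :: "nat \<Rightarrow> real"
  assumes I: "finite I" and c: "\<And>i. i \<in> I \<Longrightarrow> c i \<ge> 0" and \<theta>: "\<And>i. i \<in> I \<Longrightarrow> \<theta> i > 1"
    and j: "j \<in> I" "c j > 0" and y: "y > 0" "k / 2 = (\<Sum>i\<in>I. c i * \<theta> i * y powr (\<theta> i - 1))"
    and k: "k / 2 \<le> (\<Sum>i\<in>I. c i * \<theta> i)"
    and C: "(\<Sum>i\<in>I. c i * (\<theta> i - 1)) \<le> y * k / 2 - (\<Sum>i\<in>I. c i * y powr \<theta> i)"
  shows "k / 2 = (\<Sum>i\<in>I. c i * \<theta> i)"
proof -
  have tj: "\<theta> j > 1" using \<theta> j by auto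
  have "y * k / 2 = (\<Sum>i\<in>I. c i * \<theta> i * y powr \<theta> i)"
  proof -
    have "y * (k / 2) = (\<Sum>i\<in>I. c i * \<theta> i * (y * y powr (\<theta> i - 1)))" unfolding y(2) sum_distrib_left
      by (intro sum.cong) auto
    also have "\<dots> = (\<Sum>i\<in>I. c i * \<theta> i * y powr \<theta> i)"
      using y(1) by (intro sum.cong) (auto simp: powr_diff)
    finally show ?thesis by simp
  qed
  then have C': "(\<Sum>i\<in>I. c i * (\<theta> i - 1)) \<le> (\<Sum>i\<in>I. c i * (\<theta> i - 1) * y powr \<theta> i)"
    using C by (simp add: sum_subtractf[symmetric] algebra_simps)
  have "\<not> y > 1"
  proof
    assume y1: "y > 1"
    have "(\<Sum>i\<in>I. c i * \<theta> i) < (\<Sum>i\<in>I. c i * \<theta> i * y powr (\<theta> i - 1))"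
    proof (rule sum_strict_mono_ex1[OF I])
      show "\<forall>x\<in>I. c x * \<theta> x \<le> c x * \<theta> x * y powr (\<theta> x - 1)"
      proof
        fix x assume x: "x \<in> I"
        have "1 \<le> y powr (\<theta> x - 1)" using y1 \<theta>[OF x] by (intro ge_one_powr_ge_zero) auto
        then show "c x * \<theta> x \<le> c x * \<theta> x * y powr (\<theta> x - 1)" using mult_left_mono[of 1 "y powr (\<theta> x - 1)" "c x * \<theta> x"] c[OF x] \<theta>[OF x] by simp
      qed
      have "1 < y powr (\<theta> j - 1)" using y1 tj by simp
      then have "c j * \<theta> j < c j * \<theta> j * y powr (\<theta> j - 1)" using j tj by simp
      then show "\<exists>a\<in>I. c a * \<theta> a < c a * \<theta> a * y powr (\<theta> a - 1)" by (rule bexI[OF _ j(1)])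
    qed
    then show False using y(2) k by simp
  qed
  moreover have "\<not> y < 1"
  proof
    assume y1: "y < 1"
    have "(\<Sum>i\<in>I. c i * (\<theta> i - 1) * y powr \<theta> i) < (\<Sum>i\<in>I. c i * (\<theta> i - 1))"
    proof (rule sum_strict_mono_ex1[OF I])
      have le: "y powr \<theta> x < 1" if "x \<in> I" for x using y1 y(1) \<theta>[OF that] by (simp add: powr_lt_one)
      show "\<forall>x\<in>I. c x * (\<theta> x - 1) * y powr \<theta> x \<le> c x * (\<theta> x - 1)"
      proof
        fix x assume x: "x \<in> I"
        show "c x * (\<theta> x - 1) * y powr \<theta> x \<le> c x * (\<theta> x - 1)"
          using mult_left_mono[of "y powr \<theta> x" 1 "c x * (\<theta> x - 1)"] le[OF x] c[OF x] \<theta>[OF x] by simp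
      qed
      have "c j * (\<theta> j - 1) * y powr \<theta> j < c j * (\<theta> j - 1) * 1" using le[OF j(1)] j tj by (intro mult_strict_left_mono) auto
      then have "c j * (\<theta> j - 1) * y powr \<theta> j < c j * (\<theta> j - 1)" by (simp only: mult_1_right)
      then show "\<exists>a\<in>I. c a * (\<theta> a - 1) * y powr \<theta> a < c a * (\<theta> a - 1)" by (rule bexI[OF _ j(1)])
    qed
    then show False using C' by simp
  qed
  ultimately have "y = 1" by simp
  then show ?thesis using y(2) by simp
qed

lemma powr_Bernoulli:
  fixes y \<theta> :: real
  assumes "\<theta> > 1" "y > 0" "y \<noteq> 1"
  shows "1 + \<theta> * (y - 1) < y powr \<theta>"
proof -
  have d: "((\<lambda>y. y powr \<theta>) has_real_derivative \<theta> * x powr (\<theta> - 1)) (at x)" if "x > 0" for x :: real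
    using that by (auto intro!: derivative_eq_intros)
  consider "y < 1" | "y > 1" using assms(3) by linarith
  then show ?thesis
  proof cases
    case 1
    obtain z where z: "y < z" "z < 1" "1 powr \<theta> - y powr \<theta> = (1 - y) * (\<theta> * z powr (\<theta> - 1))"
      using MVT2[OF 1, of "\<lambda>y. y powr \<theta>" "\<lambda>x. \<theta> * x powr (\<theta> - 1)"] d assms(2) by force
    have "z powr (\<theta> - 1) < 1" using z assms by (simp add: powr_lt_one)
    then have "(1 - y) * (\<theta> * z powr (\<theta> - 1)) < (1 - y) * (\<theta> * 1)" using 1 assms by (intro mult_strict_left_mono) auto
    then show ?thesis using z(3) by (simp add: algebra_simps)
  next
    case 2
    obtain z where z: "1 < z" "z < y" "y powr \<theta> - 1 powr \<theta> = (y - 1) * (\<theta> * z powr (\<theta> - 1))"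
      using MVT2[OF 2, of "\<lambda>y. y powr \<theta>" "\<lambda>x. \<theta> * x powr (\<theta> - 1)"] d by force
    have "z powr (\<theta> - 1) > 1" using z assms by simp
    then have "(y - 1) * (\<theta> * 1) < (y - 1) * (\<theta> * z powr (\<theta> - 1))" using 2 assms by (intro mult_strict_left_mono) auto
    then show ?thesis using z(3) by (simp add: algebra_simps)
  qed
qed

lemma powr_Bernoulli_le: "\<theta> > 1 \<Longrightarrow> y > 0 \<Longrightarrow> 1 + \<theta> * (y - 1) \<le> y powr \<theta>" for y \<theta> :: real
  using powr_Bernoulli[of \<theta> y] by (cases "y = 1") auto

text \<open>The defect of the tangent line at 1 is convex and vanishes at 1, so beyond distance
  \<open>\<delta>\<close> it grows at least linearly, with the smaller of its chord slopes at
  \<open>1 + \<delta>\<close> and \<open>1 - \<delta>\<close>.\<close>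

lemma powr_Bernoulli_gap:
  fixes \<theta> \<delta> :: real
  assumes t: "\<theta> > 1" and \<delta>: "0 < \<delta>" "\<delta> < 1"
  obtains m where "m > 0" "\<And>y. y > 0 \<Longrightarrow> \<delta> \<le> \<bar>y - 1\<bar> \<Longrightarrow> m * \<bar>y - 1\<bar> \<le> y powr \<theta> - 1 - \<theta> * (y - 1)"
proof -
  define D where "D = (\<lambda>y::real. y powr \<theta> - 1 - \<theta> * (y - 1))"
  define m where "m = min (D (1 + \<delta>)) (D (1 - \<delta>)) / \<delta>"
  have "D (1 + \<delta>) > 0" "D (1 - \<delta>) > 0" using powr_Bernoulli[OF t, of "1 + \<delta>"] powr_Bernoulli[OF t, of "1 - \<delta>"] \<delta> by (auto simp: D_def)
  then have m: "m > 0" using \<delta> by (simp add: m_def)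
  have "m * \<bar>y - 1\<bar> \<le> D y" if y: "y > 0" "\<delta> \<le> \<bar>y - 1\<bar>" for y
  proof -
    define r where "r = \<delta> / \<bar>y - 1\<bar>"
    have y1: "\<bar>y - 1\<bar> > 0" using y \<delta> by linarith
    have r: "0 < r" "r \<le> 1" using y y1 \<delta> by (auto simp: r_def)
    have "((1 - r) *\<^sub>R 1 + r *\<^sub>R y) powr \<theta> \<le> (1 - r) * 1 powr \<theta> + r * y powr \<theta>"
      using convex_onD[OF powr_convex[of \<theta>], of r 1 y] t y r by simp
    then have "D (1 + r * (y - 1)) \<le> r * D y" by (simp add: D_def algebra_simps)
    moreover have "1 + r * (y - 1) = 1 + \<delta> \<or> 1 + r * (y - 1) = 1 - \<delta>" using y1 by (auto simp: r_def abs_if field_simps split: if_splits)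
    ultimately have "min (D (1 + \<delta>)) (D (1 - \<delta>)) \<le> r * D y" by auto
    then have "m \<le> r * D y / \<delta>" using \<delta> by (simp add: m_def divide_right_mono)
    also have "r * D y / \<delta> = D y / \<bar>y - 1\<bar>" using \<delta> by (simp add: r_def)
    finally show ?thesis using y1 by (simp add: field_simps)
  qed
  then show thesis using that m by (simp add: D_def)
qed

text \<open>At the top of its fibre the energy is stationary, so a perturbation of size \<open>\<epsilon>\<close> that lowers the energy to first
  order also lowers the maximum over the whole fibre.\<close>
lemma scalar_variation:
  fixes c \<theta> :: "nat \<Rightarrow> real"
  assumes I: "finite I" and c: "\<And>i. i \<in> I \<Longrightarrow> c i \<ge> 0" and \<theta>: "\<And>i. i \<in> I \<Longrightarrow> \<theta> i > 1"
    and j: "j \<in> I" "c j > 0" and k: "k / 2 = (\<Sum>i\<in>I. c i * \<theta> i)" and d: "d \<ge> 0" "\<kappa> < d"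
  obtains \<epsilon>0 where "\<epsilon>0 > 0" "\<And>\<epsilon> y. 0 < \<epsilon> \<Longrightarrow> \<epsilon> < \<epsilon>0 \<Longrightarrow> y > 0 \<Longrightarrow>
     y * (k / 2 + \<epsilon> * \<kappa> + \<epsilon>^2 * \<kappa>2) - (\<Sum>i\<in>I. c i * y powr \<theta> i) - \<epsilon> * d * y powr \<theta> j < (\<Sum>i\<in>I. c i * (\<theta> i - 1))"
proof -
  have tj: "\<theta> j > 1" using \<theta> j by auto
  define \<gamma> where "\<gamma> = (d - \<kappa>) / 2"
  have \<gamma>: "\<gamma> > 0" using d by (simp add: \<gamma>_def)
  define L where "L = \<bar>\<kappa>\<bar> + \<gamma> + d * \<theta> j + 1"
  have L: "L > 0" using \<gamma> d tj by (simp add: L_def add_nonneg_pos)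
  \<comment> \<open>Within this distance of the top, half of the first-order gain,
    \<open>\<gamma>\<close>, outweighs the error \<open>L * \<bar>y - 1\<bar>\<close>; farther away
    the strict concavity of the fibre energy has to pay.\<close>
  define \<delta> where "\<delta> = min (\<gamma> / L) (1/2) / 2"
  have \<delta>: "0 < \<delta>" "\<delta> < 1" "\<delta> < \<gamma> / L" using \<gamma> L by (auto simp: \<delta>_def min_def divide_simps)
  obtain m where m: "m > 0" "\<And>y. y > 0 \<Longrightarrow> \<delta> \<le> \<bar>y - 1\<bar> \<Longrightarrow> m * \<bar>y - 1\<bar> \<le> y powr \<theta> j - 1 - \<theta> j * (y - 1)"
    using powr_Bernoulli_gap[OF tj \<delta>(1,2)] by blast
  \<comment> \<open>The first bound absorbs the quadratic term \<open>\<kappa>2\<close>; the second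
    lets the convexity gap \<open>c j * m\<close> dominate \<open>\<epsilon> * L\<close> away from
    the top.\<close>
  define \<epsilon>0 where "\<epsilon>0 = min (\<gamma> / (\<bar>\<kappa>2\<bar> + 1)) (c j * m / L)"
  show thesis
  proof (rule that)
    show "\<epsilon>0 > 0" using \<gamma> m j L by (simp add: \<epsilon>0_def add_nonneg_pos)
    fix \<epsilon> y :: real assume \<epsilon>: "0 < \<epsilon>" "\<epsilon> < \<epsilon>0" and y: "y > 0"
    define D where "D = y powr \<theta> j - 1 - \<theta> j * (y - 1)"
    have D0: "D \<ge> 0" using powr_Bernoulli_le[OF tj y] by (simp add: D_def)
    have e2: "\<epsilon> * \<bar>\<kappa>2\<bar> \<le> \<gamma>"
    proof -
      have "\<epsilon> * (\<bar>\<kappa>2\<bar> + 1) \<le> \<gamma>" using \<epsilon> by (simp add: \<epsilon>0_def field_simps add_nonneg_pos pos_less_divide_eq)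
      then show ?thesis using \<epsilon> by (simp add: algebra_simps)
    qed
    have gap: "y * (k / 2) - (\<Sum>i\<in>I. c i * y powr \<theta> i) \<le> (\<Sum>i\<in>I. c i * (\<theta> i - 1)) - c j * D"
    proof -
      have "(\<Sum>i\<in>I. c i * (\<theta> i - 1)) - (y * (k / 2) - (\<Sum>i\<in>I. c i * y powr \<theta> i)) = (\<Sum>i\<in>I. c i * (y powr \<theta> i - 1 - \<theta> i * (y - 1)))"
        unfolding k by (simp add: sum_distrib_left sum_subtractf[symmetric] sum.distrib[symmetric] algebra_simps)
      also have "\<dots> \<ge> c j * D" unfolding D_def
      proof (rule member_le_sum[OF j(1) _ I, where f="\<lambda>i. c i * (y powr \<theta> i - 1 - \<theta> i * (y - 1))"])
        fix x assume "x \<in> I - {j}"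
        then have x: "x \<in> I" by simp
        have "0 \<le> y powr \<theta> x - 1 - \<theta> x * (y - 1)" using powr_Bernoulli_le[OF \<theta>[OF x] y] by simp
        then show "0 \<le> c x * (y powr \<theta> x - 1 - \<theta> x * (y - 1))" using c[OF x] by (rule mult_nonneg_nonneg[rotated])
      qed
      finally show ?thesis by simp
    qed
    define h where "h = y - 1"
    have br: "y * (\<kappa> + \<epsilon> * \<kappa>2) - d * (1 + \<theta> j * h) \<le> - \<gamma> + L * \<bar>h\<bar>"
    proof -
      have 1: "y * (\<kappa> + \<epsilon> * \<kappa>2) - d * (1 + \<theta> j * h) = - 2 * \<gamma> + \<epsilon> * \<kappa>2 + h * (\<kappa> + \<epsilon> * \<kappa>2 - d * \<theta> j)"
        by (simp add: h_def \<gamma>_def field_simps)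
      have 2: "\<bar>\<epsilon> * \<kappa>2\<bar> \<le> \<gamma>" using e2 \<epsilon> by (simp add: abs_mult)
      have "d * \<theta> j \<ge> 0" using d tj by simp
      then have "\<bar>\<kappa> + \<epsilon> * \<kappa>2 - d * \<theta> j\<bar> \<le> L" using 2 unfolding L_def by linarith
      then have "\<bar>h\<bar> * \<bar>\<kappa> + \<epsilon> * \<kappa>2 - d * \<theta> j\<bar> \<le> \<bar>h\<bar> * L" by (rule mult_left_mono) simp
      then have "h * (\<kappa> + \<epsilon> * \<kappa>2 - d * \<theta> j) \<le> L * \<bar>h\<bar>"
        using abs_ge_self[of "h * (\<kappa> + \<epsilon> * \<kappa>2 - d * \<theta> j)"] by (simp add: abs_mult mult.commute)
      then show ?thesis unfolding 1 using 2 by linarith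
    qed
    have key: "\<epsilon> * (y * (\<kappa> + \<epsilon> * \<kappa>2) - d * (1 + \<theta> j * h)) < c j * D"
    proof (cases "\<delta> \<le> \<bar>h\<bar>")
      case True
      have "\<epsilon> * (y * (\<kappa> + \<epsilon> * \<kappa>2) - d * (1 + \<theta> j * h)) \<le> \<epsilon> * (- \<gamma> + L * \<bar>h\<bar>)" using br \<epsilon> by (intro mult_left_mono) auto
      also have "\<dots> < \<epsilon> * (L * \<bar>h\<bar>)" using \<epsilon> \<gamma> by simp
      also have "\<dots> \<le> c j * m / L * (L * \<bar>h\<bar>)" using \<epsilon> L by (intro mult_right_mono) (auto simp: \<epsilon>0_def)
      also have "\<dots> = c j * (m * \<bar>h\<bar>)" using L by simp
      also have "\<dots> \<le> c j * D" using m(2)[OF y] True j by (simp add: h_def D_def)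
      finally show ?thesis .
    next
      case False
      then have "L * \<bar>h\<bar> < L * (\<gamma> / L)" using \<delta> L by (intro mult_strict_left_mono) auto
      then have "L * \<bar>h\<bar> < \<gamma>" using L by simp
      then have "y * (\<kappa> + \<epsilon> * \<kappa>2) - d * (1 + \<theta> j * h) < 0" using br by linarith
      then have "\<epsilon> * (y * (\<kappa> + \<epsilon> * \<kappa>2) - d * (1 + \<theta> j * h)) < 0" using \<epsilon> by (simp add: mult_pos_neg)
      moreover have "c j * D \<ge> 0" using j D0 by simp
      ultimately show ?thesis by linarith
    qed
    have "d * y powr \<theta> j \<ge> d * (1 + \<theta> j * h)" using powr_Bernoulli_le[OF tj y] d by (intro mult_left_mono) (auto simp: h_def)
    then have "\<epsilon> * (d * (1 + \<theta> j * h)) \<le> \<epsilon> * (d * y powr \<theta> j)" by (rule mult_left_mono) (use \<epsilon> in simp)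
    then have "\<epsilon> * (y * (\<kappa> + \<epsilon> * \<kappa>2)) - \<epsilon> * d * y powr \<theta> j < c j * D" using key by (simp add: algebra_simps)
    then show "y * (k / 2 + \<epsilon> * \<kappa> + \<epsilon>^2 * \<kappa>2) - (\<Sum>i\<in>I. c i * y powr \<theta> i) - \<epsilon> * d * y powr \<theta> j < (\<Sum>i\<in>I. c i * (\<theta> i - 1))"
      using gap by (simp add: power2_eq_square algebra_simps)
  qed
qed

text \<open>The exponent with which \<open>Lpow p\<close> scales along the mass-preserving dilation
  that multiplies \<open>Kf\<close> by \<open>y\<close>; equivalently the power of \<open>Kf\<close>
  in the Gagliardo--Nirenberg inequality. It exceeds 1 exactly in the mass-supercritical range
  \<open>p > 2 * (1 + 3 * s) / (1 + s)\<close>.\<close>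

definition th :: "real \<Rightarrow> real \<Rightarrow> real" where
  "th s p = (p - 2) * (1 + s) / (4 * s)"

text \<open>The exponents preserve the mass and multiply \<open>K\<close> by \<open>y\<close>.\<close>
definition msc :: "real \<Rightarrow> real \<Rightarrow> fn2 \<Rightarrow> fn2" where
  "msc s y w = dil s (y powr ((1 + 1/s) / 4)) (y powr (1/2)) w"

lemma msc_H: "y > 0 \<Longrightarrow> s > 0 \<Longrightarrow> inH s w \<Longrightarrow> inH s (msc s y w)"
  unfolding msc_def by (intro dil_H) auto

lemma Kf_msc:
  assumes "y > 0" "s > 0" "inH s w"
  shows "Kf s (msc s y w) = y * Kf s w"
proof -
  have "(y powr ((1 + 1/s) / 4))^2 = y powr ((1 + 1/s) / 4 * 2)" using assms powr_sq[of "y powr ((1 + 1/s) / 4)"] by (simp only: powr_powr) simp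
  then have "(y powr ((1 + 1/s) / 4))^2 * (y powr (1/2)) powr (1 - 1/s) = y powr ((1 + 1/s) / 4 * 2 + 1/2 * (1 - 1/s))"
    by (simp only: powr_powr powr_add)
  also have "(1 + 1/s) / 4 * 2 + 1/2 * (1 - 1/s) = 1" by (simp add: field_simps)
  finally show ?thesis unfolding msc_def using assms by (subst Kf_dil) auto
qed

lemma msc_factor:
  assumes "y > 0" "s > 0"
  shows "\<bar>y powr ((1 + 1/s) / 4)\<bar> powr p / (y powr (1/2)) powr (1 + 1/s) = y powr th s p"
proof -
  have "\<bar>y powr ((1 + 1/s) / 4)\<bar> powr p / (y powr (1/2)) powr (1 + 1/s) = y powr ((1 + 1/s) / 4 * p - 1/2 * (1 + 1/s))"
    by (simp add: powr_powr powr_diff)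
  also have "(1 + 1/s) / 4 * p - 1/2 * (1 + 1/s) = th s p" using assms by (simp add: th_def field_simps)
  finally show ?thesis .
qed

lemma Lpow_msc:
  assumes "y > 0" "s > 0" "w \<in> borel_measurable borel"
  shows "Lpow p (msc s y w) = y powr th s p * Lpow p w"
proof -
  have l: "y powr (1/2) > 0" using assms by simp
  show ?thesis unfolding msc_def Lpow_dil[OF assms(3) l] msc_factor[OF assms(1,2)] ..
qed

lemma Lpow2_msc:
  assumes "y > 0" "s > 0" "w \<in> borel_measurable borel"
  shows "Lpow 2 (msc s y w) = Lpow 2 w"
  using Lpow_msc[OF assms, of 2] assms by (simp add: th_def)

lemma coupling_msc:
  assumes "y > 0" "s > 0" "u \<in> borel_measurable borel" "v \<in> borel_measurable borel"
  shows "coupling r1 r2 (msc s y u) (msc s y v) = y powr th s (r1 + r2) * coupling r1 r2 u v"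
proof -
  have l: "y powr (1/2) > 0" using assms by simp
  show ?thesis unfolding msc_def coupling_dil[OF assms(3,4) l] msc_factor[OF assms(1,2)] ..
qed

lemma Lpow_zero_iff: "memLp p u \<Longrightarrow> Lpow p u = 0 \<longleftrightarrow> (AE z in lborel. u z = 0)"
  unfolding Lpow_def memLp_def by (subst integral_nonneg_eq_0_iff_AE) auto

section \<open>The Pohozaev set, its infimum and minimising sequences\<close>

locale params =
  fixes s \<mu>1 \<mu>2 \<beta> p q r1 r2 :: real
  assumes s: "1/2 < s" "s < 1" and \<mu>: "\<mu>1 > 0" "\<mu>2 > 0" "\<beta> > 0" and r: "r1 > 1" "r2 > 1"
    and p: "2 * (1 + 3 * s) / (1 + s) < p" "p < 2 * (1 + s) / (1 - s)"
    and q: "2 * (1 + 3 * s) / (1 + s) < q" "q < 2 * (1 + s) / (1 - s)"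
    and rr: "2 * (1 + 3 * s) / (1 + s) < r1 + r2" "r1 + r2 < 2 * (1 + s) / (1 - s)"
begin

abbreviation J :: "fn2 \<Rightarrow> fn2 \<Rightarrow> real" where "J \<equiv> Jf s \<mu>1 \<mu>2 \<beta> p q r1 r2"
abbreviation P :: "fn2 \<Rightarrow> fn2 \<Rightarrow> real" where "P \<equiv> Pf s \<mu>1 \<mu>2 \<beta> p q r1 r2"
abbreviation PS :: "real \<Rightarrow> real \<Rightarrow> (fn2 \<times> fn2) set" where "PS \<equiv> PohoSet s \<mu>1 \<mu>2 \<beta> p q r1 r2"
abbreviation C :: "real \<Rightarrow> real \<Rightarrow> real" where "C \<equiv> Cab s \<mu>1 \<mu>2 \<beta> p q r1 r2"

text \<open>Numbering the three nonlinear terms puts \<open>J\<close> and \<open>P\<close> in the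
  form of the scalar lemmas: \<open>ex\<close> is the fibre exponent of a term, and \<open>P\<close>
  is, up to the factor \<open>2 * s\<close>, the derivative of the fibre energy at
  \<open>y = 1\<close>.\<close>

definition cf :: "fn2 \<Rightarrow> fn2 \<Rightarrow> nat \<Rightarrow> real" where
  "cf u v i = (if i = 0 then \<mu>1 / p * Lpow p u else if i = 1 then \<mu>2 / q * Lpow q v else \<beta> * coupling r1 r2 u v)"

definition ex :: "nat \<Rightarrow> real" where
  "ex i = (if i = 0 then th s p else if i = 1 then th s q else th s (r1 + r2))"

lemma sum3: "(\<Sum>i<3. f i) = f 0 + f 1 + f (2::nat)" for f :: "nat \<Rightarrow> real"
  by (simp add: eval_nat_numeral)

lemma s0: "0 < s" using s by simp

lemma gt2: "2 < 2 * (1 + 3 * s) / (1 + s)" using s by (simp add: field_simps)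

lemma pqr2: "2 < p" "2 < q" "2 < r1 + r2" using gt2 p q rr by linarith+

lemma th_gt1: "2 * (1 + 3 * s) / (1 + s) < x \<Longrightarrow> 1 < th s x"
  using s by (simp add: th_def field_simps)

lemma ex_gt1: "ex i > 1"
  using th_gt1 p q rr by (simp add: ex_def)

lemma cf_nonneg: "cf u v i \<ge> 0"
  using \<mu> pqr2 by (auto simp: cf_def Lpow_nonneg coupling_nonneg)

lemma J_eq: "J u v = (Kf s u + Kf s v) / 2 - (\<Sum>i<3. cf u v i)"
  by (simp add: Jf_def sum3 cf_def)

lemma P_eq: "P u v = 2 * s * ((Kf s u + Kf s v) / 2 - (\<Sum>i<3. cf u v i * ex i))"
  using s pqr2 by (simp add: Pf_def sum3 cf_def ex_def th_def field_simps)

lemma P_zero_iff: "P u v = 0 \<longleftrightarrow> (Kf s u + Kf s v) / 2 = (\<Sum>i<3. cf u v i * ex i)"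
  using s unfolding P_eq by simp

lemma J_of_P_zero: "P u v = 0 \<Longrightarrow> J u v = (\<Sum>i<3. cf u v i * (ex i - 1))"
  unfolding P_zero_iff J_eq by (simp add: sum_subtractf right_diff_distrib)

lemma J_nonneg: "P u v = 0 \<Longrightarrow> J u v \<ge> 0"
  unfolding J_of_P_zero using cf_nonneg ex_gt1 by (intro sum_nonneg mult_nonneg_nonneg) (auto simp: less_imp_le)

lemma cf_msc:
  assumes "y > 0" "inH s u" "inH s v"
  shows "cf (msc s y u) (msc s y v) i = cf u v i * y powr ex i"
  using assms s0 inH_measurable(1) Lpow_msc coupling_msc by (auto simp: cf_def ex_def)

lemma C_le: "(u, v) \<in> PS a b \<Longrightarrow> C a b \<le> J u v"
  unfolding Cab_def
proof (rule cInf_lower)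
  show "bdd_below ((\<lambda>(u, v). J u v) ` PS a b)"
    by (rule bdd_belowI[of _ 0]) (auto simp: PohoSet_def J_nonneg)
qed force

lemma nontrivial:
  assumes "inH s u" "inH s v" "\<not> (Lpow 2 u = 0 \<and> Lpow 2 v = 0)"
  shows "Kf s u + Kf s v > 0" "\<exists>j<3. cf u v j > 0"
proof -
  have K: "Kf s u \<ge> 0" "Kf s v \<ge> 0" using Kf_nonneg s by auto
  have zero: "Kf s w > 0 \<and> Lpow x w > 0" if w: "inH s w" "Lpow 2 w \<noteq> 0" and x: "2 < x" "x < 2 * (1 + s) / (1 - s)" for w x
  proof
    have ae: "\<not> (AE z in lborel. w z = 0)" using w Lpow2_zero_iff inH_memLp by blast
    have "Kf s w \<ge> 0" using Kf_nonneg s by auto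
    moreover have "Kf s w \<noteq> 0" using Kf_zero_imp[OF s0 s(2) w(1)] ae by blast
    ultimately show "Kf s w > 0" by simp
    have "Lpow x w \<noteq> 0" using Lpow_zero_iff[OF inH_memLp_p[OF s0 s(2) x w(1)]] ae by blast
    then show "Lpow x w > 0" using Lpow_nonneg[of x w] by simp
  qed
  consider "Lpow 2 u \<noteq> 0" | "Lpow 2 v \<noteq> 0" using assms by auto
  then have "Kf s u + Kf s v > 0 \<and> (\<exists>j<3. cf u v j > 0)"
  proof cases
    case 1
    then show ?thesis using zero[OF assms(1) 1 pqr2(1) p(2)] K \<mu> pqr2 by (auto intro!: exI[of _ 0] simp: cf_def)
  next
    case 2
    then show ?thesis using zero[OF assms(2) 2 pqr2(2) q(2)] K \<mu> pqr2 by (auto intro!: exI[of _ 1] simp: cf_def)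
  qed
  then show "Kf s u + Kf s v > 0" "\<exists>j<3. cf u v j > 0" by auto
qed

text \<open>The last clause is the form in which minimality is used: every admissible nontrivial
  pair bounds the infimum by the top of its own fibre, expressed through its own
  coefficients.\<close>

lemma projection:
  assumes "inH s u" "inH s v" "\<not> (Lpow 2 u = 0 \<and> Lpow 2 v = 0)" "Lpow 2 u \<le> a" "Lpow 2 v \<le> b"
  obtains y where "y > 0" "(Kf s u + Kf s v) / 2 = (\<Sum>i<3. cf u v i * ex i * y powr (ex i - 1))"
    "(msc s y u, msc s y v) \<in> PS a b"
    "C a b \<le> y * (Kf s u + Kf s v) / 2 - (\<Sum>i<3. cf u v i * y powr ex i)"
proof -
  obtain j where j: "j < 3" "cf u v j > 0" using nontrivial(2)[OF assms(1-3)] by blast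
  obtain y where y: "y > 0" "(Kf s u + Kf s v) / 2 = (\<Sum>i<3. cf u v i * ex i * y powr (ex i - 1))"
    using scalar_projection[of "{..<3}" "cf u v" ex j "Kf s u + Kf s v"] cf_nonneg ex_gt1 j nontrivial(1)[OF assms(1-3)] by auto
  let ?u = "msc s y u" and ?v = "msc s y v"
  have m: "u \<in> borel_measurable borel" "v \<in> borel_measurable borel" using assms inH_measurable by auto
  have K: "Kf s ?u + Kf s ?v = y * (Kf s u + Kf s v)" using Kf_msc[OF y(1) s0] assms by (simp add: algebra_simps)
  have "y * ((Kf s u + Kf s v) / 2) = (\<Sum>i<3. cf u v i * ex i * (y * y powr (ex i - 1)))"
    unfolding y(2) sum_distrib_left by (intro sum.cong) auto
  also have "\<dots> = (\<Sum>i<3. cf ?u ?v i * ex i)"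
    by (intro sum.cong) (use y(1) assms in \<open>auto simp: cf_msc powr_diff\<close>)
  finally have "P ?u ?v = 0" unfolding P_zero_iff K by simp
  then have PS: "(?u, ?v) \<in> PS a b" using assms m y(1) s0 msc_H Lpow2_msc by (simp add: PohoSet_def inD_def)
  have "J ?u ?v = y * (Kf s u + Kf s v) / 2 - (\<Sum>i<3. cf u v i * y powr ex i)"
    unfolding J_eq K using y(1) assms by (simp add: cf_msc)
  then show thesis using that[OF y PS] C_le[OF PS] by simp
qed

text \<open>\<open>Cab\<close> is a real \<open>Inf\<close>, which says nothing about an empty set.
  A nonzero function is rescaled in amplitude to mass \<open>a\<close>, paired with zero and
  projected.\<close>

lemma PS_nonempty:
  assumes w: "inH s w" "Lpow 2 w \<noteq> 0" and a: "a > 0" "b > 0"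
  shows "PS a b \<noteq> {}"
proof -
  define c where "c = sqrt (a / Lpow 2 w)"
  have M: "Lpow 2 w > 0" using w Lpow_nonneg[of 2 w] by simp
  have c: "c > 0" "c^2 = a / Lpow 2 w" using M a by (auto simp: c_def)
  let ?w = "dil s c 1 w"
  have H: "inH s ?w" using dil_H[OF _ s0 w(1)] by simp
  have "Lpow 2 ?w = c^2 * Lpow 2 w" using Lpow_dil[OF inH_measurable(1)[OF w(1)], of 1 2 s c] c by (simp add: powr_numeral)
  then have "Lpow 2 ?w = a" using M by (simp add: c(2))
  moreover have "Lpow 2 (\<lambda>_. 0) = 0" by (simp add: Lpow2_eq)
  ultimately show ?thesis using projection[OF H inH_zero, of a b] a by auto
qed

text \<open>By Gagliardo--Nirenberg all nonlinear terms are of order above 1 in \<open>Kf\<close>,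
  so on the constraint the kinetic term cannot be small, and there \<open>J\<close> is at least a
  fixed fraction of it. Positivity later excludes a vanishing limit.\<close>

lemma C_pos:
  assumes ne: "PS a b \<noteq> {}" and a: "a > 0" "b > 0"
  shows "C a b > 0"
proof -
  define c where "c = max a b"
  have c: "c > 0" using a by (simp add: c_def)
  have GN: "\<exists>D>0. \<forall>w. inH s w \<longrightarrow> Lpow 2 w \<le> c \<longrightarrow> Lpow x w \<le> D * Kf s w powr th s x"
    if x: "2 < x" "x < 2 * (1 + s) / (1 - s)" for x
  proof -
    obtain D where D: "D > 0" "\<And>w. inH s w \<Longrightarrow> Lpow 2 w \<le> c \<Longrightarrow> Kf s w > 0 \<Longrightarrow> Lpow x w \<le> D * Kf s w powr th s x"
      using GN_inequality[OF s0 s(2) c x] unfolding th_def by blast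
    have "Lpow x w \<le> D * Kf s w powr th s x" if w: "inH s w" "Lpow 2 w \<le> c" for w
    proof (cases "Kf s w = 0")
      case True
      then have "Lpow x w = 0" using Lpow_zero_iff[OF inH_memLp_p[OF s0 s(2) x w(1)]] Kf_zero_imp[OF s0 s(2) w(1)] by blast
      then show ?thesis using True by simp
    next
      case False
      then show ?thesis using D(2)[OF w] Kf_nonneg[OF s0 s(2), of w] by simp
    qed
    then show ?thesis using D(1) by blast
  qed
  obtain Dp where Dp: "Dp > 0" "\<And>w. inH s w \<Longrightarrow> Lpow 2 w \<le> c \<Longrightarrow> Lpow p w \<le> Dp * Kf s w powr th s p" using GN[OF pqr2(1) p(2)] by blast
  obtain Dq where Dq: "Dq > 0" "\<And>w. inH s w \<Longrightarrow> Lpow 2 w \<le> c \<Longrightarrow> Lpow q w \<le> Dq * Kf s w powr th s q" using GN[OF pqr2(2) q(2)] by blast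
  obtain Dr where Dr: "Dr > 0" "\<And>w. inH s w \<Longrightarrow> Lpow 2 w \<le> c \<Longrightarrow> Lpow (r1 + r2) w \<le> Dr * Kf s w powr th s (r1 + r2)" using GN[OF pqr2(3) rr(2)] by blast
  define E where "E = \<mu>1 / p * Dp * ex 0 + \<mu>2 / q * Dq * ex 1 + \<beta> * (2 * Dr) * ex 2"
  define t where "t = min (ex 0) (min (ex 1) (ex 2))"
  have t: "t > 1" using ex_gt1 by (simp add: t_def)
  have ex0: "ex i > 0" for i using ex_gt1[of i] by linarith
  have E: "E > 0" unfolding E_def using \<mu> pqr2 Dp Dq Dr ex0 by (intro add_pos_pos mult_pos_pos) auto
  \<comment> \<open>Below \<open>k0\<close> the inequality \<open>k / 2 \<le> E * k powr t\<close>
    fails; the cap 1 allows all three exponents to be replaced by the smallest one,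
    \<open>t\<close>.\<close>
  define k0 where "k0 = min 1 ((1 / (2 * E)) powr (1 / (t - 1)))"
  have k0: "k0 > 0" using E by (simp add: k0_def)
  have low: "(1 - 1 / t) * (k0 / 2) \<le> J u v" if uv: "(u, v) \<in> PS a b" for u v
  proof -
    have H: "inH s u" "inH s v" and nt: "\<not> (Lpow 2 u = 0 \<and> Lpow 2 v = 0)" and P0: "P u v = 0"
      and M: "Lpow 2 u \<le> c" "Lpow 2 v \<le> c"
      using uv by (auto simp: PohoSet_def inD_def c_def)
    define k where "k = Kf s u + Kf s v"
    have k: "k > 0" using nontrivial(1)[OF H nt] by (simp add: k_def)
    have K: "0 \<le> Kf s u" "Kf s u \<le> k" "0 \<le> Kf s v" "Kf s v \<le> k" using Kf_nonneg[OF s0 s(2)] by (auto simp: k_def)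
    have c0: "cf u v 0 \<le> \<mu>1 / p * Dp * k powr ex 0"
    proof -
      have "Lpow p u \<le> Dp * Kf s u powr ex 0" using Dp(2)[OF H(1) M(1)] by (simp add: ex_def)
      also have "\<dots> \<le> Dp * k powr ex 0" using K Dp(1) ex0[of 0] by (intro mult_left_mono powr_mono2) auto
      finally show ?thesis using \<mu> pqr2 by (simp add: cf_def mult_left_mono mult.assoc del: times_divide_eq_left)
    qed
    have c1: "cf u v 1 \<le> \<mu>2 / q * Dq * k powr ex 1"
    proof -
      have "Lpow q v \<le> Dq * Kf s v powr ex 1" using Dq(2)[OF H(2) M(2)] by (simp add: ex_def)
      also have "\<dots> \<le> Dq * k powr ex 1" using K Dq(1) ex0[of 1] by (intro mult_left_mono powr_mono2) auto
      finally show ?thesis using \<mu> pqr2 by (simp add: cf_def mult_left_mono mult.assoc del: times_divide_eq_left)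
    qed
    have c2: "cf u v 2 \<le> \<beta> * (2 * Dr) * k powr ex 2"
    proof -
      have e2: "th s (r1 + r2) = ex 2" by (simp add: ex_def)
      have "coupling r1 r2 u v \<le> Lpow (r1 + r2) u + Lpow (r1 + r2) v"
        using r inH_memLp_p[OF s0 s(2) pqr2(3) rr(2)] H by (intro coupling_le) auto
      also have "\<dots> \<le> Dr * Kf s u powr ex 2 + Dr * Kf s v powr ex 2" using Dr(2)[OF H(1) M(1)] Dr(2)[OF H(2) M(2)] by (simp add: e2)
      also have "\<dots> \<le> Dr * k powr ex 2 + Dr * k powr ex 2" using K Dr(1) ex0[of 2] by (intro add_mono mult_left_mono powr_mono2) auto
      finally show ?thesis using \<mu> by (simp add: cf_def mult.assoc)
    qed
    have S: "k / 2 = (\<Sum>i<3. cf u v i * ex i)" using P0 unfolding P_zero_iff k_def .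
    have kk: "k \<ge> k0"
    proof (rule ccontr)
      assume "\<not> k \<ge> k0"
      then have k1: "k < 1" "k < (1 / (2 * E)) powr (1 / (t - 1))" by (auto simp: k0_def)
      have pw: "k powr ex i \<le> k powr t" if "i < 3" for i
      proof (rule powr_mono')
        have "i = 0 \<or> i = 1 \<or> i = 2" using that by linarith
        then show "t \<le> ex i" by (auto simp: t_def)
      qed (use k k1 in auto)
      have "k / 2 \<le> (\<mu>1 / p * Dp * k powr ex 0) * ex 0 + (\<mu>2 / q * Dq * k powr ex 1) * ex 1 + (\<beta> * (2 * Dr) * k powr ex 2) * ex 2"
        unfolding S sum3 using c0 c1 c2 ex0 by (intro add_mono mult_right_mono) (auto simp: less_imp_le)
      also have "\<dots> \<le> (\<mu>1 / p * Dp * k powr t) * ex 0 + (\<mu>2 / q * Dq * k powr t) * ex 1 + (\<beta> * (2 * Dr) * k powr t) * ex 2"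
        using pw ex0 \<mu> pqr2 Dp(1) Dq(1) Dr(1) by (intro add_mono mult_right_mono mult_left_mono) (auto simp: less_imp_le)
      also have "\<dots> = E * (k * k powr (t - 1))" using k by (simp add: E_def algebra_simps powr_diff)
      finally have "1 / (2 * E) \<le> k powr (t - 1)" using k E by (simp add: field_simps)
      moreover have "k powr (t - 1) < ((1 / (2 * E)) powr (1 / (t - 1))) powr (t - 1)"
        using k k1 t by (intro powr_less_mono2) auto
      moreover have "((1 / (2 * E)) powr (1 / (t - 1))) powr (t - 1) = 1 / (2 * E)" unfolding powr_powr using t E by simp
      ultimately show False by simp
    qed
    have "(1 - 1 / t) * (k0 / 2) \<le> (1 - 1 / t) * (k / 2)" using kk t by (intro mult_left_mono) auto
    also have "\<dots> = (\<Sum>i<3. cf u v i * ((1 - 1 / t) * ex i))" unfolding S sum_distrib_left by (intro sum.cong) auto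
    also have "\<dots> \<le> (\<Sum>i<3. cf u v i * (ex i - 1))"
    proof (intro sum_mono mult_left_mono cf_nonneg)
      fix i :: nat assume "i \<in> {..<3}"
      then have "i = 0 \<or> i = 1 \<or> i = 2" by auto
      then have "t \<le> ex i" by (auto simp: t_def)
      then have "1 \<le> ex i / t" using t by simp
      then show "(1 - 1 / t) * ex i \<le> ex i - 1" by (simp add: algebra_simps)
    qed
    also have "\<dots> = J u v" using J_of_P_zero[OF P0] by simp
    finally show ?thesis .
  qed
  have "0 < (1 - 1 / t) * (k0 / 2)" using t k0 by simp
  also have "\<dots> \<le> C a b" unfolding Cab_def by (rule cInf_greatest) (use ne low in auto)
  finally show ?thesis .
qed

text \<open>If \<open>K\<close> dropped in the limit, projecting the limit back onto the constraint would give an energy below the infimum.\<close>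
lemma minimizer:
  assumes ne: "PS a b \<noteq> {}" and a: "a > 0" "b > 0"
    and seqD: "\<And>n. inH s (un n)" "\<And>n. inH s (vn n)" "\<And>n. Lpow 2 (un n) \<le> a" "\<And>n. Lpow 2 (vn n) \<le> b"
    and uv: "inH s u" "inH s v"
    and J: "(\<lambda>n. J (un n) (vn n)) \<longlonglongrightarrow> C a b" and P: "(\<lambda>n. P (un n) (vn n)) \<longlonglongrightarrow> 0"
    and weak: "\<And>\<phi>. inH s \<phi> \<Longrightarrow> (\<lambda>n. innerH s (un n) \<phi>) \<longlonglongrightarrow> innerH s u \<phi>" "\<And>\<phi>. inH s \<phi> \<Longrightarrow> (\<lambda>n. innerH s (vn n) \<phi>) \<longlonglongrightarrow> innerH s v \<phi>"
    and strong: "\<And>\<eta>. 2 < \<eta> \<Longrightarrow> \<eta> < 2 * (1 + s) / (1 - s) \<Longrightarrow> (\<lambda>n. Lpow \<eta> (\<lambda>z. un n z - u z)) \<longlonglongrightarrow> 0"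
       "\<And>\<eta>. 2 < \<eta> \<Longrightarrow> \<eta> < 2 * (1 + s) / (1 - s) \<Longrightarrow> (\<lambda>n. Lpow \<eta> (\<lambda>z. vn n z - v z)) \<longlonglongrightarrow> 0"
  shows "(u, v) \<in> PS a b" "J u v = C a b"
    "(\<lambda>n. Kf s (\<lambda>z. un n z - u z) + Kf s (\<lambda>z. vn n z - v z)) \<longlonglongrightarrow> 0"
    "(\<lambda>n. LINT z|lborel. un n z * u z) \<longlonglongrightarrow> Lpow 2 u" "(\<lambda>n. LINT z|lborel. vn n z * v z) \<longlonglongrightarrow> Lpow 2 v"
proof -
  have diff: "inH s (\<lambda>z. w1 z - w2 z)" if "inH s w1" "inH s w2" for w1 w2 using inH_lin[OF that, of 1 "-1"] by simp
  have pair: "(\<lambda>n. LINT z|lborel. wn n z * \<phi> z) \<longlonglongrightarrow> (LINT z|lborel. w z * \<phi> z)"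
    if w: "inH s w" "\<And>n. inH s (wn n)" and M: "\<And>n. Lpow 2 (wn n) \<le> c" and l: "(\<lambda>n. Lpow p (\<lambda>z. wn n z - w z)) \<longlonglongrightarrow> 0" and \<phi>: "memLp 2 \<phi>" for w wn c \<phi>
  proof -
    have L: "memLp 2 w" "memLp 2 (wn n)" for n using w inH_memLp by auto
    have "(\<lambda>n. LINT z|lborel. (wn n z - w z) * \<phi> z) \<longlonglongrightarrow> 0"
    proof (rule L2_pairing_null[OF _ _ pqr2(1) _ l \<phi>])
      show "memLp 2 (\<lambda>z. wn n z - w z)" for n using inH_memLp(1)[OF diff[OF w(2) w(1)]] .
      show "memLp p (\<lambda>z. wn n z - w z)" for n by (rule inH_memLp_p[OF s0 s(2) pqr2(1) p(2) diff[OF w(2) w(1)]])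
      show "Lpow 2 (\<lambda>z. wn n z - w z) \<le> 2 * c + 2 * Lpow 2 w" for n
      proof -
        \<comment> \<open>The sum has nonnegative mass, which bounds the cross term from below and
          hence the mass of the difference from above.\<close>
        have "0 \<le> Lpow 2 (\<lambda>z. 1 * wn n z + 1 * w z)" by (rule Lpow_nonneg)
        then have "- (2 * (LINT z|lborel. wn n z * w z)) \<le> Lpow 2 (wn n) + Lpow 2 w" unfolding L2_lin[OF L(2) L(1)] by simp
        moreover have "Lpow 2 (\<lambda>z. wn n z - w z) = Lpow 2 (wn n) - 2 * (LINT z|lborel. wn n z * w z) + Lpow 2 w"
          using L2_lin[OF L(2)[of n] L(1), of 1 "-1"] by simp
        ultimately show ?thesis using M[of n] by simp
      qed
    qed
    then have "(\<lambda>n. (LINT z|lborel. (wn n z - w z) * \<phi> z) + (LINT z|lborel. w z * \<phi> z)) \<longlonglongrightarrow> 0 + (LINT z|lborel. w z * \<phi> z)"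
      by (intro tendsto_intros)
    moreover have "(LINT z|lborel. (wn n z - w z) * \<phi> z) + (LINT z|lborel. w z * \<phi> z) = (LINT z|lborel. wn n z * \<phi> z)" for n
      using memLp2_mult[OF L(2) \<phi>, of n] memLp2_mult[OF L(1) \<phi>] by (simp add: left_diff_distrib)
    ultimately show ?thesis by simp
  qed
  note su = strong(1)[OF pqr2(1) p(2)] and sv = strong(2)[OF pqr2(1) p(2)]
  have uu: "(LINT z|lborel. w z * w z) = Lpow 2 w" for w by (simp add: Lpow2_eq power2_eq_square)
  have pu: "(\<lambda>n. LINT z|lborel. un n z * u z) \<longlonglongrightarrow> Lpow 2 u" using pair[OF uv(1) seqD(1) seqD(3) su inH_memLp(1)[OF uv(1)]] by (simp only: uu)
  have pv: "(\<lambda>n. LINT z|lborel. vn n z * v z) \<longlonglongrightarrow> Lpow 2 v" using pair[OF uv(2) seqD(2) seqD(4) sv inH_memLp(1)[OF uv(2)]] by (simp only: uu)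
  show "(\<lambda>n. LINT z|lborel. un n z * u z) \<longlonglongrightarrow> Lpow 2 u" "(\<lambda>n. LINT z|lborel. vn n z * v z) \<longlonglongrightarrow> Lpow 2 v" by fact+
  \<comment> \<open>Subtracting the L^2 pairing, whose limit is known, from the weak convergence
    leaves the kinetic pairing.\<close>
  have Ku: "(\<lambda>n. innerK s (un n) u) \<longlonglongrightarrow> Kf s u"
    using tendsto_diff[OF weak(1)[OF uv(1)] pu] by (simp add: innerH_def uu Kf_def)
  have Kv: "(\<lambda>n. innerK s (vn n) v) \<longlonglongrightarrow> Kf s v"
    using tendsto_diff[OF weak(2)[OF uv(2)] pv] by (simp add: innerH_def uu Kf_def)
  have Mle: "Lpow 2 w \<le> c" if w: "inH s w" "\<And>n. inH s (wn n)" and M: "\<And>n. Lpow 2 (wn n) \<le> c"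
     and l: "(\<lambda>n. LINT z|lborel. wn n z * w z) \<longlonglongrightarrow> Lpow 2 w" for w wn c
  proof -
    have L: "memLp 2 w" "memLp 2 (wn n)" for n using w inH_memLp by auto
    have "(\<lambda>n. c - 2 * (LINT z|lborel. wn n z * w z) + Lpow 2 w) \<longlonglongrightarrow> c - 2 * Lpow 2 w + Lpow 2 w" by (intro tendsto_intros l)
    moreover have "0 \<le> c - 2 * (LINT z|lborel. wn n z * w z) + Lpow 2 w" for n
      using Lpow_nonneg[of 2 "\<lambda>z. 1 * wn n z + (-1) * w z"] M[of n] unfolding L2_lin[OF L(2) L(1)] by simp
    ultimately have "0 \<le> c - 2 * Lpow 2 w + Lpow 2 w" by (intro LIMSEQ_le_const[of _ _ 0]) auto
    then show ?thesis by simp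
  qed
  have Mu: "Lpow 2 u \<le> a" by (rule Mle[OF uv(1) seqD(1) seqD(3) pu])
  have Mv: "Lpow 2 v \<le> b" by (rule Mle[OF uv(2) seqD(2) seqD(4) pv])
  have Lp: "memLp x w" if "inH s w" "2 < x" "x < 2 * (1 + s) / (1 - s)" for w x using inH_memLp_p[OF s0 s(2) that(2,3,1)] .
  have Lc: "(\<lambda>n. Lpow x (wn n)) \<longlonglongrightarrow> Lpow x w"
    if x: "2 < x" "x < 2 * (1 + s) / (1 - s)" and w: "inH s w" "\<And>n. inH s (wn n)" "(\<lambda>n. Lpow x (\<lambda>z. wn n z - w z)) \<longlonglongrightarrow> 0" for x w wn
    using homogeneous_converge[OF Lpow_homogeneous[of x], of w w wn wn] x w Lp diff by (simp add: Lpow_def)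
  have cfc: "(\<lambda>n. cf (un n) (vn n) i) \<longlonglongrightarrow> cf u v i" for i
  proof -
    have "(\<lambda>n. coupling r1 r2 (un n) (vn n)) \<longlonglongrightarrow> coupling r1 r2 u v"
      using homogeneous_converge[OF coupling_homogeneous[of r1 r2], of u v un vn] r rr pqr2 Lp diff uv seqD strong
      by (simp add: coupling_def)
    then show ?thesis using Lc[OF pqr2(1) p(2) uv(1) seqD(1)] Lc[OF pqr2(2) q(2) uv(2) seqD(2)] strong p q pqr2
      by (auto simp: cf_def intro!: tendsto_intros)
  qed
  define S where "S = (\<Sum>i<3. cf u v i * ex i)"
  have Kn: "(\<lambda>n. (Kf s (un n) + Kf s (vn n)) / 2) \<longlonglongrightarrow> S"
  proof -
    have "(\<lambda>n. P (un n) (vn n) / (2 * s) + (\<Sum>i<3. cf (un n) (vn n) i * ex i)) \<longlonglongrightarrow> 0 / (2 * s) + S"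
      unfolding S_def by (intro tendsto_intros P cfc) (use s0 in simp)
    moreover have "P (un n) (vn n) / (2 * s) + (\<Sum>i<3. cf (un n) (vn n) i * ex i) = (Kf s (un n) + Kf s (vn n)) / 2" for n
      unfolding P_eq using s0 by simp
    ultimately show ?thesis by simp
  qed
  \<comment> \<open>Since \<open>P\<close> tends to zero, the kinetic part of the energy can be
    traded for nonlinear terms, and these converge to those of the limit.\<close>
  have CS: "C a b = (\<Sum>i<3. cf u v i * (ex i - 1))"
  proof (rule LIMSEQ_unique[OF J])
    have "(\<lambda>n. (Kf s (un n) + Kf s (vn n)) / 2 - (\<Sum>i<3. cf (un n) (vn n) i)) \<longlonglongrightarrow> S - (\<Sum>i<3. cf u v i)"
      by (intro tendsto_intros Kn cfc)
    then show "(\<lambda>n. J (un n) (vn n)) \<longlonglongrightarrow> (\<Sum>i<3. cf u v i * (ex i - 1))"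
      unfolding J_eq S_def by (simp add: sum_subtractf right_diff_distrib)
  qed
  have nt: "\<not> (Lpow 2 u = 0 \<and> Lpow 2 v = 0)"
  proof
    assume "Lpow 2 u = 0 \<and> Lpow 2 v = 0"
    then have z: "AE z in lborel. u z = 0" "AE z in lborel. v z = 0" using Lpow2_zero_iff inH_memLp(1) uv by blast+
    have "Lpow p u = 0" "Lpow q v = 0" using Lpow_zero_iff Lp uv p q pqr2 z by blast+
    moreover have "coupling r1 r2 u v = 0" unfolding coupling_def
      by (rule integral_eq_zero_AE) (use z(1) in \<open>eventually_elim, simp\<close>)
    ultimately have "C a b = 0" unfolding CS sum3 cf_def by simp
    then show False using C_pos[OF ne a] by simp
  qed
  have Kd: "Kf s (\<lambda>z. w1 z - w2 z) = Kf s w1 - 2 * innerK s w1 w2 + Kf s w2" if "inH s w1" "inH s w2" for w1 w2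
    using Kf_lin[OF that, of 1 "-1"] by simp
  have Kdl: "(\<lambda>n. Kf s (\<lambda>z. un n z - u z) + Kf s (\<lambda>z. vn n z - v z)) \<longlonglongrightarrow> 2 * S - (Kf s u + Kf s v)"
  proof -
    have "(\<lambda>n. 2 * ((Kf s (un n) + Kf s (vn n)) / 2) - 2 * innerK s (un n) u - 2 * innerK s (vn n) v + (Kf s u + Kf s v)) \<longlonglongrightarrow>
       2 * S - 2 * Kf s u - 2 * Kf s v + (Kf s u + Kf s v)" by (intro tendsto_intros Kn Ku Kv)
    moreover have "2 * ((Kf s (un n) + Kf s (vn n)) / 2) - 2 * innerK s (un n) u - 2 * innerK s (vn n) v + (Kf s u + Kf s v)
      = Kf s (\<lambda>z. un n z - u z) + Kf s (\<lambda>z. vn n z - v z)" for n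
      unfolding Kd[OF seqD(1) uv(1)] Kd[OF seqD(2) uv(2)] by simp
    moreover have "2 * S - 2 * Kf s u - 2 * Kf s v + (Kf s u + Kf s v) = 2 * S - (Kf s u + Kf s v)" by simp
    ultimately show ?thesis by (simp only:)
  qed
  \<comment> \<open>Weak lower semicontinuity: the kinetic energy of the differences is
    nonnegative.\<close>
  have "0 \<le> 2 * S - (Kf s u + Kf s v)"
    by (rule LIMSEQ_le_const[OF Kdl]) (use Kf_nonneg[OF s0 s(2)] in \<open>auto intro!: add_nonneg_nonneg\<close>)
  then have Kle: "(Kf s u + Kf s v) / 2 \<le> S" by simp
  obtain y where y: "y > 0" "(Kf s u + Kf s v) / 2 = (\<Sum>i<3. cf u v i * ex i * y powr (ex i - 1))"
    "C a b \<le> y * (Kf s u + Kf s v) / 2 - (\<Sum>i<3. cf u v i * y powr ex i)"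
    using projection[OF uv nt Mu Mv] by blast
  obtain j where j: "j < 3" "cf u v j > 0" using nontrivial(2)[OF uv nt] by blast
  have K: "(Kf s u + Kf s v) / 2 = S" unfolding S_def
    by (rule scalar_rigidity[of "{..<3}" "cf u v" ex j y]) (use cf_nonneg ex_gt1 j y Kle CS in \<open>auto simp: S_def\<close>)
  then have P0: "P u v = 0" unfolding P_zero_iff S_def .
  show "(u, v) \<in> PS a b" using uv nt P0 Mu Mv by (simp add: PohoSet_def inD_def)
  show "J u v = C a b" unfolding J_of_P_zero[OF P0] CS ..
  show "(\<lambda>n. Kf s (\<lambda>z. un n z - u z) + Kf s (\<lambda>z. vn n z - v z)) \<longlonglongrightarrow> 0" using Kdl K by simp
qed

end

section \<open>Integration by parts for test functions\<close>

lemma test_fun_mult: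
  assumes "test_fun \<phi>" "test_fun \<psi>"
  shows "test_fun (\<lambda>z. \<phi> z * \<psi> z)" "dxf (\<lambda>z. \<phi> z * \<psi> z) = (\<lambda>z. dxf \<phi> z * \<psi> z + \<phi> z * dxf \<psi> z)"
proof -
  obtain f2 where f: "\<And>z. (\<phi> has_derivative (\<lambda>w. fst w * dxf \<phi> z + snd w * f2 z)) (at z)"
    "continuous_on UNIV (dxf \<phi>)" "continuous_on UNIV f2" "bounded {z. \<phi> z \<noteq> 0}" using test_funD[OF assms(1)] by blast
  obtain g2 where g: "\<And>z. (\<psi> has_derivative (\<lambda>w. fst w * dxf \<psi> z + snd w * g2 z)) (at z)"
    "continuous_on UNIV (dxf \<psi>)" "continuous_on UNIV g2" "bounded {z. \<psi> z \<noteq> 0}" using test_funD[OF assms(2)] by blast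
  have 1: "((\<lambda>z. \<phi> z * \<psi> z) has_derivative (\<lambda>w. fst w * (dxf \<phi> z * \<psi> z + \<phi> z * dxf \<psi> z) + snd w * (f2 z * \<psi> z + \<phi> z * g2 z))) (at z)" for z
    by (rule has_derivative_eq_rhs[OF has_derivative_mult[OF f(1) g(1)]]) (auto simp: algebra_simps)
  have 2: "continuous_on UNIV (\<lambda>z. dxf \<phi> z * \<psi> z + \<phi> z * dxf \<psi> z)" "continuous_on UNIV (\<lambda>z. f2 z * \<psi> z + \<phi> z * g2 z)"
    by (intro continuous_intros f g test_fun_continuous assms)+
  have 3: "bounded {z. \<phi> z * \<psi> z \<noteq> 0}" by (rule bounded_subset[OF f(4)]) auto
  show "test_fun (\<lambda>z. \<phi> z * \<psi> z)" "dxf (\<lambda>z. \<phi> z * \<psi> z) = (\<lambda>z. dxf \<phi> z * \<psi> z + \<phi> z * dxf \<psi> z)"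
    using test_funI[OF 1 2 3] by auto
qed

lemma integral_dxf_zero:
  assumes T: "test_fun \<omega>"
  shows "(LINT z|lborel. dxf \<omega> z) = 0"
proof -
  obtain f2 where f2: "\<And>z. (\<omega> has_derivative (\<lambda>w. fst w * dxf \<omega> z + snd w * f2 z)) (at z)" using test_funD[OF T] by blast
  obtain R0 where R0: "\<And>z. \<omega> z \<noteq> 0 \<Longrightarrow> \<bar>fst z\<bar> \<le> R0 \<and> \<bar>snd z\<bar> \<le> R0"
    using continuous_compact_support(2)[OF test_fun_continuous[OF T] test_fun_supp(1)[OF T]] by blast
  obtain R1 where R1: "\<And>z. dxf \<omega> z \<noteq> 0 \<Longrightarrow> \<bar>fst z\<bar> \<le> R1 \<and> \<bar>snd z\<bar> \<le> R1"
    using continuous_compact_support(2)[OF test_fun_dxf[OF T]] by blast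
  \<comment> \<open>Strictly outside both supports, so that the boundary values of
    \<open>\<omega>\<close> vanish.\<close>
  define R where "R = max \<bar>R0\<bar> \<bar>R1\<bar> + 1"
  have R: "R0 < R" "R1 < R" "R > 0" by (auto simp: R_def)
  have D: "dxf \<omega> \<in> borel_measurable borel" using test_fun_memLp2(2)[OF T] by (simp add: memLp2_iff)
  have i: "integrable lborel (dxf \<omega>)"
  proof -
    have "integrable lborel (\<lambda>z. indicator (box (-R,-R) (R,R)) z * dxf \<omega> z)" by (rule memLp2_box[OF test_fun_memLp2(2)[OF T]])
    moreover have "indicator (box (-R,-R) (R,R)) z * dxf \<omega> z = dxf \<omega> z" for z
    proof (cases "dxf \<omega> z = 0")
      case False
      then have "\<bar>fst z\<bar> < R" "\<bar>snd z\<bar> < R" using R1[OF False] R by auto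
      then have "z \<in> box (-R,-R) (R,R)" by (cases z) (auto simp: box_def Basis_prod_def inner_prod_def)
      then show ?thesis by simp
    qed simp
    ultimately show ?thesis by simp
  qed
  have "(LINT z|lborel. dxf \<omega> z) = (LINT y|lborel. LINT x|lborel. dxf \<omega> (x, y))" using lborel_Fubini(2)[OF i] by simp
  also have "(\<lambda>y. LINT x|lborel. dxf \<omega> (x, y)) = (\<lambda>y. 0)"
  proof
    fix y
    have eq: "dxf \<omega> (x, y) = dxf \<omega> (x, y) * indicator {-R..R} x" for x
      using R1[of "(x, y)"] R by (cases "dxf \<omega> (x, y) = 0") (auto simp: indicator_def abs_le_iff)
    have "(LINT x|lborel. dxf \<omega> (x, y)) = (LINT x|lborel. dxf \<omega> (x, y) * indicator {-R..R} x)"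
      by (rule Bochner_Integration.integral_cong[OF refl eq])
    also have "\<dots> = \<omega> (R, y) - \<omega> (-R, y)"
    proof (rule integral_FTC_Icc_real)
      show "- R \<le> R" using R by simp
      fix x :: real
      have c: "((\<lambda>x. (x, y)) has_derivative (\<lambda>h. (h, 0))) (at x)" by (auto intro!: derivative_eq_intros)
      have "((\<lambda>x. \<omega> (x, y)) has_derivative (\<lambda>h. h * dxf \<omega> (x, y))) (at x)"
        by (rule has_derivative_eq_rhs[OF has_derivative_compose[OF c f2]]) auto
      then show "((\<lambda>x. \<omega> (x, y)) has_real_derivative dxf \<omega> (x, y)) (at x)"
        by (simp add: has_field_derivative_def mult.commute[of _ "dxf _ _"])
      have "continuous_on UNIV (\<lambda>x. dxf \<omega> (x, y))"
        by (rule continuous_on_compose2[OF test_fun_dxf(1)[OF T]]) (auto intro!: continuous_intros)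
      then show "isCont (\<lambda>x. dxf \<omega> (x, y)) x" by (simp add: continuous_on_eq_continuous_at)
    qed
    also have "\<dots> = 0"
    proof -
      have "\<omega> (R, y) = 0" using R0[of "(R, y)"] R by (cases "\<omega> (R, y) = 0") auto
      moreover have "\<omega> (- R, y) = 0" using R0[of "(-R, y)"] R by (cases "\<omega> (- R, y) = 0") auto
      ultimately show ?thesis by simp
    qed
    finally show "(LINT x|lborel. dxf \<omega> (x, y)) = 0" .
  qed
  finally show ?thesis by simp
qed

lemma test_fun_weak_dx:
  assumes T: "test_fun \<phi>"
  shows "has_weak_dx \<phi> (dxf \<phi>)"
  unfolding has_weak_dx_def
proof (intro conjI allI impI)
  show "memLp 2 (dxf \<phi>)" by (rule test_fun_memLp2[OF T])
  fix \<psi> assume S: "test_fun \<psi>"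
  have i: "integrable lborel (\<lambda>z. dxf \<phi> z * \<psi> z)" "integrable lborel (\<lambda>z. \<phi> z * dxf \<psi> z)"
    by (intro memLp2_mult test_fun_memLp2 T S)+
  have "(LINT z|lborel. dxf \<phi> z * \<psi> z + \<phi> z * dxf \<psi> z) = 0"
    using integral_dxf_zero[OF test_fun_mult(1)[OF T S]] unfolding test_fun_mult(2)[OF T S] .
  then show "(LINT z|lborel. \<phi> z * dxf \<psi> z) = - (LINT z|lborel. dxf \<phi> z * \<psi> z)" using i by simp
qed

subsection \<open>A bump function\<close>

text \<open>The third power makes the bump twice continuously differentiable: in the pairings below
  two derivatives land on it.\<close>

definition bump :: "real \<Rightarrow> real" where "bump x = (max 0 (1 - x^2))^3"
definition bump1 :: "real \<Rightarrow> real" where "bump1 x = - 6 * x * (max 0 (1 - x^2))^2"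
definition bump2 :: "real \<Rightarrow> real" where "bump2 x = - 6 * (max 0 (1 - x^2))^2 + 24 * x^2 * max 0 (1 - x^2)"

lemma bump_deriv: "(bump has_real_derivative bump1 x) (at x)"
proof -
  have p: "((\<lambda>x. (max 0 x)^3) has_real_derivative 3 * (max 0 x)^2) (at x)" for x :: real
    using pos_part_power_deriv[of 1 x] by (simp add: eval_nat_numeral)
  have "((\<lambda>x. (max 0 (1 - x^2))^3) has_real_derivative (3 * (max 0 (1 - x^2))^2) * (- 2 * x)) (at x)"
    by (rule DERIV_chain2[OF p]) (auto intro!: derivative_eq_intros)
  then show ?thesis unfolding bump_def[abs_def] by (rule DERIV_cong) (simp add: bump1_def)
qed

lemma bump1_deriv: "(bump1 has_real_derivative bump2 x) (at x)"
proof -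
  have p: "((\<lambda>x. (max 0 x)^2) has_real_derivative 2 * max 0 x) (at x)" for x :: real
    using pos_part_power_deriv[of 0 x] by (simp add: numeral_2_eq_2)
  have m: "((\<lambda>x. (max 0 (1 - x^2))^2) has_real_derivative (2 * max 0 (1 - x^2)) * (- 2 * x)) (at x)"
    by (rule DERIV_chain2[OF p]) (auto intro!: derivative_eq_intros)
  have l: "((\<lambda>x. - 6 * x) has_real_derivative - 6) (at x)" by (auto intro!: derivative_eq_intros)
  show ?thesis unfolding bump1_def[abs_def] bump2_def
    by (rule DERIV_cong[OF DERIV_mult[OF l m]]) (simp add: power2_eq_square)
qed

lemma one_less_sq: "\<bar>x\<bar> > 1 \<Longrightarrow> x^2 > (1::real)"
  using one_less_power[of "\<bar>x\<bar>" 2] by simp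

lemma bump_supp: "\<bar>x\<bar> > 1 \<Longrightarrow> bump x = 0" "\<bar>x\<bar> > 1 \<Longrightarrow> bump1 x = 0"
proof -
  assume "\<bar>x\<bar> > 1"
  then have "x^2 > 1" by (rule one_less_sq)
  then show "bump x = 0" "bump1 x = 0" by (auto simp: bump_def bump1_def)
qed

lemma bump_range: "0 \<le> bump x" "bump x \<le> 1"
proof -
  show "0 \<le> bump x" by (simp add: bump_def)
  have "max 0 (1 - x^2) \<le> 1" by simp
  then show "bump x \<le> 1" unfolding bump_def by (intro power_le_one) auto
qed

lemma bump_cont: "continuous_on UNIV bump" "continuous_on UNIV bump1" "continuous_on UNIV bump2"
  unfolding bump_def[abs_def] bump1_def[abs_def] bump2_def[abs_def] by (intro continuous_intros)+

lemma bump_bounds: "\<bar>bump1 x\<bar> \<le> 6" "\<bar>bump2 x\<bar> \<le> 30"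
proof -
  let ?m = "max 0 (1 - x^2)"
  have m: "0 \<le> ?m" "?m \<le> 1" by auto
  have m2: "0 \<le> ?m^2" "?m^2 \<le> 1" using m by (auto intro: power_le_one)
  have "\<bar>bump1 x\<bar> \<le> 6 \<and> \<bar>bump2 x\<bar> \<le> 30"
  proof (cases "\<bar>x\<bar> \<le> 1")
    case True
    have "x^2 \<le> 1" using True by (simp add: abs_square_le_1)
    have "\<bar>x\<bar> * ?m^2 \<le> 1 * 1" using True m2 by (intro mult_mono) auto
    then have "\<bar>bump1 x\<bar> \<le> 6" by (simp add: bump1_def abs_mult)
    have "x^2 * ?m \<le> 1 * 1" using \<open>x^2 \<le> 1\<close> m by (intro mult_mono) auto
    then have "x^2 * ?m \<le> 1" by simp
    moreover have "0 \<le> x^2 * ?m" using m by simp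
    moreover have "bump2 x = - 6 * ?m^2 + 24 * (x^2 * ?m)" by (simp add: bump2_def)
    ultimately have "\<bar>bump2 x\<bar> \<le> 30" using m2 by linarith
    then show ?thesis using \<open>\<bar>bump1 x\<bar> \<le> 6\<close> by simp
  next
    case False
    then have "x^2 > 1" using one_less_sq[of x] by simp
    then show ?thesis by (simp add: bump1_def bump2_def)
  qed
  then show "\<bar>bump1 x\<bar> \<le> 6" "\<bar>bump2 x\<bar> \<le> 30" by auto
qed

lemma Lipschitz_from_deriv:
  assumes "\<And>x. (f has_real_derivative f' x) (at x)" "\<And>x. \<bar>f' x\<bar> \<le> B"
  shows "\<bar>f y - f x\<bar> \<le> B * \<bar>y - x\<bar>"
proof -
  have *: "\<bar>f y - f x\<bar> \<le> B * \<bar>y - x\<bar>" if xy: "x < y" for x y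
  proof -
    obtain z where "f y - f x = (y - x) * f' z" using MVT2[OF xy, of f f'] assms(1) by blast
    then have "\<bar>f y - f x\<bar> = \<bar>y - x\<bar> * \<bar>f' z\<bar>" by (simp add: abs_mult)
    also have "\<dots> \<le> \<bar>y - x\<bar> * B" by (intro mult_left_mono assms) auto
    finally show ?thesis by (simp add: mult.commute)
  qed
  show ?thesis
  proof (cases x y rule: linorder_cases)
    case less then show ?thesis by (rule *)
  next
    case greater
    from *[OF greater] show ?thesis by (simp add: abs_minus_commute)
  qed simp
qed

text \<open>Wider than the support of \<open>bump\<close>: if \<open>y\<close> lies outside and the
  increment is at most 1, every point in a first or second difference misses the support.\<close>

definition ivl :: "real \<Rightarrow> real" where "ivl y = indicator {-2..2} y"

lemma bump_first_difference: "(bump y - bump y')^2 \<le> 36 * min 1 ((y' - y)^2) * (ivl y + ivl y')"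
proof (cases "\<bar>y' - y\<bar> \<le> 1")
  case True
  show ?thesis
  proof (cases "\<bar>y\<bar> \<le> 2")
    case T: True
    have "\<bar>bump y - bump y'\<bar>^2 \<le> (6 * \<bar>y - y'\<bar>)^2"
      using Lipschitz_from_deriv[OF bump_deriv bump_bounds(1), of y y'] by (intro power_mono) auto
    then have "(bump y - bump y')^2 \<le> 36 * (y' - y)^2 * 1" by (simp add: power_mult_distrib power2_commute)
    also have "\<dots> \<le> 36 * (y' - y)^2 * (ivl y + ivl y')" using T by (intro mult_left_mono) (auto simp: ivl_def indicator_def)
    also have "(y' - y)^2 = min 1 ((y' - y)^2)" using True by (simp add: abs_square_le_1)
    finally show ?thesis .
  next
    case F: False
    then have "\<bar>y\<bar> > 1" "\<bar>y'\<bar> > 1" using True by linarith+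
    then show ?thesis by (simp add: bump_supp ivl_def)
  qed
next
  case False
  then have m: "min 1 ((y' - y)^2) = 1" using one_less_sq[of "y' - y"] by simp
  have e: "bump x \<le> ivl x" for x using bump_range[of x] bump_supp(1)[of x] by (cases "\<bar>x\<bar> > 1") (auto simp: ivl_def indicator_def abs_le_iff)
  have i: "0 \<le> ivl x" for x by (simp add: ivl_def)
  have "\<bar>bump y - bump y'\<bar> \<le> 1" "\<bar>bump y - bump y'\<bar> \<le> ivl y + ivl y'" using bump_range[of y] bump_range[of y'] e[of y] e[of y'] by linarith+
  then have "\<bar>bump y - bump y'\<bar> * \<bar>bump y - bump y'\<bar> \<le> 1 * (ivl y + ivl y')" using i by (intro mult_mono) auto
  then have "(bump y - bump y')^2 \<le> ivl y + ivl y'" by (simp add: power2_eq_square)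
  also have "\<dots> \<le> 36 * (ivl y + ivl y')" using i[of y] i[of y'] by simp
  finally show ?thesis unfolding m by simp
qed

text \<open>First differences are only of order \<open>h\<close>, which the kernel
  \<open>\<bar>h\<bar> powr (- (1 + 2 * s))\<close> does not integrate at zero for
  \<open>s \<ge> 1/2\<close>; the symmetric second difference is of order
  \<open>h^2\<close>.\<close>

lemma bump_second_difference:
  "\<bar>2 * bump y - bump (y + h) - bump (y - h)\<bar> \<le> 60 * min 1 (h^2) * (ivl y + ivl (y + h) + ivl (y - h))"
proof (cases "\<bar>h\<bar> \<le> 1")
  case True
  show ?thesis
  proof (cases "\<bar>y\<bar> \<le> 2")
    case T: True
    \<comment> \<open>An even function of \<open>t\<close>, so its derivative vanishes at zero and
      grows at most linearly.\<close>
    define G where "G = (\<lambda>t. bump (y + t) + bump (y - t))"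
    define G' where "G' = (\<lambda>t. bump1 (y + t) - bump1 (y - t))"
    have dG: "(G has_real_derivative G' t) (at t)" for t
    proof -
      have a: "((\<lambda>t. bump (y + t)) has_real_derivative bump1 (y + t) * 1) (at t)"
        by (rule DERIV_chain2[OF bump_deriv]) (auto intro!: derivative_eq_intros)
      have b: "((\<lambda>t. bump (y - t)) has_real_derivative bump1 (y - t) * (-1)) (at t)"
        by (rule DERIV_chain2[OF bump_deriv]) (auto intro!: derivative_eq_intros)
      show ?thesis unfolding G_def G'_def by (rule DERIV_cong[OF DERIV_add[OF a b]]) simp
    qed
    have bG: "\<bar>G' t\<bar> \<le> 60 * \<bar>t\<bar>" for t
      using Lipschitz_from_deriv[OF bump1_deriv bump_bounds(2), of "y + t" "y - t"] by (simp add: G'_def)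
    have G: "\<bar>G k - G 0\<bar> \<le> 60 * k^2" if k: "k \<ge> 0" for k
    proof (cases "k = 0")
      case False
      then have "0 < k" using k by simp
      then obtain z where z: "0 < z" "z < k" "G k - G 0 = (k - 0) * G' z" using MVT2[of 0 k G G'] dG by blast
      then have "\<bar>G k - G 0\<bar> = k * \<bar>G' z\<bar>" using k by (simp add: abs_mult)
      also have "\<dots> \<le> k * (60 * k)" using bG[of z] z k by (intro mult_left_mono) auto
      finally show ?thesis by (simp add: power2_eq_square)
    qed simp
    have "2 * bump y - bump (y + h) - bump (y - h) = - (G \<bar>h\<bar> - G 0)" by (cases "h \<ge> 0") (auto simp: G_def)
    then have "\<bar>2 * bump y - bump (y + h) - bump (y - h)\<bar> \<le> 60 * h^2 * 1" using G[of "\<bar>h\<bar>"] by simp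
    also have "\<dots> \<le> 60 * h^2 * (ivl y + ivl (y + h) + ivl (y - h))" using T by (intro mult_left_mono) (auto simp: ivl_def indicator_def)
    also have "h^2 = min 1 (h^2)" using True by (simp add: abs_square_le_1)
    finally show ?thesis .
  next
    case F: False
    then have "\<bar>y\<bar> > 1" "\<bar>y + h\<bar> > 1" "\<bar>y - h\<bar> > 1" using True by linarith+
    then show ?thesis by (simp add: bump_supp ivl_def)
  qed
next
  case False
  then have m: "min 1 (h^2) = 1" using one_less_sq[of h] by simp
  have e: "bump x \<le> ivl x" for x using bump_range[of x] bump_supp(1)[of x] by (cases "\<bar>x\<bar> > 1") (auto simp: ivl_def indicator_def abs_le_iff)
  have g: "\<bar>2 * a - b - c\<bar> \<le> 60 * 1 * (A + B + D)" if "a \<le> A" "b \<le> B" "c \<le> D" "0 \<le> a" "0 \<le> b" "0 \<le> c" for a b c A B D :: real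
    using that by (simp add: abs_le_iff)
  show ?thesis unfolding m by (rule g) (use e bump_range in auto)
qed

text \<open>The Gagliardo kernel times the gain \<open>min 1 (h^2)\<close> of squared first
  differences and of second differences; integrable at zero because \<open>s < 1\<close> and at
  infinity because \<open>s > 0\<close>.\<close>

definition kern :: "real \<Rightarrow> real \<Rightarrow> real" where
  "kern s h = min 1 (h^2) / \<bar>h\<bar> powr (1 + 2 * s)"

lemma kern_measurable [measurable]: "kern s \<in> borel_measurable borel"
  unfolding kern_def[abs_def] by measurable

lemma kern_nonneg: "kern s h \<ge> 0"
  by (simp add: kern_def)

lemma kern_integral:
  assumes s: "0 < s" "s < 1"
  obtains \<kappa> where "\<kappa> > 0" "(\<integral>\<^sup>+ h. ennreal (kern s h) \<partial>lborel) \<le> ennreal \<kappa>"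
proof -
  have A: "((\<lambda>h. h powr (1 - 2 * s)) has_integral (1 powr (1 - 2 * s + 1) / (1 - 2 * s + 1))) {0..1}"
    by (rule has_integral_powr_from_0) (use s in auto)
  have B: "((\<lambda>h. h powr (- (1 + 2 * s))) has_integral - (1 powr (- (1 + 2 * s) + 1)) / (- (1 + 2 * s) + 1)) {1..}"
    by (rule has_integral_powr_to_inf) (use s in auto)
  have A': "((\<lambda>h. h powr (1 - 2 * s)) has_integral 1 / (2 - 2 * s)) {0..1}" using A by simp
  have B': "((\<lambda>h. h powr (- (1 + 2 * s))) has_integral 1 / (2 * s)) {1..}"
  proof -
    have "- (1 powr (- (1 + 2 * s) + 1)) / (- (1 + 2 * s) + 1) = 1 / (2 * s)" using s by (simp add: field_simps)
    then show ?thesis using B by (simp only:)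
  qed
  define f where "f = (\<lambda>h::real. if h \<in> {0..1} then h powr (1 - 2 * s) else 0)"
  define g where "g = (\<lambda>h::real. if h \<in> {1..} then h powr (- (1 + 2 * s)) else 0)"
  have fm[measurable]: "f \<in> borel_measurable borel" "g \<in> borel_measurable borel" unfolding f_def g_def by measurable
  have fnn: "0 \<le> f h" "0 \<le> g h" for h by (auto simp: f_def g_def)
  have f: "(\<integral>\<^sup>+ h. ennreal (f h) \<partial>lborel) = ennreal (1 / (2 - 2 * s))"
    by (rule nn_integral_has_integral_lborel[OF fm(1) fnn(1)]) (use A' in \<open>simp only: f_def has_integral_restrict_UNIV\<close>)
  have g: "(\<integral>\<^sup>+ h. ennreal (g h) \<partial>lborel) = ennreal (1 / (2 * s))"
    by (rule nn_integral_has_integral_lborel[OF fm(2) fnn(2)]) (use B' in \<open>simp only: g_def has_integral_restrict_UNIV\<close>)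
  have pt: "ennreal (kern s h) \<le> (ennreal (f h) + ennreal (g h)) + (ennreal (f (- h)) + ennreal (g (- h)))" for h
  proof -
    have pos: "kern s h \<le> f h + g h" if h: "h > 0" for h
    proof (cases "h \<le> 1")
      case True
      then have "min 1 (h^2) = h^2" using h by (simp add: power_le_one)
      then have "kern s h = h powr 2 / h powr (1 + 2 * s)" using h unfolding kern_def powr_sq[OF h, symmetric] by simp
      also have "\<dots> = h powr (2 - (1 + 2 * s))" by (rule powr_diff[symmetric])
      also have "2 - (1 + 2 * s) = 1 - 2 * s" by simp
      finally show ?thesis using True h fnn(2)[of h] by (simp add: f_def)
    next
      case False
      then have "min 1 (h^2) = 1" by (simp add: one_le_power)
      then show ?thesis using False fnn(1)[of h] using powr_minus_divide[of h "1 + 2 * s"] by (simp add: g_def kern_def)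
    qed
    have even: "kern s (- h) = kern s h" by (simp add: kern_def)
    note nn = fnn
    consider "h > 0" | "h = 0" | "- h > 0" by linarith
    then show ?thesis
    proof cases
      case 1
      then have "ennreal (kern s h) \<le> ennreal (f h) + ennreal (g h)" using pos[OF 1] nn by (simp only: ennreal_plus[symmetric] ennreal_leI)
      then show ?thesis by (rule add_increasing2[rotated]) simp
    next
      case 2 then show ?thesis by (simp add: kern_def)
    next
      case 3
      then have "ennreal (kern s h) \<le> ennreal (f (- h)) + ennreal (g (- h))" using pos[OF 3] nn[of "- h"] even by (simp only: ennreal_plus[symmetric] ennreal_leI)
      then show ?thesis by (rule add_increasing[rotated]) simp
    qed
  qed
  have r: "(\<integral>\<^sup>+ h. ennreal (f (- h)) \<partial>lborel) = ennreal (1 / (2 - 2 * s))"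
    using nn_integral_uminus[of "\<lambda>h. ennreal (f h)"] f by simp
  have r': "(\<integral>\<^sup>+ h. ennreal (g (- h)) \<partial>lborel) = ennreal (1 / (2 * s))"
    using nn_integral_uminus[of "\<lambda>h. ennreal (g h)"] g by simp
  have "(\<integral>\<^sup>+ h. ennreal (kern s h) \<partial>lborel) \<le> (\<integral>\<^sup>+ h. (ennreal (f h) + ennreal (g h)) + (ennreal (f (- h)) + ennreal (g (- h))) \<partial>lborel)"
    by (intro nn_integral_mono pt)
  also have "\<dots> = (ennreal (1 / (2 - 2 * s)) + ennreal (1 / (2 * s))) + (ennreal (1 / (2 - 2 * s)) + ennreal (1 / (2 * s)))"
    by (simp add: nn_integral_add f g r r')
  also have "\<dots> = ennreal (1 / (2 - 2 * s) + 1 / (2 * s) + (1 / (2 - 2 * s) + 1 / (2 * s)))"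
  proof -
    have n: "0 \<le> 1 / (2 - 2 * s)" "0 \<le> 1 / (2 * s)" using s by auto
    show ?thesis by (simp only: ennreal_plus n add_nonneg_nonneg)
  qed
  finally show thesis using that[of "1 / (2 - 2 * s) + 1 / (2 * s) + (1 / (2 - 2 * s) + 1 / (2 * s))"] s by (simp add: add_pos_pos)
qed

subsection \<open>A cutoff and a Liouville property\<close>

lemma borel_measurable_lborel: "borel_measurable lborel = (borel_measurable borel :: ('a::euclidean_space \<Rightarrow> 'b::topological_space) set)"
  by (rule measurable_cong_sets) simp_all

text \<open>The terms that occur are a kernel of the increment times a weight at \<open>y\<close>,
  \<open>y + h\<close> or \<open>y - h\<close>; for fixed \<open>h\<close> a vertical shift removes
  the increment from the weight.\<close>

lemma kern_weight:
  fixes W :: "real \<times> real \<Rightarrow> ennreal" and k :: "real \<Rightarrow> ennreal"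
  assumes W: "W \<in> borel_measurable borel" and k: "k \<in> borel_measurable borel"
  shows "(\<integral>\<^sup>+ t. k (snd (snd t)) * W (fst t, fst (snd t) + a * snd (snd t)) \<partial>(lborel :: (real\<times>real\<times>real) measure))
    = (\<integral>\<^sup>+ h. k h \<partial>lborel) * (\<integral>\<^sup>+ z. W z \<partial>lborel)"
proof -
  have m: "(\<lambda>t::real\<times>real\<times>real. k (snd (snd t)) * W (fst t, fst (snd t) + a * snd (snd t))) \<in> borel_measurable borel"
    by (rule borel_measurable_times_ennreal; rule measurable_borel_pairI[OF k] measurable_borel_pairI[OF W]; intro continuous_intros)
  have m2: "(\<lambda>p::real\<times>real. k (snd p) * W (x, fst p + a * snd p)) \<in> borel_measurable borel" for x
    by (rule borel_measurable_times_ennreal; rule measurable_borel_pairI[OF k] measurable_borel_pairI[OF W]; intro continuous_intros)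
  have Wx: "(\<lambda>y. W (x, y)) \<in> borel_measurable borel" for x by (rule measurable_Pair_section[OF W])
  have "(\<integral>\<^sup>+ t. k (snd (snd t)) * W (fst t, fst (snd t) + a * snd (snd t)) \<partial>(lborel :: (real\<times>real\<times>real) measure))
    = (\<integral>\<^sup>+ x. \<integral>\<^sup>+ y. \<integral>\<^sup>+ h. k h * W (x, y + a * h) \<partial>lborel \<partial>lborel \<partial>lborel)"
    unfolding nn_integral_real3[OF m] by simp
  also have "\<dots> = (\<integral>\<^sup>+ x. \<integral>\<^sup>+ h. \<integral>\<^sup>+ y. k h * W (x, y + a * h) \<partial>lborel \<partial>lborel \<partial>lborel)"
    using nn_integral_real2_swap[OF m2] by simp
  also have "\<dots> = (\<integral>\<^sup>+ x. \<integral>\<^sup>+ h. k h * (\<integral>\<^sup>+ y. W (x, y) \<partial>lborel) \<partial>lborel \<partial>lborel)"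
  proof (intro nn_integral_cong)
    fix x h :: real
    have "(\<lambda>y. W (x, y + a * h)) \<in> borel_measurable lborel"
      using measurable_borel_pairI[OF Wx, of "\<lambda>y. y + a * h"] by (simp add: continuous_intros)
    then have "(\<integral>\<^sup>+ y. k h * W (x, y + a * h) \<partial>lborel) = k h * (\<integral>\<^sup>+ y. W (x, y + a * h) \<partial>lborel)" by (rule nn_integral_cmult)
    also have "(\<integral>\<^sup>+ y. W (x, y + a * h) \<partial>lborel) = (\<integral>\<^sup>+ y. W (x, y) \<partial>lborel)"
      using nn_integral_shift[OF Wx, of x "a * h"] by (simp add: add.commute)
    finally show "(\<integral>\<^sup>+ y. k h * W (x, y + a * h) \<partial>lborel) = k h * (\<integral>\<^sup>+ y. W (x, y) \<partial>lborel)" .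
  qed
  also have "\<dots> = (\<integral>\<^sup>+ x. (\<integral>\<^sup>+ h. k h \<partial>lborel) * (\<integral>\<^sup>+ y. W (x, y) \<partial>lborel) \<partial>lborel)"
    using k by (intro nn_integral_cong nn_integral_multc) simp
  also have "\<dots> = (\<integral>\<^sup>+ h. k h \<partial>lborel) * (\<integral>\<^sup>+ x. \<integral>\<^sup>+ y. W (x, y) \<partial>lborel \<partial>lborel)"
    by (rule nn_integral_cmult) (use lborel.borel_measurable_nn_integral_fst[of W lborel] W in \<open>simp add: lborel_prod\<close>)
  also have "(\<integral>\<^sup>+ x. \<integral>\<^sup>+ y. W (x, y) \<partial>lborel \<partial>lborel) = (\<integral>\<^sup>+ z. W z \<partial>lborel)" by (rule nn_integral_real2[OF W, symmetric])
  finally show ?thesis .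
qed

definition eta :: fn2 where "eta z = bump (fst z) * bump (snd z)"

lemma eta_test: "test_fun eta" "dxf eta = (\<lambda>z. bump1 (fst z) * bump (snd z))"
proof -
  have e: "eta = (\<lambda>z. bump (fst z) * bump (snd z))" by (rule ext) (rule eta_def)
  show "test_fun eta" "dxf eta = (\<lambda>z. bump1 (fst z) * bump (snd z))" unfolding e
    by (rule test_fun_prod[OF bump_deriv bump_cont(2) bump_supp(1) bump_deriv bump_cont(2) bump_supp(1), of 1]; simp)+
qed

lemma eta_x_test: "test_fun (\<lambda>z. bump1 (fst z) * bump (snd z))" "dxf (\<lambda>z. bump1 (fst z) * bump (snd z)) = (\<lambda>z. bump2 (fst z) * bump (snd z))"
  by (rule test_fun_prod[OF bump1_deriv bump_cont(3) bump_supp(2) bump_deriv bump_cont(2) bump_supp(1), of 1]; simp)+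

lemma eta_range: "0 \<le> eta z" "eta z \<le> 1"
  using bump_range by (auto simp: eta_def mult_le_one)

lemma eta_cont: "continuous_on UNIV eta" by (rule test_fun_continuous[OF eta_test(1)])

lemma eta_measurable [measurable]: "eta \<in> borel_measurable borel"
  by (rule borel_measurable_continuous_onI[OF eta_cont])

lemma ivl_measurable [measurable]: "ivl \<in> borel_measurable borel"
  unfolding ivl_def[abs_def] by measurable

lemma ivl_nonneg: "0 \<le> ivl y" by (simp add: ivl_def)

lemma bump_le_ivl: "bump x \<le> ivl x"
  using bump_range[of x] bump_supp(1)[of x] by (cases "\<bar>x\<bar> > 1") (auto simp: ivl_def indicator_def abs_le_iff)

definition box4 :: fn2 where "box4 z = ivl (fst z) * ivl (snd z)"

lemma box4: "box4 \<in> borel_measurable borel" "0 \<le> box4 z" "(\<integral>\<^sup>+ z. ennreal (box4 z) \<partial>lborel) = ennreal 16"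
proof -
  have m1: "(\<lambda>z::real\<times>real. ivl (fst z)) \<in> borel_measurable borel" "(\<lambda>z::real\<times>real. ivl (snd z)) \<in> borel_measurable borel"
    by (rule measurable_borel_pairI[OF ivl_measurable], intro continuous_intros)+
  then show m: "box4 \<in> borel_measurable borel" unfolding box4_def[abs_def] by measurable
  show "0 \<le> box4 z" by (simp add: box4_def ivl_nonneg)
  have i4: "(\<integral>\<^sup>+ y. ennreal (ivl y) \<partial>lborel) = ennreal 4"
  proof -
    have "(\<integral>\<^sup>+ y. ennreal (ivl y) \<partial>lborel) = (\<integral>\<^sup>+ y. indicator {-2..2} y \<partial>(lborel::real measure))"
      by (intro nn_integral_cong) (auto simp: ivl_def indicator_def)
    then show ?thesis by simp
  qed
  have mb: "(\<lambda>z. ennreal (box4 z)) \<in> borel_measurable borel" using m by simp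
  have "(\<integral>\<^sup>+ z. ennreal (box4 z) \<partial>lborel) = (\<integral>\<^sup>+ x. \<integral>\<^sup>+ y. ennreal (ivl x) * ennreal (ivl y) \<partial>lborel \<partial>lborel)"
    unfolding nn_integral_real2[OF mb] by (simp add: box4_def ennreal_mult ivl_nonneg)
  also have "\<dots> = (\<integral>\<^sup>+ x. ennreal (ivl x) * ennreal 4 \<partial>lborel)"
    by (intro nn_integral_cong) (simp add: nn_integral_cmult i4 del: ennreal_numeral)
  also have "\<dots> = ennreal 4 * ennreal 4" by (simp add: nn_integral_multc i4 del: ennreal_numeral)
  also have "\<dots> = ennreal 16" by (simp add: ennreal_mult[symmetric] del: ennreal_numeral)
  finally show "(\<integral>\<^sup>+ z. ennreal (box4 z) \<partial>lborel) = ennreal 16" .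
qed

lemma eta_H:
  assumes s: "0 < s" "s < 1"
  shows "inH s eta"
  unfolding inH_def
proof (intro conjI)
  show "memLp 2 eta" by (rule test_fun_memLp2[OF eta_test(1)])
  show "\<exists>g. has_weak_dx eta g" using test_fun_weak_dx[OF eta_test(1)] by blast
  obtain \<kappa> where \<kappa>: "\<kappa> > 0" "(\<integral>\<^sup>+ h. ennreal (kern s h) \<partial>lborel) \<le> ennreal \<kappa>" using kern_integral[OF s] by blast
  have gm: "gag_integrand s eta eta \<in> borel_measurable borel" by measurable
  let ?T = "\<lambda>t::real\<times>real\<times>real. (fst t, fst (snd t), fst (snd t) + snd (snd t))"
  let ?k = "\<lambda>h. ennreal (36 * kern s h)" and ?W = "\<lambda>z. ennreal (box4 z)"
  have km: "?k \<in> borel_measurable borel" by measurable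
  have Wm: "?W \<in> borel_measurable borel" using box4(1) by measurable
  have pt: "ennreal (gag_integrand s eta eta (?T t)) \<le> ?k (snd (snd t)) * ?W (fst t, fst (snd t) + 0 * snd (snd t)) + ?k (snd (snd t)) * ?W (fst t, fst (snd t) + 1 * snd (snd t))" for t
  proof -
    obtain x y h where t: "t = (x, y, h)" by (cases t) auto
    have b: "(bump x)^2 \<le> ivl x" using bump_le_ivl[of x] bump_range[of x] mult_left_le[of "bump x" "bump x"] by (simp add: power2_eq_square)
    have "gag_integrand s eta eta (?T t) = (bump x)^2 * (bump y - bump (y + h))^2 / \<bar>h\<bar> powr (1 + 2 * s)"
      by (simp add: t gag_eq eta_def power2_eq_square algebra_simps)
    also have "\<dots> \<le> ivl x * (36 * min 1 ((y + h - y)^2) * (ivl y + ivl (y + h))) / \<bar>h\<bar> powr (1 + 2 * s)"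
      by (intro divide_right_mono mult_mono b bump_first_difference) (auto simp: ivl_nonneg)
    also have "\<dots> = 36 * kern s h * (box4 (x, y) + box4 (x, y + h))" by (simp add: kern_def box4_def algebra_simps)
    finally have "gag_integrand s eta eta (?T t) \<le> 36 * kern s h * (box4 (x, y) + box4 (x, y + h))" .
    then have "ennreal (gag_integrand s eta eta (?T t)) \<le> ennreal (36 * kern s h * (box4 (x, y) + box4 (x, y + h)))" by (rule ennreal_leI)
    also have "\<dots> = ?k h * (?W (x, y) + ?W (x, y + h))" using kern_nonneg box4(2) by (simp add: ennreal_mult ennreal_plus del: ennreal_numeral)
    finally show ?thesis by (simp add: t distrib_left del: ennreal_numeral)
  qed
  have mm: "(\<lambda>t::real\<times>real\<times>real. ?k (snd (snd t)) * ?W (fst t, fst (snd t) + a * snd (snd t))) \<in> borel_measurable lborel" for a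
    unfolding borel_measurable_lborel
    by (rule borel_measurable_times_ennreal; rule measurable_borel_pairI[OF km] measurable_borel_pairI[OF Wm]; intro continuous_intros)
  have "(\<integral>\<^sup>+ t. ennreal (gag_integrand s eta eta t) \<partial>lborel) = (\<integral>\<^sup>+ t. ennreal (gag_integrand s eta eta (?T t)) \<partial>lborel)"
    using preserving_nn_integral[OF preserving_shear, of "\<lambda>t. ennreal (gag_integrand s eta eta t)"] gm by simp
  also have "\<dots> \<le> (\<integral>\<^sup>+ t. ?k (snd (snd t)) * ?W (fst t, fst (snd t) + 0 * snd (snd t)) + ?k (snd (snd t)) * ?W (fst t, fst (snd t) + 1 * snd (snd t)) \<partial>(lborel :: (real\<times>real\<times>real) measure))"
    by (intro nn_integral_mono pt)
  also have "\<dots> = (\<integral>\<^sup>+ h. ?k h \<partial>lborel) * ennreal 16 + (\<integral>\<^sup>+ h. ?k h \<partial>lborel) * ennreal 16"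
    unfolding nn_integral_add[OF mm mm] kern_weight[OF Wm km] box4(3) ..
  also have "\<dots> < \<infinity>"
  proof -
    have "(\<integral>\<^sup>+ h. ?k h \<partial>lborel) = ennreal 36 * (\<integral>\<^sup>+ h. ennreal (kern s h) \<partial>lborel)"
      by (subst nn_integral_cmult[symmetric]) (auto simp: ennreal_mult kern_nonneg simp del: ennreal_numeral)
    also have "\<dots> \<le> ennreal 36 * ennreal \<kappa>" using \<kappa> by (intro mult_left_mono) auto
    also have "\<dots> < \<infinity>" by (simp add: ennreal_mult_less_top)
    finally show ?thesis by (simp add: ennreal_mult_less_top)
  qed
  finally have "(\<integral>\<^sup>+ t. ennreal (gag_integrand s eta eta t) \<partial>lborel) < \<infinity>" .
  then show "fracy_fin s eta" unfolding fracy_fin_def using gm by (intro integrableI_bounded) (auto simp: gag_nonneg)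
qed

text \<open>The difference of \<open>w\<close> is removed by symmetry: exchanging y and y' leaves
  \<open>w\<close> at one point against the difference of \<open>eta\<close>, and averaging over h
  and -h turns this into a second difference. The two halves need not be integrable at the diagonal,
  so the argument is carried out off a strip whose width, absent from the bound, tends to
  zero.\<close>

lemma eta_gag_bound:
  assumes s: "0 < s" "s < 1"
  obtains B where "B > 0" "\<And>w. inH s w \<Longrightarrow> \<bar>LINT t|lborel. gag_integrand s w eta t\<bar> \<le> B * (1 + Lpow 2 w)"
proof -
  obtain \<kappa> where \<kappa>: "\<kappa> > 0" "(\<integral>\<^sup>+ h. ennreal (kern s h) \<partial>lborel) \<le> ennreal \<kappa>" using kern_integral[OF s] by blast
  define B where "B = 60 * \<kappa> * 48"
  show thesis
  proof (rule that[of B])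
    show "B > 0" using \<kappa> by (simp add: B_def)
    fix w assume w: "inH s w"
    have wm[measurable]: "w \<in> borel_measurable borel" and wL: "memLp 2 w" using w inH_measurable inH_memLp by auto
    have E: "inH s eta" by (rule eta_H[OF s])
    have gi: "integrable lborel (gag_integrand s w eta)" by (rule gag_integrable[OF w E])
    have gm: "gag_integrand s w eta \<in> borel_measurable borel" by (rule gag_measurable) measurable
    let ?I = "LINT t|lborel. gag_integrand s w eta t"
    define M where "M = Lpow 2 w"
    have M0: "M \<ge> 0" by (simp add: M_def Lpow_nonneg)
    have cut: "\<bar>LINT t|lborel. (if \<bar>fst (snd t) - snd (snd t)\<bar> > \<delta> then gag_integrand s w eta t else 0)\<bar> \<le> 60 * \<kappa> * (3 * M + 48)"
      if \<delta>: "\<delta> > 0" for \<delta>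
    proof -
      define k where "k = (\<lambda>h::real. if \<bar>h\<bar> > \<delta> then 1 / \<bar>h\<bar> powr (1 + 2 * s) else 0)"
      have km[measurable]: "k \<in> borel_measurable borel" unfolding k_def by measurable
      have k0: "k h \<ge> 0" for h by (simp add: k_def)
      have kev: "k (- h) = k h" for h by (simp add: k_def)
      \<comment> \<open>This constant blows up as the strip shrinks; it serves integrability only,
        while the bound itself rests on \<open>kmin\<close>.\<close>
      define c where "c = 1 / min 1 (\<delta>^2)"
      have c: "c > 0" using \<delta> by (simp add: c_def)
      have kk: "k h \<le> c * kern s h" for h
      proof (cases "\<bar>h\<bar> > \<delta>")
        case True
        have "\<delta>^2 \<le> \<bar>h\<bar>^2" using True \<delta> by (intro power_mono) auto
        then have "min 1 (\<delta>^2) \<le> min 1 (h^2)" by auto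
        then have "1 \<le> c * min 1 (h^2)" using \<delta> unfolding c_def by (simp add: field_simps)
        then have "1 / \<bar>h\<bar> powr (1 + 2 * s) \<le> (c * min 1 (h^2)) / \<bar>h\<bar> powr (1 + 2 * s)" by (intro divide_right_mono) auto
        then show ?thesis using True by (simp add: k_def kern_def)
      next
        case False then show ?thesis using c kern_nonneg by (simp add: k_def)
      qed
      have kmin: "k h * min 1 (h^2) \<le> kern s h" for h by (simp add: k_def kern_def)
      let ?A = "\<lambda>t::real\<times>real\<times>real. w (fst t, fst (snd t)) * (eta (fst t, fst (snd t)) - eta (fst t, snd (snd t))) * k (fst (snd t) - snd (snd t))"
      let ?sw = "\<lambda>t::real\<times>real\<times>real. (fst t, snd (snd t), fst (snd t))"
      let ?sh = "\<lambda>t::real\<times>real\<times>real. (fst t, fst (snd t), fst (snd t) + snd (snd t))"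
      let ?rf = "\<lambda>t::real\<times>real\<times>real. (fst t, fst (snd t), - snd (snd t))"
      have kd: "(\<lambda>t::real\<times>real\<times>real. k (fst (snd t) - snd (snd t))) \<in> borel_measurable borel"
        by (rule measurable_borel_pairI[OF km]) (intro continuous_intros)
      have Am: "?A \<in> borel_measurable borel"
        by (intro borel_measurable_times borel_measurable_diff measurable_sections(1)[OF wm] measurable_sections(1)[OF eta_measurable] measurable_sections(2)[OF eta_measurable] kd)
      \<comment> \<open>Expanding the product of differences: the second half is the first with y
        and y' exchanged, since the kernel is even.\<close>
      have eq: "(if \<bar>fst (snd t) - snd (snd t)\<bar> > \<delta> then gag_integrand s w eta t else 0) = ?A t + ?A (?sw t)" for t
      proof -
        have kev': "k (snd (snd t) - fst (snd t)) = k (fst (snd t) - snd (snd t))" using kev[of "fst (snd t) - snd (snd t)"] by simp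
        show ?thesis unfolding fst_conv snd_conv kev' by (simp add: k_def gag_eq algebra_simps add_divide_distrib diff_divide_distrib)
      qed
      have Ai: "integrable lborel ?A"
      proof -
        have W2m: "(\<lambda>z. ennreal ((w z)^2)) \<in> borel_measurable borel" by measurable
        have km2: "(\<lambda>h. ennreal (k h)) \<in> borel_measurable borel" by measurable
        let ?F = "\<lambda>t::real\<times>real\<times>real. (w (fst t, fst (snd t)))^2 * k (fst (snd t) - snd (snd t))"
        have Fm: "?F \<in> borel_measurable borel"
          by (intro borel_measurable_times borel_measurable_power measurable_sections(1)[OF wm] kd)
        have "integrable lborel ?F"
        proof (rule integrableI_bounded)
          show "?F \<in> borel_measurable lborel" using Fm by simp
          have "(\<integral>\<^sup>+ t. ennreal (norm (?F t)) \<partial>lborel) = (\<integral>\<^sup>+ t. ennreal (?F (?sh t)) \<partial>lborel)"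
            using preserving_nn_integral[OF preserving_shear, of "\<lambda>t. ennreal (?F t)"] Fm k0 by simp
          also have "\<dots> = (\<integral>\<^sup>+ t. ennreal (k (snd (snd t))) * ennreal ((w (fst t, fst (snd t) + 0 * snd (snd t)))^2) \<partial>(lborel :: (real\<times>real\<times>real) measure))"
            by (intro nn_integral_cong) (simp add: kev ennreal_mult[symmetric] k0 mult.commute)
          also have "\<dots> = (\<integral>\<^sup>+ h. ennreal (k h) \<partial>lborel) * ennreal M"
            unfolding kern_weight[OF W2m km2] nn_integral_L2[OF wL] M_def ..
          also have "\<dots> \<le> (\<integral>\<^sup>+ h. ennreal c * ennreal (kern s h) \<partial>lborel) * ennreal M"
            using kk c by (intro mult_right_mono nn_integral_mono) (auto simp: ennreal_mult[symmetric] kern_nonneg ennreal_leI)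
          also have "\<dots> \<le> (ennreal c * ennreal \<kappa>) * ennreal M"
            using \<kappa>(2) by (subst nn_integral_cmult) (auto intro!: mult_right_mono mult_left_mono)
          also have "\<dots> < \<infinity>" by (simp add: ennreal_mult_less_top)
          finally show "(\<integral>\<^sup>+ t. ennreal (norm (?F t)) \<partial>lborel) < \<infinity>" .
        qed
        moreover have "integrable lborel (gag_integrand s eta eta)" by (rule gag_integrable[OF E E])
        ultimately have "integrable lborel (\<lambda>t. ?F t + gag_integrand s eta eta t)" by simp
        then show ?thesis
        proof (rule Bochner_Integration.integrable_bound)
          show "?A \<in> borel_measurable lborel" using Am by simp
          show "AE t in lborel. norm (?A t) \<le> norm (?F t + gag_integrand s eta eta t)"
          proof (intro AE_I2)
            fix t :: "real\<times>real\<times>real"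
            let ?a = "w (fst t, fst (snd t))" and ?b = "eta (fst t, fst (snd t)) - eta (fst t, snd (snd t))" and ?k = "k (fst (snd t) - snd (snd t))"
            have ab: "\<bar>?a * ?b\<bar> \<le> ?a^2 + ?b^2"
            proof -
              have "\<bar>?a * ?b\<bar> \<le> 2 * \<bar>?a\<bar> * \<bar>?b\<bar>" by (simp add: abs_mult)
              also have "\<dots> \<le> \<bar>?a\<bar>^2 + \<bar>?b\<bar>^2" by (rule sum_squares_bound)
              finally show ?thesis by simp
            qed
            have "\<bar>?A t\<bar> = \<bar>?a * ?b\<bar> * ?k" using k0 by (simp add: abs_mult)
            also have "\<dots> \<le> (?a^2 + ?b^2) * ?k" by (rule mult_right_mono[OF ab k0])
            also have "\<dots> = ?F t + ?b^2 * ?k" by (simp add: algebra_simps)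
            also have "\<dots> \<le> ?F t + gag_integrand s eta eta t" by (simp add: k_def gag_eq power2_eq_square)
            finally show "norm (?A t) \<le> norm (?F t + gag_integrand s eta eta t)"
              unfolding real_norm_def by (rule order_trans[OF _ abs_ge_self])
          qed
        qed
      qed
      have Aswi: "integrable lborel (\<lambda>t. ?A (?sw t))" using preserving_integrable[OF preserving_swap Am] Ai by simp
      let ?B = "\<lambda>t. ?A (?sh t)"
      have shm: "?sh \<in> borel_measurable borel" by (rule preserving_measurable[OF preserving_shear])
      have Bm: "?B \<in> borel_measurable borel" by (rule measurable_compose[OF shm Am])
      have Bi: "integrable lborel ?B" using preserving_integrable[OF preserving_shear Am] Ai by simp
      have Bri: "integrable lborel (\<lambda>t. ?B (?rf t))" using preserving_integrable[OF preserving_reflect Bm] Bi by simp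
      have "(LINT t|lborel. (if \<bar>fst (snd t) - snd (snd t)\<bar> > \<delta> then gag_integrand s w eta t else 0)) = (LINT t|lborel. ?A t + ?A (?sw t))"
        unfolding eq ..
      also have "\<dots> = (LINT t|lborel. ?A t) + (LINT t|lborel. ?A (?sw t))" by (rule Bochner_Integration.integral_add[OF Ai Aswi])
      also have "(LINT t|lborel. ?A (?sw t)) = (LINT t|lborel. ?A t)" by (rule preserving_integral[OF preserving_swap Am])
      also have "(LINT t|lborel. ?A t) = (LINT t|lborel. ?B t)" by (rule preserving_integral[OF preserving_shear Am, symmetric])
      \<comment> \<open>Both copies are equal, so one may be replaced by its reflection in the
        increment; their sum carries the second difference of \<open>eta\<close>.\<close>
      also have "(LINT t|lborel. ?B t) + (LINT t|lborel. ?B t) = (LINT t|lborel. ?B t) + (LINT t|lborel. ?B (?rf t))"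
        using preserving_integral[OF preserving_reflect Bm] by simp
      also have "\<dots> = (LINT t|lborel. ?B t + ?B (?rf t))" by (rule Bochner_Integration.integral_add[OF Bi Bri, symmetric])
      finally have I: "(LINT t|lborel. (if \<bar>fst (snd t) - snd (snd t)\<bar> > \<delta> then gag_integrand s w eta t else 0)) = (LINT t|lborel. ?B t + ?B (?rf t))" .
      let ?kk = "\<lambda>h. ennreal (60 * kern s h)"
      let ?W = "\<lambda>z. ennreal ((w z)^2)" and ?V = "\<lambda>z. ennreal (box4 z)"
      have kkm: "?kk \<in> borel_measurable borel" and Wm: "?W \<in> borel_measurable borel" by measurable
      have Vm: "?V \<in> borel_measurable borel" using box4(1) by measurable
      let ?k1 = "\<lambda>t::real\<times>real\<times>real. ?kk (snd (snd t))"
      let ?S = "\<lambda>f a. \<lambda>t::real\<times>real\<times>real. ?kk (snd (snd t)) * f (fst t, fst (snd t) + a * snd (snd t))"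
      have pt: "ennreal (norm (?B t + ?B (?rf t))) \<le> (?S ?W 0 t + ?S ?V 0 t) + ((?S ?W 0 t + ?S ?V 1 t) + (?S ?W 0 t + ?S ?V (-1) t))" for t
      proof -
        obtain x y h where t: "t = (x, y, h)" by (cases t) auto
        have "?B t + ?B (?rf t) = w (x, y) * (bump x * (2 * bump y - bump (y + h) - bump (y - h))) * k h"
          by (simp add: t eta_def kev algebra_simps)
        also have "norm \<dots> = \<bar>w (x, y)\<bar> * (bump x * \<bar>2 * bump y - bump (y + h) - bump (y - h)\<bar>) * k h"
          using bump_range[of x] k0 by (simp add: abs_mult)
        also have "\<dots> \<le> \<bar>w (x, y)\<bar> * (ivl x * (60 * min 1 (h^2) * (ivl y + ivl (y + h) + ivl (y - h)))) * k h"
          using bump_range[of x] k0 by (intro mult_right_mono mult_left_mono mult_mono bump_le_ivl bump_second_difference) (auto simp: ivl_nonneg)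
        also have "\<dots> = (k h * min 1 (h^2)) * (60 * (\<bar>w (x, y)\<bar> * (box4 (x, y) + box4 (x, y + h) + box4 (x, y - h))))"
          by (simp add: box4_def algebra_simps)
        also have "\<dots> \<le> kern s h * (60 * (\<bar>w (x, y)\<bar> * (box4 (x, y) + box4 (x, y + h) + box4 (x, y - h))))"
          by (rule mult_right_mono[OF kmin]) (simp add: box4(2))
        also have "\<dots> \<le> kern s h * (60 * (((w (x, y))^2 + box4 (x, y)) + (((w (x, y))^2 + box4 (x, y + h)) + ((w (x, y))^2 + box4 (x, y - h)))))"
        proof (intro mult_left_mono)
          have *: "\<bar>r\<bar> * box4 z \<le> r^2 + box4 z" for r z
          proof -
            have "box4 z = 0 \<or> box4 z = 1" by (auto simp: box4_def ivl_def indicator_def)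
            moreover have "\<bar>r\<bar> \<le> r^2 + 1"
            proof -
              have "2 * \<bar>r\<bar> * 1 \<le> \<bar>r\<bar>^2 + 1^2" by (rule sum_squares_bound)
              then show ?thesis by simp
            qed
            ultimately show ?thesis by auto
          qed
          show "\<bar>w (x, y)\<bar> * (box4 (x, y) + box4 (x, y + h) + box4 (x, y - h)) \<le> ((w (x, y))^2 + box4 (x, y)) + (((w (x, y))^2 + box4 (x, y + h)) + ((w (x, y))^2 + box4 (x, y - h)))"
            using *[of "w (x, y)" "(x, y)"] *[of "w (x, y)" "(x, y + h)"] *[of "w (x, y)" "(x, y - h)"] by (simp add: algebra_simps)
        qed (auto simp: kern_nonneg)
        finally have "norm (?B t + ?B (?rf t)) \<le> 60 * kern s h * (((w (x, y))^2 + box4 (x, y)) + (((w (x, y))^2 + box4 (x, y + h)) + ((w (x, y))^2 + box4 (x, y - h))))"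
          by (simp add: mult.assoc mult.left_commute)
        then have "ennreal (norm (?B t + ?B (?rf t))) \<le> ennreal (60 * kern s h * (((w (x, y))^2 + box4 (x, y)) + (((w (x, y))^2 + box4 (x, y + h)) + ((w (x, y))^2 + box4 (x, y - h)))))"
          by (rule ennreal_leI)
        also have "\<dots> = ?kk h * ((?W (x, y) + ?V (x, y)) + ((?W (x, y) + ?V (x, y + h)) + (?W (x, y) + ?V (x, y - h))))"
        proof -
          have n: "0 \<le> 60 * kern s h" "0 \<le> (w (x, y))^2" "0 \<le> box4 (x, y)" "0 \<le> box4 (x, y + h)" "0 \<le> box4 (x, y - h)"
            by (simp_all add: kern_nonneg box4(2))
          show ?thesis by (simp only: ennreal_mult ennreal_plus n add_nonneg_nonneg)
        qed
        finally show ?thesis by (simp add: t distrib_left del: ennreal_numeral)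
      qed
      have mS: "?S f a \<in> borel_measurable lborel" if f: "f \<in> borel_measurable borel" for f :: "real\<times>real \<Rightarrow> ennreal" and a
        unfolding borel_measurable_lborel
        by (rule borel_measurable_times_ennreal; rule measurable_borel_pairI[OF kkm] measurable_borel_pairI[OF f]; intro continuous_intros)
      let ?K = "\<integral>\<^sup>+ h. ?kk h \<partial>lborel"
      have Kb: "?K \<le> ennreal (60 * \<kappa>)"
      proof -
        have "?K = ennreal 60 * (\<integral>\<^sup>+ h. ennreal (kern s h) \<partial>lborel)"
          by (subst nn_integral_cmult[symmetric]) (auto simp: ennreal_mult kern_nonneg simp del: ennreal_numeral)
        also have "\<dots> \<le> ennreal 60 * ennreal \<kappa>" using \<kappa> by (intro mult_left_mono) auto
        also have "\<dots> = ennreal (60 * \<kappa>)" using \<kappa> by (simp add: ennreal_mult del: ennreal_numeral)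
        finally show ?thesis .
      qed
      have "ennreal (norm (LINT t|lborel. ?B t + ?B (?rf t))) \<le> (\<integral>\<^sup>+ t. ennreal (norm (?B t + ?B (?rf t))) \<partial>lborel)"
        by (rule integral_norm_bound_ennreal[OF Bochner_Integration.integrable_add[OF Bi Bri]])
      also have "\<dots> \<le> (\<integral>\<^sup>+ t. (?S ?W 0 t + ?S ?V 0 t) + ((?S ?W 0 t + ?S ?V 1 t) + (?S ?W 0 t + ?S ?V (-1) t)) \<partial>lborel)"
        by (intro nn_integral_mono pt)
      also have "\<dots> = (?K * ennreal M + ?K * ennreal 16) + ((?K * ennreal M + ?K * ennreal 16) + (?K * ennreal M + ?K * ennreal 16))"
      proof -
        have a1: "(\<integral>\<^sup>+ t. ?S ?W 0 t + ?S ?V a t \<partial>lborel) = ?K * ennreal M + ?K * ennreal 16" for a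
          unfolding nn_integral_add[OF mS[OF Wm] mS[OF Vm]] kern_weight[OF Wm kkm] kern_weight[OF Vm kkm] box4(3) nn_integral_L2[OF wL] M_def ..
        have m1: "(\<lambda>t. ?S ?W 0 t + ?S ?V a t) \<in> borel_measurable lborel" for a by (intro borel_measurable_add mS Wm Vm)
        have m2: "(\<lambda>t. (?S ?W 0 t + ?S ?V 1 t) + (?S ?W 0 t + ?S ?V (-1) t)) \<in> borel_measurable lborel" by (intro borel_measurable_add mS Wm Vm)
        show ?thesis unfolding nn_integral_add[OF m1 m2] nn_integral_add[OF m1 m1] a1 ..
      qed
      also have "\<dots> = ?K * (ennreal M + ennreal 16 + (ennreal M + ennreal 16 + (ennreal M + ennreal 16)))" by (simp only: distrib_left)
      also have "\<dots> \<le> ennreal (60 * \<kappa>) * (ennreal M + ennreal 16 + (ennreal M + ennreal 16 + (ennreal M + ennreal 16)))"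
        by (rule mult_right_mono[OF Kb]) simp
      also have "\<dots> = ennreal (60 * \<kappa> * (M + 16 + (M + 16 + (M + 16))))"
      proof -
        have n: "0 \<le> 60 * \<kappa>" "0 \<le> M" "(0::real) \<le> 16" using \<kappa> M0 by auto
        show ?thesis by (simp only: ennreal_mult ennreal_plus n add_nonneg_nonneg)
      qed
      finally have "norm (LINT t|lborel. ?B t + ?B (?rf t)) \<le> 60 * \<kappa> * (M + 16 + (M + 16 + (M + 16)))"
        using \<kappa> M0 by (subst (asm) ennreal_le_iff) auto
      then show ?thesis unfolding I by (simp add: algebra_simps)
    qed
    let ?d = "\<lambda>n::nat. 1 / real (Suc n)"
    let ?g = "\<lambda>n t. if \<bar>fst (snd t) - snd (snd t)\<bar> > ?d n then gag_integrand s w eta t else 0"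
    have dm: "(\<lambda>t::real\<times>real\<times>real. \<bar>fst (snd t) - snd (snd t)\<bar>) \<in> borel_measurable borel"
      by (intro borel_measurable_continuous_onI continuous_intros)
    note dm[measurable] gm[measurable]
    \<comment> \<open>The strips shrink to the diagonal, where the integrand is zero because both
      differences vanish.\<close>
    have "(\<lambda>n. LINT t|lborel. ?g n t) \<longlonglongrightarrow> ?I"
    proof (rule integral_dominated_convergence[where w="\<lambda>t. \<bar>gag_integrand s w eta t\<bar>"])
      show "AE t in lborel. (\<lambda>n. ?g n t) \<longlonglongrightarrow> gag_integrand s w eta t"
      proof (intro AE_I2)
        fix t :: "real\<times>real\<times>real"
        show "(\<lambda>n. ?g n t) \<longlonglongrightarrow> gag_integrand s w eta t"
        proof (cases "fst (snd t) = snd (snd t)")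
          case True
          then show ?thesis by (simp add: gag_eq)
        next
          case False
          then obtain N where N: "inverse (real (Suc N)) < \<bar>fst (snd t) - snd (snd t)\<bar>" using reals_Archimedean[of "\<bar>fst (snd t) - snd (snd t)\<bar>"] by auto
          have "?g n t = gag_integrand s w eta t" if "n \<ge> N" for n
          proof -
            have "1 / real (Suc n) \<le> 1 / real (Suc N)" using that by (intro divide_left_mono) auto
            then show ?thesis using N by (simp add: inverse_eq_divide)
          qed
          then show ?thesis by (intro tendsto_eventually eventually_sequentiallyI[of N])
        qed
      qed
    qed (use gi in auto)
    then have "(\<lambda>n. \<bar>LINT t|lborel. ?g n t\<bar>) \<longlonglongrightarrow> \<bar>?I\<bar>" by (rule tendsto_rabs)
    then have "\<bar>?I\<bar> \<le> 60 * \<kappa> * (3 * M + 48)" by (rule LIMSEQ_le_const2) (use cut in auto)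
    also have "\<dots> \<le> B * (1 + M)" using \<kappa> M0 by (simp add: B_def algebra_simps)
    finally show "\<bar>?I\<bar> \<le> B * (1 + Lpow 2 w)" by (simp add: M_def)
  qed
qed

text \<open>In the x-part the remaining derivative of \<open>w\<close> is moved to
  \<open>bump1\<close> as well, so that in both parts only the mass of \<open>w\<close>
  survives.\<close>

lemma eta_bound:
  assumes s: "0 < s" "s < 1"
  obtains B where "B > 0" "\<And>w. inH s w \<Longrightarrow> \<bar>innerK s w eta\<bar> \<le> B * (1 + Lpow 2 w)"
proof -
  obtain B where B: "B > 0" "\<And>w. inH s w \<Longrightarrow> \<bar>LINT t|lborel. gag_integrand s w eta t\<bar> \<le> B * (1 + Lpow 2 w)"
    using eta_gag_bound[OF s] by blast
  define D where "D = Lpow 2 (\<lambda>z. bump2 (fst z) * bump (snd z))"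
  have D: "D \<ge> 0" by (simp add: D_def Lpow_nonneg)
  have f: "frac_const s > 0" by (rule frac_const_pos[OF s])
  define B' where "B' = frac_const s * B + (1 + D)"
  have B': "B' > 0" using B f D by (simp add: B'_def add_pos_nonneg)
  have L2: "memLp 2 (\<lambda>z. bump2 (fst z) * bump (snd z))" using test_fun_memLp2(2)[OF eta_x_test(1)] unfolding eta_x_test(2) .
  have bnd: "\<bar>innerK s w eta\<bar> \<le> B' * (1 + Lpow 2 w)" if w: "inH s w" for w
  proof -
    have E: "inH s eta" by (rule eta_H[OF s])
    have wL: "memLp 2 w" using w inH_memLp by auto
    have ae: "AE z in lborel. wdx eta z = bump1 (fst z) * bump (snd z)"
      using weak_dx_unique[OF inH_wdx[OF E] test_fun_weak_dx[OF eta_test(1)]] unfolding eta_test(2) .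
    have m: "wdx w \<in> borel_measurable borel" "wdx eta \<in> borel_measurable borel" "(\<lambda>z. bump1 (fst z) * bump (snd z)) \<in> borel_measurable borel"
      using inH_measurable w E test_fun_memLp2(1)[OF eta_x_test(1)] by (auto simp: memLp2_iff)
    have "(LINT z|lborel. wdx w z * wdx eta z) = (LINT z|lborel. wdx w z * (bump1 (fst z) * bump (snd z)))"
      by (rule integral_cong_AE) (use m ae in \<open>auto elim!: eventually_mono\<close>)
    also have "\<dots> = - (LINT z|lborel. w z * (bump2 (fst z) * bump (snd z)))"
      using inH_wdx[OF w, unfolded has_weak_dx_def, THEN conjunct2, rule_format, OF eta_x_test(1)] unfolding eta_x_test(2) by simp
    finally have 1: "\<bar>LINT z|lborel. wdx w z * wdx eta z\<bar> = \<bar>LINT z|lborel. w z * (bump2 (fst z) * bump (snd z))\<bar>" by simp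
    have "ennreal (norm (LINT z|lborel. w z * (bump2 (fst z) * bump (snd z)))) \<le> (\<integral>\<^sup>+ z. ennreal (norm (w z * (bump2 (fst z) * bump (snd z)))) \<partial>lborel)"
      by (rule integral_norm_bound_ennreal[OF memLp2_mult[OF wL L2]])
    also have "\<dots> \<le> ennreal (Lpow 2 w + D)" unfolding real_norm_def D_def by (rule nn_integral_prod_bound[OF wL L2])
    finally have 2: "\<bar>LINT z|lborel. w z * (bump2 (fst z) * bump (snd z))\<bar> \<le> Lpow 2 w + D"
      using D Lpow_nonneg[of 2 w] by (subst (asm) ennreal_le_iff) auto
    have "\<bar>innerK s w eta\<bar> \<le> (Lpow 2 w + D) + frac_const s * (B * (1 + Lpow 2 w))"
    proof -
      have "\<bar>Gy s w eta\<bar> \<le> frac_const s * (B * (1 + Lpow 2 w))"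
        unfolding Gy_def abs_mult using f B(2)[OF w] by (simp add: mult_left_mono)
      then show ?thesis using 1 2 unfolding innerK_def by linarith
    qed
    also have "\<dots> \<le> B' * (1 + Lpow 2 w)"
      using mult_nonneg_nonneg[OF D Lpow_nonneg[of 2 w]] Lpow_nonneg[of 2 w] by (simp add: B'_def algebra_simps)
    finally show ?thesis .
  qed
  show thesis by (rule that[OF B' bnd])
qed

text \<open>The homogeneous dimension \<open>1 + 1/s\<close> is less than \<open>4\<close>, so the pairing of a square integrable function with
  the operator applied to a spreading cutoff tends to zero.\<close>
lemma Liouville:
  assumes s: "1/2 < s" "s < 1" and u: "inH s u" and f: "f \<in> borel_measurable borel" "\<And>z. f z \<ge> 0"
    and i: "\<And>l. l > 0 \<Longrightarrow> integrable lborel (\<lambda>z. f z * dil s 1 l eta z)"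
    and super: "\<And>l. l > 0 \<Longrightarrow> (LINT z|lborel. f z * dil s 1 l eta z) \<le> innerK s u (dil s 1 l eta)"
  shows "AE z in lborel. f z = 0"
proof -
  have s0: "0 < s" using s by simp
  obtain B where B: "B > 0" "\<And>w. inH s w \<Longrightarrow> \<bar>innerK s w eta\<bar> \<le> B * (1 + Lpow 2 w)" using eta_bound[OF s0 s(2)] by blast
  have E: "inH s eta" by (rule eta_H[OF s0 s(2)])
  have um: "u \<in> borel_measurable borel" using u inH_measurable by auto
  \<comment> \<open>Two from the order of the operator minus half of the homogeneous dimension
    \<open>1 + 1/s\<close>; positivity of this number drives the proof.\<close>
  define e where "e = (3 - 1/s) / 2"
  have e: "e > 0" using s by (simp add: e_def field_simps)
  have bnd: "(LINT z|lborel. f z * dil s 1 l eta z) \<le> B * (1 + Lpow 2 u) * l powr e" if l: "l > 0" for l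
  proof -
    \<comment> \<open>The amplitude for which the rescaled function has the mass of
      \<open>u\<close>, so that the bound for the fixed cutoff applies with a constant free of
      \<open>l\<close>.\<close>
    define c where "c = l powr (- ((1 + 1/s) / 2))"
    have c: "c > 0" using l by (simp add: c_def)
    let ?w = "dil s c (1 / l) u"
    have l1: "1 / l > 0" using l by simp
    have w: "inH s ?w" by (rule dil_H[OF l1 s0 u])
    have c2: "c^2 = l powr (- (1 + 1/s))"
    proof -
      have "c^2 = c powr 2" by (rule powr_sq[OF c])
      also have "\<dots> = l powr (- ((1 + 1/s) / 2) * 2)" unfolding c_def by (rule powr_powr)
      also have "- ((1 + 1/s) / 2) * 2 = - (1 + 1/s)"
      proof -
        have "- (X / 2) * 2 = - X" for X :: real by simp
        then show ?thesis .
      qed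
      finally show ?thesis .
    qed
    have "Lpow 2 ?w = c^2 / (1 / l) powr (1 + 1/s) * Lpow 2 u"
      using Lpow_dil[OF um l1, of 2 s c] c by (simp add: powr_numeral)
    also have "(1 / l) powr (1 + 1/s) = l powr (- (1 + 1/s))" unfolding powr_minus_divide using l by (simp add: powr_divide)
    finally have M: "Lpow 2 ?w = Lpow 2 u" using l by (simp add: c2)
    have "u = dil s (1 / c) l ?w" unfolding dil_dil[OF l l1] using c l by (simp add: dil_one)
    then have "innerK s u (dil s 1 l eta) = innerK s (dil s (1 / c) l ?w) (dil s 1 l eta)" by simp
    also have "\<dots> = 1 / c * l powr (1 - 1/s) * innerK s ?w eta" using innerK_dil[OF l s0 w E, of "1 / c" 1] by simp
    also have "\<dots> \<le> 1 / c * l powr (1 - 1/s) * (B * (1 + Lpow 2 u))"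
      using B(2)[OF w] c by (intro mult_left_mono) (auto simp: M)
    also have "1 / c * l powr (1 - 1/s) = l powr e"
    proof -
      have "1 / c = l powr ((1 + 1/s) / 2)" unfolding c_def by (simp add: powr_minus_divide)
      then have "1 / c * l powr (1 - 1/s) = l powr ((1 + 1/s) / 2 + (1 - 1/s))" by (simp only: powr_add)
      also have "(1 + 1/s) / 2 + (1 - 1/s) = e" by (simp add: e_def field_simps)
      finally show ?thesis .
    qed
    finally show ?thesis using super[OF l] by (simp add: mult.commute)
  qed
  let ?l = "\<lambda>n::nat. 1 / real (Suc n)"
  have lpos: "?l n > 0" for n by simp
  have llim: "?l \<longlonglongrightarrow> 0" using LIMSEQ_inverse_real_of_nat by (simp add: inverse_eq_divide)
  have dn: "dil s 1 l eta z \<ge> 0" for l z by (simp add: dil_def eta_range)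
  have dm: "dil s 1 l eta \<in> borel_measurable borel" for l by (rule dil_measurable) measurable
  note f(1)[measurable] dm[measurable]
  \<comment> \<open>Prepares Fatou: the dilated cutoffs converge everywhere to
    \<open>eta 0 = 1\<close>.\<close>
  have "(\<integral>\<^sup>+ z. ennreal (f z) \<partial>lborel) = (\<integral>\<^sup>+ z. liminf (\<lambda>n. ennreal (f z * dil s 1 (?l n) eta z)) \<partial>lborel)"
  proof (rule nn_integral_cong)
    fix z :: "real \<times> real"
    have "(\<lambda>n. (?l n * fst z, ?l n powr (1/s) * snd z)) \<longlonglongrightarrow> (0 * fst z, 0 * snd z)"
    proof (intro tendsto_intros llim)
      have "(\<lambda>n. ?l n powr (1/s)) \<longlonglongrightarrow> 0"
        using tendsto_powr'[OF llim tendsto_const[of "1/s"]] s0 by simp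
      then show "(\<lambda>n. ?l n powr (1/s)) \<longlonglongrightarrow> 0" .
    qed
    then have "(\<lambda>n. eta (?l n * fst z, ?l n powr (1/s) * snd z)) \<longlonglongrightarrow> eta (0 * fst z, 0 * snd z)"
      using eta_cont by (intro isCont_tendsto_compose[of _ eta]) (auto simp: continuous_on_eq_continuous_at)
    then have "(\<lambda>n. f z * dil s 1 (?l n) eta z) \<longlonglongrightarrow> f z * eta 0"
      unfolding dil_def by (intro tendsto_intros) (simp add: zero_prod_def)
    moreover have "eta 0 = 1" by (simp add: eta_def bump_def)
    ultimately have L: "(\<lambda>n. ennreal (f z * dil s 1 (?l n) eta z)) \<longlonglongrightarrow> ennreal (f z)" by (simp add: tendsto_ennrealI)
    show "ennreal (f z) = liminf (\<lambda>n. ennreal (f z * dil s 1 (?l n) eta z))"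
      by (rule lim_imp_Liminf[OF _ L, symmetric]) simp
  qed
  also have "\<dots> \<le> liminf (\<lambda>n. \<integral>\<^sup>+ z. ennreal (f z * dil s 1 (?l n) eta z) \<partial>lborel)"
    by (rule nn_integral_liminf) measurable
  also have "\<dots> \<le> liminf (\<lambda>n. ennreal (B * (1 + Lpow 2 u) * ?l n powr e))"
  proof (intro Liminf_mono always_eventually allI)
    fix n
    have "(\<integral>\<^sup>+ z. ennreal (f z * dil s 1 (?l n) eta z) \<partial>lborel) = ennreal (LINT z|lborel. f z * dil s 1 (?l n) eta z)"
      using i[OF lpos] f(2) dn by (intro nn_integral_eq_integral) auto
    then show "(\<integral>\<^sup>+ z. ennreal (f z * dil s 1 (?l n) eta z) \<partial>lborel) \<le> ennreal (B * (1 + Lpow 2 u) * ?l n powr e)"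
      using bnd[OF lpos] by (simp add: ennreal_leI)
  qed
  also have "\<dots> = 0"
  proof -
    have "(\<lambda>n. ?l n powr e) \<longlonglongrightarrow> 0" using tendsto_powr'[OF llim tendsto_const[of e]] e by simp
    then have "(\<lambda>n. B * (1 + Lpow 2 u) * ?l n powr e) \<longlonglongrightarrow> B * (1 + Lpow 2 u) * 0" by (rule tendsto_mult_left)
    then have "(\<lambda>n. ennreal (B * (1 + Lpow 2 u) * ?l n powr e)) \<longlonglongrightarrow> ennreal 0" by (intro tendsto_ennrealI) simp
    then show ?thesis using lim_imp_Liminf[of sequentially] by simp
  qed
  finally have "(\<integral>\<^sup>+ z. ennreal (f z) \<partial>lborel) = 0" by simp
  then have "AE z in lborel. ennreal (f z) = 0" by (subst (asm) nn_integral_0_iff_AE) auto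
  then show ?thesis by eventually_elim (use f(2) in \<open>auto simp: ennreal_eq_0_iff intro: antisym\<close>)
qed

subsection \<open>Saturation of the mass\<close>

text \<open>Convexity of the power. Dividing by \<open>a\<close> reduces it to Bernoulli's
  inequality when \<open>1 + b / a > 0\<close>; otherwise the left-hand side is nonpositive.\<close>

lemma abs_powr_tangent:
  fixes a b p :: real
  assumes p: "p > 1"
  shows "\<bar>a\<bar> powr p + p * (sgn a * \<bar>a\<bar> powr (p - 1) * b) \<le> \<bar>a + b\<bar> powr p"
proof (cases "a = 0")
  case False
  define t where "t = b / a"
  have "1 + p * t \<le> \<bar>1 + t\<bar> powr p"
  proof (cases "1 + t > 0")
    case True
    then show ?thesis using powr_Bernoulli_le[OF p True] by simp
  next
    case F: False
    then have "p * t \<le> p * (-1)" using p by (intro mult_left_mono) auto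
    then have "1 + p * t \<le> 0" using p by simp
    also have "0 \<le> \<bar>1 + t\<bar> powr p" by simp
    finally show ?thesis .
  qed
  then have "\<bar>a\<bar> powr p * (1 + p * t) \<le> \<bar>a\<bar> powr p * \<bar>1 + t\<bar> powr p" by (rule mult_left_mono) simp
  also have "\<dots> = \<bar>a * (1 + t)\<bar> powr p" by (simp add: abs_mult powr_mult)
  also have "a * (1 + t) = a + b" using False by (simp add: t_def field_simps)
  also have "\<bar>a\<bar> powr p * (1 + p * t) = \<bar>a\<bar> powr p + p * (sgn a * \<bar>a\<bar> powr (p - 1) * b)"
  proof -
    have "\<bar>a\<bar> powr p = \<bar>a\<bar> powr (p - 1) * \<bar>a\<bar>" using False by (simp add: powr_diff)
    moreover have "\<bar>a\<bar> * t = sgn a * b" using False by (simp add: t_def sgn_if)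
    ultimately show ?thesis by (simp add: algebra_simps)
  qed
  finally show ?thesis .
qed simp

text \<open>A one-sided substitute for differentiating \<open>Lpow p\<close>: the variations need
  the nonlinear term bounded from below, and convexity supplies that without passing to a
  limit.\<close>

lemma Lp_tangent:
  assumes p: "p > 1" and u: "memLp p u" and \<phi>: "memLp p \<phi>" and w: "memLp p (\<lambda>z. u z + \<phi> z)"
  shows "integrable lborel (\<lambda>z. sgn (u z) * \<bar>u z\<bar> powr (p - 1) * \<phi> z)"
    "Lpow p u + p * (LINT z|lborel. sgn (u z) * \<bar>u z\<bar> powr (p - 1) * \<phi> z) \<le> Lpow p (\<lambda>z. u z + \<phi> z)"
proof -
  have [measurable]: "u \<in> borel_measurable borel" "\<phi> \<in> borel_measurable borel" using u \<phi> by (auto simp: memLp_def)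
  have i: "integrable lborel (\<lambda>z. \<bar>u z\<bar> powr p + \<bar>\<phi> z\<bar> powr p)" using u \<phi> by (simp add: memLp_def)
  show j: "integrable lborel (\<lambda>z. sgn (u z) * \<bar>u z\<bar> powr (p - 1) * \<phi> z)"
  proof (rule Bochner_Integration.integrable_bound[OF i])
    show "(\<lambda>z. sgn (u z) * \<bar>u z\<bar> powr (p - 1) * \<phi> z) \<in> borel_measurable lborel" unfolding borel_measurable_lborel by measurable
    show "AE z in lborel. norm (sgn (u z) * \<bar>u z\<bar> powr (p - 1) * \<phi> z) \<le> norm (\<bar>u z\<bar> powr p + \<bar>\<phi> z\<bar> powr p)"
    proof (intro AE_I2)
      fix z
      have e: "\<bar>x\<bar> powr (p - 1) * \<bar>x\<bar> = \<bar>x\<bar> powr p" for x :: real by (cases "x = 0") (auto simp: powr_diff)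
      have "norm (sgn (u z) * \<bar>u z\<bar> powr (p - 1) * \<phi> z) \<le> \<bar>u z\<bar> powr (p - 1) * \<bar>\<phi> z\<bar>"
        by (auto simp: abs_mult abs_sgn_eq)
      also have "\<dots> \<le> \<bar>u z\<bar> powr p + \<bar>\<phi> z\<bar> powr p"
      proof (cases "\<bar>\<phi> z\<bar> \<le> \<bar>u z\<bar>")
        case True
        then have "\<bar>u z\<bar> powr (p - 1) * \<bar>\<phi> z\<bar> \<le> \<bar>u z\<bar> powr (p - 1) * \<bar>u z\<bar>" by (intro mult_left_mono) auto
        also have "\<dots> \<le> \<bar>u z\<bar> powr p + \<bar>\<phi> z\<bar> powr p" unfolding e by simp
        finally show ?thesis .
      next
        case False
        then have "\<bar>u z\<bar> powr (p - 1) * \<bar>\<phi> z\<bar> \<le> \<bar>\<phi> z\<bar> powr (p - 1) * \<bar>\<phi> z\<bar>" using p by (intro mult_right_mono powr_mono2) auto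
        also have "\<dots> \<le> \<bar>u z\<bar> powr p + \<bar>\<phi> z\<bar> powr p" unfolding e by simp
        finally show ?thesis .
      qed
      finally show "norm (sgn (u z) * \<bar>u z\<bar> powr (p - 1) * \<phi> z) \<le> norm (\<bar>u z\<bar> powr p + \<bar>\<phi> z\<bar> powr p)" by simp
    qed
  qed
  have "Lpow p u + p * (LINT z|lborel. sgn (u z) * \<bar>u z\<bar> powr (p - 1) * \<phi> z)
     = (LINT z|lborel. \<bar>u z\<bar> powr p + p * (sgn (u z) * \<bar>u z\<bar> powr (p - 1) * \<phi> z))"
    using u j by (simp add: Lpow_def memLp_def)
  also have "\<dots> \<le> Lpow p (\<lambda>z. u z + \<phi> z)" unfolding Lpow_def
    by (rule integral_mono) (use u j w abs_powr_tangent[OF p] in \<open>auto simp: memLp_def\<close>)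
  finally show "Lpow p u + p * (LINT z|lborel. sgn (u z) * \<bar>u z\<bar> powr (p - 1) * \<phi> z) \<le> Lpow p (\<lambda>z. u z + \<phi> z)" .
qed

context params
begin

text \<open>A nonnegative minimiser whose first mass were not saturated would be a supersolution of the homogeneous
  equation, which the Liouville property forbids.\<close>
lemma mass_saturated:
  assumes min: "(u, v) \<in> PS a b" "J u v = C a b" and upos: "AE z in lborel. u z \<ge> 0" and u0: "Lpow 2 u \<noteq> 0"
  shows "Lpow 2 u = a"
proof (rule ccontr)
  assume "Lpow 2 u \<noteq> a"
  then have slack: "Lpow 2 u < a" and vb: "Lpow 2 v \<le> b" and uH: "inH s u" and vH: "inH s v" and P0: "P u v = 0"
    using min(1) by (auto simp: PohoSet_def inD_def)
  have nt: "\<not> (Lpow 2 u = 0 \<and> Lpow 2 v = 0)" using u0 by simp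
  have uL: "memLp 2 u" and um[measurable]: "u \<in> borel_measurable borel" using uH inH_memLp inH_measurable by auto
  have uLp: "memLp p u" by (rule inH_memLp_p[OF s0 s(2) pqr2(1) p(2) uH])
  have p1: "p > 1" using pqr2 by simp
  define f where "f = (\<lambda>z. \<mu>1 * \<bar>u z\<bar> powr (p - 1))"
  have E: "inH s (dil s 1 l eta)" if "l > 0" for l by (rule dil_H[OF that s0 eta_H[OF s0 s(2)]])
  have En: "dil s 1 l eta z \<ge> 0" for l z by (simp add: dil_def eta_range)
  have fi: "integrable lborel (\<lambda>z. f z * dil s 1 l eta z) \<and>
      (LINT z|lborel. f z * dil s 1 l eta z) = \<mu>1 * (LINT z|lborel. sgn (u z) * \<bar>u z\<bar> powr (p - 1) * dil s 1 l eta z)" if l: "l > 0" for l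
  proof -
    let ?\<phi> = "dil s 1 l eta"
    have \<phi>Lp: "memLp p ?\<phi>" by (rule inH_memLp_p[OF s0 s(2) pqr2(1) p(2) E[OF l]])
    have \<phi>m[measurable]: "?\<phi> \<in> borel_measurable borel" using inH_measurable E[OF l] by blast
    have "memLp p (\<lambda>z. u z + ?\<phi> z)" using inH_memLp_p[OF s0 s(2) pqr2(1) p(2) inH_lin[OF uH E[OF l], of 1 1]] by simp
    note j = Lp_tangent(1)[OF p1 uLp \<phi>Lp this]
    have ae: "AE z in lborel. \<mu>1 * (sgn (u z) * \<bar>u z\<bar> powr (p - 1) * ?\<phi> z) = f z * ?\<phi> z"
      using upos by eventually_elim (auto simp: f_def sgn_if)
    have m: "(\<lambda>z. f z * ?\<phi> z) \<in> borel_measurable lborel" unfolding borel_measurable_lborel f_def by measurable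
    have mj: "(\<lambda>z. \<mu>1 * (sgn (u z) * \<bar>u z\<bar> powr (p - 1) * ?\<phi> z)) \<in> borel_measurable lborel" unfolding borel_measurable_lborel by measurable
    have "integrable lborel (\<lambda>z. f z * ?\<phi> z)" by (rule integrable_cong_AE_imp[OF integrable_mult_right[OF j] m]) (use ae in auto)
    moreover have "(LINT z|lborel. f z * ?\<phi> z) = (LINT z|lborel. \<mu>1 * (sgn (u z) * \<bar>u z\<bar> powr (p - 1) * ?\<phi> z))"
      by (rule integral_cong_AE[OF m mj]) (use ae in \<open>auto elim!: eventually_mono\<close>)
    ultimately show ?thesis by simp
  qed
  have "AE z in lborel. f z = 0"
  proof (rule Liouville[OF s uH])
    show "f \<in> borel_measurable borel" unfolding f_def by measurable
    show "\<And>z. f z \<ge> 0" using \<mu> by (simp add: f_def)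
    fix l :: real assume l: "l > 0"
    show "integrable lborel (\<lambda>z. f z * dil s 1 l eta z)" using fi[OF l] by simp
    let ?\<phi> = "dil s 1 l eta"
    have \<phi>H: "inH s ?\<phi>" by (rule E[OF l])
    have \<phi>L: "memLp 2 ?\<phi>" and \<phi>m[measurable]: "?\<phi> \<in> borel_measurable borel" using \<phi>H inH_memLp inH_measurable by auto
    have \<phi>Lp: "memLp p ?\<phi>" by (rule inH_memLp_p[OF s0 s(2) pqr2(1) p(2) \<phi>H])
    define d where "d = (LINT z|lborel. f z * ?\<phi> z)"
    define \<kappa> where "\<kappa> = innerK s u ?\<phi>"
    have d0: "d \<ge> 0" unfolding d_def using \<mu> En by (intro integral_nonneg_AE) (auto simp: f_def)
    \<comment> \<open>Otherwise adding a small multiple of the cutoff gains more in the nonlinear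
      term than it costs in the kinetic one, and the projected competitor beats the minimum.\<close>
    show "d \<le> \<kappa>"
    proof (rule ccontr)
      assume "\<not> d \<le> \<kappa>"
      then have dk: "\<kappa> < d" by simp
      define k where "k = Kf s u + Kf s v"
      have S: "k / 2 = (\<Sum>i<3. cf u v i * ex i)" using P0 unfolding P_zero_iff k_def .
      have c0: "cf u v 0 > 0"
      proof -
        have "\<not> (AE z in lborel. u z = 0)" using u0 Lpow2_zero_iff[OF uL] by simp
        then have "Lpow p u \<noteq> 0" using Lpow_zero_iff[OF uLp] by simp
        then show ?thesis using Lpow_nonneg[of p u] \<mu> pqr2 by (simp add: cf_def)
      qed
      have z3: "0 \<in> {..<3::nat}" by simp
      have "\<exists>\<epsilon>0>0. \<forall>\<epsilon> y. 0 < \<epsilon> \<longrightarrow> \<epsilon> < \<epsilon>0 \<longrightarrow> y > 0 \<longrightarrow>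
          y * (k / 2 + \<epsilon> * \<kappa> + \<epsilon>^2 * (Kf s ?\<phi> / 2)) - (\<Sum>i<3. cf u v i * y powr ex i) - \<epsilon> * d * y powr ex 0 < (\<Sum>i<3. cf u v i * (ex i - 1))"
      proof (rule scalar_variation[of "{..<3}" "cf u v" ex 0 k d \<kappa> "Kf s ?\<phi> / 2", OF finite_lessThan cf_nonneg ex_gt1 z3 c0 S d0 dk])
        fix e assume e: "0 < e" "\<And>\<epsilon> y. 0 < \<epsilon> \<Longrightarrow> \<epsilon> < e \<Longrightarrow> y > 0 \<Longrightarrow>
          y * (k / 2 + \<epsilon> * \<kappa> + \<epsilon>^2 * (Kf s ?\<phi> / 2)) - (\<Sum>i<3. cf u v i * y powr ex i) - \<epsilon> * d * y powr ex 0 < (\<Sum>i<3. cf u v i * (ex i - 1))"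
        show ?thesis using e(1) by (rule exI[of _ e, OF conjI]) (intro allI impI e(2))
      qed
      then obtain \<epsilon>0 where \<epsilon>0: "\<epsilon>0 > 0" and \<epsilon>0': "\<forall>\<epsilon> y. 0 < \<epsilon> \<longrightarrow> \<epsilon> < \<epsilon>0 \<longrightarrow> y > 0 \<longrightarrow>
          y * (k / 2 + \<epsilon> * \<kappa> + \<epsilon>^2 * (Kf s ?\<phi> / 2)) - (\<Sum>i<3. cf u v i * y powr ex i) - \<epsilon> * d * y powr ex 0 < (\<Sum>i<3. cf u v i * (ex i - 1))"
        by (elim exE conjE)
      \<comment> \<open>The slack in the mass is used here: for small positive
        \<open>\<epsilon>\<close> the competitor still has mass below \<open>a\<close>.\<close>
      have "((\<lambda>\<epsilon>. Lpow 2 u + 2 * \<epsilon> * (LINT z|lborel. u z * ?\<phi> z) + \<epsilon>^2 * Lpow 2 ?\<phi>) \<longlongrightarrow> Lpow 2 u + 2 * 0 * (LINT z|lborel. u z * ?\<phi> z) + 0^2 * Lpow 2 ?\<phi>) (at_right 0)"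
        by (intro tendsto_intros)
      then have "eventually (\<lambda>\<epsilon>. Lpow 2 u + 2 * \<epsilon> * (LINT z|lborel. u z * ?\<phi> z) + \<epsilon>^2 * Lpow 2 ?\<phi> < a) (at_right 0)"
        by (rule order_tendstoD) (use slack in simp)
      moreover have "eventually (\<lambda>\<epsilon>. \<epsilon> \<in> {0<..<\<epsilon>0}) (at_right (0::real))" using \<epsilon>0 eventually_at_right_real by blast
      ultimately have "eventually (\<lambda>\<epsilon>. Lpow 2 u + 2 * \<epsilon> * (LINT z|lborel. u z * ?\<phi> z) + \<epsilon>^2 * Lpow 2 ?\<phi> < a \<and> \<epsilon> \<in> {0<..<\<epsilon>0}) (at_right 0)"
        by (rule eventually_conj)
      then obtain \<epsilon> where \<epsilon>: "0 < \<epsilon>" "\<epsilon> < \<epsilon>0" "Lpow 2 u + 2 * \<epsilon> * (LINT z|lborel. u z * ?\<phi> z) + \<epsilon>^2 * Lpow 2 ?\<phi> < a"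
        using eventually_happens'[of "at_right (0::real)"] by (auto simp: trivial_limit_at_right_real)
      define w where "w = (\<lambda>z. u z + \<epsilon> * ?\<phi> z)"
      have w1: "w = (\<lambda>z. 1 * u z + \<epsilon> * ?\<phi> z)" by (simp add: w_def)
      have wH: "inH s w" unfolding w1 by (rule inH_lin[OF uH \<phi>H])
      have Mw: "Lpow 2 w = Lpow 2 u + 2 * \<epsilon> * (LINT z|lborel. u z * ?\<phi> z) + \<epsilon>^2 * Lpow 2 ?\<phi>"
        unfolding w1 L2_lin[OF uL \<phi>L] by simp
      have "(LINT z|lborel. u z * ?\<phi> z) \<ge> 0"
        by (rule integral_nonneg_AE) (use upos in \<open>eventually_elim, simp add: En\<close>)
      then have "\<epsilon> * (LINT z|lborel. u z * ?\<phi> z) \<ge> 0" using \<epsilon> by simp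
      moreover have "\<epsilon>^2 * Lpow 2 ?\<phi> \<ge> 0" by (simp add: Lpow_nonneg)
      moreover have "Lpow 2 u > 0" using u0 Lpow_nonneg[of 2 u] by linarith
      ultimately have "Lpow 2 w > 0" unfolding Mw by linarith
      then have ntw: "\<not> (Lpow 2 w = 0 \<and> Lpow 2 v = 0)" by simp
      have Ma: "Lpow 2 w \<le> a" using \<epsilon> unfolding Mw by simp
      have Kw: "Kf s w = Kf s u + 2 * \<epsilon> * \<kappa> + \<epsilon>^2 * Kf s ?\<phi>" unfolding w1 Kf_lin[OF uH \<phi>H] by (simp add: \<kappa>_def)
      obtain y where y: "y > 0" "C a b \<le> y * (Kf s w + Kf s v) / 2 - (\<Sum>i<3. cf w v i * y powr ex i)"
        using projection[OF wH vH ntw Ma vb] by blast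
      have wLp: "memLp p w" by (rule inH_memLp_p[OF s0 s(2) pqr2(1) p(2) wH])
      have \<epsilon>\<phi>: "memLp p (\<lambda>z. \<epsilon> * ?\<phi> z)" using inH_memLp_p[OF s0 s(2) pqr2(1) p(2) inH_lin[OF \<phi>H \<phi>H, of \<epsilon> 0]] by simp
      have c0': "cf w v 0 \<ge> cf u v 0 + \<epsilon> * d"
      proof -
        have "Lpow p u + p * (LINT z|lborel. sgn (u z) * \<bar>u z\<bar> powr (p - 1) * (\<epsilon> * ?\<phi> z)) \<le> Lpow p w"
          using Lp_tangent(2)[OF p1 uLp \<epsilon>\<phi>] wLp unfolding w_def by simp
        moreover have "(LINT z|lborel. sgn (u z) * \<bar>u z\<bar> powr (p - 1) * (\<epsilon> * ?\<phi> z)) = \<epsilon> * (LINT z|lborel. sgn (u z) * \<bar>u z\<bar> powr (p - 1) * ?\<phi> z)"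
          by (simp add: mult.left_commute)
        ultimately have "\<mu>1 / p * (Lpow p u + p * (\<epsilon> * (LINT z|lborel. sgn (u z) * \<bar>u z\<bar> powr (p - 1) * ?\<phi> z))) \<le> \<mu>1 / p * Lpow p w"
          using \<mu> pqr2 by (intro mult_left_mono) auto
        moreover have "\<mu>1 / p * (Lpow p u + p * (\<epsilon> * (LINT z|lborel. sgn (u z) * \<bar>u z\<bar> powr (p - 1) * ?\<phi> z))) = \<mu>1 / p * Lpow p u + \<epsilon> * d"
          using fi[OF l] pqr2 by (simp add: d_def field_simps)
        ultimately show ?thesis by (simp add: cf_def)
      qed
      \<comment> \<open>The competitor dominates \<open>u\<close>, and \<open>u\<close> is
        nonnegative, so the coupling can only grow; its contribution has the favourable sign and may
        be dropped.\<close>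
      have c2': "cf w v 2 \<ge> cf u v 2"
      proof -
        have Lr: "memLp (r1 + r2) x" if "inH s x" for x by (rule inH_memLp_p[OF s0 s(2) pqr2(3) rr(2) that])
        have "coupling r1 r2 u v \<le> coupling r1 r2 w v" unfolding coupling_def
        proof (rule integral_mono_AE)
          show "integrable lborel (\<lambda>z. \<bar>u z\<bar> powr r1 * \<bar>v z\<bar> powr r2)" "integrable lborel (\<lambda>z. \<bar>w z\<bar> powr r1 * \<bar>v z\<bar> powr r2)"
            using r Lr uH vH wH by (auto intro!: coupling_integrable)
          show "AE z in lborel. \<bar>u z\<bar> powr r1 * \<bar>v z\<bar> powr r2 \<le> \<bar>w z\<bar> powr r1 * \<bar>v z\<bar> powr r2"
            using upos
          proof eventually_elim
            case (elim z)
            have "\<bar>u z\<bar> \<le> \<bar>w z\<bar>" using elim \<epsilon>(1) En[of l z] by (simp add: w_def)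
            then show ?case using r by (intro mult_right_mono powr_mono2) auto
          qed
        qed
        then show ?thesis using \<mu> by (simp add: cf_def)
      qed
      have c1': "cf w v 1 = cf u v 1" by (simp add: cf_def)
      have "(\<Sum>i<3. cf u v i * y powr ex i) + \<epsilon> * d * y powr ex 0 \<le> (\<Sum>i<3. cf w v i * y powr ex i)"
      proof -
        have "(cf u v 0 + \<epsilon> * d) * y powr ex 0 \<le> cf w v 0 * y powr ex 0" by (rule mult_right_mono[OF c0']) simp
        moreover have "cf u v 2 * y powr ex 2 \<le> cf w v 2 * y powr ex 2" by (rule mult_right_mono[OF c2']) simp
        ultimately show ?thesis unfolding sum3 c1' by (simp add: algebra_simps)
      qed
      moreover have "y * (Kf s w + Kf s v) / 2 = y * (k / 2 + \<epsilon> * \<kappa> + \<epsilon>^2 * (Kf s ?\<phi> / 2))"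
        unfolding Kw k_def by (simp add: field_simps)
      ultimately have "C a b < (\<Sum>i<3. cf u v i * (ex i - 1))" using y(2) \<epsilon>0'[rule_format, OF \<epsilon>(1,2) y(1)] by linarith
      then show False using min(2) J_of_P_zero[OF P0] by simp
    qed
  qed
  then have "AE z in lborel. u z = 0" by eventually_elim (use \<mu> in \<open>auto simp: f_def\<close>)
  then show False using u0 Lpow2_zero_iff[OF uL] by simp
qed

end

section \<open>Exchange of the two components\<close>

lemma coupling_swap: "coupling r1 r2 u v = coupling r2 r1 v u"
  unfolding coupling_def by (simp add: mult.commute)

lemma Jf_swap: "Jf s \<mu>1 \<mu>2 \<beta> p q r1 r2 u v = Jf s \<mu>2 \<mu>1 \<beta> q p r2 r1 v u"
  unfolding Jf_def coupling_swap[of r1] by simp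

lemma Pf_swap: "Pf s \<mu>1 \<mu>2 \<beta> p q r1 r2 u v = Pf s \<mu>2 \<mu>1 \<beta> q p r2 r1 v u"
  unfolding Pf_def coupling_swap[of r1] by (simp add: add.commute[of r1])

lemma PohoSet_swap: "(u, v) \<in> PohoSet s \<mu>1 \<mu>2 \<beta> p q r1 r2 a b \<longleftrightarrow> (v, u) \<in> PohoSet s \<mu>2 \<mu>1 \<beta> q p r2 r1 b a"
  unfolding PohoSet_def Pf_swap[of s \<mu>1] by (auto simp: inD_def)

lemma Cab_swap: "Cab s \<mu>1 \<mu>2 \<beta> p q r1 r2 a b = Cab s \<mu>2 \<mu>1 \<beta> q p r2 r1 b a"
proof -
  have "(\<lambda>(u, v). Jf s \<mu>1 \<mu>2 \<beta> p q r1 r2 u v) ` PohoSet s \<mu>1 \<mu>2 \<beta> p q r1 r2 a b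
    = (\<lambda>(u, v). Jf s \<mu>2 \<mu>1 \<beta> q p r2 r1 u v) ` PohoSet s \<mu>2 \<mu>1 \<beta> q p r2 r1 b a" (is "?L = ?R")
  proof
    show "?L \<subseteq> ?R"
    proof
      fix x assume "x \<in> ?L"
      then obtain u v where m: "(u, v) \<in> PohoSet s \<mu>1 \<mu>2 \<beta> p q r1 r2 a b" and x: "x = Jf s \<mu>1 \<mu>2 \<beta> p q r1 r2 u v" by auto
      have "(v, u) \<in> PohoSet s \<mu>2 \<mu>1 \<beta> q p r2 r1 b a" using m by (rule iffD1[OF PohoSet_swap])
      moreover have "x = Jf s \<mu>2 \<mu>1 \<beta> q p r2 r1 v u" using x by (rule trans[OF _ Jf_swap])
      ultimately show "x \<in> ?R" by force
    qed
    show "?R \<subseteq> ?L"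
    proof
      fix x assume "x \<in> ?R"
      then obtain u v where m: "(u, v) \<in> PohoSet s \<mu>2 \<mu>1 \<beta> q p r2 r1 b a" and x: "x = Jf s \<mu>2 \<mu>1 \<beta> q p r2 r1 u v" by auto
      have "(v, u) \<in> PohoSet s \<mu>1 \<mu>2 \<beta> p q r1 r2 a b" using m by (rule iffD1[OF PohoSet_swap])
      moreover have "x = Jf s \<mu>1 \<mu>2 \<beta> p q r1 r2 v u" using x by (rule trans[OF _ Jf_swap])
      ultimately show "x \<in> ?L" by force
    qed
  qed
  then show ?thesis by (simp add: Cab_def)
qed

lemma (in params) swapped: "params s \<mu>2 \<mu>1 \<beta> q p r2 r1"
  by unfold_locales (use s \<mu> r p q rr in \<open>auto simp: add.commute\<close>)

subsection \<open>Composition with differentiable functions\<close>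

lemma L2_Cauchy_Schwarz:
  assumes "memLp 2 f" "memLp 2 g" "Lpow 2 f \<le> A^2" "Lpow 2 g \<le> B^2" "A \<ge> 0" "B \<ge> 0"
  shows "\<bar>LINT z|lborel. f z * g z\<bar> \<le> A * B"
proof -
  have m: "f \<in> borel_measurable borel" "g \<in> borel_measurable borel" using assms by (auto simp: memLp2_iff)
  note m[measurable]
  have "(ennreal (norm (LINT z|lborel. f z * g z)))^2 \<le> (\<integral>\<^sup>+ z. ennreal (norm (f z * g z)) \<partial>lborel)^2"
    by (intro power_mono integral_norm_bound_ennreal memLp2_mult assms) simp
  also have "\<dots> = (\<integral>\<^sup>+ z. ennreal \<bar>f z\<bar> * ennreal \<bar>g z\<bar> \<partial>lborel)^2" by (simp add: abs_mult ennreal_mult)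
  also have "\<dots> \<le> (\<integral>\<^sup>+ z. (ennreal \<bar>f z\<bar>)^2 \<partial>lborel) * (\<integral>\<^sup>+ z. (ennreal \<bar>g z\<bar>)^2 \<partial>lborel)"
    by (rule Cauchy_Schwarz_nn_integral) auto
  also have "\<dots> = ennreal (Lpow 2 f) * ennreal (Lpow 2 g)"
    using nn_integral_L2[OF assms(1)] nn_integral_L2[OF assms(2)] by (simp add: ennreal_power)
  also have "\<dots> \<le> ennreal (A^2) * ennreal (B^2)" using assms by (intro mult_mono ennreal_leI) auto
  also have "\<dots> = ennreal ((A * B)^2)" by (simp add: ennreal_mult power_mult_distrib)
  finally have "(LINT z|lborel. f z * g z)^2 \<le> (A * B)^2" by (simp add: ennreal_power ennreal_le_iff)
  then show ?thesis using assms by (metis abs_le_square_iff abs_of_nonneg mult_nonneg_nonneg)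
qed

text \<open>A first-order expansion in the step with quadratic remainder: the increment is the
  integral of shifted weak derivatives, and moving the shift to \<open>\<psi>\<close> costs its L^2
  modulus of continuity. It replaces mollification in the chain rule.\<close>

lemma difference_pairing:
  assumes v: "memLp 2 v" and g: "has_weak_dx v g" and \<psi>: "memLp 2 \<psi>" and D: "D \<ge> 0"
    and reg: "\<And>\<sigma>. \<sigma> \<ge> 0 \<Longrightarrow> Lpow 2 (\<lambda>z. \<psi> (fst z + \<sigma>, snd z) - \<psi> z) \<le> (D * \<sigma>)^2" and t: "t > 0"
  shows "\<bar>(LINT z|lborel. (v (fst z + t, snd z) - v z) * \<psi> z) - t * (LINT z|lborel. g z * \<psi> z)\<bar> \<le> sqrt (Lpow 2 g) * D * t^2"
proof -
  have gL: "memLp 2 g" using g by (simp add: has_weak_dx_def)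
  have vm: "v \<in> borel_measurable borel" and gm: "g \<in> borel_measurable borel" and \<psi>m: "\<psi> \<in> borel_measurable borel"
    using v gL \<psi> by (auto simp: memLp2_iff)
  let ?h = "\<lambda>\<sigma>. LINT z|lborel. g (fst z + \<sigma>, snd z) * \<psi> z"
  let ?c = "LINT z|lborel. g z * \<psi> z"
  have "(LINT z|lborel. (v (fst z + t, snd z) - v z) * \<psi> z) = (LINT z|lborel. x_avg t g z * \<psi> z)"
  proof (rule integral_cong_AE)
    show "AE z in lborel. (v (fst z + t, snd z) - v z) * \<psi> z = x_avg t g z * \<psi> z"
      using weak_dx_FTC[OF v g, of t] t by (auto elim!: eventually_mono)
  qed (use vm \<psi>m measurable_x_shift[OF vm, of t] x_avg_measurable[OF gm, of t] in auto)
  also have "\<dots> = (LINT \<sigma>|lborel. indicator {0..t} \<sigma> * ?h \<sigma>)" by (rule x_avg_pairing[OF gL \<psi>]) (use t in simp)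
  finally have 1: "(LINT z|lborel. (v (fst z + t, snd z) - v z) * \<psi> z) = (LINT \<sigma>|lborel. indicator {0..t} \<sigma> * ?h \<sigma>)" .
  have hi: "integrable lborel (\<lambda>\<sigma>. indicator {0..t} \<sigma> * ?h \<sigma>)"
  proof -
    have F: "integrable (lborel \<Otimes>\<^sub>M lborel) (\<lambda>p::real\<times>(real\<times>real). indicator {0..t} (fst p) * (g (fst (snd p) + 1 * fst p, snd (snd p)) * \<psi> (snd p)))"
      using strip_pairing[OF gL \<psi>, of t 1] t by (simp add: lborel_prod)
    show ?thesis using lborel_pair.integrable_fst'[OF F] by simp
  qed
  have ci: "integrable lborel (\<lambda>\<sigma>. indicator {0..t} \<sigma> * ?c)" by (intro integrable_mult_left integrable_real_indicator) (use t in \<open>auto simp: emeasure_lborel_Icc\<close>)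
  have c: "(LINT \<sigma>|lborel. indicator {0..t} \<sigma> * ?c) = t * ?c" using t by simp
  let ?b = "sqrt (Lpow 2 g) * D * t"
  have b0: "?b \<ge> 0" using D t by (simp add: Lpow_nonneg)
  have pt: "\<bar>indicator {0..t} \<sigma> * ?h \<sigma> - indicator {0..t} \<sigma> * ?c\<bar> \<le> indicator {0..t} \<sigma> * ?b" for \<sigma>
  proof (cases "\<sigma> \<in> {0..t}")
    case True
    then have \<sigma>: "0 \<le> \<sigma>" "\<sigma> \<le> t" by auto
    let ?\<psi> = "\<lambda>z. \<psi> (fst z + (- \<sigma>), snd z)"
    have \<psi>2: "memLp 2 ?\<psi>" by (rule memLp2_x_shift[OF \<psi>])
    have "?h \<sigma> = (LINT z|lborel. g z * ?\<psi> z)"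
      using integral_x_shift[of "\<lambda>z. g z * ?\<psi> z" \<sigma>] borel_measurable_times[OF gm measurable_x_shift[OF \<psi>m, of "- \<sigma>"]] by simp
    then have "?h \<sigma> - ?c = (LINT z|lborel. g z * (?\<psi> z - \<psi> z))"
      using memLp2_mult[OF gL \<psi>2] memLp2_mult[OF gL \<psi>] by (simp add: right_diff_distrib)
    moreover have "\<bar>LINT z|lborel. g z * (?\<psi> z - \<psi> z)\<bar> \<le> sqrt (Lpow 2 g) * (D * \<sigma>)"
    proof (rule L2_Cauchy_Schwarz[OF gL])
      show dL: "memLp 2 (\<lambda>z. ?\<psi> z - \<psi> z)" using memLp2_lin[OF \<psi>2 \<psi>, of 1 "-1"] by simp
      have "Lpow 2 (\<lambda>z. ?\<psi> z - \<psi> z) = Lpow 2 (\<lambda>z. ?\<psi> (fst z + \<sigma>, snd z) - \<psi> (fst z + \<sigma>, snd z))"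
        using Lpow2_x_shift[of "\<lambda>z. ?\<psi> z - \<psi> z" \<sigma>] dL by (simp add: memLp2_iff)
      also have "\<dots> = Lpow 2 (\<lambda>z. \<psi> (fst z + \<sigma>, snd z) - \<psi> z)" by (simp add: Lpow2_eq power2_commute)
      finally show "Lpow 2 (\<lambda>z. ?\<psi> z - \<psi> z) \<le> (D * \<sigma>)^2" using reg[OF \<sigma>(1)] by simp
    qed (use D \<sigma> in \<open>auto simp: Lpow_nonneg\<close>)
    moreover have "sqrt (Lpow 2 g) * (D * \<sigma>) \<le> ?b" using \<sigma> D by (simp add: mult_left_mono Lpow_nonneg mult.assoc)
    ultimately show ?thesis using True by simp
  qed simp
  have "\<bar>(LINT \<sigma>|lborel. indicator {0..t} \<sigma> * ?h \<sigma>) - t * ?c\<bar> = \<bar>LINT \<sigma>|lborel. indicator {0..t} \<sigma> * ?h \<sigma> - indicator {0..t} \<sigma> * ?c\<bar>"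
    unfolding Bochner_Integration.integral_diff[OF hi ci] c ..
  also have "\<dots> \<le> (LINT \<sigma>|lborel. \<bar>indicator {0..t} \<sigma> * ?h \<sigma> - indicator {0..t} \<sigma> * ?c\<bar>)" by (rule integral_abs_bound)
  also have "\<dots> \<le> (LINT \<sigma>|lborel. indicator {0..t} \<sigma> * ?b)"
  proof (rule integral_mono[OF _ _ pt])
    show "integrable lborel (\<lambda>\<sigma>. \<bar>indicator {0..t} \<sigma> * ?h \<sigma> - indicator {0..t} \<sigma> * ?c\<bar>)"
      by (intro integrable_abs Bochner_Integration.integrable_diff hi ci)
    show "integrable lborel (\<lambda>\<sigma>. indicator {0..t} \<sigma> * ?b)" by (intro integrable_mult_left integrable_real_indicator) (use t in \<open>auto simp: emeasure_lborel_Icc\<close>)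
  qed
  also have "\<dots> = sqrt (Lpow 2 g) * D * t^2" using t by (simp add: power2_eq_square)
  finally show ?thesis unfolding 1 .
qed

lemma L2_dominated:
  assumes f: "memLp 2 f" and m: "h \<in> borel_measurable borel" and le: "\<And>z. \<bar>h z\<bar> \<le> c * \<bar>f z\<bar>"
  shows "memLp 2 h" "Lpow 2 h \<le> c^2 * Lpow 2 f"
proof -
  have i: "integrable lborel (\<lambda>z. c^2 * (f z)^2)" using f by (simp add: memLp2_iff)
  have pt: "(h z)^2 \<le> c^2 * (f z)^2" for z
    using power_mono[OF le[of z], of 2] by (simp add: power_mult_distrib)
  have j: "integrable lborel (\<lambda>z. (h z)^2)"
    by (rule Bochner_Integration.integrable_bound[OF i]) (use m pt in \<open>auto simp: borel_measurable_lborel\<close>)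
  then show "memLp 2 h" using m by (simp add: memLp2_iff)
  have "Lpow 2 h \<le> (LINT z|lborel. c^2 * (f z)^2)" unfolding Lpow2_eq by (rule integral_mono[OF j i pt])
  then show "Lpow 2 h \<le> c^2 * Lpow 2 f" by (simp add: Lpow2_eq)
qed

text \<open>Bounds are imposed only below 1 because the truncations to which this is applied are
  Lipschitz only on such a half-line; the intermediate point of the mean value theorem stays
  there.\<close>

lemma C11_increments:
  fixes \<Phi> \<Phi>' :: "real \<Rightarrow> real"
  assumes D: "\<And>x. (\<Phi> has_real_derivative \<Phi>' x) (at x)" and L: "\<And>x. x \<le> 1 \<Longrightarrow> \<bar>\<Phi>' x\<bar> \<le> L"
    and L': "\<And>x y. x \<le> 1 \<Longrightarrow> y \<le> 1 \<Longrightarrow> \<bar>\<Phi>' y - \<Phi>' x\<bar> \<le> L * \<bar>y - x\<bar>" and xy: "x \<le> 1" "y \<le> 1"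
  shows "\<bar>\<Phi> y - \<Phi> x\<bar> \<le> L * \<bar>y - x\<bar>" "\<bar>\<Phi> y - \<Phi> x - \<Phi>' x * (y - x)\<bar> \<le> L * (y - x)^2"
proof -
  obtain \<xi> where \<xi>: "\<Phi> y - \<Phi> x = \<Phi>' \<xi> * (y - x)" "\<bar>\<xi> - x\<bar> \<le> \<bar>y - x\<bar>" "\<xi> \<le> 1"
  proof -
    consider "x < y" | "y < x" | "x = y" by linarith
    then show ?thesis
    proof cases
      case 1
      then obtain z where "z > x" "z < y" "\<Phi> y - \<Phi> x = (y - x) * \<Phi>' z" using MVT2[of x y \<Phi> \<Phi>'] D by blast
      then show ?thesis using xy by (intro that[of z]) auto
    next
      case 2
      then obtain z where "z > y" "z < x" "\<Phi> x - \<Phi> y = (x - y) * \<Phi>' z" using MVT2[of y x \<Phi> \<Phi>'] D by blast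
      then show ?thesis using xy by (intro that[of z]) (auto simp: algebra_simps)
    next
      case 3
      then show ?thesis using xy by (intro that[of x]) auto
    qed
  qed
  show "\<bar>\<Phi> y - \<Phi> x\<bar> \<le> L * \<bar>y - x\<bar>" unfolding \<xi>(1) abs_mult using L[OF \<xi>(3)] by (rule mult_right_mono) simp
  have L0: "L \<ge> 0" using L[of 0] by simp
  have "\<Phi> y - \<Phi> x - \<Phi>' x * (y - x) = (\<Phi>' \<xi> - \<Phi>' x) * (y - x)" unfolding \<xi>(1) by (simp add: algebra_simps)
  then have "\<bar>\<Phi> y - \<Phi> x - \<Phi>' x * (y - x)\<bar> = \<bar>\<Phi>' \<xi> - \<Phi>' x\<bar> * \<bar>y - x\<bar>" by (simp add: abs_mult)
  also have "\<dots> \<le> (L * \<bar>y - x\<bar>) * \<bar>y - x\<bar>"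
    using L'[OF xy(1) \<xi>(3)] mult_left_mono[OF \<xi>(2) L0] by (intro mult_right_mono) auto
  finally show "\<bar>\<Phi> y - \<Phi> x - \<Phi>' x * (y - x)\<bar> \<le> L * (y - x)^2" by (simp add: power2_eq_square mult.assoc)
qed

text \<open>Discrete integration by parts: the increment of \<open>\<Phi> (v z)\<close> over a step
  \<open>t\<close> is \<open>\<Phi>' (v z)\<close> times that of \<open>v\<close> up to its square,
  the shift is moved from \<open>\<Phi> (v z)\<close> to \<open>\<phi>\<close>, and both sides are
  expanded to first order. All errors are of order \<open>t^2\<close>, so division by
  \<open>t\<close> leaves the weak identity.\<close>

lemma weak_chain_rule:
  fixes \<Phi> \<Phi>' :: "real \<Rightarrow> real"
  assumes D: "\<And>x. (\<Phi> has_real_derivative \<Phi>' x) (at x)" and L: "\<And>x. x \<le> 1 \<Longrightarrow> \<bar>\<Phi>' x\<bar> \<le> L"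
    and L': "\<And>x y. x \<le> 1 \<Longrightarrow> y \<le> 1 \<Longrightarrow> \<bar>\<Phi>' y - \<Phi>' x\<bar> \<le> L * \<bar>y - x\<bar>" and z0: "\<Phi> 0 = 0"
    and \<Phi>'m: "\<Phi>' \<in> borel_measurable borel"
    and v: "memLp 2 v" and g: "has_weak_dx v g" and v1: "\<And>z. v z \<le> 1"
  shows "memLp 2 (\<lambda>z. \<Phi> (v z))" "has_weak_dx (\<lambda>z. \<Phi> (v z)) (\<lambda>z. \<Phi>' (v z) * g z)"
proof -
  have inc: "\<bar>\<Phi> y - \<Phi> x\<bar> \<le> L * \<bar>y - x\<bar>" "\<bar>\<Phi> y - \<Phi> x - \<Phi>' x * (y - x)\<bar> \<le> L * (y - x)^2" if "x \<le> 1" "y \<le> 1" for x y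
    by (rule C11_increments[where \<Phi>=\<Phi> and \<Phi>'=\<Phi>' and L=L], (rule D | erule L | (rule L', assumption, assumption) | rule that)+)+
  have L0: "L \<ge> 0" using L[of 0] by simp
  have gL: "memLp 2 g" using g by (simp add: has_weak_dx_def)
  have vm: "v \<in> borel_measurable borel" and gm: "g \<in> borel_measurable borel" using v gL by (auto simp: memLp2_iff)
  have \<Phi>m: "\<Phi> \<in> borel_measurable borel"
    by (intro borel_measurable_continuous_onI DERIV_continuous_on) (use D in \<open>auto intro: has_field_derivative_at_within\<close>)
  note [measurable] = vm gm \<Phi>m \<Phi>'m
  let ?F = "\<lambda>z. \<Phi> (v z)" and ?h = "\<lambda>z. \<Phi>' (v z) * g z"
  have Fm: "?F \<in> borel_measurable borel" by measurable
  show FL: "memLp 2 ?F" by (rule L2_dominated(1)[OF v Fm, of L]) (use inc(1)[of 0] z0 v1 in auto)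
  have hL: "memLp 2 ?h" by (rule L2_dominated(1)[OF gL, of _ L]) (use L v1 in \<open>auto simp: abs_mult intro!: mult_right_mono\<close>)
  define M where "M = Lpow 2 g"
  have M0: "M \<ge> 0" by (simp add: M_def Lpow_nonneg)
  have regv: "Lpow 2 (\<lambda>z. v (fst z + \<sigma>, snd z) - v z) \<le> \<sigma>^2 * M" if "\<sigma> \<ge> 0" for \<sigma>
    unfolding M_def by (rule x_shift_diff_L2[OF v g that])
  have dL: "memLp 2 (\<lambda>z. f (fst z + \<sigma>, snd z) - f z)" if "memLp 2 f" for f and \<sigma> :: real
    using memLp2_lin[OF memLp2_x_shift[OF that, of \<sigma>] that, of 1 "-1"] by simp
  have regF: "Lpow 2 (\<lambda>z. ?F (fst z + \<sigma>, snd z) - ?F z) \<le> (L * sqrt M * \<sigma>)^2" if \<sigma>: "\<sigma> \<ge> 0" for \<sigma>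
  proof -
    have "Lpow 2 (\<lambda>z. ?F (fst z + \<sigma>, snd z) - ?F z) \<le> L^2 * Lpow 2 (\<lambda>z. v (fst z + \<sigma>, snd z) - v z)"
      by (rule L2_dominated(2)[OF dL[OF v]]) (use dL[OF FL, of \<sigma>] inc(1) v1 in \<open>auto simp: memLp2_iff\<close>)
    also have "\<dots> \<le> L^2 * (\<sigma>^2 * M)" by (rule mult_left_mono[OF regv[OF \<sigma>]]) simp
    finally show ?thesis using M0 by (simp add: power_mult_distrib algebra_simps)
  qed
  have "(LINT z|lborel. ?F z * dxf \<phi> z) = - (LINT z|lborel. ?h z * \<phi> z)" if T: "test_fun \<phi>" for \<phi>
  proof -
    obtain B0 where B0: "\<And>z. \<bar>\<phi> z\<bar> \<le> B0" using continuous_compact_support(1)[OF test_fun_continuous[OF T] test_fun_supp(1)[OF T]] by blast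
    have B: "B0 \<ge> 0" using B0[of 0] by linarith
    have \<phi>L: "memLp 2 \<phi>" and dL2: "memLp 2 (dxf \<phi>)" using test_fun_memLp2[OF T] by auto
    have \<phi>m[measurable]: "\<phi> \<in> borel_measurable borel" using \<phi>L by (simp add: memLp2_iff)
    define N where "N = Lpow 2 (dxf \<phi>)"
    have N0: "N \<ge> 0" by (simp add: N_def Lpow_nonneg)
    have reg\<phi>: "Lpow 2 (\<lambda>z. \<phi> (fst z + \<sigma>, snd z) - \<phi> z) \<le> \<sigma>^2 * N" if "\<sigma> \<ge> 0" for \<sigma>
      unfolding N_def by (rule x_shift_diff_L2[OF \<phi>L test_fun_weak_dx[OF T] that])
    let ?\<psi> = "\<lambda>z. \<Phi>' (v z) * \<phi> z"
    have \<psi>L: "memLp 2 ?\<psi>" by (rule L2_dominated(1)[OF \<phi>L, of _ L]) (use L v1 in \<open>auto simp: abs_mult intro!: mult_right_mono\<close>)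
    \<comment> \<open>An L^2 Lipschitz constant of \<open>\<Phi>' (v z) * \<phi> z\<close> under
      horizontal shifts, from splitting the increment of the product.\<close>
    define D where "D = sqrt (2 * L^2 * N + 2 * L^2 * B0^2 * M)"
    have D0: "D \<ge> 0" using N0 M0 by (simp add: D_def)
    have D2: "D^2 = 2 * L^2 * N + 2 * L^2 * B0^2 * M" using N0 M0 by (simp add: D_def)
    have reg\<psi>: "Lpow 2 (\<lambda>z. ?\<psi> (fst z + \<sigma>, snd z) - ?\<psi> z) \<le> (D * \<sigma>)^2" if \<sigma>: "\<sigma> \<ge> 0" for \<sigma>
    proof -
      have iv: "integrable lborel (\<lambda>z. (v (fst z + \<sigma>, snd z) - v z)^2)" and i\<phi>: "integrable lborel (\<lambda>z. (\<phi> (fst z + \<sigma>, snd z) - \<phi> z)^2)"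
        and i\<psi>: "integrable lborel (\<lambda>z. (?\<psi> (fst z + \<sigma>, snd z) - ?\<psi> z)^2)"
        using dL[OF v, of \<sigma>] dL[OF \<phi>L, of \<sigma>] dL[OF \<psi>L, of \<sigma>] by (auto simp: memLp2_iff)
      have pt: "(?\<psi> (fst z + \<sigma>, snd z) - ?\<psi> z)^2 \<le> 2 * L^2 * (\<phi> (fst z + \<sigma>, snd z) - \<phi> z)^2 + 2 * L^2 * B0^2 * (v (fst z + \<sigma>, snd z) - v z)^2" for z
      proof -
        define A where "A = \<Phi>' (v (fst z + \<sigma>, snd z)) * (\<phi> (fst z + \<sigma>, snd z) - \<phi> z)"
        define B where "B = (\<Phi>' (v (fst z + \<sigma>, snd z)) - \<Phi>' (v z)) * \<phi> z"
        have e: "?\<psi> (fst z + \<sigma>, snd z) - ?\<psi> z = A + B" by (simp add: A_def B_def algebra_simps)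
        have "\<bar>A\<bar> \<le> L * \<bar>\<phi> (fst z + \<sigma>, snd z) - \<phi> z\<bar>" unfolding A_def abs_mult by (rule mult_right_mono[OF L[OF v1]]) simp
        from power_mono[OF this abs_ge_zero, of 2] have A: "A^2 \<le> L^2 * (\<phi> (fst z + \<sigma>, snd z) - \<phi> z)^2" by (simp add: power_mult_distrib)
        have "\<bar>B\<bar> \<le> (L * \<bar>v (fst z + \<sigma>, snd z) - v z\<bar>) * B0" unfolding B_def abs_mult by (rule mult_mono[OF L'[OF v1 v1] B0]) (use L0 in auto)
        from power_mono[OF this abs_ge_zero, of 2] have B: "B^2 \<le> L^2 * B0^2 * (v (fst z + \<sigma>, snd z) - v z)^2" by (simp add: power_mult_distrib mult_ac)
        have "(A + B)^2 \<le> 2 * A^2 + 2 * B^2" using zero_le_power2[of "A - B"] by (simp add: power2_eq_square algebra_simps)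
        then show ?thesis unfolding e using A B by (simp add: algebra_simps)
      qed
      have "Lpow 2 (\<lambda>z. ?\<psi> (fst z + \<sigma>, snd z) - ?\<psi> z)
        \<le> (LINT z|lborel. 2 * L^2 * (\<phi> (fst z + \<sigma>, snd z) - \<phi> z)^2 + 2 * L^2 * B0^2 * (v (fst z + \<sigma>, snd z) - v z)^2)"
        unfolding Lpow2_eq by (rule integral_mono[OF i\<psi> _ pt]) (intro Bochner_Integration.integrable_add integrable_mult_right iv i\<phi>)
      also have "\<dots> = 2 * L^2 * Lpow 2 (\<lambda>z. \<phi> (fst z + \<sigma>, snd z) - \<phi> z) + 2 * L^2 * B0^2 * Lpow 2 (\<lambda>z. v (fst z + \<sigma>, snd z) - v z)"
        using iv i\<phi> by (simp add: Lpow2_eq)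
      also have "\<dots> \<le> 2 * L^2 * (\<sigma>^2 * N) + 2 * L^2 * B0^2 * (\<sigma>^2 * M)"
        by (intro add_mono mult_left_mono regv[OF \<sigma>] reg\<phi>[OF \<sigma>]) auto
      also have "\<dots> = (D * \<sigma>)^2" unfolding power_mult_distrib D2 by (simp add: algebra_simps)
      finally show ?thesis .
    qed
    define X where "X = (LINT z|lborel. g z * ?\<psi> z)"
    define Y where "Y = (LINT z|lborel. dxf \<phi> z * ?F z)"
    \<comment> \<open>The constants of the errors \<open>E1\<close>, \<open>E2\<close>,
      \<open>E4\<close> and \<open>E5\<close>, in this order.\<close>
    define K where "K = L * B0 * M + sqrt M * D + sqrt N * (L * sqrt M) + sqrt N * (L * sqrt M)"
    have key: "\<bar>X + Y\<bar> \<le> K * t" if t: "t > 0" for t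
    proof -
      let ?S = "\<lambda>f z. f (fst z + t, snd z) :: real"
      have FtL: "memLp 2 (?S ?F)" by (rule memLp2_x_shift[OF FL])
      have dF: "memLp 2 (\<lambda>z. ?S ?F z - ?F z)" and dv: "memLp 2 (\<lambda>z. ?S v z - v z)" and d\<phi>: "memLp 2 (\<lambda>z. ?S \<phi> z - \<phi> z)"
        using dL FL v \<phi>L by auto
      define I1 where "I1 = (LINT z|lborel. (?S ?F z - ?F z) * \<phi> z)"
      define I2 where "I2 = (LINT z|lborel. (?S v z - v z) * ?\<psi> z)"
      define I3 where "I3 = (LINT z|lborel. (?S \<phi> z - \<phi> z) * ?S ?F z)"
      define I4 where "I4 = (LINT z|lborel. dxf \<phi> z * ?S ?F z)"
      have I12: "I1 - I2 = (LINT z|lborel. (?S ?F z - ?F z) * \<phi> z - (?S v z - v z) * ?\<psi> z)"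
        unfolding I1_def I2_def by (rule Bochner_Integration.integral_diff[symmetric] memLp2_mult dF \<phi>L dv \<psi>L)+
      have "\<bar>I1 - I2\<bar> \<le> (LINT z|lborel. L * B0 * (?S v z - v z)^2)"
        unfolding I12
      proof (rule order_trans[OF integral_abs_bound], rule integral_mono)
        show "integrable lborel (\<lambda>z. \<bar>(?S ?F z - ?F z) * \<phi> z - (?S v z - v z) * ?\<psi> z\<bar>)"
          by (intro integrable_abs Bochner_Integration.integrable_diff memLp2_mult dF \<phi>L dv \<psi>L)
        show "integrable lborel (\<lambda>z. L * B0 * (?S v z - v z)^2)" using dv by (simp add: memLp2_iff)
        fix z
        have e: "(?S ?F z - ?F z) * \<phi> z - (?S v z - v z) * ?\<psi> z = (?S ?F z - ?F z - \<Phi>' (v z) * (?S v z - v z)) * \<phi> z" by (simp add: algebra_simps)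
        have "\<bar>(?S ?F z - ?F z) * \<phi> z - (?S v z - v z) * ?\<psi> z\<bar> \<le> (L * (?S v z - v z)^2) * B0" unfolding e abs_mult by (rule mult_mono[OF inc(2)[OF v1 v1] B0]) (use L0 in auto)
        then show "\<bar>(?S ?F z - ?F z) * \<phi> z - (?S v z - v z) * ?\<psi> z\<bar> \<le> L * B0 * (?S v z - v z)^2" by (simp add: mult_ac)
      qed
      also have "\<dots> = L * B0 * Lpow 2 (\<lambda>z. ?S v z - v z)" by (simp add: Lpow2_eq)
      also have "\<dots> \<le> L * B0 * (t^2 * M)" by (rule mult_left_mono[OF regv]) (use t L0 B in auto)
      finally have E1: "\<bar>I1 - I2\<bar> \<le> L * B0 * M * t^2" by (simp add: mult_ac)
      have E2: "\<bar>I2 - t * X\<bar> \<le> sqrt M * D * t^2" unfolding I2_def X_def M_def by (rule difference_pairing[OF v g \<psi>L D0 reg\<psi> t])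
      have E3: "I1 = - I3"
      proof -
        have a: "(LINT z|lborel. ?S \<phi> z * ?S ?F z) = (LINT z|lborel. \<phi> z * ?F z)"
          by (rule integral_x_shift[of "\<lambda>z. \<phi> z * ?F z" t]) simp
        show ?thesis unfolding I1_def I3_def left_diff_distrib
          using memLp2_mult[OF FtL \<phi>L] memLp2_mult[OF FL \<phi>L] memLp2_mult[OF memLp2_x_shift[OF \<phi>L, of t] FtL] memLp2_mult[OF \<phi>L FtL] a
          by (simp add: mult.commute)
      qed
      have regFt: "Lpow 2 (\<lambda>z. ?S ?F (fst z + \<sigma>, snd z) - ?S ?F z) \<le> (L * sqrt M * \<sigma>)^2" if "\<sigma> \<ge> 0" for \<sigma>
        using regF[OF that] Lpow2_x_shift[of "\<lambda>z. ?F (fst z + \<sigma>, snd z) - ?F z" t] dL[OF FL, of \<sigma>] by (simp add: memLp2_iff add.commute add.left_commute)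
      have E4: "\<bar>I3 - t * I4\<bar> \<le> sqrt N * (L * sqrt M) * t^2" unfolding I3_def I4_def N_def
        by (rule difference_pairing[OF \<phi>L test_fun_weak_dx[OF T] FtL _ regFt t]) (use L0 M0 in auto)
      have I4Y: "I4 - Y = (LINT z|lborel. dxf \<phi> z * (?S ?F z - ?F z))"
        unfolding I4_def Y_def right_diff_distrib by (rule Bochner_Integration.integral_diff[symmetric] memLp2_mult dL2 FtL FL)+
      have "\<bar>I4 - Y\<bar> \<le> sqrt N * (L * sqrt M * t)" unfolding I4Y
        by (rule L2_Cauchy_Schwarz[OF dL2 dF]) (use N0 M0 L0 t regF in \<open>auto simp: N_def\<close>)
      then have "t * \<bar>I4 - Y\<bar> \<le> t * (sqrt N * (L * sqrt M * t))" using t by (intro mult_left_mono) auto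
      then have E5: "\<bar>t * I4 - t * Y\<bar> \<le> sqrt N * (L * sqrt M) * t^2"
        using t by (simp add: abs_mult flip: right_diff_distrib) (simp add: power2_eq_square mult_ac)
      have "\<bar>t * X + t * Y\<bar> \<le> K * t^2" using E1 E2 E3 E4 E5 unfolding K_def distrib_right by linarith
      moreover have "\<bar>t * X + t * Y\<bar> = t * \<bar>X + Y\<bar>" using t abs_mult[of t "X + Y"] by (simp add: distrib_left)
      ultimately have "t * \<bar>X + Y\<bar> \<le> t * (K * t)" by (simp add: power2_eq_square mult_ac)
      then show ?thesis using t by simp
    qed
    have "X + Y = 0"
    proof (rule ccontr)
      assume n: "X + Y \<noteq> 0"
      show False
      proof (cases "K > 0")
        case True
        then have "\<bar>X + Y\<bar> \<le> K * (\<bar>X + Y\<bar> / (2 * K))" using n by (intro key) auto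
        then show False using True n by simp
      next
        case False
        then show False using key[of 1] n by simp
      qed
    qed
    then show ?thesis unfolding X_def Y_def by (simp add: mult_ac)
  qed
  then show "has_weak_dx ?F ?h" using hL by (simp add: has_weak_dx_def)
qed

lemma inH_compose:
  fixes \<Phi> \<Phi>' :: "real \<Rightarrow> real"
  assumes D: "\<And>x. (\<Phi> has_real_derivative \<Phi>' x) (at x)" and L: "\<And>x. x \<le> 1 \<Longrightarrow> \<bar>\<Phi>' x\<bar> \<le> L"
    and L': "\<And>x y. x \<le> 1 \<Longrightarrow> y \<le> 1 \<Longrightarrow> \<bar>\<Phi>' y - \<Phi>' x\<bar> \<le> L * \<bar>y - x\<bar>" and z0: "\<Phi> 0 = 0"
    and \<Phi>'m: "\<Phi>' \<in> borel_measurable borel"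
    and v: "inH s v" and v1: "\<And>z. v z \<le> 1"
  shows "inH s (\<lambda>z. \<Phi> (v z))" "AE z in lborel. wdx (\<lambda>z. \<Phi> (v z)) z = \<Phi>' (v z) * wdx v z"
proof -
  have R: "memLp 2 (\<lambda>z. \<Phi> (v z))" "has_weak_dx (\<lambda>z. \<Phi> (v z)) (\<lambda>z. \<Phi>' (v z) * wdx v z)"
    by (rule weak_chain_rule[where \<Phi>=\<Phi> and \<Phi>'=\<Phi>' and L=L],
        (rule D z0 \<Phi>'m inH_memLp(1)[OF v] inH_wdx[OF v] v1 | erule L | (rule L', assumption, assumption))+)+
  have inc: "\<bar>\<Phi> y - \<Phi> x\<bar> \<le> L * \<bar>y - x\<bar>" if "x \<le> 1" "y \<le> 1" for x y
    by (rule C11_increments(1)[where \<Phi>=\<Phi> and \<Phi>'=\<Phi>' and L=L], (rule D | erule L | (rule L', assumption, assumption) | rule that)+)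
  let ?F = "\<lambda>z. \<Phi> (v z)"
  have Fm: "?F \<in> borel_measurable borel" using R(1) by (simp add: memLp2_iff)
  have i: "integrable lborel (\<lambda>t. L^2 * gag_integrand s v v t)" using v by (simp add: inH_def fracy_fin_def)
  have "integrable lborel (gag_integrand s ?F ?F)"
  proof (rule Bochner_Integration.integrable_bound[OF i])
    show "gag_integrand s ?F ?F \<in> borel_measurable lborel" unfolding borel_measurable_lborel by (rule gag_measurable[OF Fm Fm])
    have "gag_integrand s ?F ?F t \<le> L^2 * gag_integrand s v v t" for t
    proof -
      define a where "a = v (fst t, fst (snd t))"
      define b where "b = v (fst t, snd (snd t))"
      define k where "k = \<bar>fst (snd t) - snd (snd t)\<bar> powr (1 + 2 * s)"
      have "\<bar>\<Phi> a - \<Phi> b\<bar> \<le> L * \<bar>a - b\<bar>" by (rule inc) (simp_all add: a_def b_def v1)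
      from power_mono[OF this abs_ge_zero, of 2] have "(\<Phi> a - \<Phi> b)^2 \<le> L^2 * (a - b)^2" by (simp add: power_mult_distrib)
      then have "(\<Phi> a - \<Phi> b)^2 / k \<le> L^2 * (a - b)^2 / k" by (rule divide_right_mono) (simp add: k_def)
      then show ?thesis by (simp add: gag_eq a_def b_def k_def power2_eq_square)
    qed
    then show "AE t in lborel. norm (gag_integrand s ?F ?F t) \<le> norm (L^2 * gag_integrand s v v t)"
      using gag_nonneg[of s] by (auto intro!: AE_I2)
  qed
  then show H: "inH s ?F" using R by (auto simp: inH_def fracy_fin_def)
  show "AE z in lborel. wdx ?F z = \<Phi>' (v z) * wdx v z" by (rule weak_dx_unique[OF inH_wdx[OF H] R(2)])
qed

subsection \<open>Strong maximum principle\<close>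

text \<open>Dilating \<open>w\<close> back by \<open>1 / l\<close> reduces this to the undilated
  cutoff; the constant may depend on \<open>l\<close>.\<close>

lemma eta_dil_bound:
  assumes s: "0 < s" "s < 1" and l: "l > 0"
  obtains B where "B > 0" "\<And>w. inH s w \<Longrightarrow> \<bar>innerK s (dil s 1 l eta) w\<bar> \<le> B * (1 + Lpow 2 w)"
proof -
  obtain B0 where B0: "B0 > 0" "\<And>w. inH s w \<Longrightarrow> \<bar>innerK s w eta\<bar> \<le> B0 * (1 + Lpow 2 w)" using eta_bound[OF s] by blast
  define m where "m = 1 / (1 / l) powr (1 + 1/s)"
  define c where "c = l powr (1 - 1/s)"
  have m0: "m > 0" and c0: "c > 0" using l by (auto simp: m_def c_def)
  have "\<bar>innerK s (dil s 1 l eta) w\<bar> \<le> c * B0 * (1 + m) * (1 + Lpow 2 w)" if w: "inH s w" for w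
  proof -
    let ?w = "dil s 1 (1 / l) w"
    have wH: "inH s ?w" by (rule dil_H[OF _ s(1) w]) (use l in simp)
    have e: "w = dil s 1 l ?w" using l by (simp add: dil_dil dil_one)
    have "innerK s (dil s 1 l eta) w = c * innerK s eta ?w"
      using innerK_dil[OF l s(1) eta_H[OF s] wH, of 1 1] e by (simp add: c_def)
    then have "\<bar>innerK s (dil s 1 l eta) w\<bar> = c * \<bar>innerK s ?w eta\<bar>" using c0 by (simp add: abs_mult innerK_sym)
    also have "\<dots> \<le> c * (B0 * (1 + Lpow 2 ?w))" using B0(2)[OF wH] c0 by simp
    also have "Lpow 2 ?w = m * Lpow 2 w" using Lpow_dil[OF inH_measurable(1)[OF w], of "1/l"] l by (simp add: m_def)
    also have "c * (B0 * (1 + m * Lpow 2 w)) \<le> c * (B0 * ((1 + m) * (1 + Lpow 2 w)))"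
      using c0 B0(1) m0 Lpow_nonneg[of 2 w] by (intro mult_left_mono) (auto simp: algebra_simps)
    finally show ?thesis by (simp add: mult_ac)
  qed
  moreover have "c * B0 * (1 + m) > 0" using c0 B0(1) m0 by simp
  ultimately show thesis by (rule that[rotated])
qed

text \<open>\<open>cube3\<close> is the test function; \<open>sq2\<close> is its companion for which
  the product of the x-derivatives of \<open>v\<close> and \<open>cube3 (v z)\<close> is the squared
  x-derivative of \<open>sq2 (v z)\<close>. With the third power this companion still has a
  Lipschitz derivative, as the chain rule requires.\<close>

definition cube3 :: "real \<Rightarrow> real" where "cube3 x = (max 0 x)^3 / 3"
definition sq2 :: "real \<Rightarrow> real" where "sq2 x = (max 0 x)^2 / 2"

lemma cube3_compose:
  assumes v: "inH s v" and v1: "\<And>z. v z \<le> 1"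
  shows "inH s (\<lambda>z. cube3 (v z))" "AE z in lborel. wdx (\<lambda>z. cube3 (v z)) z = (max 0 (v z))^2 * wdx v z"
proof -
  have D: "(cube3 has_real_derivative (max 0 x)^2) (at x)" for x
    using DERIV_cdivide[OF pos_part_power_deriv[of 1 x], of 3] by (simp add: cube3_def[abs_def] eval_nat_numeral)
  have "\<bar>(max 0 x)^2\<bar> \<le> 2" if "x \<le> 1" for x :: real using that power_mono[of "max 0 x" 1 2] by simp
  moreover have "\<bar>(max 0 y)^2 - (max 0 x)^2\<bar> \<le> 2 * \<bar>y - x\<bar>" if "x \<le> 1" "y \<le> 1" for x y :: real
  proof -
    have "(max 0 y)^2 - (max 0 x)^2 = (max 0 y + max 0 x) * (max 0 y - max 0 x)" by (simp add: power2_eq_square algebra_simps)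
    also have "\<bar>\<dots>\<bar> \<le> 2 * \<bar>y - x\<bar>" unfolding abs_mult by (rule mult_mono) (use that in auto)
    finally show ?thesis .
  qed
  moreover have "(\<lambda>x::real. (max 0 x)^2) \<in> borel_measurable borel" by measurable
  ultimately show "inH s (\<lambda>z. cube3 (v z))" "AE z in lborel. wdx (\<lambda>z. cube3 (v z)) z = (max 0 (v z))^2 * wdx v z"
    using inH_compose[where \<Phi>=cube3 and \<Phi>'="\<lambda>x. (max 0 x)^2" and L=2, OF D _ _ _ _ v v1] by (auto simp: cube3_def)
qed

lemma sq2_weak_dx:
  assumes v: "inH s v" and v1: "\<And>z. v z \<le> 1"
  shows "memLp 2 (\<lambda>z. sq2 (v z))" "has_weak_dx (\<lambda>z. sq2 (v z)) (\<lambda>z. max 0 (v z) * wdx v z)"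
proof -
  have D: "(sq2 has_real_derivative max 0 x) (at x)" for x
    using DERIV_cdivide[OF pos_part_power_deriv[of 0 x], of 2] by (simp add: sq2_def[abs_def] eval_nat_numeral)
  have "(\<lambda>x::real. max 0 x) \<in> borel_measurable borel" by measurable
  moreover have "\<bar>max 0 y - max 0 x\<bar> \<le> 2 * \<bar>y - x\<bar>" for x y :: real by (auto simp: max_def)
  ultimately show "memLp 2 (\<lambda>z. sq2 (v z))" "has_weak_dx (\<lambda>z. sq2 (v z)) (\<lambda>z. max 0 (v z) * wdx v z)"
    using weak_chain_rule[where \<Phi>=sq2 and \<Phi>'="\<lambda>x. max 0 x" and L=2, OF D _ _ _ _ inH_memLp(1)[OF v] inH_wdx[OF v] v1] by (simp_all add: sq2_def)
qed

text \<open>Signs are required at every point, so that limits of truncations can be taken pointwise;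
  a function with a sign almost everywhere is first replaced by its positive part.\<close>

definition supersolution :: "real \<Rightarrow> fn2 \<Rightarrow> bool" where
  "supersolution s u \<longleftrightarrow> inH s u \<and> (\<forall>z. u z \<ge> 0) \<and> (\<forall>\<phi>. inH s \<phi> \<longrightarrow> (\<forall>z. \<phi> z \<ge> 0) \<longrightarrow> innerH s u \<phi> \<ge> 0)"

text \<open>The supersolution inequality is tested with \<open>(\<eta> - k u)\<^sub>+\<^sup>3 / 3\<close>, \<open>\<eta>\<close> a dilated bump; the bounds below do not depend on \<open>k\<close>.\<close>
lemma truncation_estimate:
  assumes s: "0 < s" "s < 1" and U: "supersolution s u" and l: "l > 0"
  shows "\<exists>C\<ge>0. (\<forall>k>0. \<forall>t\<ge>0. (\<integral>\<^sup>+ z. ennreal ((sq2 (dil s 1 l eta (fst z + t, snd z) - k * u (fst z + t, snd z)) - sq2 (dil s 1 l eta z - k * u z))^2) \<partial>lborel) \<le> ennreal (t^2 * C)) \<and>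
    (\<forall>k>0. (\<integral>\<^sup>+ t. ennreal (gag_integrand s (\<lambda>z. dil s 1 l eta z - k * u z) (\<lambda>z. cube3 (dil s 1 l eta z - k * u z)) t) \<partial>lborel) \<le> ennreal C)"
proof -
  have u: "inH s u" and u0: "\<And>z. u z \<ge> 0" using U by (auto simp: supersolution_def)
  let ?\<eta> = "dil s 1 l eta"
  obtain B where B: "B > 0" "\<And>w. inH s w \<Longrightarrow> \<bar>innerK s ?\<eta> w\<bar> \<le> B * (1 + Lpow 2 w)" using eta_dil_bound[OF s l] by blast
  have \<eta>H: "inH s ?\<eta>" by (rule dil_H[OF l s(1) eta_H[OF s]])
  have \<eta>L: "memLp 2 ?\<eta>" by (rule inH_memLp[OF \<eta>H])
  have \<eta>01: "0 \<le> ?\<eta> z" "?\<eta> z \<le> 1" for z by (simp_all add: dil_def eta_range)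
  define N where "N = Lpow 2 ?\<eta>"
  define E where "E = B * (1 + N) + N"
  have N0: "N \<ge> 0" by (simp add: N_def Lpow_nonneg)
  have E0: "E \<ge> 0" using B(1) N0 by (simp add: E_def)
  define C where "C = E + E / frac_const s"
  have fp: "frac_const s > 0" by (rule frac_const_pos[OF s])
  have CE: "E \<le> C" "E / frac_const s \<le> C" using E0 fp by (auto simp: C_def)
  have main: "(t \<ge> 0 \<longrightarrow> (\<integral>\<^sup>+ z. ennreal ((sq2 (?\<eta> (fst z + t, snd z) - k * u (fst z + t, snd z)) - sq2 (?\<eta> z - k * u z))^2) \<partial>lborel) \<le> ennreal (t^2 * C)) \<and>
    (\<integral>\<^sup>+ t. ennreal (gag_integrand s (\<lambda>z. ?\<eta> z - k * u z) (\<lambda>z. cube3 (?\<eta> z - k * u z)) t) \<partial>lborel) \<le> ennreal C" if k: "k > 0" for k t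
  proof -
    define v where "v = (\<lambda>z. ?\<eta> z - k * u z)"
    define w where "w = (\<lambda>z. cube3 (v z))"
    have v_lin: "v = (\<lambda>z. 1 * ?\<eta> z + (- k) * u z)" by (simp add: v_def)
    have vH: "inH s v" unfolding v_lin by (rule inH_lin[OF \<eta>H u])
    have v_le: "v z \<le> ?\<eta> z" for z using k u0[of z] by (simp add: v_def)
    have v1: "v z \<le> 1" for z using v_le[of z] \<eta>01[of z] by linarith
    have wH: "inH s w" and dw: "AE z in lborel. wdx w z = (max 0 (v z))^2 * wdx v z"
      unfolding w_def using cube3_compose[OF vH v1] by auto
    have w0: "w z \<ge> 0" for z by (simp add: w_def cube3_def)
    have wm: "w \<in> borel_measurable borel" and vm: "v \<in> borel_measurable borel" and um: "u \<in> borel_measurable borel"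
      using wH vH u inH_measurable by auto
    have w_le: "w z \<le> ?\<eta> z" for z
    proof -
      have "(max 0 (v z))^3 \<le> (?\<eta> z)^3" using v_le[of z] \<eta>01[of z] by (intro power_mono) auto
      also have "\<dots> \<le> ?\<eta> z" using power_decreasing[of 1 3 "?\<eta> z"] \<eta>01[of z] by simp
      finally show ?thesis using \<eta>01[of z] by (simp add: w_def cube3_def)
    qed
    \<comment> \<open>Where \<open>w\<close> is positive, \<open>k * u z\<close> lies below the
      cutoff; this is why the zeroth-order term stays bounded uniformly in \<open>k\<close>.\<close>
    have uw: "k * u z * w z \<le> (?\<eta> z)^2" for z
    proof (cases "v z \<le> 0")
      case True
      then show ?thesis by (simp add: w_def cube3_def max_absorb1)
    next
      case False
      then have "k * u z \<le> ?\<eta> z" by (simp add: v_def)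
      then have "k * u z * w z \<le> ?\<eta> z * ?\<eta> z" using w_le[of z] w0[of z] \<eta>01[of z] by (intro mult_mono) auto
      then show ?thesis by (simp add: power2_eq_square)
    qed
    have Lw: "Lpow 2 w \<le> N" unfolding N_def
      using L2_dominated(2)[OF \<eta>L wm, of 1] w0 w_le \<eta>01 by (simp add: abs_of_nonneg)
    have iuw: "integrable lborel (\<lambda>z. u z * w z)" by (rule memLp2_mult[OF inH_memLp(1)[OF u] inH_memLp(1)[OF wH]])
    have "(LINT z|lborel. k * (u z * w z)) \<le> (LINT z|lborel. (?\<eta> z)^2)"
      by (rule integral_mono) (use iuw \<eta>L uw in \<open>auto simp: memLp2_iff mult.assoc\<close>)
    then have kuw: "k * (LINT z|lborel. u z * w z) \<le> N" by (simp add: N_def Lpow2_eq)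
    have "innerH s u w \<ge> 0" using U wH w0 by (simp add: supersolution_def)
    then have "- (k * innerK s u w) \<le> k * (LINT z|lborel. u z * w z)" using k mult_left_mono[of 0 "innerH s u w" k] by (simp add: innerH_def distrib_left)
    moreover have "innerK s ?\<eta> w \<le> B * (1 + N)"
    proof -
      have "innerK s ?\<eta> w \<le> B * (1 + Lpow 2 w)" using B(2)[OF wH] by linarith
      also have "\<dots> \<le> B * (1 + N)" using Lw B(1) by simp
      finally show ?thesis .
    qed
    moreover have "innerK s v w = innerK s ?\<eta> w - k * innerK s u w" unfolding v_lin using innerK_lin[OF \<eta>H u wH, of 1 "- k"] by simp
    ultimately have K: "innerK s v w \<le> E" using kuw by (simp add: E_def)
    let ?h = "\<lambda>z. max 0 (v z) * wdx v z"
    have xx: "(LINT z|lborel. wdx v z * wdx w z) = Lpow 2 ?h" unfolding Lpow2_eq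
    proof (rule integral_cong_AE)
      show "AE z in lborel. wdx v z * wdx w z = (?h z)^2" using dw by eventually_elim (simp add: power2_eq_square)
    qed (use inH_measurable(2)[OF vH] inH_measurable(2)[OF wH] vm in \<open>auto simp: borel_measurable_lborel\<close>)
    \<comment> \<open>Monotonicity makes the Gagliardo part of the pairing nonnegative, so the bound
      on the sum controls each part.\<close>
    have mono: "cube3 a \<le> cube3 b" if "a \<le> b" for a b :: real
      unfolding cube3_def using that by (intro divide_right_mono power_mono) auto
    have g0: "gag_integrand s v w t \<ge> 0" for t
    proof -
      have "0 \<le> (a - b) * (cube3 a - cube3 b)" for a b :: real
        using mono[of a b] mono[of b a] by (cases "a \<le> b") (auto intro: mult_nonneg_nonneg mult_nonpos_nonpos)
      then show ?thesis by (simp add: gag_eq w_def)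
    qed
    have gi: "integrable lborel (gag_integrand s v w)" by (rule gag_integrable[OF vH wH])
    have G0: "(LINT t|lborel. gag_integrand s v w t) \<ge> 0" using g0 by simp
    have X: "Lpow 2 ?h \<le> E" and Y: "frac_const s * (LINT t|lborel. gag_integrand s v w t) \<le> E"
      using K Lpow_nonneg[of 2 ?h] mult_nonneg_nonneg[OF less_imp_le[OF fp] G0] by (auto simp: innerK_def Gy_def xx)
    have "(LINT t|lborel. gag_integrand s v w t) \<le> C"
    proof -
      have "(LINT t|lborel. gag_integrand s v w t) \<le> E / frac_const s" unfolding pos_le_divide_eq[OF fp] using Y by (simp add: mult.commute)
      then show ?thesis using CE(2) by linarith
    qed
    then have Y': "(\<integral>\<^sup>+ t. ennreal (gag_integrand s v w t) \<partial>lborel) \<le> ennreal C"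
      using nn_integral_eq_integral[OF gi] g0 by (simp add: ennreal_leI)
    have "(\<integral>\<^sup>+ z. ennreal ((sq2 (v (fst z + t, snd z)) - sq2 (v z))^2) \<partial>lborel) \<le> ennreal (t^2 * C)" if t: "t \<ge> 0"
    proof -
      note G = sq2_weak_dx[OF vH v1]
      have "memLp 2 (\<lambda>z. sq2 (v (fst z + t, snd z)) - sq2 (v z))" using memLp2_lin[OF memLp2_x_shift[OF G(1), of t] G(1), of 1 "-1"] by simp
      then have "(\<integral>\<^sup>+ z. ennreal ((sq2 (v (fst z + t, snd z)) - sq2 (v z))^2) \<partial>lborel) = ennreal (Lpow 2 (\<lambda>z. sq2 (v (fst z + t, snd z)) - sq2 (v z)))"
        by (rule nn_integral_L2)
      also have "\<dots> \<le> ennreal (t^2 * Lpow 2 ?h)" by (rule ennreal_leI[OF x_shift_diff_L2[OF G t]])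
      also have "\<dots> \<le> ennreal (t^2 * C)" using X CE(1) by (intro ennreal_leI mult_left_mono) auto
      finally show ?thesis .
    qed
    with Y' show ?thesis by (simp add: v_def w_def)
  qed
  have "C \<ge> 0" using E0 fp by (simp add: C_def)
  then show ?thesis using main by (intro exI[of _ C]) blast
qed

text \<open>As the factor of \<open>u\<close> grows, the truncation dies wherever
  \<open>u > 0\<close> and is unchanged where \<open>u = 0\<close>, so the limits see only the zero
  set.\<close>

lemma vanishing_truncation:
  fixes e x :: real
  assumes "x \<ge> 0"
  shows "(\<lambda>n. sq2 (e - real (Suc n) * x)) \<longlonglongrightarrow> (if x = 0 then sq2 e else 0)"
    "(\<lambda>n. cube3 (e - real (Suc n) * x)) \<longlonglongrightarrow> (if x = 0 then cube3 e else 0)"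
proof -
  have "eventually (\<lambda>n. sq2 (e - real (Suc n) * x) = (if x = 0 then sq2 e else 0) \<and> cube3 (e - real (Suc n) * x) = (if x = 0 then cube3 e else 0)) sequentially"
  proof (cases "x = 0")
    case False
    then have x: "x > 0" using assms by simp
    obtain N :: nat where N: "e / x < real N" using reals_Archimedean2 by blast
    have "e - real (Suc n) * x \<le> 0" if "n \<ge> N" for n
    proof -
      have "e / x \<le> real (Suc n)" using N that by simp
      then show ?thesis using x by (simp add: field_simps)
    qed
    then show ?thesis using False by (auto simp: eventually_sequentially sq2_def cube3_def max_absorb1 intro!: exI[of _ N])
  qed simp
  then show "(\<lambda>n. sq2 (e - real (Suc n) * x)) \<longlonglongrightarrow> (if x = 0 then sq2 e else 0)"
    "(\<lambda>n. cube3 (e - real (Suc n) * x)) \<longlonglongrightarrow> (if x = 0 then cube3 e else 0)"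
    by (auto intro!: tendsto_eventually elim: eventually_mono)
qed

text \<open>Fatou in the bound that is uniform in \<open>k\<close>. The limit lives on the zero set
  and jumps when a shift leaves it, yet its increments are of order \<open>t\<close> in L^2.\<close>

lemma zero_set_x_increments:
  assumes s: "0 < s" "s < 1" and U: "supersolution s u" and l: "l > 0"
  shows "\<exists>C\<ge>0. \<forall>t\<ge>0. (\<integral>\<^sup>+ z. ennreal (((if u (fst z + t, snd z) = 0 then sq2 (dil s 1 l eta (fst z + t, snd z)) else 0) - (if u z = 0 then sq2 (dil s 1 l eta z) else 0))^2) \<partial>lborel) \<le> ennreal (t^2 * C)"
proof -
  have u: "inH s u" and u0: "\<And>z. u z \<ge> 0" using U by (auto simp: supersolution_def)
  let ?\<eta> = "dil s 1 l eta"
  obtain C where C0: "C \<ge> 0" and C: "\<forall>k>0. \<forall>t\<ge>0. (\<integral>\<^sup>+ z. ennreal ((sq2 (?\<eta> (fst z + t, snd z) - k * u (fst z + t, snd z)) - sq2 (?\<eta> z - k * u z))^2) \<partial>lborel) \<le> ennreal (t^2 * C)"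
    using truncation_estimate[OF s U l] by (elim exE conjE)
  have um[measurable]: "u \<in> borel_measurable borel" by (rule inH_measurable[OF u])
  have \<eta>m[measurable]: "?\<eta> \<in> borel_measurable borel" by (rule dil_measurable) measurable
  have sh: "(\<lambda>z. f (fst z + t, snd z)) \<in> borel_measurable borel" if "f \<in> borel_measurable borel" for f :: fn2 and t
    by (rule measurable_x_shift[OF that])
  have "(\<integral>\<^sup>+ z. ennreal (((if u (fst z + t, snd z) = 0 then sq2 (?\<eta> (fst z + t, snd z)) else 0) - (if u z = 0 then sq2 (?\<eta> z) else 0))^2) \<partial>lborel) \<le> ennreal (t^2 * C)"
    if t: "t \<ge> 0" for t
  proof -
    let ?D = "\<lambda>n z. (sq2 (?\<eta> (fst z + t, snd z) - real (Suc n) * u (fst z + t, snd z)) - sq2 (?\<eta> z - real (Suc n) * u z))^2"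
    have m: "(\<lambda>z. ennreal (?D n z)) \<in> borel_measurable borel" for n
      using sh[OF um, of t] sh[OF \<eta>m, of t] unfolding sq2_def by measurable
    have lim: "(\<lambda>n. ennreal (?D n z)) \<longlonglongrightarrow> ennreal (((if u (fst z + t, snd z) = 0 then sq2 (?\<eta> (fst z + t, snd z)) else 0) - (if u z = 0 then sq2 (?\<eta> z) else 0))^2)" for z
      by (intro tendsto_ennrealI tendsto_power tendsto_diff vanishing_truncation(1) u0)
    have "(\<integral>\<^sup>+ z. ennreal (((if u (fst z + t, snd z) = 0 then sq2 (?\<eta> (fst z + t, snd z)) else 0) - (if u z = 0 then sq2 (?\<eta> z) else 0))^2) \<partial>lborel)
      = (\<integral>\<^sup>+ z. liminf (\<lambda>n. ennreal (?D n z)) \<partial>lborel)"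
      by (rule nn_integral_cong[OF lim_imp_Liminf[OF trivial_limit_sequentially lim, symmetric]])
    also have "\<dots> \<le> liminf (\<lambda>n. \<integral>\<^sup>+ z. ennreal (?D n z) \<partial>lborel)" by (rule nn_integral_liminf) (use m in \<open>simp add: borel_measurable_lborel\<close>)
    also have "\<dots> \<le> liminf (\<lambda>n. ennreal (t^2 * C))" by (intro Liminf_mono always_eventually allI C[rule_format] t) simp
    also have "\<dots> = ennreal (t^2 * C)" by (simp add: Liminf_const)
    finally show ?thesis .
  qed
  with C0 show ?thesis by blast
qed

text \<open>At such a pair of points the Gagliardo integrand of the truncation grows linearly in
  \<open>k\<close>, while its integral stays bounded. Dividing by \<open>k\<close> and applying
  Fatou leaves a limit that is positive on these pairs and has integral zero.\<close>

lemma zero_set_y_sections: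
  assumes s: "0 < s" "s < 1" and U: "supersolution s u" and l: "l > 0"
  shows "AE t in lborel. \<not> (u (fst t, fst (snd t)) = 0 \<and> dil s 1 l eta (fst t, fst (snd t)) > 0 \<and> u (fst t, snd (snd t)) > 0)"
proof -
  have u: "inH s u" and u0: "\<And>z. u z \<ge> 0" using U by (auto simp: supersolution_def)
  let ?\<eta> = "dil s 1 l eta"
  obtain C where C0: "C \<ge> 0" and C: "\<forall>k>0. (\<integral>\<^sup>+ t. ennreal (gag_integrand s (\<lambda>z. ?\<eta> z - k * u z) (\<lambda>z. cube3 (?\<eta> z - k * u z)) t) \<partial>lborel) \<le> ennreal C"
    using truncation_estimate[OF s U l] by (elim exE conjE)
  have um[measurable]: "u \<in> borel_measurable borel" by (rule inH_measurable[OF u])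
  have \<eta>m[measurable]: "?\<eta> \<in> borel_measurable borel" by (rule dil_measurable) measurable
  let ?g = "\<lambda>n t. ennreal (1 / real (Suc n)) * ennreal (gag_integrand s (\<lambda>z. ?\<eta> z - real (Suc n) * u z) (\<lambda>z. cube3 (?\<eta> z - real (Suc n) * u z)) t)"
  have gm[measurable]: "gag_integrand s (\<lambda>z. ?\<eta> z - real (Suc n) * u z) (\<lambda>z. cube3 (?\<eta> z - real (Suc n) * u z)) \<in> borel_measurable borel" for n
    by (rule gag_measurable) (unfold cube3_def, measurable)
  have m: "?g n \<in> borel_measurable borel" for n by measurable
  have "(\<integral>\<^sup>+ t. liminf (\<lambda>n. ?g n t) \<partial>lborel) \<le> liminf (\<lambda>n. \<integral>\<^sup>+ t. ?g n t \<partial>lborel)"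
    by (rule nn_integral_liminf) (use m in \<open>simp add: borel_measurable_lborel\<close>)
  also have "\<dots> \<le> liminf (\<lambda>n. ennreal (1 / real (Suc n)) * ennreal C)"
  proof (intro Liminf_mono always_eventually allI)
    fix n
    have "(\<integral>\<^sup>+ t. ?g n t \<partial>lborel) = ennreal (1 / real (Suc n)) * (\<integral>\<^sup>+ t. ennreal (gag_integrand s (\<lambda>z. ?\<eta> z - real (Suc n) * u z) (\<lambda>z. cube3 (?\<eta> z - real (Suc n) * u z)) t) \<partial>lborel)"
      by (rule nn_integral_cmult) (use gm in \<open>simp add: borel_measurable_lborel\<close>)
    also have "\<dots> \<le> ennreal (1 / real (Suc n)) * ennreal C" by (intro mult_left_mono C[rule_format]) auto
    finally show "(\<integral>\<^sup>+ t. ?g n t \<partial>lborel) \<le> ennreal (1 / real (Suc n)) * ennreal C" .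
  qed
  also have "\<dots> = 0"
  proof -
    have "(\<lambda>n. ennreal (1 / real (Suc n) * C)) \<longlonglongrightarrow> ennreal (0 * C)"
      by (intro tendsto_ennrealI tendsto_mult tendsto_const LIMSEQ_Suc[OF lim_1_over_n])
    moreover have "ennreal (1 / real (Suc n) * C) = ennreal (1 / real (Suc n)) * ennreal C" for n by (rule ennreal_mult) (use C0 in auto)
    ultimately have "(\<lambda>n. ennreal (1 / real (Suc n)) * ennreal C) \<longlonglongrightarrow> ennreal (0 * C)" by simp
    from lim_imp_Liminf[OF trivial_limit_sequentially this] show ?thesis by simp
  qed
  finally have "(\<integral>\<^sup>+ t. liminf (\<lambda>n. ?g n t) \<partial>lborel) = 0" by simp
  then have "AE t in lborel. liminf (\<lambda>n. ?g n t) = 0"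
    by (subst (asm) nn_integral_0_iff_AE) (use m in \<open>auto simp: borel_measurable_lborel\<close>)
  then show ?thesis
  proof eventually_elim
    case (elim t)
    show ?case
    proof
      define z1 z2 where "z1 = (fst t, fst (snd t))" and "z2 = (fst t, snd (snd t))"
      define d where "d = \<bar>fst (snd t) - snd (snd t)\<bar> powr (1 + 2 * s)"
      assume "u (fst t, fst (snd t)) = 0 \<and> ?\<eta> (fst t, fst (snd t)) > 0 \<and> u (fst t, snd (snd t)) > 0"
      then have h: "u z1 = 0" "?\<eta> z1 > 0" "u z2 > 0" by (auto simp: z1_def z2_def)
      have "fst (snd t) \<noteq> snd (snd t)" using h by (auto simp: z1_def z2_def)
      then have d0: "d > 0" by (simp add: d_def)
      \<comment> \<open>Since \<open>u\<close> vanishes at the first point, one factor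
        \<open>k\<close> remains attached to \<open>u z2\<close>, and the division cancels
        it.\<close>
      have eq: "?g n t = ennreal ((1 / real (Suc n) * (?\<eta> z1 - ?\<eta> z2) + u z2) * (cube3 (?\<eta> z1 - real (Suc n) * u z1) - cube3 (?\<eta> z2 - real (Suc n) * u z2)) / d)" for n
        unfolding ennreal_mult'[symmetric, of "1 / real (Suc n)", simplified] gag_eq d_def z1_def z2_def
        using h(1) by (simp add: ennreal_mult'[symmetric] z1_def z2_def field_simps)
      have "(\<lambda>n. ?g n t) \<longlonglongrightarrow> ennreal ((0 * (?\<eta> z1 - ?\<eta> z2) + u z2) * (cube3 (?\<eta> z1) - 0) / d)"
        unfolding eq using vanishing_truncation(2)[OF u0[of z1], of "?\<eta> z1"] vanishing_truncation(2)[OF u0[of z2], of "?\<eta> z2"] h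
        by (intro tendsto_ennrealI tendsto_divide tendsto_mult tendsto_add tendsto_diff tendsto_const LIMSEQ_Suc[OF lim_1_over_n]) (use d0 in auto)
      then have "ennreal ((0 * (?\<eta> z1 - ?\<eta> z2) + u z2) * (cube3 (?\<eta> z1) - 0) / d) = 0"
        using elim by (simp only: lim_imp_Liminf[OF trivial_limit_sequentially])
      moreover have "u z2 * cube3 (?\<eta> z1) / d > 0" using h d0 by (simp add: cube3_def)
      ultimately show False by (simp add: ennreal_eq_0_iff)
    qed
  qed
qed

lemma nn_x_shift_measurable: "f \<in> borel_measurable borel \<Longrightarrow> (\<lambda>z::real\<times>real. f (fst z + a, snd z) :: ennreal) \<in> borel_measurable borel"
  by (rule measurable_borel_pairI[where f="\<lambda>z. (fst z + a, snd z)" and g=f]) (auto intro!: continuous_intros)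

text \<open>The number 27/64 is the value \<open>(1 - 1/4)^3\<close> of \<open>bump\<close> at 1/2,
  one factor for each coordinate.\<close>

lemma eta_dil_lower:
  assumes s: "0 < s" "s < 1" and l: "0 < l" "l \<le> 1" "l * \<bar>fst z\<bar> \<le> 1/2" "l * \<bar>snd z\<bar> \<le> 1/2"
  shows "dil s 1 l eta z \<ge> (27/64)^2"
proof -
  have b: "bump x \<ge> 27/64" if "\<bar>x\<bar> \<le> 1/2" for x
  proof -
    have "x^2 \<le> 1/4" using power_mono[OF that abs_ge_zero, of 2] by (simp add: power_divide)
    then have "(3/4)^3 \<le> (max 0 (1 - x^2))^3" by (intro power_mono) auto
    then show ?thesis by (simp add: bump_def power_divide)
  qed
  have "l powr (1/s) \<le> l powr 1" using l s by (intro powr_mono') auto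
  then have "l powr (1/s) * \<bar>snd z\<bar> \<le> 1/2" using l mult_right_mono[of "l powr (1/s)" l "\<bar>snd z\<bar>"] by simp
  then have "bump (l powr (1/s) * snd z) \<ge> 27/64" by (intro b) (simp add: abs_mult)
  moreover have "bump (l * fst z) \<ge> 27/64" using l by (intro b) (simp add: abs_mult)
  ultimately have "27/64 * (27/64) \<le> bump (l * fst z) * bump (l powr (1/s) * snd z)" by (intro mult_mono) auto
  then show ?thesis by (simp add: dil_def eta_def power2_eq_square)
qed

text \<open>Cutting a translation into \<open>N\<close> equal steps, the quadratic bound for the increments leaves a measure of order \<open>1/N\<close>.\<close>
lemma zero_set_x_invariant:
  assumes s: "0 < s" "s < 1" and U: "supersolution s u" and t: "t \<ge> 0"
  shows "AE z in lborel. (u (fst z + t, snd z) = 0) = (u z = 0)"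
proof -
  have um[measurable]: "u \<in> borel_measurable borel" using U inH_measurable by (auto simp: supersolution_def)
  have ush[measurable]: "(\<lambda>z. u (fst z + h, snd z)) \<in> borel_measurable borel" for h by (rule measurable_x_shift[OF um])
  \<comment> \<open>Marks the points whose membership in the zero set changes under the shift; it is
    subadditive along consecutive shifts.\<close>
  define c :: "real \<Rightarrow> real \<times> real \<Rightarrow> ennreal" where "c h z = (if (u (fst z + h, snd z) = 0) = (u z = 0) then 0 else 1)" for h z
  define bx :: "real \<Rightarrow> real \<times> real \<Rightarrow> ennreal" where "bx r z = indicator {-r..r} (fst z) * indicator {-r..r} (snd z)" for r z
  have cm[measurable]: "c h \<in> borel_measurable borel" for h unfolding c_def by measurable
  have bm[measurable]: "bx r \<in> borel_measurable borel" for r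
  proof -
    have [measurable]: "(\<lambda>z::real\<times>real. indicator {-r..r} (fst z) :: ennreal) \<in> borel_measurable borel" "(\<lambda>z::real\<times>real. indicator {-r..r} (snd z) :: ennreal) \<in> borel_measurable borel"
      by (rule measurable_borel_pairI[where g="indicator {-r..r}"]; auto intro: continuous_intros)+
    show ?thesis unfolding bx_def by measurable
  qed
  have box: "(\<integral>\<^sup>+ z. bx R z * c t z \<partial>lborel) = 0" if R: "R \<ge> 1" for R
  proof -
    \<comment> \<open>Makes the dilated cutoff at least \<open>(27/64)^2\<close> on the box of
      half-width \<open>R + 2 * t\<close>, which contains every point reached by a step of length at
      most \<open>t\<close> from the box of half-width \<open>R + t\<close>.\<close>
    define l where "l = 1 / (2 * (R + 2 * t))"
    have Rt: "2 * (R + 2 * t) \<ge> 2" using R t by simp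
    then have l: "0 < l" "l \<le> 1" by (simp_all add: l_def)
    have lb: "dil s 1 l eta z \<ge> (27/64)^2" if "\<bar>fst z\<bar> \<le> R + 2 * t" "\<bar>snd z\<bar> \<le> R + 2 * t" for z
    proof (rule eta_dil_lower[OF s l])
      show "l * \<bar>fst z\<bar> \<le> 1/2" "l * \<bar>snd z\<bar> \<le> 1/2" using that Rt by (simp_all add: l_def field_simps)
    qed
    obtain C where C0: "C \<ge> 0" and C:
      "\<forall>t\<ge>0. (\<integral>\<^sup>+ z. ennreal (((if u (fst z + t, snd z) = 0 then sq2 (dil s 1 l eta (fst z + t, snd z)) else 0) - (if u z = 0 then sq2 (dil s 1 l eta z) else 0))^2) \<partial>lborel) \<le> ennreal (t^2 * C)"
      using zero_set_x_increments[OF s U l(1)] by (elim exE conjE)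
    have \<eta>m[measurable]: "dil s 1 l eta \<in> borel_measurable borel" by (rule dil_measurable) measurable
    define k :: real where "k = (sq2 ((27/64)^2))^2"
    have k: "k > 0" by (simp add: k_def sq2_def)
    have sqm: "sq2 x \<ge> sq2 ((27/64)^2)" if "x \<ge> (27/64)^2" for x :: real
      unfolding sq2_def using that by (intro divide_right_mono power_mono) auto
    have sq0: "sq2 ((27/64)^2) \<ge> 0" by (simp add: sq2_def)
    \<comment> \<open>A change of membership forces a jump of squared size at least
      \<open>k\<close>, so the quadratic bound on increments limits the measure of such
      points.\<close>
    have step: "(\<integral>\<^sup>+ z. bx (R + t) z * c h z \<partial>lborel) \<le> ennreal (h^2 * C / k)" if h: "0 \<le> h" "h \<le> t" for h
    proof -
      let ?F = "\<lambda>z. if u z = 0 then sq2 (dil s 1 l eta z) else 0"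
      have Fm[measurable]: "?F \<in> borel_measurable borel" unfolding sq2_def by measurable
      have pt: "bx (R + t) z * c h z \<le> ennreal (1 / k) * ennreal ((?F (fst z + h, snd z) - ?F z)^2)" for z
      proof (cases "bx (R + t) z * c h z = 0")
        case False
        then have z: "\<bar>fst z\<bar> \<le> R + t" "\<bar>snd z\<bar> \<le> R + t" and ne: "(u (fst z + h, snd z) = 0) \<noteq> (u z = 0)"
          by (auto simp: bx_def c_def indicator_def split: if_splits)
        have one: "bx (R + t) z * c h z = 1" using False by (auto simp: bx_def c_def indicator_def split: if_splits)
        have l1: "sq2 (dil s 1 l eta z) \<ge> sq2 ((27/64)^2)" "sq2 (dil s 1 l eta (fst z + h, snd z)) \<ge> sq2 ((27/64)^2)"
          using z h t by (auto intro!: sqm lb)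
        have "sq2 ((27/64)^2) \<le> \<bar>?F (fst z + h, snd z) - ?F z\<bar>" using ne l1 by auto
        from power_mono[OF this sq0, of 2] have "k \<le> (?F (fst z + h, snd z) - ?F z)^2" by (simp add: k_def)
        then have "1 \<le> 1 / k * (?F (fst z + h, snd z) - ?F z)^2" using k by simp
        then have "ennreal 1 \<le> ennreal (1 / k * (?F (fst z + h, snd z) - ?F z)^2)" by (rule ennreal_leI)
        also have "\<dots> = ennreal (1 / k) * ennreal ((?F (fst z + h, snd z) - ?F z)^2)" by (rule ennreal_mult) (use k in auto)
        finally show ?thesis unfolding one by simp
      next
        case True
        show ?thesis unfolding True by (rule zero_le)
      qed
      have "(\<integral>\<^sup>+ z. bx (R + t) z * c h z \<partial>lborel) \<le> (\<integral>\<^sup>+ z. ennreal (1 / k) * ennreal ((?F (fst z + h, snd z) - ?F z)^2) \<partial>lborel)"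
        by (rule nn_integral_mono[OF pt])
      also have "\<dots> = ennreal (1 / k) * (\<integral>\<^sup>+ z. ennreal ((?F (fst z + h, snd z) - ?F z)^2) \<partial>lborel)"
        by (rule nn_integral_cmult) (use measurable_x_shift[OF Fm, of h] Fm in \<open>simp add: borel_measurable_lborel\<close>)
      also have "\<dots> \<le> ennreal (1 / k) * ennreal (h^2 * C)" using C[rule_format, OF h(1)] by (intro mult_left_mono) auto
      also have "\<dots> = ennreal (h^2 * C / k)" using C0 k ennreal_mult[of "1 / k" "h^2 * C"] by simp
      finally show ?thesis .
    qed
    have bound: "(\<integral>\<^sup>+ z. bx R z * c t z \<partial>lborel) \<le> ennreal (1 / real (Suc n) * (t^2 * C / k))" for n
    proof -
      define h where "h = t / real (Suc n)"
      have h: "0 \<le> h" "h \<le> t" using t by (auto simp: h_def divide_simps mult_le_cancel_left1)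
      have ind: "(\<integral>\<^sup>+ z. bx R z * c (real j * h) z \<partial>lborel) \<le> of_nat j * ennreal (h^2 * C / k)" if "j \<le> Suc n" for j
        using that
      proof (induction j)
        case 0
        then show ?case by (simp add: c_def)
      next
        case (Suc j)
        have jh: "0 \<le> real j * h" "real j * h \<le> t"
        proof -
          have "real j * h \<le> real (Suc n) * h" using Suc.prems h by (intro mult_right_mono) auto
          then show "real j * h \<le> t" by (simp add: h_def)
        qed (use h in simp)
        let ?f = "\<lambda>z. bx (R + t) z * c h z"
        have pt: "bx R z * c (real (Suc j) * h) z \<le> bx R z * c (real j * h) z + ?f (fst z + real j * h, snd z)" for z
        proof -
          have "c (real (Suc j) * h) z \<le> c (real j * h) z + c h (fst z + real j * h, snd z)"
            by (auto simp: c_def algebra_simps)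
          then have "bx R z * c (real (Suc j) * h) z \<le> bx R z * (c (real j * h) z + c h (fst z + real j * h, snd z))" by (rule mult_left_mono) simp
          also have "\<dots> = bx R z * c (real j * h) z + bx R z * c h (fst z + real j * h, snd z)" by (rule distrib_left)
          also have "\<dots> \<le> bx R z * c (real j * h) z + ?f (fst z + real j * h, snd z)"
          proof (intro add_left_mono mult_right_mono)
            show "bx R z \<le> bx (R + t) (fst z + real j * h, snd z)" using jh t by (auto simp: bx_def indicator_def)
          qed simp
          finally show ?thesis .
        qed
        have fm: "?f \<in> borel_measurable borel" by measurable
        have "(\<integral>\<^sup>+ z. bx R z * c (real (Suc j) * h) z \<partial>lborel) \<le> (\<integral>\<^sup>+ z. bx R z * c (real j * h) z + ?f (fst z + real j * h, snd z) \<partial>lborel)"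
          by (rule nn_integral_mono[OF pt])
        also have "\<dots> = (\<integral>\<^sup>+ z. bx R z * c (real j * h) z \<partial>lborel) + (\<integral>\<^sup>+ z. ?f (fst z + real j * h, snd z) \<partial>lborel)"
        proof (rule nn_integral_add; unfold borel_measurable_lborel)
          show "(\<lambda>z. bx R z * c (real j * h) z) \<in> borel_measurable borel" by measurable
          show "(\<lambda>z. ?f (fst z + real j * h, snd z)) \<in> borel_measurable borel" by (rule nn_x_shift_measurable[OF fm])
        qed
        also have "(\<integral>\<^sup>+ z. ?f (fst z + real j * h, snd z) \<partial>lborel) = (\<integral>\<^sup>+ z. ?f z \<partial>lborel)" by (rule nn_integral_x_shift[OF fm])
        also have "(\<integral>\<^sup>+ z. bx R z * c (real j * h) z \<partial>lborel) + (\<integral>\<^sup>+ z. ?f z \<partial>lborel) \<le> of_nat j * ennreal (h^2 * C / k) + ennreal (h^2 * C / k)"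
          using Suc by (intro add_mono step h) auto
        also have "\<dots> = of_nat (Suc j) * ennreal (h^2 * C / k)" by (simp add: distrib_right add.commute)
        finally show ?case .
      qed
      have "(\<integral>\<^sup>+ z. bx R z * c t z \<partial>lborel) \<le> of_nat (Suc n) * ennreal (h^2 * C / k)"
        using ind[OF order_refl] by (simp add: h_def)
      also have "\<dots> = ennreal (real (Suc n) * (h^2 * C / k))" using C0 k by (subst ennreal_mult) (auto simp: ennreal_of_nat_eq_real_of_nat)
      also have "real (Suc n) * (h^2 * C / k) = 1 / real (Suc n) * (t^2 * C / k)" by (simp add: h_def power2_eq_square field_simps del: of_nat_Suc)
      finally show ?thesis .
    qed
    have "(\<lambda>n. ennreal (1 / real (Suc n) * (t^2 * C / k))) \<longlonglongrightarrow> ennreal (0 * (t^2 * C / k))"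
      by (intro tendsto_ennrealI tendsto_mult tendsto_const LIMSEQ_Suc[OF lim_1_over_n])
    from tendsto_lowerbound[OF this always_eventually[OF allI, OF bound]] show ?thesis by simp
  qed
  have "AE z in lborel. \<forall>n::nat. bx (real (Suc n)) z * c t z = 0"
    unfolding AE_all_countable
  proof
    fix n
    show "AE z in lborel. bx (real (Suc n)) z * c t z = 0"
    proof -
      have "(\<integral>\<^sup>+ z. bx (real (Suc n)) z * c t z \<partial>lborel) = 0" by (rule box) simp
      then show ?thesis by (subst (asm) nn_integral_0_iff_AE) (unfold borel_measurable_lborel, measurable)
    qed
  qed
  then show ?thesis
  proof eventually_elim
    case (elim z)
    obtain n :: nat where "\<bar>fst z\<bar> + \<bar>snd z\<bar> < real n" using reals_Archimedean2 by blast
    then have "fst z \<in> {-real (Suc n)..real (Suc n)}" "snd z \<in> {-real (Suc n)..real (Suc n)}" by auto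
    then have one: "bx (real (Suc n)) z = 1" unfolding bx_def by (simp only: indicator_simps mult_1)
    have c0: "c t z = 0" using elim[rule_format, of n] unfolding one by simp
    show ?case
    proof (rule ccontr)
      assume n: "\<not> ?case"
      show False using c0 unfolding c_def if_not_P[OF n] by simp
    qed
  qed
qed

text \<open>With \<open>\<zeta> x\<close> and \<open>\<pi> x\<close> the lengths of the zero set and
  its complement on a vertical line, the vertical result gives \<open>\<zeta> x * \<pi> x\<close>
  integral zero, and horizontal invariance allows \<open>\<pi>\<close> to be shifted freely.
  Integrating over the shift factorises, so one of the two sets is null.\<close>

theorem strong_maximum_principle:
  assumes s: "0 < s" "s < 1" and U: "supersolution s u" and ne: "Lpow 2 u \<noteq> 0"
  shows "AE z in lborel. u z > 0"
proof -
  have u: "inH s u" and u0: "\<And>z. u z \<ge> 0" using U by (auto simp: supersolution_def)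
  have um[measurable]: "u \<in> borel_measurable borel" by (rule inH_measurable[OF u])
  define A B :: "real \<times> real \<Rightarrow> ennreal" where "A z = (if u z = 0 then 1 else 0)" and "B z = (if u z = 0 then 0 else 1)" for z
  have Am[measurable]: "A \<in> borel_measurable borel" and Bm[measurable]: "B \<in> borel_measurable borel" unfolding A_def B_def by measurable
  define \<zeta> \<pi> where "\<zeta> x = (\<integral>\<^sup>+ y. A (x, y) \<partial>lborel)" and "\<pi> x = (\<integral>\<^sup>+ y. B (x, y) \<partial>lborel)" for x
  have sm: "(\<lambda>x. \<integral>\<^sup>+ y. f (x, y) \<partial>(lborel :: real measure)) \<in> borel_measurable borel" if "f \<in> borel_measurable borel" for f :: "real \<times> real \<Rightarrow> ennreal"
    using lborel.borel_measurable_nn_integral_fst[of f "lborel :: real measure"] that by (simp add: lborel_prod borel_measurable_lborel)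
  have \<zeta>m[measurable]: "\<zeta> \<in> borel_measurable borel" and \<pi>m[measurable]: "\<pi> \<in> borel_measurable borel"
    unfolding \<zeta>_def \<pi>_def using sm Am Bm by auto
  have sec: "AE t in lborel. \<not> (u (fst t, fst (snd t)) = 0 \<and> u (fst t, snd (snd t)) > 0)"
  proof -
    \<comment> \<open>Every point lies where one of these countably many spread-out cutoffs is
      positive.\<close>
    have "AE t in lborel. \<forall>n::nat. \<not> (u (fst t, fst (snd t)) = 0 \<and> dil s 1 (1 / real (Suc n)) eta (fst t, fst (snd t)) > 0 \<and> u (fst t, snd (snd t)) > 0)"
      unfolding AE_all_countable by (intro allI zero_set_y_sections[OF s U]) simp
    then show ?thesis
    proof eventually_elim
      case (elim t)
      obtain n :: nat where n: "2 * (\<bar>fst t\<bar> + \<bar>fst (snd t)\<bar>) < real n" using reals_Archimedean2 by blast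
      then have "dil s 1 (1 / real (Suc n)) eta (fst t, fst (snd t)) \<ge> (27/64)^2"
        by (intro eta_dil_lower[OF s]) (auto simp: divide_simps)
      then have "dil s 1 (1 / real (Suc n)) eta (fst t, fst (snd t)) > 0" by (rule less_le_trans[rotated]) simp
      then show ?case using elim by blast
    qed
  qed
  have zero: "(\<integral>\<^sup>+ x. \<zeta> x * \<pi> x \<partial>lborel) = 0"
  proof -
    let ?f = "\<lambda>t::real\<times>real\<times>real. A (fst t, fst (snd t)) * B (fst t, snd (snd t))"
    have fm: "?f \<in> borel_measurable borel" unfolding A_def B_def using measurable_sections(1,2)[OF um] by measurable
    have sA: "(\<lambda>y. A (x, y)) \<in> borel_measurable borel" and sB: "(\<lambda>y. B (x, y)) \<in> borel_measurable borel" for x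
      using measurable_Pair_section[OF Am] measurable_Pair_section[OF Bm] by auto
    have "(\<integral>\<^sup>+ t. ?f t \<partial>lborel) = 0"
      by (subst nn_integral_0_iff_AE) (use fm sec u0 in \<open>auto simp: borel_measurable_lborel A_def B_def less_le elim!: eventually_mono\<close>)
    moreover have "(\<integral>\<^sup>+ t. ?f t \<partial>lborel) = (\<integral>\<^sup>+ x. \<integral>\<^sup>+ y. \<integral>\<^sup>+ y'. A (x, y) * B (x, y') \<partial>lborel \<partial>lborel \<partial>lborel)"
      using nn_integral_real3[OF fm] by simp
    moreover have "\<dots> = (\<integral>\<^sup>+ x. \<zeta> x * \<pi> x \<partial>lborel)"
      unfolding \<zeta>_def \<pi>_def using sA sB by (simp add: nn_integral_cmult nn_integral_multc borel_measurable_lborel)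
    ultimately show ?thesis by simp
  qed
  have inv: "AE x in lborel. \<pi> (x + t) = \<pi> x" for t
  proof -
    have "AE z in lborel. (u (fst z + t, snd z) = 0) = (u z = 0)"
    proof (cases "t \<ge> 0")
      case True
      then show ?thesis by (rule zero_set_x_invariant[OF s U])
    next
      case False
      have "AE z in lborel. (u (fst z + - t, snd z) = 0) = (u z = 0)" by (rule zero_set_x_invariant[OF s U]) (use False in simp)
      from preserving_AE[OF preserving_shift[of "(t, 0)"] this] show ?thesis by (auto simp: add.commute elim!: eventually_mono)
    qed
    then have "AE z in lborel \<Otimes>\<^sub>M lborel. B (fst z + t, snd z) = B z" unfolding lborel_prod by eventually_elim (simp add: B_def)
    from lborel_pair.AE_pair[OF this] have "AE x in lborel. AE y in lborel. B (x + t, y) = B (x, y)" by simp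
    then show ?thesis by eventually_elim (unfold \<pi>_def, rule nn_integral_cong_AE)
  qed
  have "(\<integral>\<^sup>+ x. \<zeta> x * \<pi> (x + t) \<partial>lborel) = 0" for t
  proof -
    have "(\<integral>\<^sup>+ x. \<zeta> x * \<pi> (x + t) \<partial>lborel) = (\<integral>\<^sup>+ x. \<zeta> x * \<pi> x \<partial>lborel)"
      by (rule nn_integral_cong_AE) (use inv[of t] in \<open>auto elim!: eventually_mono\<close>)
    then show ?thesis using zero by simp
  qed
  then have "0 = (\<integral>\<^sup>+ t. \<integral>\<^sup>+ x. \<zeta> x * \<pi> (x + t) \<partial>lborel \<partial>lborel)" by simp
  also have "\<dots> = (\<integral>\<^sup>+ x. \<integral>\<^sup>+ t. \<zeta> x * \<pi> (x + t) \<partial>lborel \<partial>lborel)"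
  proof -
    have m: "(\<lambda>p::real\<times>real. \<zeta> (snd p) * \<pi> (snd p + fst p)) \<in> borel_measurable borel"
      by (intro borel_measurable_times_ennreal measurable_borel_pairI[OF \<zeta>m] measurable_borel_pairI[OF \<pi>m] continuous_intros)
    show ?thesis using nn_integral_real2_swap[OF m] by simp
  qed
  also have "\<dots> = (\<integral>\<^sup>+ x. \<zeta> x * (\<integral>\<^sup>+ t. \<pi> t \<partial>lborel) \<partial>lborel)"
  proof (rule nn_integral_cong)
    fix x
    have "(\<integral>\<^sup>+ t. \<zeta> x * \<pi> (x + t) \<partial>lborel) = \<zeta> x * (\<integral>\<^sup>+ t. \<pi> (x + t) \<partial>lborel)"
      by (rule nn_integral_cmult) measurable
    then show "(\<integral>\<^sup>+ t. \<zeta> x * \<pi> (x + t) \<partial>lborel) = \<zeta> x * (\<integral>\<^sup>+ t. \<pi> t \<partial>lborel)" using nn_integral_shift[OF \<pi>m, of x] by simp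
  qed
  also have "\<dots> = (\<integral>\<^sup>+ x. \<zeta> x \<partial>lborel) * (\<integral>\<^sup>+ t. \<pi> t \<partial>lborel)" by (rule nn_integral_multc) measurable
  also have "\<dots> = (\<integral>\<^sup>+ z. A z \<partial>lborel) * (\<integral>\<^sup>+ z. B z \<partial>lborel)"
    unfolding \<zeta>_def \<pi>_def by (simp add: nn_integral_real2[OF Am] nn_integral_real2[OF Bm])
  finally have "(\<integral>\<^sup>+ z. A z \<partial>lborel) * (\<integral>\<^sup>+ z. B z \<partial>lborel) = 0" by (rule sym)
  then have "(\<integral>\<^sup>+ z. A z \<partial>lborel) = 0 \<or> (\<integral>\<^sup>+ z. B z \<partial>lborel) = 0" by (simp only: mult_eq_0_iff)
  then consider "(\<integral>\<^sup>+ z. A z \<partial>lborel) = 0" | "(\<integral>\<^sup>+ z. B z \<partial>lborel) = 0" by (elim disjE)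
  then show ?thesis
  proof cases
    case 1
    then have "AE z in lborel. A z = 0" by (subst (asm) nn_integral_0_iff_AE) (auto simp: borel_measurable_lborel)
    then show ?thesis by eventually_elim (use u0 in \<open>auto simp: A_def less_le split: if_splits\<close>)
  next
    case 2
    then have "AE z in lborel. B z = 0" by (subst (asm) nn_integral_0_iff_AE) (auto simp: borel_measurable_lborel)
    then have "AE z in lborel. u z = 0" by eventually_elim (auto simp: B_def split: if_splits)
    then show ?thesis using ne Lpow2_zero_iff inH_memLp(1)[OF u] by blast
  qed
qed

subsection \<open>Ground states and the sharp Gagliardo--Nirenberg inequality\<close>

text \<open>Passing to the positive part changes \<open>u\<close> only on a null set and alters no
  pairing.\<close>

lemma strong_maximum_principle_AE:
  assumes s: "0 < s" "s < 1" and u: "inH s u" and pos: "AE z in lborel. u z \<ge> 0" and ne: "Lpow 2 u \<noteq> 0"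
    and super: "\<And>\<phi>. inH s \<phi> \<Longrightarrow> (\<forall>z. \<phi> z \<ge> 0) \<Longrightarrow> innerH s u \<phi> \<ge> 0"
  shows "AE z in lborel. u z > 0"
proof -
  define D where "D = (\<lambda>z. max 0 (u z) - u z)"
  have um[measurable]: "u \<in> borel_measurable borel" by (rule inH_measurable[OF u])
  have Dm: "D \<in> borel_measurable borel" unfolding D_def by measurable
  have D0: "AE z in lborel. D z = 0" using pos by eventually_elim (simp add: D_def)
  have DH: "inH s D" by (rule inH_zero_AE[OF Dm D0])
  have e: "(\<lambda>z. max 0 (u z)) = (\<lambda>z. 1 * u z + 1 * D z)" by (simp add: D_def)
  have vH: "inH s (\<lambda>z. max 0 (u z))" unfolding e by (rule inH_lin[OF u DH])
  have "innerH s (\<lambda>z. max 0 (u z)) \<phi> = innerH s u \<phi>" if \<phi>: "inH s \<phi>" for \<phi>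
  proof -
    have "innerK s (\<lambda>z. max 0 (u z)) \<phi> = innerK s u \<phi>"
      unfolding e innerK_lin[OF u DH \<phi>] innerK_zero_AE[OF Dm D0 \<phi>] by simp
    moreover have "(LINT z|lborel. max 0 (u z) * \<phi> z) = (LINT z|lborel. u z * \<phi> z)"
    proof (rule integral_cong_AE)
      show "AE z in lborel. max 0 (u z) * \<phi> z = u z * \<phi> z" using pos by eventually_elim simp
    qed (use inH_measurable(1)[OF \<phi>] in \<open>simp_all add: borel_measurable_lborel\<close>)
    ultimately show ?thesis by (simp add: innerH_def)
  qed
  then have U: "supersolution s (\<lambda>z. max 0 (u z))" using vH super by (auto simp: supersolution_def)
  have eq: "AE z in lborel. max 0 (u z) = u z" using pos by eventually_elim simp
  have "Lpow 2 (\<lambda>z. max 0 (u z)) = Lpow 2 u" unfolding Lpow_def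
    by (rule integral_cong_AE) (use eq in \<open>auto simp: borel_measurable_lborel elim!: eventually_mono\<close>)
  then have "AE z in lborel. max 0 (u z) > 0" using strong_maximum_principle[OF s U] ne by simp
  then show ?thesis by eventually_elim simp
qed

text \<open>The scale-invariant quotient whose maximisers are the rescaled ground states.\<close>
definition gn_quotient :: "real \<Rightarrow> real \<Rightarrow> fn2 \<Rightarrow> real" where
  "gn_quotient s p w = Lpow p w / (Kf s w powr th s p * Lpow 2 w powr (p / 2 - th s p))"

text \<open>Here \<open>\<kappa>\<close>, \<open>m\<close> and \<open>\<alpha>\<close> are
  \<open>Kf\<close>, the mass and \<open>Lpow p\<close> of a weak solution relative to a maximiser;
  \<open>lin\<close> comes from the Nehari identity and \<open>le\<close> from maximality. Concavity
  of the logarithm against the linear relation leaves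
  \<open>(\<theta> + \<tau> - 1) * ln \<alpha> \<ge> 0\<close>; equality in
  \<open>ln x \<le> x - 1\<close> gives rigidity.\<close>

lemma ln_AM_GM:
  fixes \<theta> \<tau> :: real
  assumes t: "\<theta> > 0" "\<tau> > 0" "\<theta> + \<tau> > 1" and pos: "\<kappa> > 0" "m > 0" "\<alpha> > 0"
    and lin: "\<theta> * \<kappa> + \<tau> * m = (\<theta> + \<tau>) * \<alpha>" and le: "ln \<alpha> \<le> \<theta> * ln \<kappa> + \<tau> * ln m"
  shows "\<alpha> \<ge> 1" "\<alpha> = 1 \<Longrightarrow> \<kappa> = 1 \<and> m = 1"
proof -
  have a: "ln (\<kappa> / \<alpha>) \<le> \<kappa> / \<alpha> - 1" "ln (m / \<alpha>) \<le> m / \<alpha> - 1" using pos by (auto intro!: ln_le_minus_one)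
  have z: "\<theta> * (\<kappa> / \<alpha> - 1) + \<tau> * (m / \<alpha> - 1) = 0"
  proof -
    have "\<theta> * (\<kappa> / \<alpha> - 1) + \<tau> * (m / \<alpha> - 1) = (\<theta> * \<kappa> + \<tau> * m) / \<alpha> - (\<theta> + \<tau>)" using pos by (simp add: field_simps)
    then show ?thesis unfolding lin using pos by simp
  qed
  have b: "\<theta> * ln (\<kappa> / \<alpha>) \<le> \<theta> * (\<kappa> / \<alpha> - 1)" "\<tau> * ln (m / \<alpha>) \<le> \<tau> * (m / \<alpha> - 1)"
    using a t by (auto intro!: mult_left_mono)
  have c: "\<theta> * ln (\<kappa> / \<alpha>) + \<tau> * ln (m / \<alpha>) = \<theta> * ln \<kappa> + \<tau> * ln m - (\<theta> + \<tau>) * ln \<alpha>"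
    using pos by (simp add: ln_div algebra_simps)
  have "ln \<alpha> \<le> (\<theta> + \<tau>) * ln \<alpha>" using b z c le by linarith
  then have "(\<theta> + \<tau> - 1) * ln \<alpha> \<ge> 0" by (simp add: algebra_simps)
  then have "ln \<alpha> \<ge> 0" using t by (simp add: zero_le_mult_iff)
  then show "\<alpha> \<ge> 1" using pos by (simp add: ln_ge_zero_iff)
  assume \<alpha>1: "\<alpha> = 1"
  note b' = b[unfolded \<alpha>1 div_by_1] and z' = z[unfolded \<alpha>1 div_by_1] and le' = le[unfolded \<alpha>1 ln_one]
  have "\<theta> * ln \<kappa> = \<theta> * (\<kappa> - 1)" "\<tau> * ln m = \<tau> * (m - 1)" using b' z' le' by linarith+
  then have "ln \<kappa> = \<kappa> - 1" "ln m = m - 1" using t by (simp_all only: mult_cancel_left) auto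
  then show "\<kappa> = 1 \<and> m = 1" using pos ln_eq_minus_one by blast
qed

locale subcritical =
  fixes s p :: real
  assumes s: "0 < s" "s < 1" and p: "2 < p" "p < 2 * (1 + s) / (1 - s)" and th1: "th s p > 1"
begin

abbreviation \<theta> where "\<theta> \<equiv> th s p"
definition \<tau> where "\<tau> = p / 2 - \<theta>"

lemma \<tau>_pos: "\<tau> > 0"
proof -
  have "p * (1 - s) < 2 * (1 + s)" using p s by (simp add: pos_less_divide_eq)
  moreover have "\<tau> = (2 * (1 + s) - p * (1 - s)) / (4 * s)" using s by (simp add: \<tau>_def th_def field_simps)
  ultimately show ?thesis using s by simp
qed

text \<open>Invariance of the quotient under change of amplitude and under dilation,
  respectively.\<close>

lemma exponents: "2 * \<theta> + 2 * \<tau> = p" "(1 - 1/s) * \<theta> - (1 + 1/s) * \<tau> = - (1 + 1/s)"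
  using s by (simp_all add: \<tau>_def th_def field_simps)

lemma nontrivial:
  assumes w: "inH s w" "Lpow 2 w \<noteq> 0"
  shows "Kf s w > 0" "Lpow 2 w > 0" "Lpow p w > 0"
proof -
  have n: "\<not> (AE z in lborel. w z = 0)" using Lpow2_zero_iff[OF inH_memLp(1)[OF w(1)]] w(2) by simp
  show "Kf s w > 0" using Kf_zero_imp[OF s w(1)] n Kf_nonneg[OF s, of w] by fastforce
  show "Lpow 2 w > 0" using w(2) Lpow_nonneg[of 2 w] by simp
  show "Lpow p w > 0" using Lpow_zero_iff[OF inH_memLp_p[OF s p w(1)]] n Lpow_nonneg[of p w] by fastforce
qed

lemma gn_quotient_dil:
  assumes c: "c > 0" "l > 0" and w: "inH s w"
  shows "gn_quotient s p (dil s c l w) = gn_quotient s p w"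
proof -
  define F where "F = c powr p / l powr (1 + 1/s)"
  have F: "F > 0" using c by (simp add: F_def)
  have wm: "w \<in> borel_measurable borel" by (rule inH_measurable[OF w])
  have e1: "Kf s (dil s c l w) powr \<theta> = c powr (2 * \<theta>) * l powr ((1 - 1/s) * \<theta>) * Kf s w powr \<theta>"
    unfolding Kf_dil[OF c(2) s(1) w] powr_sq[OF c(1)] using c Kf_nonneg[OF s, of w] by (simp only: powr_mult powr_powr)
  have e2: "Lpow 2 (dil s c l w) powr \<tau> = c powr (2 * \<tau>) * l powr (- (1 + 1/s) * \<tau>) * Lpow 2 w powr \<tau>"
  proof -
    have "Lpow 2 (dil s c l w) = c powr 2 * l powr (- (1 + 1/s)) * Lpow 2 w"
      using c unfolding Lpow_dil[OF wm c(2)] powr_minus by (simp add: divide_inverse)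
    then show ?thesis using c Lpow_nonneg[of 2 w] by (simp only: powr_mult powr_powr)
  qed
  have e3: "c powr (2 * \<theta>) * l powr ((1 - 1/s) * \<theta>) * (c powr (2 * \<tau>) * l powr (- (1 + 1/s) * \<tau>)) = F"
  proof -
    have "c powr (2 * \<theta>) * c powr (2 * \<tau>) = c powr p" unfolding powr_add[symmetric] exponents ..
    moreover have "l powr ((1 - 1/s) * \<theta>) * l powr (- (1 + 1/s) * \<tau>) = l powr (- (1 + 1/s))"
    proof -
      have "(1 - 1/s) * \<theta> + - (1 + 1/s) * \<tau> = - (1 + 1/s)" using exponents(2) by (simp only: mult_minus_left add_uminus_conv_diff)
      then show ?thesis unfolding powr_add[symmetric] by (simp only:)
    qed
    ultimately have "c powr (2 * \<theta>) * l powr ((1 - 1/s) * \<theta>) * (c powr (2 * \<tau>) * l powr (- (1 + 1/s) * \<tau>)) = c powr p * l powr (- (1 + 1/s))"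
    proof -
      have "c powr (2 * \<theta>) * l powr ((1 - 1/s) * \<theta>) * (c powr (2 * \<tau>) * l powr (- (1 + 1/s) * \<tau>))
        = (c powr (2 * \<theta>) * c powr (2 * \<tau>)) * (l powr ((1 - 1/s) * \<theta>) * l powr (- (1 + 1/s) * \<tau>))" by (simp only: mult_ac)
      with \<open>c powr (2 * \<theta>) * c powr (2 * \<tau>) = c powr p\<close> \<open>l powr ((1 - 1/s) * \<theta>) * l powr (- (1 + 1/s) * \<tau>) = l powr (- (1 + 1/s))\<close>
      show ?thesis by (simp only:)
    qed
    then show ?thesis unfolding F_def powr_minus divide_inverse .
  qed
  have "Kf s (dil s c l w) powr \<theta> * Lpow 2 (dil s c l w) powr \<tau> = F * (Kf s w powr \<theta> * Lpow 2 w powr \<tau>)"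
    unfolding e1 e2 e3[symmetric] by (simp only: mult_ac)
  moreover have "Lpow p (dil s c l w) = F * Lpow p w" unfolding Lpow_dil[OF wm c(2)] F_def using c by simp
  ultimately show ?thesis using F unfolding gn_quotient_def \<tau>_def[symmetric] by simp
qed

text \<open>Any competitor can be moved by amplitude and dilation to the mass of \<open>u\<close>
  and onto the constraint without changing the quotient. There \<open>Kf\<close> is proportional to
  \<open>Lpow p\<close>, so the quotient decreases in \<open>Lpow p\<close> because
  \<open>\<theta> > 1\<close>, and the minimality of \<open>Lpow p u\<close> turns into maximality
  of the quotient.\<close>

lemma sharp_quotient:
  assumes \<mu>: "\<mu> > 0" and u: "inH s u" "Lpow 2 u \<noteq> 0" and P: "Kf s u = 2 * \<theta> * \<mu> / p * Lpow p u"
    and min: "\<And>w. inH s w \<Longrightarrow> Lpow 2 w = Lpow 2 u \<Longrightarrow> Kf s w = 2 * \<theta> * \<mu> / p * Lpow p w \<Longrightarrow> Lpow p u \<le> Lpow p w"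
    and w: "inH s w" "Lpow 2 w \<noteq> 0"
  shows "gn_quotient s p w \<le> gn_quotient s p u"
proof -
  note nu = nontrivial[OF u] and nw = nontrivial[OF w]
  define B where "B = 2 * \<theta> * \<mu> / p"
  have B: "B > 0" using th1 \<mu> p by (simp add: B_def)
  define c where "c = sqrt (Lpow 2 u / Lpow 2 w)"
  have c: "c > 0" "c^2 = Lpow 2 u / Lpow 2 w" using nu nw by (auto simp: c_def)
  define w1 where "w1 = dil s c 1 w"
  have w1H: "inH s w1" unfolding w1_def by (rule dil_H[OF _ s(1) w(1)]) simp
  have w1M: "Lpow 2 w1 = Lpow 2 u" unfolding w1_def Lpow_dil[OF inH_measurable(1)[OF w(1)] zero_less_one] using c nw by simp
  note n1 = nontrivial[OF w1H, unfolded w1M, OF u(2)]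
  \<comment> \<open>Solves the constraint along the fibre: \<open>Kf\<close> is multiplied by
    \<open>y\<close> and \<open>Lpow p\<close> by \<open>y powr \<theta>\<close>.\<close>
  define y where "y = (Kf s w1 / (B * Lpow p w1)) powr (1 / (\<theta> - 1))"
  have y: "y > 0" "y powr (\<theta> - 1) = Kf s w1 / (B * Lpow p w1)" using n1 B th1 by (auto simp: y_def powr_powr)
  define w2 where "w2 = msc s y w1"
  have w2H: "inH s w2" unfolding w2_def by (rule msc_H[OF y(1) s(1) w1H])
  have M2: "Lpow 2 w2 = Lpow 2 u" unfolding w2_def Lpow2_msc[OF y(1) s(1) inH_measurable(1)[OF w1H]] by (rule w1M)
  have A2: "Lpow p w2 = y powr \<theta> * Lpow p w1" unfolding w2_def by (rule Lpow_msc[OF y(1) s(1) inH_measurable(1)[OF w1H]])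
  have "y powr \<theta> = y powr (\<theta> - 1) * y" using y(1) powr_add[of y "\<theta> - 1" 1] by simp
  then have "B * Lpow p w2 = y * Kf s w1" unfolding A2 y(2) using B n1 by simp
  then have K2: "Kf s w2 = B * Lpow p w2" unfolding w2_def Kf_msc[OF y(1) s(1) w1H] by simp
  have le: "Lpow p u \<le> Lpow p w2" by (rule min[OF w2H M2]) (use K2 in \<open>simp add: B_def\<close>)
  have q: "x / ((B * x) powr \<theta> * m) = x powr (1 - \<theta>) / (B powr \<theta> * m)" if "x > 0" for x m
    using that B by (simp add: powr_mult powr_diff)
  have "gn_quotient s p w = gn_quotient s p w2"
    unfolding w2_def w1_def msc_def using y(1) c(1) w(1) dil_H[OF zero_less_one s(1) w(1)] by (simp add: gn_quotient_dil)
  also have "\<dots> = Lpow p w2 powr (1 - \<theta>) / (B powr \<theta> * Lpow 2 u powr \<tau>)"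
    unfolding gn_quotient_def K2 M2 \<tau>_def[symmetric] by (rule q) (use le nu in linarith)
  also have "\<dots> \<le> Lpow p u powr (1 - \<theta>) / (B powr \<theta> * Lpow 2 u powr \<tau>)"
    using th1 nu le by (intro divide_right_mono powr_mono2') auto
  also have "\<dots> = gn_quotient s p u"
    unfolding gn_quotient_def P B_def[symmetric] \<tau>_def[symmetric] by (rule q[symmetric]) (use nu in simp)
  finally show ?thesis .
qed

text \<open>The two normalisations make both coefficients in the Euler--Lagrange equation of the
  quotient equal to one.\<close>

lemma maximiser_weak_sol:
  assumes u: "inH s u" "Lpow 2 u \<noteq> 0" and K: "p * Kf s u = 2 * \<theta> * Lpow p u" and M: "p * Lpow 2 u = 2 * \<tau> * Lpow p u"
    and max: "\<And>w. inH s w \<Longrightarrow> Lpow 2 w \<noteq> 0 \<Longrightarrow> gn_quotient s p w \<le> gn_quotient s p u"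
  shows "weak_sol s p u"
  unfolding weak_sol_def
proof (intro conjI allI impI)
  show "inH s u" by (rule u)
  fix \<phi> assume \<phi>: "inH s \<phi>"
  note nu = nontrivial[OF u]
  have p1: "p > 1" using p by simp
  define I where "I = (LINT z|lborel. sgn (u z) * \<bar>u z\<bar> powr (p - 1) * \<phi> z)"
  define k where "k = innerK s u \<phi>"
  define m where "m = (LINT z|lborel. u z * \<phi> z)"
  define KK where "KK \<epsilon> = Kf s u + 2 * \<epsilon> * k + \<epsilon>^2 * Kf s \<phi>" for \<epsilon>
  define MM where "MM \<epsilon> = Lpow 2 u + 2 * \<epsilon> * m + \<epsilon>^2 * Lpow 2 \<phi>" for \<epsilon>
  define Q where "Q = gn_quotient s p u"
  \<comment> \<open>Replacing \<open>Lpow p\<close> of the competitor by its tangent at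
    \<open>u\<close> keeps the inequality and yields an explicit differentiable function that is
    nonnegative near \<open>\<epsilon> = 0\<close> and zero there.\<close>
  define f where "f \<epsilon> = Q * (KK \<epsilon> powr \<theta> * MM \<epsilon> powr \<tau>) - Lpow p u - p * (\<epsilon> * I)" for \<epsilon>
  have QA: "Q * (Kf s u powr \<theta> * Lpow 2 u powr \<tau>) = Lpow p u" using nu by (simp add: Q_def gn_quotient_def \<tau>_def)
  have f0: "f 0 = 0" by (simp add: f_def KK_def MM_def QA)
  have fpos: "f \<epsilon> \<ge> 0" if nz: "MM \<epsilon> \<noteq> 0" for \<epsilon>
  proof -
    define w where "w = (\<lambda>z. u z + \<epsilon> * \<phi> z)"
    have w_lin: "w = (\<lambda>z. 1 * u z + \<epsilon> * \<phi> z)" by (simp add: w_def)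
    have wH: "inH s w" unfolding w_lin by (rule inH_lin[OF u(1) \<phi>])
    have Kw: "Kf s w = KK \<epsilon>" unfolding w_lin Kf_lin[OF u(1) \<phi>] by (simp add: KK_def k_def)
    have Mw: "Lpow 2 w = MM \<epsilon>" unfolding w_lin L2_lin[OF inH_memLp(1)[OF u(1)] inH_memLp(1)[OF \<phi>]] by (simp add: MM_def m_def)
    have Mw0: "Lpow 2 w \<noteq> 0" using nz Mw by simp
    note nw = nontrivial[OF wH Mw0]
    have \<epsilon>\<phi>: "memLp p (\<lambda>z. \<epsilon> * \<phi> z)" using inH_memLp_p[OF s p inH_lin[OF \<phi> \<phi>, of \<epsilon> 0]] by simp
    have "Lpow p u + p * (LINT z|lborel. sgn (u z) * \<bar>u z\<bar> powr (p - 1) * (\<epsilon> * \<phi> z)) \<le> Lpow p w"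
      using Lp_tangent(2)[OF p1 inH_memLp_p[OF s p u(1)] \<epsilon>\<phi>] inH_memLp_p[OF s p wH] unfolding w_def by simp
    moreover have "(LINT z|lborel. sgn (u z) * \<bar>u z\<bar> powr (p - 1) * (\<epsilon> * \<phi> z)) = \<epsilon> * I"
      by (simp add: I_def mult.left_commute)
    moreover have "Lpow p w \<le> Q * (KK \<epsilon> powr \<theta> * MM \<epsilon> powr \<tau>)"
      using max[OF wH Mw0] nw unfolding Q_def[symmetric] gn_quotient_def[of s p w] Kw Mw \<tau>_def[symmetric] by (simp add: pos_divide_le_eq)
    ultimately show ?thesis by (simp add: f_def)
  qed
  have d: "(f has_real_derivative p * (k + m) - p * I) (at 0)"
  proof -
    have K0: "KK 0 = Kf s u" and M0: "MM 0 = Lpow 2 u" by (simp_all add: KK_def MM_def)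
    have dK: "(KK has_real_derivative 2 * k) (at 0)" unfolding KK_def by (auto intro!: derivative_eq_intros)
    have dM: "(MM has_real_derivative 2 * m) (at 0)" unfolding MM_def by (auto intro!: derivative_eq_intros)
    have dKp: "((\<lambda>\<epsilon>. KK \<epsilon> powr \<theta>) has_real_derivative \<theta> * Kf s u powr (\<theta> - 1) * (2 * k)) (at 0)"
      using DERIV_fun_powr[OF dK, of \<theta>] nu K0 by simp
    have dMp: "((\<lambda>\<epsilon>. MM \<epsilon> powr \<tau>) has_real_derivative \<tau> * Lpow 2 u powr (\<tau> - 1) * (2 * m)) (at 0)"
      using DERIV_fun_powr[OF dM, of \<tau>] nu M0 by simp
    have "(f has_real_derivative Q * (\<theta> * Kf s u powr (\<theta> - 1) * (2 * k) * Lpow 2 u powr \<tau> + \<tau> * Lpow 2 u powr (\<tau> - 1) * (2 * m) * Kf s u powr \<theta>) - p * I) (at 0)"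
    proof -
      have dl: "((\<lambda>\<epsilon>. p * (\<epsilon> * I)) has_real_derivative p * I) (at 0)" by (auto intro!: derivative_eq_intros)
      show ?thesis
        using DERIV_diff[OF DERIV_diff[OF DERIV_cmult[OF DERIV_mult[OF dKp dMp, unfolded K0 M0], of Q] DERIV_const[of "Lpow p u"]] dl]
        by (simp only: f_def[abs_def] diff_0_right)
    qed
    moreover have "Q * (\<theta> * Kf s u powr (\<theta> - 1) * (2 * k) * Lpow 2 u powr \<tau> + \<tau> * Lpow 2 u powr (\<tau> - 1) * (2 * m) * Kf s u powr \<theta>) = p * (k + m)"
    proof -
      have "Q * (\<theta> * Kf s u powr (\<theta> - 1) * (2 * k) * Lpow 2 u powr \<tau> + \<tau> * Lpow 2 u powr (\<tau> - 1) * (2 * m) * Kf s u powr \<theta>)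
        = Q * (Kf s u powr \<theta> * Lpow 2 u powr \<tau>) * (2 * \<theta> / Kf s u * k + 2 * \<tau> / Lpow 2 u * m)"
        using nu by (simp add: powr_diff field_simps)
      also have "\<dots> = 2 * \<theta> * Lpow p u / Kf s u * k + 2 * \<tau> * Lpow p u / Lpow 2 u * m" unfolding QA by (simp add: algebra_simps)
      also have "\<dots> = p * (k + m)" unfolding K[symmetric] M[symmetric] using nu by (simp add: algebra_simps)
      finally show ?thesis .
    qed
    ultimately show ?thesis by simp
  qed
  have "isCont MM 0" unfolding MM_def by (intro continuous_intros)
  then have "(MM \<longlongrightarrow> Lpow 2 u) (at 0)" by (simp add: isCont_def MM_def)
  then have "eventually (\<lambda>\<epsilon>. MM \<epsilon> > 0) (at 0)" by (rule order_tendstoD) (use nu in simp)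
  then obtain \<delta> where \<delta>: "\<delta> > 0" "\<And>\<epsilon>. \<epsilon> \<noteq> 0 \<Longrightarrow> \<bar>\<epsilon>\<bar> < \<delta> \<Longrightarrow> MM \<epsilon> > 0" by (auto simp: eventually_at dist_real_def)
  have "p * (k + m) - p * I = 0"
  proof (rule DERIV_local_min[OF d \<delta>(1)], intro allI impI)
    fix \<epsilon> assume e: "\<bar>0 - \<epsilon>\<bar> < \<delta>"
    show "f 0 \<le> f \<epsilon>"
    proof (cases "\<epsilon> = 0")
      case False
      then have "MM \<epsilon> > 0" using \<delta>(2) e by simp
      then show ?thesis using fpos f0 by simp
    qed simp
  qed
  then have "k + m = I" using p by (simp flip: right_diff_distrib)
  then show "innerH s u \<phi> = (LINT z|lborel. sgn (u z) * \<bar>u z\<bar> powr (p - 1) * \<phi> z)" by (simp add: innerH_def k_def m_def I_def)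
qed

lemma weak_sol_Nehari:
  assumes "weak_sol s p w"
  shows "Lpow 2 w + Kf s w = Lpow p w"
proof -
  have "innerH s w w = (LINT z|lborel. sgn (w z) * \<bar>w z\<bar> powr (p - 1) * w z)" using assms by (simp add: weak_sol_def)
  also have "\<dots> = Lpow p w" unfolding Lpow_def
  proof (rule Bochner_Integration.integral_cong[OF refl])
    fix z
    show "sgn (w z) * \<bar>w z\<bar> powr (p - 1) * w z = \<bar>w z\<bar> powr p"
      by (cases "w z = 0") (auto simp: powr_diff sgn_if)
  qed
  finally show ?thesis by (simp add: innerH_self)
qed

lemma weak_sol_compare:
  assumes u: "inH s u" "Lpow 2 u \<noteq> 0" and K: "p * Kf s u = 2 * \<theta> * Lpow p u" and M: "p * Lpow 2 u = 2 * \<tau> * Lpow p u"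
    and max: "\<And>w. inH s w \<Longrightarrow> Lpow 2 w \<noteq> 0 \<Longrightarrow> gn_quotient s p w \<le> gn_quotient s p u"
    and w: "weak_sol s p w" "Lpow 2 w \<noteq> 0"
  shows "Lpow p u \<le> Lpow p w" "Lpow p w = Lpow p u \<Longrightarrow> Kf s w = Kf s u \<and> Lpow 2 w = Lpow 2 u"
proof -
  have wH: "inH s w" using w by (simp add: weak_sol_def)
  note nu = nontrivial[OF u] and nw = nontrivial[OF wH w(2)]
  define \<kappa> m \<alpha> where "\<kappa> = Kf s w / Kf s u" and "m = Lpow 2 w / Lpow 2 u" and "\<alpha> = Lpow p w / Lpow p u"
  have pos: "\<kappa> > 0" "m > 0" "\<alpha> > 0" using nu nw by (auto simp: \<kappa>_def m_def \<alpha>_def)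
  have p2: "p = 2 * (\<theta> + \<tau>)" using exponents(1) by simp
  have e: "Kf s w = \<kappa> * Kf s u" "Lpow 2 w = m * Lpow 2 u" "Lpow p w = \<alpha> * Lpow p u" using nu by (auto simp: \<kappa>_def m_def \<alpha>_def)
  have lin: "\<theta> * \<kappa> + \<tau> * m = (\<theta> + \<tau>) * \<alpha>"
  proof -
    have "\<alpha> * Lpow p u = m * Lpow 2 u + \<kappa> * Kf s u" using weak_sol_Nehari[OF w(1)] unfolding e by (rule sym)
    then have "p * (\<alpha> * Lpow p u) = p * (m * Lpow 2 u + \<kappa> * Kf s u)" by (simp only:)
    also have "\<dots> = \<kappa> * (p * Kf s u) + m * (p * Lpow 2 u)" by (simp add: algebra_simps)
    also have "\<dots> = 2 * (\<theta> * \<kappa> + \<tau> * m) * Lpow p u" unfolding K M by (simp add: algebra_simps)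
    finally have "p * \<alpha> * Lpow p u = 2 * (\<theta> * \<kappa> + \<tau> * m) * Lpow p u" by (simp add: mult.assoc)
    then have A: "p * \<alpha> = 2 * (\<theta> * \<kappa> + \<tau> * m)" using nu by simp
    have B: "p * \<alpha> = 2 * (\<theta> + \<tau>) * \<alpha>" using arg_cong[OF p2, of "\<lambda>x. x * \<alpha>"] .
    have "2 * (\<theta> * \<kappa> + \<tau> * m) = 2 * ((\<theta> + \<tau>) * \<alpha>)" using trans[OF A[symmetric] B] by (simp only: mult.assoc)
    then show ?thesis by (rule mult_left_cancel[THEN iffD1, rotated]) simp
  qed
  have "\<alpha> \<le> \<kappa> powr \<theta> * m powr \<tau>"
  proof -
    have "Lpow p w \<le> gn_quotient s p u * (Kf s w powr \<theta> * Lpow 2 w powr \<tau>)"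
      using max[OF wH w(2)] nw unfolding gn_quotient_def[of s p w] \<tau>_def[symmetric] by (simp add: pos_divide_le_eq)
    also have "\<dots> = \<kappa> powr \<theta> * m powr \<tau> * Lpow p u"
      unfolding e(1,2) using nu pos by (simp add: gn_quotient_def powr_mult \<tau>_def)
    finally show ?thesis using nu by (simp add: \<alpha>_def pos_divide_le_eq)
  qed
  then have "ln \<alpha> \<le> ln (\<kappa> powr \<theta> * m powr \<tau>)" using pos by simp
  then have le: "ln \<alpha> \<le> \<theta> * ln \<kappa> + \<tau> * ln m" using pos by (simp add: ln_mult ln_powr)
  have t: "\<theta> > 0" "\<theta> + \<tau> > 1" using th1 \<tau>_pos by auto
  note R = ln_AM_GM[OF t(1) \<tau>_pos t(2) pos lin le]
  show "Lpow p u \<le> Lpow p w" using R(1) nu by (simp add: \<alpha>_def pos_le_divide_eq)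
  assume "Lpow p w = Lpow p u"
  then have "\<alpha> = 1" using nu by (simp add: \<alpha>_def)
  then show "Kf s w = Kf s u \<and> Lpow 2 w = Lpow 2 u" using R(2) e by simp
qed

text \<open>\<open>u_gs\<close> is a choice, so some positive ground state must exist first:
  \<open>u\<close> is one, its strict positivity coming from the maximum principle. The chosen
  function then has the same least action, and the equality case of the comparison fixes its three
  scalars.\<close>

lemma u_gs_scalars:
  assumes u: "inH s u" "Lpow 2 u \<noteq> 0" and K: "p * Kf s u = 2 * \<theta> * Lpow p u" and M: "p * Lpow 2 u = 2 * \<tau> * Lpow p u"
    and max: "\<And>w. inH s w \<Longrightarrow> Lpow 2 w \<noteq> 0 \<Longrightarrow> gn_quotient s p w \<le> gn_quotient s p u"
    and pos: "AE z in lborel. u z \<ge> 0"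
  shows "inH s (u_gs s p)" "Kf s (u_gs s p) = Kf s u" "Lpow 2 (u_gs s p) = Lpow 2 u" "Lpow p (u_gs s p) = Lpow p u"
proof -
  have W: "weak_sol s p u" by (rule maximiser_weak_sol[OF u K M max])
  \<comment> \<open>By the Nehari identity, comparing actions is comparing
    \<open>Lpow p\<close>.\<close>
  have act: "action s p w = (1/2 - 1/p) * Lpow p w" if "weak_sol s p w" for w
    using weak_sol_Nehari[OF that] by (simp add: action_def innerH_self algebra_simps)
  have pp: "1/2 - 1/p > 0" using p by (simp add: field_simps)
  have cmp: "Lpow p u \<le> Lpow p w" "Lpow p w = Lpow p u \<Longrightarrow> Kf s w = Kf s u \<and> Lpow 2 w = Lpow 2 u" if "weak_sol s p w" "Lpow 2 w \<noteq> 0" for w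
    using weak_sol_compare[OF u K M max that] by blast+
  have um: "u \<in> borel_measurable borel" by (rule inH_measurable[OF u(1)])
  have "AE z in lborel. u z > 0"
  proof (rule strong_maximum_principle_AE[OF s u(1) pos u(2)])
    fix \<phi> assume \<phi>: "inH s \<phi>" "\<forall>z. \<phi> z \<ge> 0"
    have "innerH s u \<phi> = (LINT z|lborel. sgn (u z) * \<bar>u z\<bar> powr (p - 1) * \<phi> z)" using W \<phi> by (simp add: weak_sol_def)
    also have "\<dots> \<ge> 0" by (rule integral_nonneg_AE) (use pos \<phi>(2) in \<open>auto simp: sgn_if elim!: eventually_mono\<close>)
    finally show "innerH s u \<phi> \<ge> 0" .
  qed
  then have "is_pos_ground_state s p u"
    unfolding is_pos_ground_state_def using W cmp(1) act pp by (auto intro!: mult_left_mono)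
  then have G: "is_pos_ground_state s p (u_gs s p)" unfolding u_gs_def by (rule someI[of "is_pos_ground_state s p"])
  then have V: "weak_sol s p (u_gs s p)" and Vpos: "AE z in lborel. u_gs s p z > 0" and Va: "action s p (u_gs s p) \<le> action s p u"
    using W u(2) by (auto simp: is_pos_ground_state_def)
  show VH: "inH s (u_gs s p)" using V by (simp add: weak_sol_def)
  \<comment> \<open>Positivity rules out the zero function, which is also a weak solution.\<close>
  have "\<not> (AE z in lborel. u_gs s p z = 0)"
  proof
    assume "AE z in lborel. u_gs s p z = 0"
    then have "AE z in lborel. u z = 0" using Vpos by eventually_elim simp
    then show False using u(2) Lpow2_zero_iff[OF inH_memLp(1)[OF u(1)]] by simp
  qed
  then have V2: "Lpow 2 (u_gs s p) \<noteq> 0" using Lpow2_zero_iff[OF inH_memLp(1)[OF VH]] by simp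
  have "Lpow p (u_gs s p) \<le> Lpow p u" using Va pp unfolding act[OF V] act[OF W] by simp
  then show A: "Lpow p (u_gs s p) = Lpow p u" using cmp(1)[OF V V2] by simp
  show "Kf s (u_gs s p) = Kf s u" "Lpow 2 (u_gs s p) = Lpow 2 u" using cmp(2)[OF V V2 A] by auto
qed

text \<open>The multiplier of a minimiser is read off its Nehari and Pohozaev identities; \<open>lam_z\<close> recovers it from the masses.\<close>
lemma ground_state_level:
  assumes \<mu>: "\<mu> > 0" and u: "inH s u" "Lpow 2 u \<noteq> 0" and pos: "AE z in lborel. u z \<ge> 0" and P: "Kf s u = 2 * \<theta> * \<mu> / p * Lpow p u"
    and min: "\<And>w. inH s w \<Longrightarrow> Lpow 2 w = Lpow 2 u \<Longrightarrow> Kf s w = 2 * \<theta> * \<mu> / p * Lpow p w \<Longrightarrow> Lpow p u \<le> Lpow p w"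
  shows "inH s (z_fun s p \<mu> (Lpow 2 u))" "Kf s (z_fun s p \<mu> (Lpow 2 u)) = Kf s u" "Lpow p (z_fun s p \<mu> (Lpow 2 u)) = Lpow p u"
proof -
  note nu = nontrivial[OF u]
  have um: "u \<in> borel_measurable borel" by (rule inH_measurable[OF u(1)])
  have sharp: "gn_quotient s p w \<le> gn_quotient s p u" if "inH s w" "Lpow 2 w \<noteq> 0" for w
    by (rule sharp_quotient[OF \<mu> u P min that])
  \<comment> \<open>The multiplier of the mass term in the equation of \<open>u\<close>, obtained by
    eliminating \<open>Kf\<close> between the Nehari and Pohozaev identities.\<close>
  define \<Lambda> where "\<Lambda> = 2 * \<tau> * \<mu> * Lpow p u / (p * Lpow 2 u)"
  have \<Lambda>: "\<Lambda> > 0" using nu \<mu> \<tau>_pos p by (simp add: \<Lambda>_def)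
  \<comment> \<open>Amplitude and dilation that normalise both \<open>\<Lambda>\<close> and
    \<open>\<mu>\<close> to one.\<close>
  define c where "c = (\<mu> / \<Lambda>) powr (1 / (p - 2))"
  define l where "l = \<Lambda> powr (- 1/2)"
  have c: "c > 0" and l: "l > 0" using \<mu> \<Lambda> by (auto simp: c_def l_def)
  have cp: "c powr p = c^2 * (\<mu> / \<Lambda>)"
  proof -
    have "c powr (p - 2) = \<mu> / \<Lambda>" using \<mu> \<Lambda> p by (simp add: c_def powr_powr)
    moreover have "c powr p = c powr 2 * c powr (p - 2)" by (simp flip: powr_add)
    ultimately show ?thesis using c by simp
  qed
  have l2: "l^2 * \<Lambda> = 1"
  proof -
    have "l^2 = \<Lambda> powr (- 1)" unfolding powr_sq[OF l] unfolding l_def powr_powr by simp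
    then show ?thesis using \<Lambda> by (simp add: powr_minus)
  qed
  define U where "U = dil s c l u"
  have UH: "inH s U" unfolding U_def by (rule dil_H[OF l s(1) u(1)])
  define N where "N = l powr (1 + 1/s)"
  have N: "N > 0" using l by (simp add: N_def)
  have MU: "Lpow 2 U = c^2 / N * Lpow 2 u" and AU: "Lpow p U = c^2 * (\<mu> / \<Lambda>) / N * Lpow p u"
    unfolding U_def Lpow_dil[OF um l] N_def using c cp by simp_all
  have KU: "Kf s U = c^2 * (l^2 / N) * Kf s u"
  proof -
    have "l powr (1 - 1/s) = l powr 2 / l powr (1 + 1/s)" by (simp flip: powr_diff)
    then show ?thesis unfolding U_def Kf_dil[OF l s(1) u(1)] N_def using l by simp
  qed
  have U0: "Lpow 2 U \<noteq> 0" using MU nu c N by simp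
  have M: "p * Lpow 2 U = 2 * \<tau> * Lpow p U"
    unfolding MU AU using N c \<Lambda> nu p \<mu> \<tau>_pos by (simp add: \<Lambda>_def field_simps)
  have K: "p * Kf s U = 2 * \<theta> * Lpow p U"
  proof -
    have "p * Kf s U = c^2 * (l^2 * \<Lambda>) / N * (2 * \<theta> * \<mu> * Lpow p u) / \<Lambda>" unfolding KU P using p \<Lambda> by (simp add: field_simps)
    also have "\<dots> = 2 * \<theta> * Lpow p U" unfolding l2 AU using \<Lambda> N by (simp add: field_simps)
    finally show ?thesis .
  qed
  have Umax: "gn_quotient s p w \<le> gn_quotient s p U" if "inH s w" "Lpow 2 w \<noteq> 0" for w
    using sharp[OF that] gn_quotient_dil[OF c l u(1)] by (simp add: U_def)
  have Upos: "AE z in lborel. U z \<ge> 0"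
    using AE_scale[OF l _ pos, of "l powr (1/s)"] l c by (auto simp: U_def dil_def elim!: eventually_mono)
  have V: "inH s (u_gs s p)" "Kf s (u_gs s p) = Kf s U" "Lpow 2 (u_gs s p) = Lpow 2 U" "Lpow p (u_gs s p) = Lpow p U"
    by (rule u_gs_scalars[OF UH U0 K M Umax Upos], assumption+)+
  \<comment> \<open>\<open>lam_z\<close> is defined from the mass of \<open>u_gs\<close>, which is
    the mass of \<open>U\<close>; after taking logarithms the relation is linear in
    \<open>ln \<Lambda>\<close>.\<close>
  have lam: "lam_z s p \<mu> (Lpow 2 u) = \<Lambda>"
  proof -
    define d where "d = (1 + s) * (p - 2) - 4 * s"
    have "4 * s < (p - 2) * (1 + s)" using th1 s by (simp add: th_def pos_less_divide_eq)
    then have d: "d > 0" by (simp add: d_def mult.commute)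
    have lnM: "ln (Lpow 2 U) = 2 / (p - 2) * (ln \<mu> - ln \<Lambda>) + (1 + s) / (2 * s) * ln \<Lambda> + ln (Lpow 2 u)"
    proof -
      have "ln (Lpow 2 U) = 2 * ln c - (1 + 1/s) * ln l + ln (Lpow 2 u)"
        unfolding MU N_def using c l nu by (simp add: ln_mult ln_div ln_powr ln_realpow)
      moreover have "ln c = 1 / (p - 2) * (ln \<mu> - ln \<Lambda>)" "ln l = - 1/2 * ln \<Lambda>" using \<mu> \<Lambda> by (simp_all add: c_def l_def ln_powr ln_div)
      ultimately show ?thesis using s by (simp add: field_simps)
    qed
    have pos: "lam_z s p \<mu> (Lpow 2 u) > 0" unfolding lam_z_def Let_def V(3) using nu \<mu> U0 Lpow_nonneg[of 2 U] by simp
    have "ln (lam_z s p \<mu> (Lpow 2 u)) = - 2 * s * (p - 2) / d * ln (Lpow 2 u) + 4 * s * (p - 2) / d * (ln (Lpow 2 U) / 2) + - 4 * s / d * ln \<mu>"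
      unfolding lam_z_def Let_def V(3) d_def[symmetric] using nu \<mu> U0 Lpow_nonneg[of 2 U]
      by (simp add: ln_mult ln_powr ln_sqrt)
    also have "\<dots> = 2 * s * (p - 2) / d * (ln (Lpow 2 U) - ln (Lpow 2 u)) - 4 * s / d * ln \<mu>" using d by (simp add: field_simps)
    also have "\<dots> = ln \<Lambda>"
    proof -
      define Y where "Y = ln (Lpow 2 U) - ln (Lpow 2 u)"
      have Y: "Y = 2 / (p - 2) * (ln \<mu> - ln \<Lambda>) + (1 + s) / (2 * s) * ln \<Lambda>" unfolding Y_def lnM by simp
      have "2 * s * (p - 2) * Y = 4 * s * (ln \<mu> - ln \<Lambda>) + (p - 2) * (1 + s) * ln \<Lambda>"
        unfolding Y using p s by (simp add: field_simps)
      then have "2 * s * (p - 2) * Y - 4 * s * ln \<mu> = ln \<Lambda> * d" by (simp add: d_def algebra_simps)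
      then have "(2 * s * (p - 2) * Y - 4 * s * ln \<mu>) / d = ln \<Lambda>" using d by simp
      then show ?thesis unfolding Y_def[symmetric] by (simp add: diff_divide_distrib)
    qed
    finally show ?thesis using pos \<Lambda> by (simp add: ln_inj_iff)
  qed
  have ci: "(\<Lambda> / \<mu>) powr (1 / (p - 2)) = 1 / c"
  proof -
    have "(\<Lambda> / \<mu>) powr (1 / (p - 2)) * c = ((\<Lambda> / \<mu>) * (\<mu> / \<Lambda>)) powr (1 / (p - 2))"
      unfolding c_def by (simp only: powr_mult)
    also have "\<dots> = 1" using \<mu> \<Lambda> by simp
    finally show ?thesis using c by (simp only: eq_divide_eq) simp
  qed
  have li: "\<Lambda> powr (1/2) = 1 / l"
  proof -
    have "\<Lambda> powr (1/2) * l = \<Lambda> powr (1/2 + - 1/2)" unfolding l_def by (rule powr_add[symmetric])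
    also have "\<dots> = 1" using \<Lambda> by simp
    finally show ?thesis using l by (simp only: eq_divide_eq) simp
  qed
  have z: "z_fun s p \<mu> (Lpow 2 u) = dil s (1 / c) (1 / l) (u_gs s p)"
  proof -
    have "(\<Lambda> powr (1/2)) powr (1/s) = \<Lambda> powr (1 / (2 * s))" by (simp add: powr_powr)
    then show ?thesis unfolding z_fun_def lam Let_def ci dil_def li[symmetric] by (auto simp: fun_eq_iff)
  qed
  have l': "1 / l > 0" using l by simp
  \<comment> \<open>\<open>z_fun\<close> applies the inverse dilation to \<open>u_gs\<close>, whose
    scalars agree with those of \<open>U\<close>; hence its own scalars are those of
    \<open>u\<close>.\<close>
  have undo: "dil s (1 / c) (1 / l) U = u" unfolding U_def dil_dil[OF l' l] using c l by (simp add: dil_one)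
  show "inH s (z_fun s p \<mu> (Lpow 2 u))" unfolding z by (rule dil_H[OF l' s(1) V(1)])
  show "Kf s (z_fun s p \<mu> (Lpow 2 u)) = Kf s u"
    unfolding z Kf_dil[OF l' s(1) V(1)] V(2) using Kf_dil[OF l' s(1) UH, of "1 / c"] unfolding undo by simp
  show "Lpow p (z_fun s p \<mu> (Lpow 2 u)) = Lpow p u"
    unfolding z Lpow_dil[OF inH_measurable(1)[OF V(1)] l'] V(4) using Lpow_dil[OF inH_measurable(1)[OF UH] l', of p s "1 / c"] unfolding undo by simp
qed

end

lemma Lpow2_eta:
  fixes s :: real
  assumes "0 < s" "s < 1"
  shows "Lpow 2 eta \<noteq> 0"
proof
  assume "Lpow 2 eta = 0"
  then have e0: "AE z in lborel. eta z = 0" using Lpow2_zero_iff[OF inH_memLp(1)[OF eta_H[OF assms]]] by simp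
  define A where "A = {- (1/2)..1/2 :: real} \<times> {- (1/2)..1/2 :: real}"
  from e0 have "AE z in lborel. z \<notin> A"
  proof eventually_elim
    case (elim z)
    show ?case
    proof
      assume "z \<in> A"
      then have "\<bar>fst z\<bar> \<le> 1/2" "\<bar>snd z\<bar> \<le> 1/2" by (auto simp: A_def)
      then show False using eta_dil_lower[OF assms, of 1 z] elim by (simp add: dil_one)
    qed
  qed
  moreover have "A \<in> sets (lborel \<Otimes>\<^sub>M lborel)" unfolding A_def by (rule pair_measureI) auto
  ultimately have "A \<in> null_sets (lborel \<Otimes>\<^sub>M lborel)" unfolding lborel_prod by (subst AE_iff_null_sets) auto
  then have "emeasure (lborel \<Otimes>\<^sub>M lborel) A = 0" by (simp add: null_sets_def)
  then show False unfolding A_def by (subst (asm) lborel.emeasure_pair_measure_Times) auto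
qed

section \<open>Minimisers with a vanishing component\<close>

context params
begin

lemma single_component:
  assumes x: "inH s x" "Lpow 2 x = 0"
  shows "Kf s x = 0" "P w x = 0 \<longleftrightarrow> Kf s w = 2 * th s p * \<mu>1 / p * Lpow p w"
    "J w x = Kf s w / 2 - \<mu>1 / p * Lpow p w" "P w x = 0 \<Longrightarrow> J w x = \<mu>1 / p * Lpow p w * (th s p - 1)"
proof -
  have x0: "AE z in lborel. x z = 0" using Lpow2_zero_iff[OF inH_memLp(1)[OF x(1)]] x(2) by simp
  show K: "Kf s x = 0" unfolding Kf_def by (rule innerK_zero_AE[OF inH_measurable(1)[OF x(1)] x0 x(1)])
  have "Lpow q x = 0" unfolding Lpow_def by (rule integral_eq_zero_AE) (use x0 pqr2 in \<open>auto elim!: eventually_mono\<close>)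
  then have c1: "cf w x 1 = 0" by (simp add: cf_def)
  have "coupling r1 r2 w x = 0" unfolding coupling_def by (rule integral_eq_zero_AE) (use x0 r in \<open>auto elim!: eventually_mono\<close>)
  then have c2: "cf w x 2 = 0" by (simp add: cf_def)
  have c0: "cf w x 0 = \<mu>1 / p * Lpow p w" "ex 0 = th s p" by (simp_all add: cf_def ex_def)
  show "P w x = 0 \<longleftrightarrow> Kf s w = 2 * th s p * \<mu>1 / p * Lpow p w"
    unfolding P_zero_iff sum3 c0 c1 c2 K by (auto simp: field_simps)
  show "J w x = Kf s w / 2 - \<mu>1 / p * Lpow p w" unfolding J_eq sum3 c0 c1 c2 K by simp
  show "J w x = \<mu>1 / p * Lpow p w * (th s p - 1)" if "P w x = 0"
    unfolding J_of_P_zero[OF that] sum3 c0 c1 c2 by simp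
qed

text \<open>Pairs (w, 0) whose \<open>w\<close> has mass \<open>a\<close> and satisfies the scalar
  constraint are admissible, so minimality of the pair gives the scalar minimality from which the
  ground state level is computed.\<close>

lemma semitrivial_level:
  assumes b: "b \<ge> 0" and min: "(u, v) \<in> PS a b" "J u v = C a b" and upos: "AE z in lborel. u z \<ge> 0"
    and mass: "Lpow 2 u = a" and v0: "Lpow 2 v = 0"
  shows "J (z_fun s p \<mu>1 a) (\<lambda>z. 0) = C a b"
proof -
  interpret subcritical s p by unfold_locales (use s0 s pqr2 p th_gt1[OF p(1)] in auto)
  have uH: "inH s u" and vH: "inH s v" and Puv: "P u v = 0" and u0: "Lpow 2 u \<noteq> 0"
    using min(1) v0 by (auto simp: PohoSet_def inD_def)
  have zH: "inH s (\<lambda>_. 0)" and z2: "Lpow 2 (\<lambda>_. 0) = 0" by (rule inH_zero) (simp add: Lpow_def)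
  note U = single_component(2-4)[OF vH v0, of u] and Z = single_component(2-4)[OF zH z2]
  have Ku: "Kf s u = 2 * th s p * \<mu>1 / p * Lpow p u" using U(1) Puv by simp
  have Ju: "C a b = \<mu>1 / p * Lpow p u * (th s p - 1)" using U(3)[OF Puv] min(2) by simp
  have "Lpow p u \<le> Lpow p w" if w: "inH s w" "Lpow 2 w = Lpow 2 u" "Kf s w = 2 * th s p * \<mu>1 / p * Lpow p w" for w
  proof -
    have Pw: "P w (\<lambda>_. 0) = 0" using Z(1) w(3) by simp
    then have "(w, \<lambda>_. 0) \<in> PS a b" using w u0 mass b zH z2 by (simp add: PohoSet_def inD_def)
    then have "C a b \<le> J w (\<lambda>_. 0)" by (rule C_le)
    then have "\<mu>1 / p * (th s p - 1) * Lpow p u \<le> \<mu>1 / p * (th s p - 1) * Lpow p w" unfolding Ju Z(3)[OF Pw] by (simp only: mult_ac)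
    moreover have "\<mu>1 / p * (th s p - 1) > 0" using \<mu> pqr2 th1 by simp
    ultimately show ?thesis by (simp only: mult_le_cancel_left_pos)
  qed
  from ground_state_level[OF \<mu>(1) uH u0 upos Ku this, unfolded mass]
  have G: "Kf s (z_fun s p \<mu>1 a) = Kf s u" "Lpow p (z_fun s p \<mu>1 a) = Lpow p u" by simp_all
  show ?thesis unfolding Z(2) G using U(2) min(2) by simp
qed

end

section \<open>Attainment of both masses and strong convergence\<close>

theorem theorem5p1:
  fixes s \<mu>1 \<mu>2 \<beta> p q r1 r2 a b :: real
    and un vn :: "nat \<Rightarrow> real \<times> real \<Rightarrow> real"
    and u v :: "real \<times> real \<Rightarrow> real"
    and lam1 lam2 :: "nat \<Rightarrow> real"
  assumes "1/2 < s" "s < 1" "\<mu>1 > 0" "\<mu>2 > 0" "\<beta> > 0" "r1 > 1" "r2 > 1"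
    and "2 * (1 + 3 * s) / (1 + s) < p" "p < 2 * (1 + s) / (1 - s)"
    and "2 * (1 + 3 * s) / (1 + s) < q" "q < 2 * (1 + s) / (1 - s)"
    and "2 * (1 + 3 * s) / (1 + s) < r1 + r2" "r1 + r2 < 2 * (1 + s) / (1 - s)"
    and "a > 0" "b > 0"
    and seqD: "\<forall>n. inD s (un n) (vn n) \<and> Lpow 2 (un n) \<le> a \<and> Lpow 2 (vn n) \<le> b"
    and bdd: "\<exists>M. \<forall>n. normD2 s (un n) (vn n) \<le> M"
    and i: "(\<lambda>n. Jf s \<mu>1 \<mu>2 \<beta> p q r1 r2 (un n) (vn n))
              \<longlonglongrightarrow> Cab s \<mu>1 \<mu>2 \<beta> p q r1 r2 a b"
    and ii: "\<forall>\<epsilon>>0. eventually (\<lambda>n. \<forall>\<phi> \<psi>. inD s \<phi> \<psi> \<and> normD2 s \<phi> \<psi> \<le> 1 \<longrightarrow>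
              \<bar>dJ s \<mu>1 \<mu>2 \<beta> p q r1 r2 (un n) (vn n) \<phi> \<psi>
               + lam1 n * (LINT z|lborel. un n z * \<phi> z)
               + lam2 n * (LINT z|lborel. vn n z * \<psi> z)\<bar> \<le> \<epsilon>) sequentially"
    and iii: "(\<lambda>n. Pf s \<mu>1 \<mu>2 \<beta> p q r1 r2 (un n) (vn n)) \<longlonglongrightarrow> 0"
    and iv_lim: "inD s u v"
    and iv_weak: "\<forall>\<phi> \<psi>. inD s \<phi> \<psi> \<longrightarrow>
              (\<lambda>n. innerH s (un n) \<phi> + innerH s (vn n) \<psi>) \<longlonglongrightarrow> innerH s u \<phi> + innerH s v \<psi>"
    and iv_strong: "\<forall>\<eta>. 2 < \<eta> \<and> \<eta> < 2 * (1 + s) / (1 - s) \<longrightarrow>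
              (\<forall>n. memLp \<eta> (\<lambda>z. un n z - u z) \<and> memLp \<eta> (\<lambda>z. vn n z - v z))
              \<and> (\<lambda>n. Lpow \<eta> (\<lambda>z. un n z - u z)) \<longlonglongrightarrow> 0
              \<and> (\<lambda>n. Lpow \<eta> (\<lambda>z. vn n z - v z)) \<longlonglongrightarrow> 0"
    and iv_pos: "AE z in lborel. u z \<ge> 0" "AE z in lborel. v z \<ge> 0"
    and energy: "Cab s \<mu>1 \<mu>2 \<beta> p q r1 r2 a b
              < min (Jf s \<mu>1 \<mu>2 \<beta> p q r1 r2 (z_fun s p \<mu>1 a) (\<lambda>z. 0))
                    (Jf s \<mu>1 \<mu>2 \<beta> p q r1 r2 (\<lambda>z. 0) (z_fun s q \<mu>2 b))"
  shows "\<exists>r. strict_mono r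
           \<and> (\<lambda>n. normD2 s (\<lambda>z. un (r n) z - u z) (\<lambda>z. vn (r n) z - v z)) \<longlonglongrightarrow> 0
           \<and> Lpow 2 u = a \<and> Lpow 2 v = b"
proof -
  interpret params s \<mu>1 \<mu>2 \<beta> p q r1 r2 by unfold_locales (use assms in auto)
  interpret swap: params s \<mu>2 \<mu>1 \<beta> q p r2 r1 by (rule swapped)
  have ab: "a > 0" "b > 0" by fact+
  have ne: "PS a b \<noteq> {}" by (rule PS_nonempty[OF eta_H[OF s0 s(2)] Lpow2_eta[OF s0 s(2)] ab])
  have unH: "inH s (un n)" and vnH: "inH s (vn n)" and una: "Lpow 2 (un n) \<le> a" and vnb: "Lpow 2 (vn n) \<le> b" for n
    using seqD by (auto simp: inD_def)
  have uH: "inH s u" and vH: "inH s v" using iv_lim by (auto simp: inD_def)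
  \<comment> \<open>Testing with a zero component separates the joint weak convergence into one for
    each component.\<close>
  have inner0: "innerH s w (\<lambda>_. 0) = 0" if "inH s w" for w
    using innerK_zero_AE[of "\<lambda>_. 0" s w] that by (simp add: innerH_def innerK_sym[of s w])
  have wu: "(\<lambda>n. innerH s (un n) \<phi>) \<longlonglongrightarrow> innerH s u \<phi>" if "inH s \<phi>" for \<phi>
    using iv_weak[rule_format, of \<phi> "\<lambda>_. 0"] that inH_zero inner0[OF vnH] inner0[OF vH] by (simp add: inD_def)
  have wv: "(\<lambda>n. innerH s (vn n) \<phi>) \<longlonglongrightarrow> innerH s v \<phi>" if "inH s \<phi>" for \<phi>
    using iv_weak[rule_format, of "\<lambda>_. 0" \<phi>] that inH_zero inner0[OF unH] inner0[OF uH] by (simp add: inD_def)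
  have su: "(\<lambda>n. Lpow \<eta> (\<lambda>z. un n z - u z)) \<longlonglongrightarrow> 0" and sv: "(\<lambda>n. Lpow \<eta> (\<lambda>z. vn n z - v z)) \<longlonglongrightarrow> 0"
    if "2 < \<eta>" "\<eta> < 2 * (1 + s) / (1 - s)" for \<eta>
    using iv_strong that by auto
  have min: "(u, v) \<in> PS a b" "J u v = C a b"
    and Klim: "(\<lambda>n. Kf s (\<lambda>z. un n z - u z) + Kf s (\<lambda>z. vn n z - v z)) \<longlonglongrightarrow> 0"
    and Mu: "(\<lambda>n. LINT z|lborel. un n z * u z) \<longlonglongrightarrow> Lpow 2 u" and Mv: "(\<lambda>n. LINT z|lborel. vn n z * v z) \<longlonglongrightarrow> Lpow 2 v"
    by (rule minimizer[OF ne ab unH vnH una vnb uH vH i iii wu wv su sv], assumption+)+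
  have min': "(v, u) \<in> PohoSet s \<mu>2 \<mu>1 \<beta> q p r2 r1 b a" "Jf s \<mu>2 \<mu>1 \<beta> q p r2 r1 v u = Cab s \<mu>2 \<mu>1 \<beta> q p r2 r1 b a"
    using min PohoSet_swap[of u v s] Jf_swap[of s \<mu>1 \<mu>2 \<beta> p q r1 r2 u v] Cab_swap[of s \<mu>1 \<mu>2 \<beta> p q r1 r2 a b] by simp_all
  have u_or: "Lpow 2 u \<noteq> 0 \<Longrightarrow> Lpow 2 u = a" by (rule mass_saturated[OF min iv_pos(1)])
  have v_or: "Lpow 2 v \<noteq> 0 \<Longrightarrow> Lpow 2 v = b" by (rule swap.mass_saturated[OF min' iv_pos(2)])
  \<comment> \<open>A vanishing component makes the minimum equal to one of the two thresholds,
    against the strict inequality.\<close>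
  have "Lpow 2 v \<noteq> 0"
  proof
    assume v0: "Lpow 2 v = 0"
    then have "Lpow 2 u \<noteq> 0" using min(1) by (simp add: PohoSet_def)
    then have "J (z_fun s p \<mu>1 a) (\<lambda>z. 0) = C a b" using semitrivial_level[OF _ min iv_pos(1) u_or v0] ab by simp
    then show False using energy by simp
  qed
  then have mv: "Lpow 2 v = b" by (rule v_or)
  have "Lpow 2 u \<noteq> 0"
  proof
    assume u0: "Lpow 2 u = 0"
    have "swap.J (z_fun s q \<mu>2 b) (\<lambda>z. 0) = swap.C b a" using swap.semitrivial_level[OF _ min' iv_pos(2) mv u0] ab by simp
    then show False using energy Jf_swap[of s \<mu>1 \<mu>2 \<beta> p q r1 r2 "\<lambda>z. 0" "z_fun s q \<mu>2 b"] Cab_swap[of s \<mu>1 \<mu>2 \<beta> p q r1 r2 a b] by simp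
  qed
  then have mu: "Lpow 2 u = a" by (rule u_or)
  \<comment> \<open>Saturation enters here: the masses along the sequence are at most that of the
    limit, so the limit of the cross term squeezes the squared distance to zero.\<close>
  have L2: "(\<lambda>n. Lpow 2 (\<lambda>z. wn n z - w z)) \<longlonglongrightarrow> 0"
    if H: "\<And>n. inH s (wn n)" "inH s w" and le: "\<And>n. Lpow 2 (wn n) \<le> m" and w: "Lpow 2 w = m"
      and lim: "(\<lambda>n. LINT z|lborel. wn n z * w z) \<longlonglongrightarrow> Lpow 2 w" for wn :: "nat \<Rightarrow> fn2" and w m
  proof (rule tendsto_sandwich[where f="\<lambda>_. 0"])
    have "Lpow 2 (\<lambda>z. wn n z - w z) = Lpow 2 (wn n) - 2 * (LINT z|lborel. wn n z * w z) + Lpow 2 w" for n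
      using L2_lin[OF inH_memLp(1)[OF H(1)] inH_memLp(1)[OF H(2)], of 1 n "- 1"] by simp
    then show "\<forall>\<^sub>F n in sequentially. Lpow 2 (\<lambda>z. wn n z - w z) \<le> m - 2 * (LINT z|lborel. wn n z * w z) + m"
      using le w by (intro always_eventually allI) simp
    have "(\<lambda>n. m - 2 * (LINT z|lborel. wn n z * w z) + m) \<longlonglongrightarrow> m - 2 * m + m" using lim unfolding w by (intro tendsto_intros)
    then show "(\<lambda>n. m - 2 * (LINT z|lborel. wn n z * w z) + m) \<longlonglongrightarrow> 0" by simp
  qed (auto simp: Lpow_nonneg)
  have "(\<lambda>n. normD2 s (\<lambda>z. un n z - u z) (\<lambda>z. vn n z - v z)) \<longlonglongrightarrow> 0 + 0 + 0"
    unfolding normD2_def innerH_self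
    using tendsto_add[OF tendsto_add[OF L2[OF unH uH una mu Mu] L2[OF vnH vH vnb mv Mv]] Klim] by (simp add: add_ac)
  \<comment> \<open>The whole sequence converges, so the identity serves as the subsequence.\<close>
  then show ?thesis using mu mv by (intro exI[of _ id]) (auto simp: strict_mono_id)
qed

end
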